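(* Let $\Omega$ be either the unit polydisc $\mathbb{D}^d$ or the open Euclidean unit ball $\mathbb{B}_d$ in $\mathbb{C}^d$, let $G$ be a finite pseudoreflection group acting on $\Omega$ by $\sigma\cdot z=\sigma z$, and let $\boldsymbol\theta$ be a basic polynomial map associated to $G$. Let $\widetilde u\in L^\infty(\partial\Omega)$ be a $G$-invariant function with $\widetilde u=u\circ\boldsymbol\theta$. Then for every one-dimensional representation $\varrho$ of $G$, $$\Gamma_\varrho\,T_u=T_{\widetilde u}\,\Gamma_\varrho\quad\text{on } H^2_\varrho(\boldsymbol\theta(\Omega)),$$ where $T_u$ is the Toeplitz operator on $H^2_\varrho(\boldsymbol\theta(\Omega))$, $T_{\widetilde u}:\mathbb{P}_\varrho(H^2(\Omega))\to\mathbb{P}_\varrho(H^2(\Omega))$ is the restriction of the Toeplitz operator on $H^2(\Omega)$, and $\Gamma_\varrho:H^2_\varrho(\boldsymbol\theta(\Omega))\to\mathbb{P}_\varrho(H^2(\Omega))$ is given by $\Gamma_\varrho f=\frac{1}{\sqrt{|G|}}\,\ell_\varrho\,(f\circ\boldsymbol\theta)$.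
   Context: A pseudoreflection on $\mathbb{C}^d$ is a linear map $\sigma\in GL(d,\mathbb{C})$ of finite order such that $I_d-\sigma$ has rank $1$; a pseudoreflection group is a group generated by pseudoreflections. $G$ acts on functions by $\sigma(f)(z)=f(\sigma^{-1}\cdot z)$; $f$ is $G$-invariant if $\sigma(f)=f$ for all $\sigma\in G$. By the Chevalley–Shephard–Todd theorem, $\mathbb{C}[z_1,\dots,z_d]^G=\mathbb{C}[\theta_1,\dots,\theta_d]$ for algebraically independent homogeneous polynomials $\theta_i$; $\boldsymbol\theta=(\theta_1,\dots,\theta_d)$ is called a basic polynomial map associated to $G$. $\boldsymbol\theta(\Omega)$ is a domain. $\partial X$ denotes the Shilov boundary of a domain $X$; $\partial\mathbb{D}^d=\mathbb{T}^d$ and $\partial\mathbb{B}_d=S_d$ (unit sphere), each with its normalized Lebesgue measure, denoted here $m$. $L^2(\partial\Omega)$, $L^\infty(\partial\Omega)$ are taken with respect to $m$. $H^2(\Omega)$ is the usual Hardy space, identified via boundary values with a closed subspace of $L^2(\partial\Omega)$, and $\widetilde P:L^2(\partial\Omega)\to H^2(\Omega)$ is the orthogonal projection. For $\widetilde u\in L^\infty(\partial\Omega)$, $T_{\widetilde u}f=\widetilde P(\widetilde uf)$, $f\in H^2(\Omega)$. For a one-dimensional representation $\varrho$ with character $\chi_\varrho=\varrho$, $\mathbb{P}_\varrho\phi=\frac{1}{|G|}\sum_{\sigma\in G}\chi_\varrho(\sigma^{-1})\,\phi\circ\sigma^{-1}$ on $L^2(\partial\Omega)$ or $H^2(\Omega)$.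 Its ranges are $\mathbb{P}_\varrho(L^2(\partial\Omega))=\{f\in L^2(\partial\Omega):\sigma(f)=\chi_\varrho(\sigma)f\ \forall\sigma\in G\}$ and $\mathbb{P}_\varrho(H^2(\Omega))=\{f\in H^2(\Omega):\sigma(f)=\chi_\varrho(\sigma)f\ \forall\sigma\in G\}$. For $G$-invariant $\widetilde u$, $\mathbb{P}_\varrho(H^2(\Omega))$ is a reducing subspace for $T_{\widetilde u}$. Generating polynomial $\ell_\varrho$: let $H_1,\dots,H_t$ be the distinct reflecting hyperplanes of $G$ (hyperplanes fixed pointwise by some pseudoreflection in $G$), let $G_i=\langle a_i\rangle$ be the cyclic subgroup of elements of $G$ acting trivially on $H_i$, and let $\ell_i$ be a linear polynomial with zero set $H_i$. Let $c_i$ be the least non-negative integer with $\varrho(a_i)=(\det a_i)^{c_i}$, and put $\ell_\varrho=\prod_{i=1}^t\ell_i^{c_i}$. $H^2_\varrho(\boldsymbol\theta(\Omega))$ is the Hilbert space of holomorphic $f$ on $\boldsymbol\theta(\Omega)$ with $$\|f\|^2=\frac1{|G|}\sup_{0<r<1}\int_{\partial\Omega}|f(\boldsymbol\theta(r\zeta))|^2|\ell_\varrho(r\zeta)|^2\,dm(\zeta)<\infty.$$ $L^2_\varrho(\partial\boldsymbol\theta(\Omega))$ is the $L^2$ space of the measure $m_\varrho$ on $\partial\boldsymbol\theta(\Omega)$ defined by $\int_{\partial\boldsymbol\theta(\Omega)}f\,dm_\varrho=\int_{\partial\Omega}(f\circ\boldsymbol\theta)|\ell_\varrho|^2\,dm$,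 with norm $\|f\|^2=\frac1{|G|}\int|f|^2dm_\varrho$. The formula $\Gamma_\varrho f=\frac1{\sqrt{|G|}}\ell_\varrho(f\circ\boldsymbol\theta)$ defines unitary maps $L^2_\varrho(\partial\boldsymbol\theta(\Omega))\to\mathbb{P}_\varrho(L^2(\partial\Omega))$ and $H^2_\varrho(\boldsymbol\theta(\Omega))\to\mathbb{P}_\varrho(H^2(\Omega))$. Through $\Gamma_\varrho^{-1}\circ i_\varrho\circ\Gamma_\varrho$, where $i_\varrho:\mathbb{P}_\varrho(H^2(\Omega))\to\mathbb{P}_\varrho(L^2(\partial\Omega))$ is the natural inclusion, $H^2_\varrho(\boldsymbol\theta(\Omega))$ is regarded as a closed subspace of $L^2_\varrho(\partial\boldsymbol\theta(\Omega))$; let $P_\varrho$ be the orthogonal projection onto it. For bounded measurable $u$ on $\partial\boldsymbol\theta(\Omega)$, the Toeplitz operator $T_u$ on $H^2_\varrho(\boldsymbol\theta(\Omega))$ is $T_uf=P_\varrho(uf)$.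
   Formalization: Γ_ϱ is shown to map into P_{ϱ*}(H²(Ω)), ϱ*(σ)=ϱ(σ⁻¹), not P_ϱ(H²(Ω)): with ϱ(a_i)=(det a_i)^{c_i} the stated codomain fails for non-real ϱ (d=1, cube roots of unity, ϱ(ω)=ω, ℓ_ϱ=z). The two agree for real ϱ. *)

theory Defs
  imports
    "HOL-Analysis.Analysis"
    "HOL-Algebra.Generated_Groups"
    "HOL-Library.Poly_Mapping"
begin

section \<open>Domains, boundaries and their measures\<close>

definition polydisc :: "(complex ^ 'd) set" where
  "polydisc = {z. \<forall>i. norm (z $ i) < 1}"

definition torus :: "(complex ^ 'd) set" where
  "torus = {z. \<forall>i. norm (z $ i) = 1}"

text \<open>Normalized Lebesgue measure on the torus: the image of normalized Lebesgue measure on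
  the cube \<open>[0, 2\<pi>]\<^sup>d\<close> under the coordinatewise exponential map.\<close>

definition torus_measure :: "(complex ^ 'd) measure" where
  "torus_measure =
     distr (uniform_measure lborel (cbox 0 (\<chi> i. 2 * pi :: real ^ 'd)))
       (restrict_space borel torus) (\<lambda>t. \<chi> i. cis (t $ i))"

text \<open>Normalized surface measure on the unit sphere: by polar coordinates it is the image of
  the normalized volume of the (punctured) unit ball under the radial projection
  \<open>z \<mapsto> z / \<parallel>z\<parallel>\<close>, which is \<open>sgn\<close>.\<close>

definition sphere_measure :: "(complex ^ 'd) measure" where
  "sphere_measure =
     distr (restrict_space (uniform_measure lborel (ball 0 1)) (- {0}))
       (restrict_space borel (sphere 0 1)) sgn"

text \<open>\<open>\<Omega>\<close> is the polydisc or the ball, and \<open>m\<close> is the normalized measure on its Shilov boundary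
  (the torus or the sphere), which is \<open>space m\<close>.\<close>

definition domain_with_measure :: "(complex ^ 'd) set \<Rightarrow> (complex ^ 'd) measure \<Rightarrow> bool" where
  "domain_with_measure \<Omega> m \<longleftrightarrow>
     (\<Omega> = polydisc \<and> m = torus_measure) \<or> (\<Omega> = ball 0 1 \<and> m = sphere_measure)"

text \<open>Holomorphy in several variables: the real Frechet derivative exists and is
  complex-linear.  It is only used on open sets.\<close>

definition holomorphic_several :: "(complex ^ 'd \<Rightarrow> complex) \<Rightarrow> (complex ^ 'd) set \<Rightarrow> bool" where
  "holomorphic_several f S \<longleftrightarrow>
     (\<forall>z\<in>S. \<exists>f'. (f has_derivative f') (at z within S) \<and> (\<forall>c v. f' (c *s v) = c * f' v))"

text \<open>The smallest closed subset of \<open>closure X\<close> on which every function that is continuous on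
  \<open>closure X\<close> and holomorphic on \<open>X\<close> attains its maximum modulus (for bounded \<open>X\<close>).\<close>

definition shilov_boundary :: "(complex ^ 'd) set \<Rightarrow> (complex ^ 'd) set" where
  "shilov_boundary X =
     \<Inter> {K. closed K \<and> K \<subseteq> closure X \<and>
          (\<forall>f. continuous_on (closure X) f \<and> holomorphic_several f X \<longrightarrow>
             (\<forall>z\<in>closure X. \<exists>w\<in>K. norm (f z) \<le> norm (f w)))}"

section \<open>Pseudoreflection groups\<close>

definition GL :: "(complex ^ 'd ^ 'd) monoid" where
  "GL = \<lparr>carrier = {A. invertible A}, mult = (**), one = mat 1\<rparr>"

definition pseudoreflection :: "complex ^ 'd ^ 'd \<Rightarrow> bool" where
  "pseudoreflection \<sigma> \<longleftrightarrow>
     \<sigma> \<in> carrier GL \<and> (\<exists>n::nat. n > 0 \<and> \<sigma> [^]\<^bsub>GL\<^esub> n = \<one>\<^bsub>GL\<^esub>) \<and> rank (mat 1 - \<sigma>) = 1"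

definition pseudoreflection_group :: "(complex ^ 'd ^ 'd) set \<Rightarrow> bool" where
  "pseudoreflection_group G \<longleftrightarrow> (\<exists>S \<subseteq> {\<sigma>. pseudoreflection \<sigma>}. G = generate GL S)"

definition acts_on :: "(complex ^ 'd ^ 'd) set \<Rightarrow> (complex ^ 'd) set \<Rightarrow> bool" where
  "acts_on G \<Omega> \<longleftrightarrow> (\<forall>\<sigma>\<in>G. (\<lambda>z. \<sigma> *v z) ` \<Omega> = \<Omega>)"

definition act :: "complex ^ 'd ^ 'd \<Rightarrow> (complex ^ 'd \<Rightarrow> complex) \<Rightarrow> complex ^ 'd \<Rightarrow> complex" where
  "act \<sigma> f = (\<lambda>z. f (matrix_inv \<sigma> *v z))"

definition one_dim_rep :: "(complex ^ 'd ^ 'd) set \<Rightarrow> (complex ^ 'd ^ 'd \<Rightarrow> complex) \<Rightarrow> bool" where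
  "one_dim_rep G \<rho> \<longleftrightarrow> \<rho> \<in> hom (GL\<lparr>carrier := G\<rparr>) \<lparr>carrier = - {0}, mult = (*), one = 1\<rparr>"

definition contragredient :: "(complex ^ 'd ^ 'd \<Rightarrow> complex) \<Rightarrow> complex ^ 'd ^ 'd \<Rightarrow> complex" where
  "contragredient \<rho> = (\<lambda>\<sigma>. \<rho> (matrix_inv \<sigma>))"

definition rep_proj ::
  "(complex ^ 'd ^ 'd) set \<Rightarrow> (complex ^ 'd ^ 'd \<Rightarrow> complex) \<Rightarrow>
   (complex ^ 'd \<Rightarrow> complex) \<Rightarrow> complex ^ 'd \<Rightarrow> complex" where
  "rep_proj G \<rho> \<phi> =
     (\<lambda>z. 1 / of_nat (card G) * (\<Sum>\<sigma>\<in>G. \<rho> (matrix_inv \<sigma>) * act \<sigma> \<phi> z))"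

section \<open>Basic polynomial maps\<close>

type_synonym 'd poly_several = "('d \<Rightarrow>\<^sub>0 nat) \<Rightarrow>\<^sub>0 complex"

definition eval_poly :: "'d::finite poly_several \<Rightarrow> complex ^ 'd \<Rightarrow> complex" where
  "eval_poly p z =
     (\<Sum>k\<in>Poly_Mapping.keys p.
        Poly_Mapping.lookup p k * (\<Prod>i\<in>UNIV. (z $ i) ^ Poly_Mapping.lookup k i))"

definition homogeneous :: "'d::finite poly_several \<Rightarrow> bool" where
  "homogeneous p \<longleftrightarrow> (\<exists>n. \<forall>k\<in>Poly_Mapping.keys p. (\<Sum>i\<in>UNIV. Poly_Mapping.lookup k i) = n)"

text \<open>Polynomials over the complex numbers are identified with polynomial functions, so the
  third conjunct says \<open>\<complex>[z]\<^sup>G = \<complex>[\<theta>\<^sub>1, \<dots>, \<theta>\<^sub>d]\<close>.\<close>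

definition basic_polynomial_map ::
  "(complex ^ 'd ^ 'd) set \<Rightarrow> (complex ^ 'd \<Rightarrow> complex ^ 'd) \<Rightarrow> bool" where
  "basic_polynomial_map G \<theta> \<longleftrightarrow>
     (\<forall>i. \<exists>p. homogeneous p \<and> (\<forall>z. \<theta> z $ i = eval_poly p z)) \<and>
     (\<forall>q. (\<forall>z. eval_poly q (\<theta> z) = 0) \<longrightarrow> q = 0) \<and>
     {f \<in> range eval_poly. \<forall>\<sigma>\<in>G. act \<sigma> f = f} = {eval_poly q \<circ> \<theta> |q. True}"

section \<open>Generating polynomials\<close>

definition reflecting_hyperplanes :: "(complex ^ 'd ^ 'd) set \<Rightarrow> (complex ^ 'd) set set" where
  "reflecting_hyperplanes G = {{z. \<sigma> *v z = z} |\<sigma>. \<sigma> \<in> G \<and> pseudoreflection \<sigma>}"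

definition pointwise_stabilizer ::
  "(complex ^ 'd ^ 'd) set \<Rightarrow> (complex ^ 'd) set \<Rightarrow> (complex ^ 'd ^ 'd) set" where
  "pointwise_stabilizer G H = {\<sigma> \<in> G. \<forall>z\<in>H. \<sigma> *v z = z}"

text \<open>\<open>\<l>\<close> is a generating polynomial for \<open>\<rho>\<close>, for some choice of generators \<open>a H\<close> of the
  cyclic stabilizers and of linear forms with zero sets \<open>H\<close> (given by coefficient vectors
  \<open>v H\<close>; a linear polynomial vanishing on a hyperplane through the origin has no constant term).

  Since \<open>\<l>\<^sub>H (a z) = det a * \<l>\<^sub>H z\<close>, the condition \<open>\<rho> a = (det a) ^ c\<close> yields
  \<open>\<l> \<circ> \<sigma> = \<rho> \<sigma> \<cdot> \<l>\<close>, that is, \<open>act \<sigma> \<l> = contragredient \<rho> \<sigma> \<cdot> \<l>\<close>: a function of the form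
  \<open>\<l> \<cdot> (f \<circ> \<theta>)\<close> therefore lies in the range of \<open>rep_proj G (contragredient \<rho>)\<close>.  This is the range of
  \<open>rep_proj G \<rho>\<close> when \<open>\<rho>\<close> is real-valued, but not in general: for the group of cube roots of
  unity acting on the disc and \<open>\<rho> \<omega> = \<omega>\<close> one gets \<open>\<l> = z\<close>, while
  \<open>act \<omega> \<l> = \<omega>\<^sup>2 \<cdot> \<l>\<close>.\<close>

definition is_generating_polynomial ::
  "(complex ^ 'd ^ 'd) set \<Rightarrow> (complex ^ 'd ^ 'd \<Rightarrow> complex) \<Rightarrow> (complex ^ 'd \<Rightarrow> complex) \<Rightarrow> bool"
  where
  "is_generating_polynomial G \<rho> \<l> \<longleftrightarrow>
     (\<exists>a v.
        (\<forall>H\<in>reflecting_hyperplanes G.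
           a H \<in> G \<and> generate GL {a H} = pointwise_stabilizer G H \<and>
           {z. (\<Sum>i\<in>UNIV. v H $ i * z $ i) = 0} = H) \<and>
        (\<forall>z. \<l> z = (\<Prod>H\<in>reflecting_hyperplanes G.
                     (\<Sum>i\<in>UNIV. v H $ i * z $ i) ^ (LEAST c::nat. \<rho> (a H) = det (a H) ^ c))))"

section \<open>\<open>L\<^sup>2\<close> spaces and abstract Toeplitz operators\<close>

text \<open>Elements of \<open>L\<^sup>2\<close> are represented by square-integrable functions.\<close>

definition L2 :: "'a measure \<Rightarrow> ('a \<Rightarrow> complex) set" where
  "L2 M = {f \<in> borel_measurable M. integrable M (\<lambda>x. (norm (f x))\<^sup>2)}"

definition L2_inner :: "'a measure \<Rightarrow> ('a \<Rightarrow> complex) \<Rightarrow> ('a \<Rightarrow> complex) \<Rightarrow> complex" where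
  "L2_inner M f g = (LINT x|M. f x * cnj (g x))"

definition Linfty :: "'a measure \<Rightarrow> ('a \<Rightarrow> complex) set" where
  "Linfty M = {f \<in> borel_measurable M. \<exists>C. AE x in M. norm (f x) \<le> C}"

text \<open>\<open>V\<close> is a space of functions that is regarded as a closed subspace of an \<open>L\<^sup>2\<close> space with
  inner product \<open>ip\<close> by means of the embedding \<open>E\<close>.  The orthogonal projection of \<open>g\<close> onto this
  subspace is returned as an element of \<open>V\<close>.\<close>

definition orth_proj ::
  "('b set) \<Rightarrow> ('b \<Rightarrow> 'a \<Rightarrow> complex) \<Rightarrow> (('a \<Rightarrow> complex) \<Rightarrow> ('a \<Rightarrow> complex) \<Rightarrow> complex) \<Rightarrow>
   ('a \<Rightarrow> complex) \<Rightarrow> 'b" where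
  "orth_proj V E ip g = (THE h. h \<in> V \<and> (\<forall>k\<in>V. ip (\<lambda>x. g x - E h x) (E k) = 0))"

definition toeplitz ::
  "('b set) \<Rightarrow> ('b \<Rightarrow> 'a \<Rightarrow> complex) \<Rightarrow> (('a \<Rightarrow> complex) \<Rightarrow> ('a \<Rightarrow> complex) \<Rightarrow> complex) \<Rightarrow>
   ('a \<Rightarrow> complex) \<Rightarrow> 'b \<Rightarrow> 'b" where
  "toeplitz V E ip u f = orth_proj V E ip (\<lambda>x. u x * E f x)"

section \<open>The Hardy space of \<open>\<Omega>\<close>\<close>

text \<open>Functions on a domain are represented by functions that vanish outside it, so that
  equality of elements is equality of HOL functions.\<close>

definition hardy :: "(complex ^ 'd) set \<Rightarrow> (complex ^ 'd) measure \<Rightarrow> (complex ^ 'd \<Rightarrow> complex) set"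
  where
  "hardy \<Omega> m =
     {f. holomorphic_several f \<Omega> \<and> (\<forall>z. z \<notin> \<Omega> \<longrightarrow> f z = 0) \<and>
         (SUP r\<in>{0<..<1}. \<integral>\<^sup>+ \<zeta>. ennreal ((norm (f (r *\<^sub>R \<zeta>)))\<^sup>2) \<partial>m) < \<infinity>}"

text \<open>Boundary values: the limit of the dilates \<open>\<zeta> \<mapsto> f (r \<zeta>)\<close> in \<open>L\<^sup>2(m)\<close> as \<open>r\<close> increases to 1;
  some representative of this limit is chosen.\<close>

definition boundary_value ::
  "(complex ^ 'd) measure \<Rightarrow> (complex ^ 'd \<Rightarrow> complex) \<Rightarrow> complex ^ 'd \<Rightarrow> complex" where
  "boundary_value m f =
     (SOME F. F \<in> L2 m \<and>
        ((\<lambda>r. \<integral>\<^sup>+ \<zeta>. ennreal ((norm (f (r *\<^sub>R \<zeta>) - F \<zeta>))\<^sup>2) \<partial>m) \<longlongrightarrow> 0) (at_left 1))"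

definition hardy_toeplitz ::
  "(complex ^ 'd) set \<Rightarrow> (complex ^ 'd) measure \<Rightarrow> (complex ^ 'd \<Rightarrow> complex) \<Rightarrow>
   (complex ^ 'd \<Rightarrow> complex) \<Rightarrow> complex ^ 'd \<Rightarrow> complex" where
  "hardy_toeplitz \<Omega> m = toeplitz (hardy \<Omega> m) (boundary_value m) (L2_inner m)"

section \<open>The Hardy space of \<open>\<theta>(\<Omega>)\<close>\<close>

definition qhardy_norm_sq ::
  "(complex ^ 'd) measure \<Rightarrow> (complex ^ 'd ^ 'd) set \<Rightarrow> (complex ^ 'd \<Rightarrow> complex ^ 'd) \<Rightarrow>
   (complex ^ 'd \<Rightarrow> complex) \<Rightarrow> (complex ^ 'd \<Rightarrow> complex) \<Rightarrow> ennreal" where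
  "qhardy_norm_sq m G \<theta> \<l> f =
     ennreal (1 / real (card G)) *
     (SUP r\<in>{0<..<1}. \<integral>\<^sup>+ \<zeta>. ennreal ((norm (f (\<theta> (r *\<^sub>R \<zeta>))))\<^sup>2 * (norm (\<l> (r *\<^sub>R \<zeta>)))\<^sup>2) \<partial>m)"

definition qhardy ::
  "(complex ^ 'd) set \<Rightarrow> (complex ^ 'd) measure \<Rightarrow> (complex ^ 'd ^ 'd) set \<Rightarrow>
   (complex ^ 'd \<Rightarrow> complex ^ 'd) \<Rightarrow> (complex ^ 'd \<Rightarrow> complex) \<Rightarrow> (complex ^ 'd \<Rightarrow> complex) set" where
  "qhardy \<Omega> m G \<theta> \<l> =
     {f. holomorphic_several f (\<theta> ` \<Omega>) \<and> (\<forall>w. w \<notin> \<theta> ` \<Omega> \<longrightarrow> f w = 0) \<and>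
         qhardy_norm_sq m G \<theta> \<l> f < \<infinity>}"

definition qmeasure ::
  "(complex ^ 'd) set \<Rightarrow> (complex ^ 'd) measure \<Rightarrow> (complex ^ 'd \<Rightarrow> complex ^ 'd) \<Rightarrow>
   (complex ^ 'd \<Rightarrow> complex) \<Rightarrow> (complex ^ 'd) measure" where
  "qmeasure \<Omega> m \<theta> \<l> =
     distr (density m (\<lambda>\<zeta>. ennreal ((norm (\<l> \<zeta>))\<^sup>2)))
       (restrict_space borel (shilov_boundary (\<theta> ` \<Omega>))) \<theta>"

definition qinner ::
  "(complex ^ 'd) set \<Rightarrow> (complex ^ 'd) measure \<Rightarrow> (complex ^ 'd ^ 'd) set \<Rightarrow>
   (complex ^ 'd \<Rightarrow> complex ^ 'd) \<Rightarrow> (complex ^ 'd \<Rightarrow> complex) \<Rightarrow>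
   (complex ^ 'd \<Rightarrow> complex) \<Rightarrow> (complex ^ 'd \<Rightarrow> complex) \<Rightarrow> complex" where
  "qinner \<Omega> m G \<theta> \<l> f g = 1 / of_nat (card G) * L2_inner (qmeasure \<Omega> m \<theta> \<l>) f g"

text \<open>\<open>\<Gamma>\<close> on \<open>L\<^sup>2\<close> of the boundary, and on the Hardy space of \<open>\<theta>(\<Omega>)\<close>.\<close>

definition Gamma_L2 ::
  "(complex ^ 'd ^ 'd) set \<Rightarrow> (complex ^ 'd \<Rightarrow> complex ^ 'd) \<Rightarrow> (complex ^ 'd \<Rightarrow> complex) \<Rightarrow>
   (complex ^ 'd \<Rightarrow> complex) \<Rightarrow> complex ^ 'd \<Rightarrow> complex" where
  "Gamma_L2 G \<theta> \<l> f = (\<lambda>\<zeta>. 1 / of_real (sqrt (real (card G))) * \<l> \<zeta> * f (\<theta> \<zeta>))"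

definition Gamma_hardy ::
  "(complex ^ 'd) set \<Rightarrow> (complex ^ 'd ^ 'd) set \<Rightarrow> (complex ^ 'd \<Rightarrow> complex ^ 'd) \<Rightarrow>
   (complex ^ 'd \<Rightarrow> complex) \<Rightarrow> (complex ^ 'd \<Rightarrow> complex) \<Rightarrow> complex ^ 'd \<Rightarrow> complex" where
  "Gamma_hardy \<Omega> G \<theta> \<l> f =
     (\<lambda>z. if z \<in> \<Omega> then 1 / of_real (sqrt (real (card G))) * \<l> z * f (\<theta> z) else 0)"

text \<open>The embedding \<open>\<Gamma>\<^sup>-\<^sup>1 \<circ> i \<circ> \<Gamma>\<close> of the Hardy space of \<open>\<theta>(\<Omega>)\<close> into \<open>L\<^sup>2\<close>.\<close>

definition qboundary_value ::
  "(complex ^ 'd) set \<Rightarrow> (complex ^ 'd) measure \<Rightarrow> (complex ^ 'd ^ 'd) set \<Rightarrow>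
   (complex ^ 'd \<Rightarrow> complex ^ 'd) \<Rightarrow> (complex ^ 'd \<Rightarrow> complex) \<Rightarrow>
   (complex ^ 'd \<Rightarrow> complex) \<Rightarrow> complex ^ 'd \<Rightarrow> complex" where
  "qboundary_value \<Omega> m G \<theta> \<l> f =
     (SOME F. F \<in> L2 (qmeasure \<Omega> m \<theta> \<l>) \<and>
        (AE \<zeta> in m. Gamma_L2 G \<theta> \<l> F \<zeta> = boundary_value m (Gamma_hardy \<Omega> G \<theta> \<l> f) \<zeta>))"

definition qtoeplitz ::
  "(complex ^ 'd) set \<Rightarrow> (complex ^ 'd) measure \<Rightarrow> (complex ^ 'd ^ 'd) set \<Rightarrow>
   (complex ^ 'd \<Rightarrow> complex ^ 'd) \<Rightarrow> (complex ^ 'd \<Rightarrow> complex) \<Rightarrow>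
   (complex ^ 'd \<Rightarrow> complex) \<Rightarrow> (complex ^ 'd \<Rightarrow> complex) \<Rightarrow> complex ^ 'd \<Rightarrow> complex" where
  "qtoeplitz \<Omega> m G \<theta> \<l> =
     toeplitz (qhardy \<Omega> m G \<theta> \<l>) (qboundary_value \<Omega> m G \<theta> \<l>) (qinner \<Omega> m G \<theta> \<l>)"

end

theory Submission
  imports Defs "HOL-Complex_Analysis.Complex_Analysis" "HOL-Algebra.Multiplicative_Group" "HOL-Probability.Probability"
begin

text \<open>The map \<open>\<Gamma>\<close> identifies the Hardy space of \<open>\<theta>(\<Omega>)\<close> with the functions of the Hardy space of \<open>\<Omega>\<close>
  that transform like \<open>\<l>\<close> under \<open>G\<close>. For surjectivity, the homogeneous components of such a function are
  semi-invariant polynomials, hence divisible by \<open>\<l>\<close> with \<open>G\<close>-invariant quotients, which are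
  polynomials in \<open>\<theta>\<close>; the partial sums converge locally uniformly on \<open>\<Omega>\<close>, division by \<open>\<l>\<close> preserves this by
  the maximum principle, and \<open>\<theta>\<close> is open, so the quotients converge locally uniformly on \<open>\<theta>(\<Omega>)\<close>.
  The same quotients, now converging in \<open>L\<^sup>2\<close>, give the boundary values, so \<open>\<Gamma>\<close> is isometric on the boundary
  and intertwines multiplication by \<open>u\<close> and \<open>u \<circ> \<theta>\<close>. Since \<open>G\<close> preserves the measure, multiplication
  by an invariant symbol and the projection onto the Hardy space commute with \<open>G\<close>; hence the Toeplitz
  operator on \<open>\<Omega>\<close> preserves the range of \<open>\<Gamma>\<close>, where its defining orthogonality relations are those of \<open>T\<^sub>u\<close>.

  That \<open>\<theta>\<close> maps the support of the measure into the Shilov boundary of \<open>\<theta>(\<Omega>)\<close> follows from the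
  symmetrized powers of a function peaking at a single point.\<close>

text \<open>Boundary values and Toeplitz operators are given by \<open>SOME\<close> and
  \<open>THE\<close>, so their defining conditions say something only once existence and uniqueness
  are known. This forces a development of completeness and of orthogonal projection. The one
  estimate that has to be proved for each domain separately is \<open>eval_bound\<close>: values of
  polynomials on a compact set are controlled by their L2 norm on the boundary. In both cases it
  rests on the orthogonality of monomials, a consequence of invariance of the measure under rotation
  of coordinates. Hardy functions are approximated by sums of homogeneous parts, because linear maps
  respect the degree but not the single monomials; this is what makes the algebra of semi-invariants
  applicable to each approximant. Surjectivity of \<Gamma> is indispensable for the orthogonality
  relations: the test functions coming from the quotient must exhaust the semi-invariant ones. The
  Shilov boundary enters because \<open>qmeasure\<close> is an image measure on its Borel sets, so
  that \<theta> must be a measurable map into it.\<close>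

no_notation fps_nth (infixl "$" 75)

section \<open>Polynomial functions\<close>

text \<open>Polynomials are handled as functions, so that composition with matrices and with
  \<theta>, and division, become closure properties of a set. After the closure rules, coefficients
  return only in the orthogonal expansion into monomials.\<close>

definition polyfuns :: "(complex ^ 'd::finite \<Rightarrow> complex) set" where
  "polyfuns = range eval_poly"

lemma eval_poly_superset:
  assumes "finite K" "Poly_Mapping.keys p \<subseteq> K"
  shows "eval_poly p z =
    (\<Sum>k\<in>K. Poly_Mapping.lookup p k * (\<Prod>i\<in>UNIV. (z $ i) ^ Poly_Mapping.lookup k i))"
  unfolding eval_poly_def using assms
  by (intro sum.mono_neutral_left) (auto simp: in_keys_iff)

lemma eval_poly_add: "eval_poly (p + q) z = eval_poly p z + eval_poly q z"
proof -
  let ?K = "Poly_Mapping.keys p \<union> Poly_Mapping.keys q"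
  have "Poly_Mapping.keys (p + q) \<subseteq> ?K" by (rule keys_add)
  then show ?thesis
    by (simp add: eval_poly_superset[where K = ?K] lookup_add algebra_simps sum.distrib)
qed

lemma eval_poly_single:
  "eval_poly (Poly_Mapping.single k c) z = c * (\<Prod>i\<in>UNIV. (z $ i) ^ Poly_Mapping.lookup k i)"
  by (subst eval_poly_superset[where K = "{k}"]) auto

lemma polyfuns_add: "f \<in> polyfuns \<Longrightarrow> g \<in> polyfuns \<Longrightarrow> (\<lambda>z. f z + g z) \<in> polyfuns"
  unfolding polyfuns_def by (auto simp: image_iff fun_eq_iff) (metis eval_poly_add)

lemma polyfuns_const: "(\<lambda>z. c) \<in> polyfuns"
proof -
  have "(\<lambda>z. c) = eval_poly (Poly_Mapping.single 0 c)"
    by (auto simp: eval_poly_single)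
  then show ?thesis unfolding polyfuns_def by blast
qed

lemma polyfuns_coord:
  fixes i :: "'d::finite"
  shows "(\<lambda>z. z $ i) \<in> polyfuns"
proof -
  have "(\<Prod>j\<in>UNIV. (z $ j) ^ Poly_Mapping.lookup (Poly_Mapping.single i 1) j) = z $ i" for z :: "complex ^ 'd"
    by (subst prod.remove[of _ i]) (auto simp: lookup_single when_def intro!: prod.neutral)
  then have "(\<lambda>z. z $ i) = eval_poly (Poly_Mapping.single (Poly_Mapping.single i 1) 1)"
    by (auto simp: eval_poly_single)
  then show ?thesis unfolding polyfuns_def by blast
qed

lemma polyfuns_sum: "(\<And>i. i \<in> A \<Longrightarrow> f i \<in> polyfuns) \<Longrightarrow> (\<lambda>z. \<Sum>i\<in>A. f i z) \<in> polyfuns"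
  by (induction A rule: infinite_finite_induct) (auto intro: polyfuns_add polyfuns_const)

lemma polyfuns_mult:
  assumes "f \<in> polyfuns" "g \<in> polyfuns"
  shows "(\<lambda>z. f z * g z) \<in> polyfuns"
proof -
  obtain p q where pq: "f = eval_poly p" "g = eval_poly q"
    using assms unfolding polyfuns_def by auto
  have "f z * g z = (\<Sum>k\<in>Poly_Mapping.keys p. \<Sum>l\<in>Poly_Mapping.keys q.
      eval_poly (Poly_Mapping.single (k + l) (Poly_Mapping.lookup p k * Poly_Mapping.lookup q l)) z)" for z
    unfolding pq eval_poly_single lookup_add power_add prod.distrib
    unfolding eval_poly_def sum_product by (simp add: algebra_simps)
  then have "(\<lambda>z. f z * g z) = (\<lambda>z. \<Sum>k\<in>Poly_Mapping.keys p. \<Sum>l\<in>Poly_Mapping.keys q.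
      eval_poly (Poly_Mapping.single (k + l) (Poly_Mapping.lookup p k * Poly_Mapping.lookup q l)) z)"
    by auto
  moreover have "\<dots> \<in> polyfuns"
    by (intro polyfuns_sum) (auto simp: polyfuns_def)
  ultimately show ?thesis by simp
qed

lemma polyfuns_prod: "(\<And>i. i \<in> A \<Longrightarrow> f i \<in> polyfuns) \<Longrightarrow> (\<lambda>z. \<Prod>i\<in>A. f i z) \<in> polyfuns"
  by (induction A rule: infinite_finite_induct) (auto intro: polyfuns_mult polyfuns_const)

lemma polyfuns_power: "f \<in> polyfuns \<Longrightarrow> (\<lambda>z. f z ^ n) \<in> polyfuns"
  by (induction n) (auto intro: polyfuns_mult polyfuns_const)

lemma polyfuns_cmult: "f \<in> polyfuns \<Longrightarrow> (\<lambda>z. c * f z) \<in> polyfuns"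
  by (intro polyfuns_mult polyfuns_const)

lemma polyfuns_minus: "f \<in> polyfuns \<Longrightarrow> (\<lambda>z. - f z) \<in> polyfuns"
  using polyfuns_cmult[of f "-1"] by simp

lemma polyfuns_diff: "f \<in> polyfuns \<Longrightarrow> g \<in> polyfuns \<Longrightarrow> (\<lambda>z. f z - g z) \<in> polyfuns"
  using polyfuns_add[OF _ polyfuns_minus] by fastforce

lemmas polyfuns_intros = polyfuns_add polyfuns_const polyfuns_coord polyfuns_sum polyfuns_mult
  polyfuns_prod polyfuns_power polyfuns_minus polyfuns_diff

text \<open>Constants and coordinates generate the algebra of polynomials. With this rule,
  derivatives, restriction to lines and division are treated without coefficients.\<close>

lemma polyfuns_induct [consumes 1, case_names const coord add mult]:
  assumes f: "f \<in> polyfuns"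
    and const: "\<And>c. P (\<lambda>z. c)" and coord: "\<And>i. P (\<lambda>z. z $ i)"
    and add: "\<And>f g. f \<in> polyfuns \<Longrightarrow> g \<in> polyfuns \<Longrightarrow> P f \<Longrightarrow> P g \<Longrightarrow> P (\<lambda>z. f z + g z)"
    and mult: "\<And>f g. f \<in> polyfuns \<Longrightarrow> g \<in> polyfuns \<Longrightarrow> P f \<Longrightarrow> P g \<Longrightarrow> P (\<lambda>z. f z * g z)"
  shows "P f"
proof -
  let ?Q = "\<lambda>f. f \<in> polyfuns \<and> P f"
  have sum: "?Q (\<lambda>z. \<Sum>i\<in>A. g i z)" if "\<And>i. i \<in> A \<Longrightarrow> ?Q (g i)" for A and g :: "('a \<Rightarrow>\<^sub>0 nat) \<Rightarrow> _"
    using that by (induction A rule: infinite_finite_induct) (auto intro: const polyfuns_const add polyfuns_add)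
  have prod: "?Q (\<lambda>z. \<Prod>i\<in>A. g i z)" if "\<And>i. i \<in> A \<Longrightarrow> ?Q (g i)" for A and g :: "'a \<Rightarrow> _"
    using that by (induction A rule: infinite_finite_induct) (auto intro: const polyfuns_const mult polyfuns_mult)
  have power: "?Q (\<lambda>z. z $ i ^ n)" for i n
    by (induction n) (auto intro: const polyfuns_const mult polyfuns_mult coord polyfuns_coord)
  have monom: "?Q (\<lambda>z. c * (\<Prod>i\<in>UNIV. z $ i ^ n i))" for c and n :: "'a \<Rightarrow> nat"
  proof -
    have "?Q (\<lambda>z. \<Prod>i\<in>UNIV. z $ i ^ n i)" by (rule prod) (rule power)
    then show ?thesis by (auto intro: mult const polyfuns_mult polyfuns_const)
  qed
  obtain p where p: "f = eval_poly p" using f unfolding polyfuns_def by auto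
  have "?Q (eval_poly p)"
    unfolding eval_poly_def[abs_def] by (intro sum monom)
  then show ?thesis using p by simp
qed

lemma polyfuns_linear: "(\<lambda>z. \<Sum>i\<in>UNIV. v $ i * z $ i) \<in> polyfuns"
  by (intro polyfuns_intros)

lemma polyfuns_compose:
  assumes "f \<in> polyfuns" "\<And>i. (\<lambda>z. g z $ i) \<in> polyfuns"
  shows "(\<lambda>z. f (g z)) \<in> polyfuns"
  using assms(1) by (induction rule: polyfuns_induct) (auto intro: polyfuns_intros assms(2))

lemma polyfuns_matrix: "f \<in> polyfuns \<Longrightarrow> (\<lambda>z. f (A *v z)) \<in> polyfuns"
  by (rule polyfuns_compose) (auto simp: matrix_vector_mult_def intro!: polyfuns_intros)

lemma continuous_on_polyfuns: "f \<in> polyfuns \<Longrightarrow> continuous_on S f"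
  by (induction rule: polyfuns_induct) (auto intro!: continuous_intros)

lemma polyfuns_has_derivative:
  assumes "f \<in> polyfuns"
  shows "\<exists>f'. (f has_derivative f') (at z within S) \<and> (\<forall>c v. f' (c *s v) = c * f' v)"
  using assms
proof (induction rule: polyfuns_induct)
  case (const c) then show ?case by (intro exI[of _ "\<lambda>_. 0"]) auto
next
  case (coord i) then show ?case
    by (intro exI[of _ "\<lambda>v. v $ i"]) (auto intro: bounded_linear_imp_has_derivative bounded_linear_vec_nth)
next
  case (add f g)
  then obtain f' g' where "(f has_derivative f') (at z within S)" "(g has_derivative g') (at z within S)"
    "\<forall>c v. f' (c *s v) = c * f' v" "\<forall>c v. g' (c *s v) = c * g' v" by blast
  then show ?case
    by (intro exI[of _ "\<lambda>v. f' v + g' v"]) (auto intro!: derivative_intros simp: algebra_simps)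
next
  case (mult f g)
  then obtain f' g' where "(f has_derivative f') (at z within S)" "(g has_derivative g') (at z within S)"
    "\<forall>c v. f' (c *s v) = c * f' v" "\<forall>c v. g' (c *s v) = c * g' v" by blast
  then show ?case
    by (intro exI[of _ "\<lambda>v. f z * g' v + f' v * g z"]) (intro conjI has_derivative_mult, auto simp: algebra_simps)
qed

lemma holomorphic_several_polyfuns: "f \<in> polyfuns \<Longrightarrow> holomorphic_several f S"
  unfolding holomorphic_several_def using polyfuns_has_derivative by blast

section \<open>Zeros of polynomials along complex lines\<close>

lemma polyfuns_line:
  assumes "f \<in> polyfuns"
  shows "\<exists>p. \<forall>c. f (a + c *s h) = poly p c"
  using assms
proof (induction rule: polyfuns_induct)
  case (const c) then show ?case by (intro exI[of _ "[:c:]"]) auto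
next
  case (coord i) then show ?case by (intro exI[of _ "[:a $ i, h $ i:]"]) auto
next
  case (add f g)
  then obtain p q where "\<forall>c. f (a + c *s h) = poly p c" "\<forall>c. g (a + c *s h) = poly q c" by blast
  then show ?case by (intro exI[of _ "p + q"]) auto
next
  case (mult f g)
  then obtain p q where "\<forall>c. f (a + c *s h) = poly p c" "\<forall>c. g (a + c *s h) = poly q c" by blast
  then show ?case by (intro exI[of _ "p * q"]) auto
qed

lemma polyfuns_zeros_line:
  assumes "f \<in> polyfuns" "f (a + c *s h) \<noteq> 0"
  shows "finite {c. f (a + c *s h) = 0}"
proof -
  obtain p where p: "\<forall>c. f (a + c *s h) = poly p c" using polyfuns_line[OF assms(1)] by blast
  then have "p \<noteq> 0" using assms(2) by auto
  then show ?thesis using p poly_roots_finite by simp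
qed

text \<open>These are the complex affine subspaces and the empty set. Factors have to be cancelled
  on a reflecting hyperplane as well as on the whole space, hence the generality.\<close>

definition line_closed :: "(complex ^ 'd) set \<Rightarrow> bool" where
  "line_closed S \<longleftrightarrow> (\<forall>a\<in>S. \<forall>b\<in>S. \<forall>c. a + c *s (b - a) \<in> S)"

lemma line_closed_UNIV [simp]: "line_closed UNIV"
  by (simp add: line_closed_def)

lemma line_closed_hyperplane: "line_closed {z. (\<Sum>i\<in>UNIV. v $ i * z $ i) = 0}"
  unfolding line_closed_def
proof clarify
  fix a b :: "complex ^ 'a" and c
  assume a: "(\<Sum>i\<in>UNIV. v $ i * a $ i) = 0" and b: "(\<Sum>i\<in>UNIV. v $ i * b $ i) = 0"
  have "(\<Sum>i\<in>UNIV. v $ i * (a + c *s (b - a)) $ i) =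
    (\<Sum>i\<in>UNIV. v $ i * a $ i) + c * ((\<Sum>i\<in>UNIV. v $ i * b $ i) - (\<Sum>i\<in>UNIV. v $ i * a $ i))"
    by (simp add: algebra_simps sum.distrib sum_subtractf sum_distrib_left)
  then show "(\<Sum>i\<in>UNIV. v $ i * (a + c *s (b - a)) $ i) = 0" using a b by simp
qed

text \<open>If both factors were nonzero somewhere, each would have only finitely many zeros on the
  line joining the two points, yet together their zeros would cover this line.\<close>

lemma polyfuns_mult_eq_0:
  assumes S: "line_closed S" and fg: "f \<in> polyfuns" "g \<in> polyfuns"
    and eq: "\<And>z. z \<in> S \<Longrightarrow> f z * g z = 0" and a: "a \<in> S" "f a \<noteq> 0" and b: "b \<in> S"
  shows "g b = 0"
proof (rule ccontr)
  assume "g b \<noteq> 0"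
  then have "finite {c. g (a + c *s (b - a)) = 0}"
    by (intro polyfuns_zeros_line[where c = 1] fg) auto
  moreover have "finite {c. f (a + c *s (b - a)) = 0}"
    using a by (intro polyfuns_zeros_line[where c = 0] fg) auto
  moreover have "UNIV = {c. f (a + c *s (b - a)) = 0} \<union> {c. g (a + c *s (b - a)) = 0}"
    using eq S a b unfolding line_closed_def by (auto simp: set_eq_iff)
  ultimately have "finite (UNIV :: complex set)" by (metis finite_UnI)
  then show False using infinite_UNIV_char_0 by blast
qed

lemma polyfuns_prod_nonzero:
  assumes S: "line_closed S" "S \<noteq> {}" and "finite A"
    and f: "\<And>i. i \<in> A \<Longrightarrow> f i \<in> polyfuns" "\<And>i. i \<in> A \<Longrightarrow> \<exists>z\<in>S. f i z \<noteq> 0"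
  shows "\<exists>z\<in>S. (\<Prod>i\<in>A. f i z) \<noteq> 0"
  using \<open>finite A\<close> f
proof (induction A)
  case empty then show ?case using S by auto
next
  case (insert i A)
  then obtain a b where "a \<in> S" "f i a \<noteq> 0" "b \<in> S" "(\<Prod>i\<in>A. f i b) \<noteq> 0" by blast
  moreover have "(\<lambda>z. \<Prod>i\<in>A. f i z) \<in> polyfuns" using insert by (intro polyfuns_intros) auto
  ultimately have "\<not> (\<forall>z\<in>S. f i z * (\<Prod>i\<in>A. f i z) = 0)"
    using polyfuns_mult_eq_0[OF S(1), of "f i" "\<lambda>z. \<Prod>i\<in>A. f i z"] insert by blast
  then show ?case using insert by auto
qed

lemma continuous_on_scalar_mult_vec:
  fixes f :: "'a::topological_space \<Rightarrow> complex" and g :: "'a \<Rightarrow> complex ^ 'd"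
  assumes "continuous_on S f" "continuous_on S g"
  shows "continuous_on S (\<lambda>x. f x *s g x)"
  unfolding vector_scalar_mult_def by (intro continuous_intros assms)

text \<open>On the line from a point of \<open>U\<close> to \<open>a\<close>, the part inside
  \<open>U\<close> is open and nonempty, hence infinite, while the polynomial has finitely many
  zeros there.\<close>

lemma polyfuns_zeros_no_interior:
  assumes f: "f \<in> polyfuns" "f a \<noteq> 0" and U: "open U" "U \<noteq> {}"
  shows "\<exists>z\<in>U. f z \<noteq> 0"
proof (rule ccontr)
  assume *: "\<not> (\<exists>z\<in>U. f z \<noteq> 0)"
  obtain b where b: "b \<in> U" using U by auto
  have "f (b + 1 *s (a - b)) \<noteq> 0" using f by simp
  then have fin: "finite {c. f (b + c *s (a - b)) = 0}"
    using polyfuns_zeros_line[OF f(1), of b 1 "a - b"] by blast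
  have cont: "continuous_on UNIV (\<lambda>c. b + c *s (a - b))"
    unfolding vector_scalar_mult_def by (intro continuous_intros)
  define C where "C = (\<lambda>c. b + c *s (a - b)) -` U"
  have "open C" unfolding C_def by (rule open_vimage[OF U(1) cont])
  moreover have "0 \<in> C" unfolding C_def using b by simp
  moreover have "C \<subseteq> {c. f (b + c *s (a - b)) = 0}"
    unfolding C_def using * by (intro subsetI CollectI) (metis vimageE)
  then have "finite C" using fin by (rule finite_subset)
  ultimately show False using finite_imp_not_open[of C] by blast
qed

text \<open>The pairing is read as a polynomial in \<open>v\<close>: for each fixed nonzero
  \<open>a\<close> it is a nonzero linear form, and a finite product of nonzero polynomials is
  nonzero somewhere.\<close>

lemma separating_linear:
  assumes "finite A" "0 \<notin> A"
  shows "\<exists>v. \<forall>a\<in>A. (\<Sum>i\<in>UNIV. v $ i * a $ i) \<noteq> (0::complex)"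
proof -
  have "\<exists>v\<in>UNIV. (\<Prod>a\<in>A. \<Sum>i\<in>UNIV. v $ i * a $ i) \<noteq> (0::complex)"
  proof (rule polyfuns_prod_nonzero)
    fix a assume "a \<in> A"
    show "(\<lambda>v. \<Sum>i\<in>UNIV. v $ i * a $ i) \<in> polyfuns" by (intro polyfuns_intros)
    obtain j where "a $ j \<noteq> 0" using \<open>a \<in> A\<close> assms(2) by (metis vec_eq_iff zero_index)
    then have "(\<Sum>i\<in>UNIV. axis j 1 $ i * a $ i) \<noteq> 0"
      by (simp add: axis_def if_distrib[where f = "\<lambda>x. x * _"] cong: if_cong)
    then show "\<exists>v\<in>UNIV. (\<Sum>i\<in>UNIV. v $ i * a $ i) \<noteq> 0" by blast
  qed (use assms in auto)
  then show ?thesis using assms(1) by auto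
qed

section \<open>Division by a linear form\<close>

lemma polyfuns_divide_shift:
  assumes "f \<in> polyfuns" "s \<in> polyfuns"
  shows "\<exists>r\<in>polyfuns. \<forall>z. f (z + s z *s w) = f z + s z * r z"
  using assms(1)
proof (induction rule: polyfuns_induct)
  case (const c) then show ?case by (intro bexI[of _ "\<lambda>_. 0"] polyfuns_intros) auto
next
  case (coord i) then show ?case by (intro bexI[of _ "\<lambda>_. w $ i"] polyfuns_intros) auto
next
  case (add f g)
  then obtain r t where *: "r \<in> polyfuns" "t \<in> polyfuns" "\<forall>z. f (z + s z *s w) = f z + s z * r z"
    "\<forall>z. g (z + s z *s w) = g z + s z * t z" by blast
  then show ?case by (intro bexI[of _ "\<lambda>z. r z + t z"] polyfuns_intros) (auto simp: algebra_simps)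
next
  case (mult f g)
  then obtain r t where *: "r \<in> polyfuns" "t \<in> polyfuns" "\<forall>z. f (z + s z *s w) = f z + s z * r z"
    "\<forall>z. g (z + s z *s w) = g z + s z * t z" by blast
  show ?case
  proof (intro bexI[of _ "\<lambda>z. r z * g z + f z * t z + s z * r z * t z"] allI)
    show "(\<lambda>z. r z * g z + f z * t z + s z * r z * t z) \<in> polyfuns"
      by (intro polyfuns_add polyfuns_mult * mult assms)
  qed (simp add: * algebra_simps)
qed

text \<open>With \<open>l w = 1\<close>, the point \<open>z - l z *s w\<close> lies on the
  hyperplane, where \<open>f\<close> vanishes. A shift by a polynomial multiple of a fixed vector
  changes \<open>f\<close> by a polynomial multiple of that factor, and this remainder is the
  quotient.\<close>

lemma polyfuns_divide_linear:
  assumes f: "f \<in> polyfuns" and v: "v \<noteq> 0"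
    and zero: "\<And>z. (\<Sum>i\<in>UNIV. v $ i * z $ i) = 0 \<Longrightarrow> f z = 0"
  shows "\<exists>g\<in>polyfuns. \<forall>z. f z = (\<Sum>i\<in>UNIV. v $ i * z $ i) * g z"
proof -
  define l where "l z = (\<Sum>i\<in>UNIV. v $ i * z $ i)" for z
  obtain j where j: "v $ j \<noteq> 0" using v by (metis vec_eq_iff zero_index)
  define w where "w = axis j (1 / v $ j)"
  have lw: "l w = 1" using j
    by (simp add: l_def w_def axis_def if_distrib[where f = "\<lambda>x. _ * x"] cong: if_cong)
  have l: "l \<in> polyfuns" unfolding l_def[abs_def] by (rule polyfuns_linear)
  have ladd: "l (z + c *s w) = l z + c * l w" for z c
    by (simp add: l_def algebra_simps sum.distrib sum_distrib_left)
  obtain r where r: "r \<in> polyfuns" "\<forall>z. f (z + (- l z) *s w) = f z + (- l z) * r z"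
    using polyfuns_divide_shift[OF f polyfuns_minus[OF l], of w] by blast
  have "f (z + (- l z) *s w) = 0" for z
    using ladd[of z "- l z"] lw zero[folded l_def] by simp
  then have "f z = l z * r z" for z using r(2)[rule_format, of z] by simp
  then show ?thesis using r(1) unfolding l_def by blast
qed

section \<open>Interpolation and separately polynomial functions\<close>

lemma Lagrange_interpolation:
  fixes p :: "complex poly"
  assumes "Polynomial.degree p \<le> n"
  shows "poly p x = (\<Sum>k\<le>n. poly p (of_nat k) * (\<Prod>m\<in>{..n} - {k}. (x - of_nat m) / (of_nat k - of_nat m)))"
proof -
  define L where "L k = (\<Prod>m\<in>{..n} - {k}. Polynomial.smult (1 / (of_nat k - of_nat m)) [:- of_nat m, 1 :: complex:])" for k :: nat
  define q where "q = (\<Sum>k\<le>n. Polynomial.smult (poly p (of_nat k)) (L k))"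
  have L: "poly (L k) x = (\<Prod>m\<in>{..n} - {k}. (x - of_nat m) / (of_nat k - of_nat m))" for k x
    by (simp add: L_def poly_prod diff_divide_distrib)
  have deg: "Polynomial.degree (L k) \<le> n" if "k \<le> n" for k
  proof -
    have "Polynomial.degree (L k) \<le> (\<Sum>m\<in>{..n} - {k}. Polynomial.degree (Polynomial.smult (1 / (of_nat k - of_nat m)) [:- of_nat m, 1::complex:]))"
      unfolding L_def by (rule order.trans[OF degree_prod_sum_le]) auto
    also have "\<dots> \<le> (\<Sum>m\<in>{..n} - {k}. 1)"
      by (intro sum_mono) (auto simp: degree_smult_eq)
    also have "\<dots> = n" using that by simp
    finally show ?thesis .
  qed
  have "p = q"
  proof (rule poly_eqI_degree[of "of_nat ` {..n}"])
    fix x :: complex assume "x \<in> of_nat ` {..n}"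
    then obtain k where k: "k \<le> n" "x = of_nat k" by auto
    show "poly p x = poly q x"
    proof -
      have "poly (L j) x = (if j = k then 1 else 0)" if "j \<le> n" for j
      proof (cases "j = k")
        case True then show ?thesis using k by (auto simp: L intro!: prod.neutral)
      next
        case False
        have "poly (L j) x = 0" unfolding L
          by (rule prod_zero) (use False k in \<open>auto intro!: bexI[of _ k]\<close>)
        then show ?thesis using False by simp
      qed
      then have "poly q x = (\<Sum>j\<le>n. poly p (of_nat j) * (if j = k then 1 else 0))"
        by (simp add: q_def poly_sum)
      also have "\<dots> = poly p x" using k by (simp add: if_distrib cong: if_cong)
      finally show ?thesis by simp
    qed
  next
    have card: "card (of_nat ` {..n} :: complex set) = Suc n"
      by (subst card_image) (auto simp: inj_on_def)
    show "Polynomial.degree p < card (of_nat ` {..n} :: complex set)" using assms card by simp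
    have "Polynomial.degree q \<le> n" unfolding q_def
      by (intro degree_sum_le) (use deg in \<open>auto intro: order.trans[OF degree_smult_le]\<close>)
    then show "Polynomial.degree q < card (of_nat ` {..n} :: complex set)" using card by simp
  qed
  then have "poly p x = poly q x" by simp
  also have "\<dots> = (\<Sum>k\<le>n. poly p (of_nat k) * (\<Prod>m\<in>{..n} - {k}. (x - of_nat m) / (of_nat k - of_nat m)))"
    unfolding q_def poly_sum poly_smult L ..
  finally show ?thesis .
qed

text \<open>Interpolation in one coordinate after the other writes \<open>F\<close> through values
  with more coordinates frozen. The common degree bound lets the same nodes \<open>0, ..., n\<close>
  serve on every line.\<close>

lemma separately_polynomial_imp_polyfuns:
  assumes sep: "\<And>z i. \<exists>p. Polynomial.degree p \<le> n \<and> (\<forall>c. F (z + c *s axis i 1) = poly p c)"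
  shows "F \<in> polyfuns"
proof -
  have "\<forall>b. (\<lambda>z. F (\<chi> i. if i \<in> A then z $ i else b $ i)) \<in> polyfuns" if "finite A" for A :: "'a set"
    using that
  proof (induction A)
    case empty then show ?case by (auto intro: polyfuns_const)
  next
    case (insert j A)
    show ?case
    proof
      fix b
      let ?b = "\<lambda>k. (\<chi> i. if i = j then of_nat k else b $ i) :: complex ^ 'a"
      let ?L = "\<lambda>k z. (\<Prod>m\<in>{..n} - {k}. (z $ j - of_nat m) / (of_nat k - of_nat m)) :: complex"
      have "F (\<chi> i. if i \<in> insert j A then z $ i else b $ i) =
        (\<Sum>k\<le>n. F (\<chi> i. if i \<in> A then z $ i else ?b k $ i) * ?L k z)" for z
      proof -
        \<comment> \<open>Coordinate \<open>j\<close> is set to 0, so that the point in question and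
          all nodes lie on one line through \<open>y\<close>, at the parameters \<open>z $ j\<close>
          and \<open>k\<close>.\<close>
        define y where "y = (\<chi> i. if i = j then 0 else if i \<in> A then z $ i else b $ i)"
        obtain p where p: "Polynomial.degree p \<le> n" "\<forall>c. F (y + c *s axis j 1) = poly p c" using sep by blast
        have 1: "(\<chi> i. if i \<in> insert j A then z $ i else b $ i) = y + (z $ j) *s axis j 1"
          by (auto simp: y_def vec_eq_iff axis_def)
        have 2: "(\<chi> i. if i \<in> A then z $ i else ?b k $ i) = y + of_nat k *s axis j 1" for k
          using insert(2) by (auto simp: y_def vec_eq_iff axis_def)
        show ?thesis unfolding 1 2 p(2)[rule_format] by (rule Lagrange_interpolation[OF p(1)])
      qed
      moreover have "(\<lambda>z. \<Sum>k\<le>n. F (\<chi> i. if i \<in> A then z $ i else ?b k $ i) * ?L k z) \<in> polyfuns"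
        unfolding divide_inverse
        by (intro polyfuns_sum polyfuns_mult polyfuns_prod polyfuns_diff polyfuns_coord polyfuns_const
            insert(3)[rule_format])
      ultimately show "(\<lambda>z. F (\<chi> i. if i \<in> insert j A then z $ i else b $ i)) \<in> polyfuns"
        by simp
    qed
  qed
  from this[of UNIV] show ?thesis by simp
qed

section \<open>Linear forms and hyperplanes\<close>

definition lin :: "complex ^ 'd \<Rightarrow> complex ^ 'd \<Rightarrow> complex" where
  "lin v z = (\<Sum>i\<in>UNIV. v $ i * z $ i)"

lemma lin_add: "lin v (x + y) = lin v x + lin v y"
  by (simp add: lin_def algebra_simps sum.distrib)

lemma lin_scale: "lin v (c *s x) = c * lin v x"
  by (simp add: lin_def algebra_simps sum_distrib_left)

lemma lin_diff: "lin v (x - y) = lin v x - lin v y"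
  by (simp add: lin_def algebra_simps sum_subtractf)

lemma lin_polyfuns: "lin v \<in> polyfuns"
  unfolding lin_def[abs_def] by (rule polyfuns_linear)

lemma lin_nonzero:
  assumes "v \<noteq> 0"
  shows "\<exists>w. lin v w = 1"
proof -
  obtain j where j: "v $ j \<noteq> 0" using assms by (metis vec_eq_iff zero_index)
  have "lin v (axis j (1 / v $ j)) = 1" using j
    by (simp add: lin_def axis_def if_distrib[where f = "\<lambda>x. _ * x"] cong: if_cong)
  then show ?thesis by blast
qed

lemma lin_proportional:
  assumes v: "v \<noteq> 0" and sub: "\<And>z. lin v z = 0 \<Longrightarrow> f z = 0"
    and add: "\<And>x y. f (x + y) = f x + f y" and scale: "\<And>c x. f (c *s x) = c * f x"
  shows "\<exists>k. \<forall>z. f z = k * lin v z"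
proof -
  obtain w where w: "lin v w = 1" using lin_nonzero[OF v] by blast
  have "f z = f w * lin v z" for z
  proof -
    have "f (z + (- lin v z) *s w) = 0" by (rule sub) (simp add: lin_add lin_diff lin_scale w)
    then show ?thesis by (simp only: add scale) (simp add: algebra_simps)
  qed
  then show ?thesis by blast
qed

lemma det_add_row_multiples:
  fixes A :: "'a::field ^ 'n ^ 'n"
  assumes "finite S" "j \<notin> S"
  shows "det (\<chi> i. if i \<in> S then A $ i + c i *s A $ j else A $ i) = det A"
  using assms
proof (induction S)
  case empty then show ?case by (simp add: vec_nth_inverse)
next
  case (insert i S)
  let ?B = "\<chi> i. if i \<in> S then A $ i + c i *s A $ j else A $ i"
  have eq: "(\<chi> k. if k \<in> insert i S then A $ k + c k *s A $ j else A $ k) =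
    (\<chi> k. if k = i then row i ?B + c i *s row j ?B else row k ?B)"
    using insert by (auto simp: vec_eq_iff row_def)
  have "det ?B = det A" by (rule insert.IH) (use insert in auto)
  moreover have "i \<noteq> j" using insert by auto
  ultimately show ?case unfolding eq by (rule trans[OF det_row_operation, rotated])
qed

text \<open>\<open>C\<close> changes coordinates so that the \<open>j\<close>-th one becomes
  \<open>lin v\<close>. In \<open>C ** A\<close> row \<open>j\<close> of \<open>C\<close> is scaled
  by \<open>1 + lin v w\<close>, and the other rows only gain multiples of row
  \<open>j\<close>.\<close>

lemma det_rank_one_perturbation:
  fixes A :: "complex ^ 'd ^ 'd"
  assumes A: "\<And>z. A *v z = z + lin v z *s w" and v: "v \<noteq> 0"
  shows "det A = 1 + lin v w"
proof -
  obtain j where j: "v $ j \<noteq> 0" using v by (metis vec_eq_iff zero_index)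
  define C where "C = (\<chi> i. if i = j then v else axis i 1)"
  have Cmul: "(C *v z) $ i = (if i = j then lin v z else z $ i)" for z i
    by (auto simp: C_def matrix_vector_mult_def lin_def axis_def if_distrib[where f = "\<lambda>x. x * _"] cong: if_cong)
  have "C *v z = 0 \<Longrightarrow> z = 0" for z
  proof -
    assume *: "C *v z = 0"
    then have z: "z $ i = 0" if "i \<noteq> j" for i using Cmul[of z i] that by simp
    have "lin v z = v $ j * z $ j" unfolding lin_def
      by (subst sum.remove[of _ j]) (auto simp: z)
    then have "z $ j = 0" using Cmul[of z j] * j by simp
    then have "z $ i = 0" for i using z[of i] by (cases "i = j") auto
    then show "z = 0" by (simp add: vec_eq_iff)
  qed
  then have "invertible C" using invertible_left_inverse matrix_left_invertible_ker by blast
  then have detC: "det C \<noteq> 0" by (simp add: invertible_det_nz)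
  define B where "B = (\<chi> i. if i = j then (1 + lin v w) *s C $ j else C $ i)"
  have CA: "C ** A = (\<chi> i. if i \<in> UNIV - {j} then C $ i + w $ i *s C $ j else (1 + lin v w) *s C $ j)"
  proof (subst matrix_eq, intro allI)
    fix z
    have "(C ** A) *v z = C *v (z + lin v z *s w)"
      by (simp only: matrix_vector_mul_assoc[symmetric] A)
    also have "\<dots> = (\<chi> i. if i \<in> UNIV - {j} then C $ i + w $ i *s C $ j else (1 + lin v w) *s C $ j) *v z"
    proof (subst vec_eq_iff, intro allI)
      fix i
      have Ci: "(\<Sum>k\<in>UNIV. C $ i $ k * z $ k) = (if i = j then lin v z else z $ i)" for i
        using Cmul[of z i] by (simp add: matrix_vector_mult_def)
      show "(C *v (z + lin v z *s w)) $ i =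
        ((\<chi> i. if i \<in> UNIV - {j} then C $ i + w $ i *s C $ j else (1 + lin v w) *s C $ j) *v z) $ i"
      proof (cases "i = j")
        case True
        then show ?thesis unfolding Cmul
          by (simp add: matrix_vector_mult_def lin_add lin_scale distrib_right sum.distrib mult.assoc
              sum_distrib_left[symmetric] Ci) (simp add: algebra_simps)?
      next
        case False
        then show ?thesis unfolding Cmul
          by (simp add: matrix_vector_mult_def distrib_right sum.distrib mult.assoc sum_distrib_left[symmetric] Ci)
      qed
    qed
    finally show "(C ** A) *v z = \<dots>" .
  qed
  have "det (C ** A) = (1 + lin v w) * det (\<chi> i. if i \<in> UNIV - {j} then C $ i + w $ i *s C $ j else C $ i)"
  proof -
    have 1: "C ** A = (\<chi> i. if i = j then (1 + lin v w) *s C $ j else C $ i + w $ i *s C $ j)"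
      unfolding CA by (auto simp: vec_eq_iff)
    have 2: "(\<chi> i. if i \<in> UNIV - {j} then C $ i + w $ i *s C $ j else C $ i) =
      (\<chi> i. if i = j then C $ j else C $ i + w $ i *s C $ j)"
      by (auto simp: vec_eq_iff)
    show ?thesis unfolding 1 2 by (rule det_row_mul)
  qed
  also have "\<dots> = (1 + lin v w) * det C"
    by (subst det_add_row_multiples) auto
  finally show ?thesis using detC by (simp add: det_mul)
qed

section \<open>Rank and conjugation\<close>

lemma rank_mult_le_right: "rank (A ** B) \<le> rank B" for A :: "'a::field ^ 'n ^ 'n"
proof -
  have "rows (A ** B) \<subseteq> vec.span (rows B)"
  proof
    fix r assume "r \<in> rows (A ** B)"
    then obtain i where "r = row i (A ** B)" by (auto simp: rows_def)
    then have "r = (\<Sum>k\<in>UNIV. A $ i $ k *s row k B)"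
      by (auto simp: vec_eq_iff row_def matrix_matrix_mult_def)
    also have "\<dots> \<in> vec.span (rows B)"
      by (intro vec.span_sum vec.span_scale vec.span_base) (auto simp: rows_def)
    finally show "r \<in> vec.span (rows B)" .
  qed
  then have "vec.dim (rows (A ** B)) \<le> vec.dim (vec.span (rows B))" by (rule vec.dim_subset)
  then show ?thesis by (simp add: row_rank_def_gen)
qed

lemma rank_mult_le_left: "rank (A ** B) \<le> rank A" for A :: "'a::field ^ 'n ^ 'n"
proof -
  have "rows (A ** B) = (\<lambda>r. transpose B *v r) ` rows A"
  proof -
    have "row i (A ** B) = transpose B *v row i A" for i
      by (auto simp: vec_eq_iff row_def matrix_matrix_mult_def vector_matrix_mult_def mult.commute)
    then show ?thesis unfolding rows_def by auto
  qed
  then show ?thesis unfolding row_rank_def_gen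
    using vec.dim_image_le[OF matrix_vector_mul_linear_gen[of "transpose B"], of "rows A"] by simp
qed

lemma matrix_inv_mult:
  assumes "invertible A"
  shows "A ** matrix_inv A = mat 1" "matrix_inv A ** A = mat 1"
proof -
  have "A ** matrix_inv A = mat 1 \<and> matrix_inv A ** A = mat 1"
    unfolding matrix_inv_def by (rule someI_ex) (use assms invertible_def in blast)
  then show "A ** matrix_inv A = mat 1" "matrix_inv A ** A = mat 1" by auto
qed

lemma matrix_inv_vector:
  fixes A :: "complex ^ 'd ^ 'd"
  assumes "invertible A"
  shows "A *v (matrix_inv A *v z) = z" "matrix_inv A *v (A *v z) = z"
  by (simp_all add: matrix_vector_mul_assoc matrix_inv_mult[OF assms])

lemma invertible_matrix_inv: "invertible A \<Longrightarrow> invertible (matrix_inv A)"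
  using matrix_inv_mult invertible_def by blast

lemma matrix_inv_matrix_inv:
  fixes A :: "complex ^ 'd ^ 'd"
  assumes "invertible A"
  shows "matrix_inv (matrix_inv A) = A"
proof -
  have "matrix_inv (matrix_inv A) = (A ** matrix_inv A) ** matrix_inv (matrix_inv A)"
    by (simp add: matrix_inv_mult[OF assms])
  also have "\<dots> = A ** (matrix_inv A ** matrix_inv (matrix_inv A))" by (simp add: matrix_mul_assoc)
  also have "\<dots> = A" by (simp add: matrix_inv_mult[OF invertible_matrix_inv[OF assms]])
  finally show ?thesis .
qed

lemma rank_conj:
  fixes A P :: "complex ^ 'd ^ 'd"
  assumes "invertible P"
  shows "rank (P ** A ** matrix_inv P) = rank A"
proof (rule antisym)
  show "rank (P ** A ** matrix_inv P) \<le> rank A"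
    by (meson order.trans rank_mult_le_left rank_mult_le_right)
  have "A = matrix_inv P ** (P ** A ** matrix_inv P) ** P"
    by (simp add: matrix_mul_assoc matrix_inv_mult[OF assms])
       (simp add: matrix_mul_assoc[symmetric] matrix_inv_mult[OF assms])
  then show "rank A \<le> rank (P ** A ** matrix_inv P)"
    by (metis order.trans rank_mult_le_left rank_mult_le_right)
qed

lemma rank_zero: "rank (0 :: 'a::field ^ 'n ^ 'n) = 0"
proof -
  have "rows (0 :: 'a ^ 'n ^ 'n) \<subseteq> {0}" by (auto simp: rows_def row_def vec_eq_iff)
  then show ?thesis by (simp add: row_rank_def_gen)
qed

section \<open>Finite pseudoreflection groups\<close>

lemma GL_simps [simp]:
  "carrier GL = {A. invertible A}" "mult GL = (**)" "one GL = mat 1"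
  by (simp_all add: GL_def)

lemma group_GL: "group (GL :: (complex ^ 'd ^ 'd) monoid)"
proof (rule groupI)
  fix x y z :: "complex ^ 'd ^ 'd"
  show "x \<in> carrier GL \<Longrightarrow> y \<in> carrier GL \<Longrightarrow> x \<otimes>\<^bsub>GL\<^esub> y \<in> carrier GL"
    by (simp add: invertible_mult)
  show "\<one>\<^bsub>GL\<^esub> \<in> carrier (GL :: (complex ^ 'd ^ 'd) monoid)"
    by (auto simp: invertible_def intro: exI[of _ "mat 1"])
  show "x \<in> carrier GL \<Longrightarrow> \<exists>y\<in>carrier GL. y \<otimes>\<^bsub>GL\<^esub> x = \<one>\<^bsub>GL\<^esub>"
    using matrix_inv_mult invertible_matrix_inv by auto
qed (auto simp: matrix_mul_assoc)

lemma inv_GL: "invertible A \<Longrightarrow> inv\<^bsub>GL\<^esub> A = matrix_inv A" for A :: "complex ^ 'd ^ 'd"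
  using group.inv_equality[OF group_GL, of "matrix_inv A" A]
  by (simp add: matrix_inv_mult invertible_matrix_inv)

locale pr_group =
  fixes G :: "(complex ^ 'd ^ 'd) set"
  assumes fin: "finite G" and pr: "pseudoreflection_group G"
begin

lemma subgroup_G: "subgroup G GL"
proof -
  obtain S where S: "S \<subseteq> {\<sigma>. pseudoreflection \<sigma>}" "G = generate GL S"
    using pr unfolding pseudoreflection_group_def by blast
  show ?thesis unfolding S(2)
    by (rule group.generate_is_subgroup[OF group_GL]) (use S in \<open>auto simp: pseudoreflection_def\<close>)
qed

lemma invertible: "\<sigma> \<in> G \<Longrightarrow> invertible \<sigma>"
  using subgroup.subset[OF subgroup_G] by auto

lemma one_in: "mat 1 \<in> G"
  using subgroup.one_closed[OF subgroup_G] by simp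

lemma mult_in: "\<sigma> \<in> G \<Longrightarrow> \<tau> \<in> G \<Longrightarrow> \<sigma> ** \<tau> \<in> G"
  using subgroup.m_closed[OF subgroup_G] by simp

lemma inv_in: "\<sigma> \<in> G \<Longrightarrow> matrix_inv \<sigma> \<in> G"
  using subgroup.m_inv_closed[OF subgroup_G] inv_GL invertible by metis

lemma card_pos: "card G > 0"
  using fin one_in card_gt_0_iff by blast

lemmas mv_inv = matrix_inv_vector[OF invertible]

lemma bij_inv: "bij_betw matrix_inv G G"
  by (rule bij_betw_byWitness[where f' = matrix_inv])
     (auto simp: inv_in matrix_inv_matrix_inv invertible)

lemma bij_mult: "\<tau> \<in> G \<Longrightarrow> bij_betw (\<lambda>\<sigma>. \<sigma> ** \<tau>) G G"
  by (rule bij_betw_byWitness[where f' = "\<lambda>\<sigma>. \<sigma> ** matrix_inv \<tau>"])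
     (auto simp: mult_in inv_in matrix_mul_assoc[symmetric] matrix_inv_mult invertible)

lemma pow_card: "\<sigma> \<in> G \<Longrightarrow> \<sigma> [^]\<^bsub>GL\<^esub> card G = mat 1"
proof -
  assume s: "\<sigma> \<in> G"
  have "group (GL\<lparr>carrier := G\<rparr>)" by (rule subgroup.subgroup_is_group[OF subgroup_G group_GL])
  from group.pow_order_eq_1[OF this] s
  show ?thesis by (simp add: order_def monoid.nat_pow_consistent[OF group.is_monoid[OF group_GL], symmetric])
qed

lemma pow_in: "\<sigma> \<in> G \<Longrightarrow> \<sigma> [^]\<^bsub>GL\<^esub> (n::nat) \<in> G"
  by (induction n) (auto simp: one_in mult_in)

end

locale pr_rep = pr_group G for G :: "(complex ^ 'd ^ 'd) set" +
  fixes \<rho> :: "complex ^ 'd ^ 'd \<Rightarrow> complex"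
  assumes rep: "one_dim_rep G \<rho>"
begin

lemma rep_mult: "\<sigma> \<in> G \<Longrightarrow> \<tau> \<in> G \<Longrightarrow> \<rho> (\<sigma> ** \<tau>) = \<rho> \<sigma> * \<rho> \<tau>"
  using rep by (auto simp: one_dim_rep_def hom_def)

lemma rep_nz: "\<sigma> \<in> G \<Longrightarrow> \<rho> \<sigma> \<noteq> 0"
  using rep by (auto simp: one_dim_rep_def hom_def)

lemma rep_one: "\<rho> (mat 1) = 1"
  using rep_mult[OF one_in one_in] rep_nz[OF one_in] by simp

lemma rep_inv: "\<sigma> \<in> G \<Longrightarrow> \<rho> (matrix_inv \<sigma>) = 1 / \<rho> \<sigma>"
  using rep_mult[of \<sigma> "matrix_inv \<sigma>"] inv_in[of \<sigma>] rep_one rep_nz[of \<sigma>]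
  by (simp add: matrix_inv_mult invertible field_simps)

lemma rep_pow: "\<sigma> \<in> G \<Longrightarrow> \<rho> (\<sigma> [^]\<^bsub>GL\<^esub> (n::nat)) = \<rho> \<sigma> ^ n"
  by (induction n) (auto simp: rep_one rep_mult pow_in)

end

lemma det_pow: "det (\<sigma> [^]\<^bsub>GL\<^esub> (n::nat)) = det \<sigma> ^ n" for \<sigma> :: "complex ^ 'd ^ 'd"
  by (induction n) (auto simp: det_mul)

section \<open>Reflecting hyperplanes and the generating polynomial\<close>

locale generating_data = pr_rep G \<rho> for G :: "(complex ^ 'd ^ 'd) set" and \<rho> +
  fixes a :: "(complex ^ 'd) set \<Rightarrow> complex ^ 'd ^ 'd" and v :: "(complex ^ 'd) set \<Rightarrow> complex ^ 'd"
  assumes data: "\<And>H. H \<in> reflecting_hyperplanes G \<Longrightarrow>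
      a H \<in> G \<and> generate GL {a H} = pointwise_stabilizer G H \<and> {z. lin (v H) z = 0} = H"
begin

abbreviation "R \<equiv> reflecting_hyperplanes G"

definition cexp :: "(complex ^ 'd) set \<Rightarrow> nat" where
  "cexp H = (LEAST c. \<rho> (a H) = det (a H) ^ c)"

definition lpoly :: "complex ^ 'd \<Rightarrow> complex" where
  "lpoly z = (\<Prod>H\<in>R. lin (v H) z ^ cexp H)"

lemma finite_R: "finite R"
proof -
  have "R \<subseteq> (\<lambda>\<sigma>. {z. \<sigma> *v z = z}) ` G" unfolding reflecting_hyperplanes_def by auto
  then show ?thesis using fin finite_surj by blast
qed

lemma a_in: "H \<in> R \<Longrightarrow> a H \<in> G" and lin_v: "H \<in> R \<Longrightarrow> lin (v H) z = 0 \<longleftrightarrow> z \<in> H"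
  and stab: "H \<in> R \<Longrightarrow> pointwise_stabilizer G H = generate GL {a H}"
  using data by blast+

lemma v_nonzero: "H \<in> R \<Longrightarrow> v H \<noteq> 0"
proof
  assume H: "H \<in> R" and v0: "v H = 0"
  obtain \<sigma> where \<sigma>: "H = {z. \<sigma> *v z = z}" "pseudoreflection \<sigma>"
    using H unfolding reflecting_hyperplanes_def by blast
  have "lin (v H) z = 0" for z using v0 by (simp add: lin_def)
  then have "\<forall>z. \<sigma> *v z = z" using lin_v[OF H] \<sigma>(1) by blast
  then have "\<sigma> = mat 1" by (simp add: matrix_eq)
  then show False using \<sigma>(2) by (simp add: pseudoreflection_def rank_zero)
qed

text \<open>Subtracting \<open>lin (v H) z *s w0\<close> moves \<open>z\<close> into
  \<open>H\<close>, where \<open>s\<close> is the identity. Hence \<open>s\<close> displaces every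
  point in one fixed direction, and its determinant is the factor by which it multiplies the linear
  form.\<close>

lemma stab_form:
  assumes H: "H \<in> R" and s: "s \<in> pointwise_stabilizer G H"
  shows "\<exists>w. (\<forall>z. s *v z = z + lin (v H) z *s w) \<and> det s = 1 + lin (v H) w"
proof -
  obtain w0 where w0: "lin (v H) w0 = 1" using lin_nonzero[OF v_nonzero[OF H]] by blast
  have eq: "s *v z = z + lin (v H) z *s (s *v w0 - w0)" for z
  proof -
    have "z - lin (v H) z *s w0 \<in> H"
      using lin_v[OF H, of "z - lin (v H) z *s w0"] by (simp add: lin_diff lin_scale w0 del: vector_ssub_ldistrib)
    then have "s *v (z - lin (v H) z *s w0) = z - lin (v H) z *s w0"
      using s unfolding pointwise_stabilizer_def by blast
    then show ?thesis
      by (simp add: matrix_vector_mult_diff_distrib vector_scalar_commute algebra_simps)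
  qed
  then show ?thesis using det_rank_one_perturbation[OF eq v_nonzero[OF H]] by blast
qed

lemma lin_stab:
  assumes "H \<in> R" "s \<in> pointwise_stabilizer G H"
  shows "lin (v H) (s *v z) = det s * lin (v H) z"
  using stab_form[OF assms] by (auto simp: lin_add lin_scale algebra_simps)

text \<open>An element of determinant 1 would be a shear. The displacement of its
  \<open>n\<close>-th power grows like \<open>n\<close>, which contradicts finite order unless it is
  zero.\<close>

lemma stab_det_1:
  assumes H: "H \<in> R" and s: "s \<in> pointwise_stabilizer G H" and d: "det s = 1"
  shows "s = mat 1"
proof -
  obtain w where w: "\<And>z. s *v z = z + lin (v H) z *s w" "lin (v H) w = 0"
    using stab_form[OF H s] d by auto
  have pow: "(s [^]\<^bsub>GL\<^esub> n) *v z = z + (of_nat n * lin (v H) z) *s w" for n :: nat and z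
  proof (induction n arbitrary: z)
    case (Suc n)
    show ?case
      by (simp add: matrix_vector_mul_assoc[symmetric] w(1) Suc lin_add lin_scale w(2))
         (simp add: vec_eq_iff algebra_simps)
  qed (simp add: vec_eq_iff)
  have "s \<in> G" using s unfolding pointwise_stabilizer_def by blast
  obtain w0 where w0: "lin (v H) w0 = 1" using lin_nonzero[OF v_nonzero[OF H]] by blast
  have "w = 0" using pow[of "card G" w0] pow_card[OF \<open>s \<in> G\<close>] card_pos w0 by simp
  then show ?thesis using w(1) by (simp add: matrix_eq)
qed

lemma a_stab: "H \<in> R \<Longrightarrow> a H \<in> pointwise_stabilizer G H"
  using stab[of H] generate.incl[of "a H" "{a H}" GL] by auto

lemma stab_pow: "s \<in> pointwise_stabilizer G H \<Longrightarrow> s [^]\<^bsub>GL\<^esub> (n::nat) \<in> pointwise_stabilizer G H"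
  by (induction n) (auto simp: pointwise_stabilizer_def one_in mult_in matrix_vector_mul_assoc[symmetric])

text \<open>Without this the \<open>LEAST\<close> in the exponent would be meaningless. If
  \<open>k\<close> is the order of \<kappa> \<open>= det (a H)\<close>, then \<open>a H\<close> to
  the power \<open>k\<close> has determinant 1 and so is the identity. Thus
  \<open>\<rho> (a H)\<close> is a \<open>k\<close>-th root of unity, and the \<open>k\<close>
  distinct powers of \<kappa> are all of these roots.\<close>

lemma cexp_exists:
  assumes H: "H \<in> R"
  shows "\<exists>c. \<rho> (a H) = det (a H) ^ c"
proof -
  define \<kappa> where "\<kappa> = det (a H)"
  define k where "k = (LEAST k. k > 0 \<and> \<kappa> ^ k = 1)"
  have "\<kappa> ^ card G = 1"
    using det_pow[of "a H" "card G"] unfolding \<kappa>_def pow_card[OF a_in[OF H]] det_I by (rule sym)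
  then have k: "k > 0 \<and> \<kappa> ^ k = 1"
    unfolding k_def using LeastI[of "\<lambda>k. k > 0 \<and> \<kappa> ^ k = 1" "card G"] card_pos by blast
  have kmin: "\<not> (j > 0 \<and> \<kappa> ^ j = 1)" if "j < k" for j
    using not_less_Least[of j] that unfolding k_def by blast
  have "a H [^]\<^bsub>GL\<^esub> k = mat 1"
    by (rule stab_det_1[OF H stab_pow[OF a_stab[OF H]]]) (use k in \<open>simp add: det_pow \<kappa>_def\<close>)
  then have "\<rho> (a H) ^ k = 1" using rep_pow[OF a_in[OF H], of k] rep_one by simp
  have "\<kappa> \<noteq> 0" using k by (auto simp: power_0_left)
  have "inj_on (\<lambda>j. \<kappa> ^ j) {..<k}"
  proof (rule linorder_inj_onI)
    fix i j assume ij: "i < j" "i \<in> {..<k}" "j \<in> {..<k}"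
    show "\<kappa> ^ i \<noteq> \<kappa> ^ j"
    proof
      assume "\<kappa> ^ i = \<kappa> ^ j"
      then have "\<kappa> ^ (j - i) = 1" using ij \<open>\<kappa> \<noteq> 0\<close> by (simp add: power_diff)
      moreover have "j - i < k" "j - i > 0" using ij by auto
      ultimately show False using kmin[of "j - i"] by blast
    qed
  qed auto
  then have "card ((\<lambda>j. \<kappa> ^ j) ` {..<k}) = k" by (simp add: card_image)
  moreover have "(\<lambda>j. \<kappa> ^ j) ` {..<k} \<subseteq> {z. z ^ k = 1}"
  proof clarify
    fix j
    have "(\<kappa> ^ j) ^ k = (\<kappa> ^ k) ^ j" by (simp add: power_mult[symmetric] mult.commute)
    then show "(\<kappa> ^ j) ^ k = 1" using k by simp
  qed
  ultimately have "(\<lambda>j. \<kappa> ^ j) ` {..<k} = {z. z ^ k = 1}"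
    using k by (intro card_subset_eq) (auto simp: card_roots_unity_eq finite_roots_unity)
  then show ?thesis using \<open>\<rho> (a H) ^ k = 1\<close> unfolding \<kappa>_def by auto
qed

lemma rho_a: "H \<in> R \<Longrightarrow> \<rho> (a H) = det (a H) ^ cexp H"
  unfolding cexp_def using cexp_exists by (rule LeastI_ex)

lemma cexp_le: "\<rho> (a H) = det (a H) ^ c \<Longrightarrow> cexp H \<le> c"
  unfolding cexp_def by (rule Least_le)

lemma det_nz: "\<sigma> \<in> G \<Longrightarrow> det \<sigma> \<noteq> 0"
  using invertible invertible_det_nz by blast

lemma det_inv: "\<sigma> \<in> G \<Longrightarrow> det (matrix_inv \<sigma>) = 1 / det \<sigma>"
  using det_mul[of \<sigma> "matrix_inv \<sigma>"] det_nz[of \<sigma>]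
  by (simp add: matrix_inv_mult invertible field_simps)

lemma rho_stab:
  assumes H: "H \<in> R" and s: "s \<in> pointwise_stabilizer G H"
  shows "\<rho> s = det s ^ cexp H"
proof -
  have "s \<in> G \<and> \<rho> s = det s ^ cexp H"
    using s unfolding stab[OF H]
  proof (induction rule: generate.induct)
    case one show ?case by (simp add: one_in rep_one)
  next
    case (incl h) then show ?case using H by (simp add: a_in rho_a)
  next
    case (inv h)
    then have "h = a H" by simp
    moreover have "inv\<^bsub>GL\<^esub> a H = matrix_inv (a H)" using inv_GL invertible a_in[OF H] by blast
    ultimately show ?case using H
      by (simp add: inv_in a_in rep_inv det_inv rho_a power_one_over)
  next
    case (eng h1 h2) then show ?case by (simp add: mult_in rep_mult det_mul power_mult_distrib)
  qed
  then show ?thesis by simp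
qed

lemma image_inv: "\<tau> \<in> G \<Longrightarrow> (\<lambda>z. matrix_inv \<tau> *v z) ` (\<lambda>z. \<tau> *v z) ` H = H"
  by (simp add: image_image mv_inv)

lemma image_mem: "\<tau> \<in> G \<Longrightarrow> z \<in> (\<lambda>z. \<tau> *v z) ` H \<longleftrightarrow> matrix_inv \<tau> *v z \<in> H"
  by (auto simp: mv_inv image_iff) (metis mv_inv(1))

lemma R_image:
  assumes H: "H \<in> R" and t: "\<tau> \<in> G"
  shows "(\<lambda>z. \<tau> *v z) ` H \<in> R"
proof -
  obtain \<sigma> where \<sigma>: "H = {z. \<sigma> *v z = z}" "pseudoreflection \<sigma>" "\<sigma> \<in> G"
    using H unfolding reflecting_hyperplanes_def by blast
  define \<sigma>' where "\<sigma>' = \<tau> ** \<sigma> ** matrix_inv \<tau>"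
  have in': "\<sigma>' \<in> G" unfolding \<sigma>'_def using t \<sigma> by (intro mult_in inv_in)
  have "mat 1 - \<sigma>' = \<tau> ** (mat 1 - \<sigma>) ** matrix_inv \<tau>"
    unfolding matrix_eq
    by (simp add: \<sigma>'_def matrix_vector_mul_assoc[symmetric] matrix_vector_mult_diff_rdistrib
        matrix_vector_mult_diff_distrib mv_inv t)
  then have "rank (mat 1 - \<sigma>') = 1"
    using \<sigma>(2) rank_conj[OF invertible[OF t]] by (simp add: pseudoreflection_def)
  moreover have "\<exists>n::nat. n > 0 \<and> \<sigma>' [^]\<^bsub>GL\<^esub> n = \<one>\<^bsub>GL\<^esub>"
    using pow_card[OF in'] card_pos by auto
  ultimately have "pseudoreflection \<sigma>'"
    unfolding pseudoreflection_def using invertible[OF in'] by simp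
  moreover have "(\<lambda>z. \<tau> *v z) ` H = {z. \<sigma>' *v z = z}"
  proof (rule Set.set_eqI)
    fix z
    have "z \<in> (\<lambda>z. \<tau> *v z) ` H \<longleftrightarrow> \<sigma> *v (matrix_inv \<tau> *v z) = matrix_inv \<tau> *v z"
      unfolding image_mem[OF t] \<sigma>(1) by simp
    also have "\<dots> \<longleftrightarrow> \<tau> *v (\<sigma> *v (matrix_inv \<tau> *v z)) = z" by (metis mv_inv t)
    finally show "z \<in> (\<lambda>z. \<tau> *v z) ` H \<longleftrightarrow> z \<in> {z. \<sigma>' *v z = z}"
      by (simp add: \<sigma>'_def matrix_vector_mul_assoc[symmetric])
  qed
  ultimately show ?thesis unfolding reflecting_hyperplanes_def using in' by blast
qed

text \<open>The conjugate of \<open>a H\<close> by \<tau> stabilizes the image hyperplane, and both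
  \<rho> and \<open>det\<close> are unchanged by conjugation. So the exponent of the image also
  serves for \<open>H\<close>, where the least one was taken. Applied to the inverse of \<tau> this
  yields equality.\<close>

lemma cexp_image_le:
  assumes H: "H \<in> R" and t: "\<tau> \<in> G"
  shows "cexp H \<le> cexp ((\<lambda>z. \<tau> *v z) ` H)"
proof (rule cexp_le)
  let ?H = "(\<lambda>z. \<tau> *v z) ` H" and ?s = "\<tau> ** a H ** matrix_inv \<tau>"
  have "?s \<in> pointwise_stabilizer G ?H"
    using a_stab[OF H] t
    by (auto simp: pointwise_stabilizer_def mult_in inv_in matrix_vector_mul_assoc[symmetric] mv_inv)
  then have "\<rho> ?s = det ?s ^ cexp ?H" by (rule rho_stab[OF R_image[OF H t]])
  then show "\<rho> (a H) = det (a H) ^ cexp ?H"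
    using t a_in[OF H] rep_nz[of \<tau>] det_nz[of \<tau>]
    by (simp add: rep_mult mult_in inv_in rep_inv det_mul det_inv)
qed

lemma cexp_image:
  assumes H: "H \<in> R" and t: "\<tau> \<in> G"
  shows "cexp ((\<lambda>z. \<tau> *v z) ` H) = cexp H"
  using cexp_image_le[OF H t] cexp_image_le[OF R_image[OF H t] inv_in[OF t]] image_inv[OF t, of H]
  by simp

lemma R_subset_eq:
  assumes H: "H \<in> R" "H' \<in> R" "H \<subseteq> H'"
  shows "H = H'"
proof -
  have "\<exists>k. \<forall>z. lin (v H') z = k * lin (v H) z"
    by (rule lin_proportional[OF v_nonzero[OF H(1)]]) (use H lin_v lin_add lin_scale in auto)
  then obtain k where k: "\<And>z. lin (v H') z = k * lin (v H) z" by blast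
  have "k \<noteq> 0" using lin_nonzero[OF v_nonzero[OF H(2)]] k by auto
  then show ?thesis using k lin_v[OF H(1)] lin_v[OF H(2)] by auto
qed

text \<open>No reflecting hyperplane contains another, so each of the other forms is nonzero
  somewhere on \<open>H\<close>, and hence so is their product. It allows the factors of the other
  hyperplanes to be cancelled on \<open>H\<close>.\<close>

lemma generic_point:
  assumes H: "H \<in> R" and A: "A \<subseteq> R - {H}"
  shows "\<exists>z\<in>H. (\<Prod>H'\<in>A. lin (v H') z ^ cexp H') \<noteq> 0"
proof (rule polyfuns_prod_nonzero)
  have Heq: "{z. (\<Sum>i\<in>UNIV. v H $ i * z $ i) = 0} = H" using lin_v[OF H] by (auto simp: lin_def)
  show "line_closed H" using line_closed_hyperplane[of "v H"] Heq by simp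
  have "0 \<in> H" using lin_v[OF H, of 0] by (simp add: lin_def)
  then show "H \<noteq> {}" by blast
  show "finite A" using finite_R A finite_subset by blast
  show "\<exists>z\<in>H. lin (v H') z ^ cexp H' \<noteq> 0" if "H' \<in> A" for H'
    using R_subset_eq[OF H, of H'] that A lin_v by (metis Diff_iff insertI1 power_not_zero subset_iff)
qed (intro polyfuns_power lin_polyfuns)

lemma lpoly_polyfuns: "lpoly \<in> polyfuns"
  unfolding lpoly_def[abs_def] by (intro polyfuns_prod polyfuns_power lin_polyfuns)

lemma lpoly_nonzero: "\<exists>z. lpoly z \<noteq> 0"
proof -
  have "\<exists>z\<in>UNIV. (\<Prod>H\<in>R. lin (v H) z ^ cexp H) \<noteq> 0"
  proof (rule polyfuns_prod_nonzero)
    show "\<exists>z\<in>UNIV. lin (v H) z ^ cexp H \<noteq> 0" if "H \<in> R" for H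
      using lin_nonzero[OF v_nonzero[OF that]] by (metis UNIV_I power_one zero_neq_one)
  qed (auto intro: polyfuns_power lin_polyfuns finite_R)
  then show ?thesis unfolding lpoly_def by blast
qed

text \<open>\<sigma> permutes the hyperplanes other than its own \<open>H0\<close> and preserves
  exponents, so their product \<open>B\<close> is multiplied by a constant \<open>K\<close>.
  Evaluation at a point of \<open>H0\<close>, which \<sigma> fixes and where \<open>B\<close> is
  nonzero, gives \<open>K = 1\<close>. The factor of \<open>H0\<close> contributes a power of
  \<open>det \<sigma>\<close>, which is \<open>\<rho> \<sigma>\<close>.\<close>

lemma lpoly_reflection:
  assumes \<sigma>: "\<sigma> \<in> G" "pseudoreflection \<sigma>"
  shows "lpoly (\<sigma> *v z) = \<rho> \<sigma> * lpoly z"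
proof -
  define H0 where "H0 = {z. \<sigma> *v z = z}"
  have H0: "H0 \<in> R" unfolding H0_def reflecting_hyperplanes_def using \<sigma> by blast
  have st: "\<sigma> \<in> pointwise_stabilizer G H0" unfolding pointwise_stabilizer_def H0_def using \<sigma> by blast
  define \<phi> where "\<phi> H = (\<lambda>z. matrix_inv \<sigma> *v z) ` H" for H
  define B where "B z = (\<Prod>H\<in>R - {H0}. lin (v H) z ^ cexp H)" for z
  have \<phi>H0: "\<phi> H0 = H0"
  proof -
    have "matrix_inv \<sigma> *v z = z" if "z \<in> H0" for z
      using that mv_inv(2)[OF \<sigma>(1), of z] by (simp add: H0_def)
    then show ?thesis unfolding \<phi>_def by simp
  qed
  have inv\<phi>: "(\<lambda>z. \<sigma> *v z) ` \<phi> H = H" for H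
    unfolding \<phi>_def by (simp add: image_image mv_inv \<sigma>)
  have bij: "bij_betw \<phi> (R - {H0}) (R - {H0})"
  proof (rule bij_betw_byWitness[where f' = "\<lambda>H. (\<lambda>z. \<sigma> *v z) ` H"])
    show "\<forall>H\<in>R - {H0}. (\<lambda>z. \<sigma> *v z) ` \<phi> H = H" using inv\<phi> by blast
    show "\<forall>H\<in>R - {H0}. \<phi> ((\<lambda>z. \<sigma> *v z) ` H) = H" unfolding \<phi>_def using image_inv[OF \<sigma>(1)] by blast
    show "\<phi> ` (R - {H0}) \<subseteq> R - {H0}"
      using R_image[OF _ inv_in[OF \<sigma>(1)]] inv\<phi> \<phi>H0 unfolding \<phi>_def by (metis (no_types, lifting) DiffE DiffI image_subsetI insertI1 singletonD)
    show "(\<lambda>H. (\<lambda>z. \<sigma> *v z) ` H) ` (R - {H0}) \<subseteq> R - {H0}"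
      using R_image[OF _ \<sigma>(1)] image_inv[OF \<sigma>(1)] \<phi>H0 unfolding \<phi>_def by (metis (no_types, lifting) DiffE DiffI image_subsetI insertI1 singletonD)
  qed
  have "\<exists>k. \<forall>z. lin (v H) (\<sigma> *v z) = k * lin (v (\<phi> H)) z" if H: "H \<in> R" for H
  proof (rule lin_proportional)
    have \<phi>R: "\<phi> H \<in> R" unfolding \<phi>_def by (rule R_image[OF H inv_in[OF \<sigma>(1)]])
    show "v (\<phi> H) \<noteq> 0" by (rule v_nonzero[OF \<phi>R])
    show "lin (v H) (\<sigma> *v z) = 0" if "lin (v (\<phi> H)) z = 0" for z
    proof -
      have "z \<in> \<phi> H" using that lin_v[OF \<phi>R] by blast
      then have "\<sigma> *v z \<in> H" using inv\<phi>[of H] by blast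
      then show ?thesis using lin_v[OF H] by blast
    qed
  qed (simp_all add: matrix_vector_right_distrib vector_scalar_commute lin_add lin_scale)
  then obtain k where k: "\<And>H z. H \<in> R \<Longrightarrow> lin (v H) (\<sigma> *v z) = k H * lin (v (\<phi> H)) z" by metis
  define K where "K = (\<Prod>H\<in>R - {H0}. k H ^ cexp H)"
  have BK: "B (\<sigma> *v z) = K * B z" for z
  proof -
    have "B (\<sigma> *v z) = (\<Prod>H\<in>R - {H0}. k H ^ cexp H * lin (v (\<phi> H)) z ^ cexp (\<phi> H))"
      unfolding B_def \<phi>_def
      by (intro prod.cong refl)
         (simp add: k power_mult_distrib cexp_image inv_in \<sigma> \<phi>_def)
    also have "\<dots> = K * (\<Prod>H\<in>R - {H0}. lin (v (\<phi> H)) z ^ cexp (\<phi> H))"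
      by (simp add: prod.distrib K_def)
    also have "(\<Prod>H\<in>R - {H0}. lin (v (\<phi> H)) z ^ cexp (\<phi> H)) = B z"
      unfolding B_def by (rule prod.reindex_bij_betw[OF bij])
    finally show ?thesis .
  qed
  obtain z0 where "z0 \<in> H0" "B z0 \<noteq> 0" using generic_point[OF H0, of "R - {H0}"] unfolding B_def by blast
  then have "K = 1" using BK[of z0] by (simp add: H0_def)
  have split: "lpoly z = lin (v H0) z ^ cexp H0 * B z" for z
    unfolding lpoly_def B_def by (rule prod.remove[OF finite_R H0])
  show ?thesis
    unfolding split BK \<open>K = 1\<close> lin_stab[OF H0 st] rho_stab[OF H0 st] by (simp add: power_mult_distrib)
qed

lemma lpoly_semi_invariant: "\<sigma> \<in> G \<Longrightarrow> lpoly (\<sigma> *v z) = \<rho> \<sigma> * lpoly z"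
proof -
  assume s: "\<sigma> \<in> G"
  obtain S where S: "S \<subseteq> {\<sigma>. pseudoreflection \<sigma>}" "G = generate GL S"
    using pr unfolding pseudoreflection_group_def by blast
  have SG: "S \<subseteq> G" unfolding S(2) by (auto intro: generate.incl)
  have "\<sigma> \<in> generate GL S" using s S(2) by simp
  then have "\<sigma> \<in> G \<and> (\<forall>z. lpoly (\<sigma> *v z) = \<rho> \<sigma> * lpoly z)"
  proof (induction rule: generate.induct)
    case one show ?case using one_in by (simp add: rep_one)
  next
    case (incl h) then show ?case using lpoly_reflection[of h] S SG by blast
  next
    case (inv h)
    then have h: "h \<in> G" "pseudoreflection h" using S SG by auto
    have "lpoly (matrix_inv h *v z) = \<rho> (matrix_inv h) * lpoly z" for z
      using lpoly_reflection[OF h, of "matrix_inv h *v z"] rep_nz[OF h(1)]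
      by (simp add: mv_inv h rep_inv)
    moreover have "inv\<^bsub>GL\<^esub> h = matrix_inv h" by (rule inv_GL[OF invertible[OF h(1)]])
    ultimately show ?case using inv_in[OF h(1)] by simp
  next
    case (eng h1 h2) then show ?case
      by (simp add: matrix_vector_mul_assoc[symmetric] rep_mult mult_in)
  qed
  then show ?thesis by blast
qed

text \<open>Comparing \<open>P (a H *v z)\<close> with \<open>\<rho> (a H) * P z\<close> on
  \<open>H\<close>, where \<open>a H\<close> acts trivially, leaves the factor
  \<kappa>\<open>^k -\<close>\<kappa>\<open>^cexp H\<close>. Minimality of the exponent makes it
  nonzero, so one more power of the linear form can be extracted.\<close>

lemma vanish_step:
  assumes P: "\<And>z. P (a H *v z) = \<rho> (a H) * P z" and H: "H \<in> R" and A: "A \<subseteq> R - {H}"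
    and Q: "Q \<in> polyfuns" and k: "k < cexp H"
    and eq: "\<And>z. P z = (\<Prod>H'\<in>A. lin (v H') z ^ cexp H') * lin (v H) z ^ k * Q z"
    and z: "z \<in> H"
  shows "Q z = 0"
proof -
  define \<kappa> where "\<kappa> = det (a H)"
  define B where "B z = (\<Prod>H'\<in>A. lin (v H') z ^ cexp H')" for z
  have B: "B \<in> polyfuns" unfolding B_def[abs_def] by (intro polyfuns_prod polyfuns_power lin_polyfuns)
  have la: "lin (v H) (a H *v z) = \<kappa> * lin (v H) z" for z
    unfolding \<kappa>_def by (rule lin_stab[OF H a_stab[OF H]])
  define f where "f z = \<kappa> ^ k * (B (a H *v z) * Q (a H *v z)) - \<kappa> ^ cexp H * (B z * Q z)" for z
  have f: "f \<in> polyfuns" unfolding f_def[abs_def]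
    by (intro polyfuns_diff polyfuns_cmult polyfuns_mult B Q polyfuns_matrix)
  have l0: "lin (v H) z ^ k * f z = 0" for z
    using P[of z] unfolding eq[folded B_def] la rho_a[OF H] f_def \<kappa>_def[symmetric]
    by (simp add: power_mult_distrib algebra_simps)
  obtain w where w: "lin (v H) w = 1" using lin_nonzero[OF v_nonzero[OF H]] by blast
  \<comment> \<open>The power of the linear form has to be cancelled as an identity of polynomials
    on the whole space, before restricting to \<open>H\<close>, where that power may vanish.\<close>
  have f0: "f z = 0" for z
    by (rule polyfuns_mult_eq_0[where S = UNIV and f = "\<lambda>z. lin (v H) z ^ k" and a = w])
       (use l0 w f in \<open>auto intro: polyfuns_power lin_polyfuns\<close>)
  have fixa: "a H *v z = z" if "z \<in> H" for z
    using a_stab[OF H] that unfolding pointwise_stabilizer_def by blast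
  have "\<kappa> ^ k \<noteq> \<kappa> ^ cexp H"
    using cexp_le[of H k] k rho_a[OF H] unfolding \<kappa>_def by auto
  then have BQ: "B z * Q z = 0" if "z \<in> H" for z
    using f0[of z] fixa[OF that] unfolding f_def by (simp add: left_diff_distrib[symmetric])
  obtain z0 where z0: "z0 \<in> H" "B z0 \<noteq> 0" using generic_point[OF H A] unfolding B_def by blast
  have Heq: "{z. (\<Sum>i\<in>UNIV. v H $ i * z $ i) = 0} = H" using lin_v[OF H] by (auto simp: lin_def)
  have "line_closed H" using line_closed_hyperplane[of "v H"] Heq by simp
  from polyfuns_mult_eq_0[OF this B Q BQ z0 z] show ?thesis by blast
qed

text \<open>The hyperplanes are treated one after another, each linear form being extracted once at
  a time by \<open>vanish_step\<close>. The quotient is invariant since \<open>P\<close> and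
  \<open>lpoly\<close> transform by the same character.\<close>

lemma lpoly_dvd:
  assumes P: "P \<in> polyfuns" and semi: "\<And>\<sigma> z. \<sigma> \<in> G \<Longrightarrow> P (\<sigma> *v z) = \<rho> \<sigma> * P z"
  shows "\<exists>Q\<in>polyfuns. (\<forall>z. P z = lpoly z * Q z) \<and> (\<forall>\<sigma>\<in>G. \<forall>z. Q (\<sigma> *v z) = Q z)"
proof -
  have "\<exists>Q\<in>polyfuns. \<forall>z. P z = (\<Prod>H\<in>A. lin (v H) z ^ cexp H) * Q z" if "finite A" "A \<subseteq> R" for A
    using that
  proof (induction A)
    case empty then show ?case using P by auto
  next
    case (insert H A)
    then have H: "H \<in> R" and A: "A \<subseteq> R - {H}" by auto
    have "k \<le> cexp H \<longrightarrow>
        (\<exists>Q\<in>polyfuns. \<forall>z. P z = (\<Prod>H\<in>A. lin (v H) z ^ cexp H) * lin (v H) z ^ k * Q z)" for k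
    proof (induction k)
      case 0 then show ?case using insert by auto
    next
      case (Suc k)
      show ?case
      proof
        assume le: "Suc k \<le> cexp H"
        then obtain Q where Q: "Q \<in> polyfuns"
          "\<And>z. P z = (\<Prod>H\<in>A. lin (v H) z ^ cexp H) * lin (v H) z ^ k * Q z" using Suc by auto
        have "Q z = 0" if "z \<in> H" for z
          by (rule vanish_step[OF semi[OF a_in[OF H]] H A Q(1) _ Q(2) that]) (use le in auto)
        then have "\<exists>Q'\<in>polyfuns. \<forall>z. Q z = (\<Sum>i\<in>UNIV. v H $ i * z $ i) * Q' z"
          using lin_v[OF H] unfolding lin_def
          by (intro polyfuns_divide_linear[OF Q(1) v_nonzero[OF H]]) blast
        then obtain Q' where "Q' \<in> polyfuns" "\<And>z. Q z = lin (v H) z * Q' z" unfolding lin_def by blast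
        then show "\<exists>Q\<in>polyfuns. \<forall>z. P z = (\<Prod>H\<in>A. lin (v H) z ^ cexp H) * lin (v H) z ^ Suc k * Q z"
          using Q(2) by (intro bexI[of _ Q']) (auto simp: algebra_simps)
      qed
    qed
    from this[of "cexp H"] obtain Q where "Q \<in> polyfuns"
      "\<forall>z. P z = (\<Prod>H\<in>A. lin (v H) z ^ cexp H) * lin (v H) z ^ cexp H * Q z" by blast
    then show ?case using insert by (intro bexI[of _ Q]) (auto simp: algebra_simps)
  qed
  from this[OF finite_R order_refl] obtain Q where Q: "Q \<in> polyfuns" "\<And>z. P z = lpoly z * Q z"
    unfolding lpoly_def by blast
  have "Q (\<sigma> *v z) - Q z = 0" if \<sigma>: "\<sigma> \<in> G" for \<sigma> z
  proof -
    obtain z0 where z0: "lpoly z0 \<noteq> 0" using lpoly_nonzero by blast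
    have eq: "lpoly z * (Q (\<sigma> *v z) - Q z) = 0" for z
      using semi[OF \<sigma>, of z] rep_nz[OF \<sigma>] unfolding Q(2) lpoly_semi_invariant[OF \<sigma>]
      by (simp add: algebra_simps)
    show ?thesis
      by (rule polyfuns_mult_eq_0[where S = UNIV and f = lpoly and a = z0])
         (use eq z0 Q(1) in \<open>auto intro: lpoly_polyfuns polyfuns_diff polyfuns_matrix\<close>)
  qed
  then show ?thesis using Q by auto
qed

end

section \<open>Holomorphic functions of several variables\<close>

lemma norm_scalar_mult_vec: "norm (c *s z) = norm c * norm z" for z :: "complex ^ 'd"
  by (simp add: norm_vec_def norm_mult L2_set_right_distrib)

lemma scaleR_eq_scalar_mult: "r *\<^sub>R z = complex_of_real r *s z" for z :: "complex ^ 'd"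
  by (auto simp: vec_eq_iff scaleR_conv_of_real[symmetric])

lemma bounded_linear_scalar_mult_vec: "bounded_linear (\<lambda>c. c *s h)" for h :: "complex ^ 'd"
  by (rule bounded_linear_intro[where K = "norm h"])
     (auto simp: vec_eq_iff algebra_simps norm_scalar_mult_vec)

lemma open_line_preimage:
  fixes a h :: "complex ^ 'd"
  assumes "open U"
  shows "open {c. a + c *s h \<in> U}"
proof -
  have "continuous_on UNIV (\<lambda>c. a + c *s h)"
    unfolding vector_scalar_mult_def by (intro continuous_intros)
  from open_vimage[OF assms this] show ?thesis by (simp add: vimage_def)
qed

lemma holomorphic_several_line:
  assumes f: "holomorphic_several f U" and U: "open U"
  shows "(\<lambda>c. f (a + c *s h)) holomorphic_on {c. a + c *s h \<in> U}"
proof (rule holomorphic_onI)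
  fix c assume c: "c \<in> {c. a + c *s h \<in> U}"
  then obtain f' where f': "(f has_derivative f') (at (a + c *s h) within U)" "\<And>c v. f' (c *s v) = c * f' v"
    using f unfolding holomorphic_several_def by blast
  have "(f has_derivative f') (at (a + c *s h))"
    using f'(1) at_within_open[OF _ U] c by auto
  moreover have "((\<lambda>c. a + c *s h) has_derivative (\<lambda>t. t *s h)) (at c)"
    using has_derivative_add[OF has_derivative_const bounded_linear_imp_has_derivative[OF bounded_linear_scalar_mult_vec]]
    by simp
  ultimately have "((\<lambda>c. f (a + c *s h)) has_derivative (\<lambda>t. f' (t *s h))) (at c)"
    using has_derivative_compose[of "\<lambda>c. a + c *s h" "\<lambda>t. t *s h" c UNIV f f'] by simp
  then have "((\<lambda>c. f (a + c *s h)) has_field_derivative f' h) (at c)"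
    unfolding has_field_derivative_def by (simp add: f'(2) mult.commute[of _ "f' h"] fun_eq_iff)
  then show "(\<lambda>c. f (a + c *s h)) field_differentiable at c within {c. a + c *s h \<in> U}"
    using field_differentiable_def field_differentiable_at_within by blast
qed

lemma holomorphic_several_continuous_on: "holomorphic_several f S \<Longrightarrow> continuous_on S f"
  unfolding holomorphic_several_def continuous_on_eq_continuous_within
  using has_derivative_continuous by blast

lemma has_derivative_vec_componentwise:
  fixes F :: "'a::real_normed_vector \<Rightarrow> complex ^ 'd"
  assumes "\<And>i. ((\<lambda>z. F z $ i) has_derivative (\<lambda>v. F' v $ i)) (at x within S)"
  shows "(F has_derivative F') (at x within S)"
proof (subst has_derivative_componentwise_within, intro ballI)
  fix b :: "complex ^ 'd" assume "b \<in> Basis"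
  then obtain i u where b: "b = axis i u" "u \<in> Basis" by (auto simp: Basis_vec_def)
  have "((\<lambda>x. F x $ i \<bullet> u) has_derivative (\<lambda>x. F' x $ i \<bullet> u)) (at x within S)"
    by (rule has_derivative_inner_left[OF assms])
  then show "((\<lambda>x. F x \<bullet> b) has_derivative (\<lambda>x. F' x \<bullet> b)) (at x within S)"
    by (simp add: b inner_axis)
qed

lemma polynomial_map_has_derivative:
  assumes "\<And>i. (\<lambda>z. \<theta> z $ i) \<in> polyfuns"
  shows "\<exists>D. (\<theta> has_derivative D) (at z within S) \<and> (\<forall>c v. D (c *s v) = c *s D v)"
proof -
  have "\<forall>i. \<exists>f'. ((\<lambda>z. \<theta> z $ i) has_derivative f') (at z within S) \<and> (\<forall>c v. f' (c *s v) = c * f' v)"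
    using polyfuns_has_derivative[OF assms] by blast
  then obtain f' where f': "\<And>i. ((\<lambda>z. \<theta> z $ i) has_derivative f' i) (at z within S)"
    "\<And>i c v. f' i (c *s v) = c * f' i v" by metis
  show ?thesis
    by (rule exI[of _ "\<lambda>v. \<chi> i. f' i v"])
       (auto intro!: has_derivative_vec_componentwise simp: f' vec_eq_iff)
qed

lemma holomorphic_several_compose_polynomial_map:
  assumes f: "holomorphic_several f (\<theta> ` S)" and \<theta>: "\<And>i. (\<lambda>z. \<theta> z $ i) \<in> polyfuns"
  shows "holomorphic_several (\<lambda>z. f (\<theta> z)) S"
  unfolding holomorphic_several_def
proof
  fix z assume z: "z \<in> S"
  obtain D where D: "(\<theta> has_derivative D) (at z within S)" "\<And>c v. D (c *s v) = c *s D v"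
    using polynomial_map_has_derivative[OF \<theta>] by blast
  obtain f' where f': "(f has_derivative f') (at (\<theta> z) within \<theta> ` S)" "\<And>c v. f' (c *s v) = c * f' v"
    using f z unfolding holomorphic_several_def by blast
  show "\<exists>f'. ((\<lambda>z. f (\<theta> z)) has_derivative f') (at z within S) \<and> (\<forall>c v. f' (c *s v) = c * f' v)"
    using has_derivative_in_compose[OF D(1) f'(1)] by (intro exI[of _ "\<lambda>v. f' (D v)"]) (simp add: D f')
qed

lemma holomorphic_several_mult:
  assumes "holomorphic_several f S" "holomorphic_several g S"
  shows "holomorphic_several (\<lambda>z. f z * g z) S"
  unfolding holomorphic_several_def
proof
  fix z assume z: "z \<in> S"
  obtain f' g' where *: "(f has_derivative f') (at z within S)" "(g has_derivative g') (at z within S)"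
    "\<And>c v. f' (c *s v) = c * f' v" "\<And>c v. g' (c *s v) = c * g' v"
    using assms z unfolding holomorphic_several_def by meson
  show "\<exists>f'. ((\<lambda>z. f z * g z) has_derivative f') (at z within S) \<and> (\<forall>c v. f' (c *s v) = c * f' v)"
    using has_derivative_mult[OF *(1,2)]
    by (intro exI[of _ "\<lambda>v. f z * g' v + f' v * g z"]) (auto simp: * algebra_simps)
qed

lemma holomorphic_several_const: "holomorphic_several (\<lambda>z. c) S"
  by (rule holomorphic_several_polyfuns[OF polyfuns_const])

lemma holomorphic_several_cmult: "holomorphic_several f S \<Longrightarrow> holomorphic_several (\<lambda>z. c * f z) S"
  by (intro holomorphic_several_mult holomorphic_several_const)

lemma holomorphic_several_add:
  assumes "holomorphic_several f S" "holomorphic_several g S"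
  shows "holomorphic_several (\<lambda>z. f z + g z) S"
  unfolding holomorphic_several_def
proof
  fix z assume z: "z \<in> S"
  obtain f' g' where *: "(f has_derivative f') (at z within S)" "(g has_derivative g') (at z within S)"
    "\<And>c v. f' (c *s v) = c * f' v" "\<And>c v. g' (c *s v) = c * g' v"
    using assms z unfolding holomorphic_several_def by meson
  show "\<exists>f'. ((\<lambda>z. f z + g z) has_derivative f') (at z within S) \<and> (\<forall>c v. f' (c *s v) = c * f' v)"
    using has_derivative_add[OF *(1,2)]
    by (intro exI[of _ "\<lambda>v. f' v + g' v"]) (auto simp: * algebra_simps)
qed

lemma holomorphic_several_cong:
  assumes "\<And>z. z \<in> S \<Longrightarrow> f z = g z"
  shows "holomorphic_several f S \<longleftrightarrow> holomorphic_several g S"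
  unfolding holomorphic_several_def
  by (intro ball_cong refl ex_cong conj_cong) (use assms has_derivative_transform in \<open>metis\<close>)

section \<open>Locally uniform limits of polynomials\<close>

lemma linear_Cauchy_estimate:
  assumes f: "f \<in> polyfuns" and f': "(f has_derivative f') (at x)" "\<And>c v. f' (c *s v) = c * f' v"
    and r: "r > 0" and B: "\<And>y. y \<in> cball x r \<Longrightarrow> norm (f y) \<le> B"
  shows "norm (f' h) \<le> B / r * norm h"
proof (cases "h = 0")
  case True
  then have "f' h = 0" using f'(2)[of 0 h] by simp
  then show ?thesis using True by simp
next
  case False
  \<comment> \<open>On the circle of radius \<open>s\<close> the point \<open>x + c *s h\<close>
    stays at distance exactly \<open>r\<close> from \<open>x\<close>.\<close>
  define s where "s = r / norm h"
  have s: "s > 0" using False r by (simp add: s_def)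
  let ?g = "\<lambda>c. f (x + c *s h)"
  have hol: "?g holomorphic_on UNIV"
    using holomorphic_several_line[OF holomorphic_several_polyfuns[OF f] open_UNIV] by simp
  have "norm ((deriv ^^ 1) ?g 0) \<le> fact 1 * B / s ^ 1"
  proof (rule Cauchy_inequality[OF _ _ s])
    show "?g holomorphic_on ball 0 s" using hol holomorphic_on_subset by blast
    show "continuous_on (cball 0 s) ?g"
      using hol holomorphic_on_imp_continuous_on holomorphic_on_subset by blast
    show "norm (?g c) \<le> B" if "norm (0 - c) = s" for c
      using that False by (intro B) (simp add: dist_norm norm_scalar_mult_vec s_def)
  qed
  moreover have "(?g has_field_derivative f' h) (at 0)"
  proof -
    have "((\<lambda>c. x + c *s h) has_derivative (\<lambda>t. t *s h)) (at 0)"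
      using has_derivative_add[OF has_derivative_const bounded_linear_imp_has_derivative[OF bounded_linear_scalar_mult_vec]]
      by simp
    then have "(?g has_derivative (\<lambda>t. f' (t *s h))) (at 0)"
      using has_derivative_compose[of "\<lambda>c. x + c *s h" "\<lambda>t. t *s h" 0 UNIV f f'] f'(1) by simp
    then show ?thesis
      unfolding has_field_derivative_def by (simp add: f'(2) mult.commute[of _ "f' h"] fun_eq_iff)
  qed
  ultimately show ?thesis by (simp add: DERIV_imp_deriv s_def field_simps)
qed

text \<open>Cauchy estimates on balls of half the radius turn uniform convergence of the functions
  into a uniform Cauchy condition for their derivatives. The limit is then differentiable, and
  complex linearity passes to the limit of the derivatives.\<close>

lemma polyfuns_uniform_limit_holomorphic:
  fixes F :: "nat \<Rightarrow> complex ^ 'd \<Rightarrow> complex"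
  assumes F: "\<And>n. F n \<in> polyfuns"
    and lim: "\<And>z. z \<in> U \<Longrightarrow> \<exists>e>0. uniform_limit (cball z e) F f sequentially"
  shows "holomorphic_several f U"
  unfolding holomorphic_several_def
proof
  fix z assume "z \<in> U"
  then obtain e where e: "e > 0" and ul: "uniform_limit (cball z e) F f sequentially"
    using lim by blast
  define S where "S = ball z (e / 2)"
  have "\<forall>n x. \<exists>f'. (F n has_derivative f') (at x) \<and> (\<forall>c v. f' (c *s v) = c * f' v)"
    using polyfuns_has_derivative[OF F] by blast
  then obtain D where D: "\<And>n x. (F n has_derivative D n x) (at x)" "\<And>n x c v. D n x (c *s v) = c * D n x v"
    by metis
  have est: "norm (D m x h - D n x h) \<le> B / (e / 2) * norm h"
    if x: "x \<in> S" and B: "\<And>y. y \<in> cball z e \<Longrightarrow> norm (F m y - F n y) \<le> B" for m n x h B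
  proof (rule linear_Cauchy_estimate[where f = "\<lambda>y. F m y - F n y" and x = x and f' = "\<lambda>h. D m x h - D n x h"])
    show "(\<lambda>y. F m y - F n y) \<in> polyfuns" by (intro polyfuns_diff F)
    show "((\<lambda>y. F m y - F n y) has_derivative (\<lambda>h. D m x h - D n x h)) (at x)"
      by (intro has_derivative_diff D)
    show "norm (F m y - F n y) \<le> B" if "y \<in> cball x (e / 2)" for y
    proof (rule B)
      have "dist z y \<le> dist z x + dist x y" by (rule dist_triangle)
      then show "y \<in> cball z e" using that x by (simp add: S_def)
    qed
  qed (use e D in \<open>auto simp: algebra_simps\<close>)
  have cauchy: "\<exists>N. \<forall>m\<ge>N. \<forall>n\<ge>N. \<forall>x\<in>S. \<forall>h. norm (D m x h - D n x h) \<le> \<epsilon> * norm h" if "\<epsilon> > 0" for \<epsilon>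
  proof -
    \<comment> \<open>Two members of the sequence differ by at most \<open>2 *\<close>\<delta>, and
      the Cauchy estimate divides this by the radius \<open>e / 2\<close>.\<close>
    define \<delta> where "\<delta> = \<epsilon> * (e / 2) / 2"
    have "\<delta> > 0" using that e by (simp add: \<delta>_def)
    then obtain N where N: "\<forall>n\<ge>N. \<forall>y\<in>cball z e. dist (F n y) (f y) < \<delta>"
      using uniform_limitD[OF ul] unfolding eventually_sequentially by blast
    have "norm (D m x h - D n x h) \<le> \<epsilon> * norm h" if "m \<ge> N" "n \<ge> N" "x \<in> S" for m n x h
    proof -
      have "norm (F m y - F n y) \<le> 2 * \<delta>" if y: "y \<in> cball z e" for y
      proof -
        have "dist (F m y) (F n y) \<le> dist (F m y) (f y) + dist (F n y) (f y)" by (rule dist_triangle2)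
        also have "\<dots> \<le> \<delta> + \<delta>" using N \<open>m \<ge> N\<close> \<open>n \<ge> N\<close> y by (intro add_mono) (auto intro: less_imp_le)
        finally show ?thesis by (simp add: dist_norm)
      qed
      from est[OF \<open>x \<in> S\<close> this, of h] show ?thesis using e by (simp add: \<delta>_def)
    qed
    then show ?thesis by blast
  qed
  have conv: "convergent (\<lambda>n. D n x h)" if x: "x \<in> S" for x h
  proof (rule Cauchy_convergent, rule CauchyI)
    fix \<epsilon> :: real assume "\<epsilon> > 0"
    define \<delta> where "\<delta> = \<epsilon> / 2 / (norm h + 1)"
    have "\<delta> > 0" using \<open>\<epsilon> > 0\<close> by (auto simp: \<delta>_def add_nonneg_pos)
    then obtain N where N: "\<forall>m\<ge>N. \<forall>n\<ge>N. \<forall>x\<in>S. \<forall>h. norm (D m x h - D n x h) \<le> \<delta> * norm h"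
      using cauchy by blast
    have "norm h + 1 > 0" by (simp add: add_nonneg_pos)
    then have "\<delta> * (norm h + 1) = \<epsilon> / 2" unfolding \<delta>_def by (metis less_numeral_extra(3) nonzero_eq_divide_eq)
    then have "\<delta> * norm h \<le> \<epsilon> / 2" using \<open>\<delta> > 0\<close> by (simp add: distrib_left)
    then have "\<delta> * norm h < \<epsilon>" using \<open>\<epsilon> > 0\<close> by linarith
    then show "\<exists>N. \<forall>m\<ge>N. \<forall>n\<ge>N. norm (D m x h - D n x h) < \<epsilon>"
      using N x by (intro exI[of _ N]) (meson le_less_trans)
  qed
  define g' where "g' x h = lim (\<lambda>n. D n x h)" for x h
  have g': "(\<lambda>n. D n x h) \<longlonglongrightarrow> g' x h" if "x \<in> S" for x h
    unfolding g'_def using conv[OF that] convergent_LIMSEQ_iff by blast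
  have "z \<in> S" using e by (simp add: S_def)
  have "\<exists>g. \<forall>x\<in>S. (\<lambda>n. F n x) \<longlonglongrightarrow> g x \<and> (g has_derivative g' x) (at x within S)"
  proof (rule has_derivative_sequence)
    show "convex S" by (simp add: S_def)
    show "(F n has_derivative D n x) (at x within S)" for n x
      by (rule has_derivative_at_withinI[OF D(1)])
    show "\<forall>\<^sub>F n in sequentially. \<forall>x\<in>S. \<forall>h. norm (D n x h - g' x h) \<le> \<epsilon> * norm h" if eps: "\<epsilon> > 0" for \<epsilon>
    proof -
      obtain N where N: "\<forall>m\<ge>N. \<forall>n\<ge>N. \<forall>x\<in>S. \<forall>h. norm (D m x h - D n x h) \<le> \<epsilon> * norm h"
        using cauchy[OF eps] by blast
      have "norm (D m x h - g' x h) \<le> \<epsilon> * norm h" if "m \<ge> N" "x \<in> S" for m x h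
      proof (rule tendsto_upperbound)
        show "(\<lambda>n. norm (D m x h - D n x h)) \<longlonglongrightarrow> norm (D m x h - g' x h)"
          by (intro tendsto_intros g' that)
        show "\<forall>\<^sub>F n in sequentially. norm (D m x h - D n x h) \<le> \<epsilon> * norm h"
          using N that unfolding eventually_sequentially by blast
      qed simp
      then show ?thesis unfolding eventually_sequentially by blast
    qed
    show "(\<lambda>n. F n z) \<longlonglongrightarrow> f z"
      using tendsto_uniform_limitI[OF ul] e by simp
  qed (rule \<open>z \<in> S\<close>)
  then obtain g where g: "\<And>x. x \<in> S \<Longrightarrow> (\<lambda>n. F n x) \<longlonglongrightarrow> g x" "\<And>x. x \<in> S \<Longrightarrow> (g has_derivative g' x) (at x within S)"
    by blast
  have gf: "g x = f x" if "x \<in> S" for x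
  proof -
    have "x \<in> cball z e" using that e by (simp add: S_def)
    then show ?thesis using g(1)[OF that] tendsto_uniform_limitI[OF ul] LIMSEQ_unique by blast
  qed
  have "(f has_derivative g' z) (at z within S)"
    using has_derivative_transform[OF \<open>z \<in> S\<close> _ g(2)[OF \<open>z \<in> S\<close>], of f] gf by simp
  then have "(f has_derivative g' z) (at z)"
    using at_within_open[OF \<open>z \<in> S\<close>] by (simp add: S_def)
  then have "(f has_derivative g' z) (at z within U)" by (rule has_derivative_at_withinI)
  moreover have "g' z (c *s v) = c * g' z v" for c v
  proof (rule LIMSEQ_unique[OF g'[OF \<open>z \<in> S\<close>]])
    show "(\<lambda>n. D n z (c *s v)) \<longlonglongrightarrow> c * g' z v"
      unfolding D(2) by (intro tendsto_intros g' \<open>z \<in> S\<close>)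
  qed
  ultimately show "\<exists>f'. (f has_derivative f') (at z within U) \<and> (\<forall>c v. f' (c *s v) = c * f' v)" by blast
qed

section \<open>Homogeneous expansion\<close>

text \<open>The coefficient of \<open>c ^ n\<close> in \<open>f (c *s z)\<close>, which is the
  component of degree \<open>n\<close> of the Taylor series at 0. The definition uses one-variable
  derivatives only; that it is a polynomial in \<open>z\<close> is a theorem,
  \<open>hom_part_polyfuns\<close>.\<close>

definition hom_part :: "(complex ^ 'd \<Rightarrow> complex) \<Rightarrow> nat \<Rightarrow> complex ^ 'd \<Rightarrow> complex" where
  "hom_part f n z = (deriv ^^ n) (\<lambda>c. f (c *s z)) 0 / fact n"

lemma holomorphic_several_radial:
  assumes "holomorphic_several f U" "open U"
  shows "(\<lambda>c. f (c *s z)) holomorphic_on {c. c *s z \<in> U}" "open {c. c *s z \<in> U}"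
  using holomorphic_several_line[OF assms, of 0 z] open_line_preimage[OF assms(2), of 0 z] by auto

lemma hom_part_scale:
  assumes f: "holomorphic_several f U" and U: "open U" "0 \<in> U"
  shows "hom_part f n (c *s z) = c ^ n * hom_part f n z"
proof -
  let ?T = "{t. t *s z \<in> U}" and ?S = "{t. t *s (c *s z) \<in> U}"
  have "(deriv ^^ n) (\<lambda>w. (\<lambda>t. f (t *s z)) (c * w)) 0 = c ^ n * (deriv ^^ n) (\<lambda>t. f (t *s z)) (c * 0)"
    by (rule higher_deriv_compose_linear[where T = ?T and S = ?S])
       (use holomorphic_several_radial[OF f U(1), of z] holomorphic_several_radial(2)[OF f U(1), of "c *s z"] U
         in \<open>auto simp: mult.commute\<close>)
  then show ?thesis by (simp add: hom_part_def mult.commute)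
qed

lemma hom_part_sums:
  assumes f: "holomorphic_several f U" and U: "open U" and bal: "\<And>z c. z \<in> U \<Longrightarrow> norm c \<le> 1 \<Longrightarrow> c *s z \<in> U"
    and z: "z \<in> U"
  shows "(\<lambda>n. hom_part f n z) sums f z"
proof -
  have "open {c. c *s z \<in> U}" "1 \<in> {c. c *s z \<in> U}"
    using holomorphic_several_radial[OF f U] z by auto
  then obtain e where e: "e > 0" "ball 1 e \<subseteq> {c. c *s z \<in> U}" by (meson open_contains_ball)
  \<comment> \<open>The power series in \<open>c\<close> is summed at \<open>c = 1\<close>, so a
    disc of radius larger than 1 is required; openness provides it.\<close>
  define r where "r = 1 + e / 2"
  have "complex_of_real r \<in> ball 1 e" using e by (simp add: r_def dist_norm norm_divide)
  then have rz: "complex_of_real r *s z \<in> U" using e by blast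
  have r: "r > 1" using e by (simp add: r_def)
  have "ball 0 r \<subseteq> {c. c *s z \<in> U}"
  proof
    fix c :: complex assume "c \<in> ball 0 r"
    then have "norm (c / r) \<le> 1" using r by (simp add: norm_divide)
    from bal[OF rz this] show "c \<in> {c. c *s z \<in> U}" using r by simp
  qed
  then have "(\<lambda>c. f (c *s z)) holomorphic_on ball 0 r"
    using holomorphic_several_radial[OF f U] holomorphic_on_subset by blast
  from holomorphic_power_series[OF this, of 1] r show ?thesis by (simp add: hom_part_def)
qed

lemma hom_part_bound:
  assumes f: "holomorphic_several f U" and U: "open U"
    and B: "\<And>c. norm c \<le> 1 \<Longrightarrow> c *s z \<in> U \<and> norm (f (c *s z)) \<le> B"
  shows "norm (hom_part f n z) \<le> B"
proof -
  have sub: "cball 0 1 \<subseteq> {c. c *s z \<in> U}" using B by auto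
  have hol: "(\<lambda>c. f (c *s z)) holomorphic_on cball 0 1"
    using holomorphic_several_radial[OF f U] holomorphic_on_subset sub by blast
  have "norm ((deriv ^^ n) (\<lambda>c. f (c *s z)) 0) \<le> fact n * B / 1 ^ n"
    by (rule Cauchy_inequality)
       (use hol B in \<open>auto intro: holomorphic_on_imp_continuous_on elim: holomorphic_on_subset\<close>)
  then show ?thesis by (simp add: hom_part_def norm_divide field_simps)
qed

lemma hom_part_growth:
  assumes f: "holomorphic_several f U" and U: "open U" "0 \<in> U"
    and \<delta>: "\<delta> > 0" and M: "\<And>z. norm z \<le> \<delta> \<Longrightarrow> norm (hom_part f n z) \<le> M"
  shows "norm (hom_part f n z) \<le> M * (norm z / \<delta>) ^ n"
proof (cases "z = 0")
  case True
  have "M \<ge> 0" using order_trans[OF norm_ge_zero M[of 0]] \<delta> by simp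
  show ?thesis
  proof (cases "n = 0")
    case True then show ?thesis using M[of z] \<open>z = 0\<close> \<delta> by simp
  next
    case False
    then have "hom_part f n z = 0" using hom_part_scale[OF f U, of n 0 z] True by (simp add: power_0_left)
    then show ?thesis using \<open>M \<ge> 0\<close> \<delta> by simp
  qed
next
  case False
  define c where "c = complex_of_real (\<delta> / norm z)"
  have "norm (c *s z) \<le> \<delta>" using False \<delta> by (simp add: c_def norm_scalar_mult_vec norm_divide)
  then have "norm (c ^ n * hom_part f n z) \<le> M" using M hom_part_scale[OF f U, of n c z] by metis
  moreover have "norm c = \<delta> / norm z" using \<delta> by (simp add: c_def norm_divide)
  ultimately have "(\<delta> / norm z) ^ n * norm (hom_part f n z) \<le> M" by (simp add: norm_mult norm_power)
  then show ?thesis using False \<delta> by (simp add: field_simps)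
qed

text \<open>After removal of the lower parts, which are polynomials by induction,
  \<open>f (t z) / t ^ n\<close> tends to the part of degree \<open>n\<close> uniformly on a small
  ball as \<open>t\<close> tends to 0. So this part is holomorphic on short line segments, by
  homogeneity entire on every line, and by its growth and Liouville a polynomial of degree at most
  \<open>n\<close> there. Polynomials in each variable with a common degree bound are
  polynomials.\<close>

lemma hom_part_polyfuns:
  assumes f: "holomorphic_several f U" and U: "open U" "0 \<in> U"
  shows "hom_part f n \<in> polyfuns"
proof (induction n rule: less_induct)
  case (less n)
  note scale = hom_part_scale[OF f U]
  obtain \<delta> where \<delta>: "\<delta> > 0" "cball 0 \<delta> \<subseteq> U" using U by (meson open_contains_cball)
  have "compact (f ` cball 0 \<delta>)"
    by (intro compact_continuous_image compact_cball)
       (use holomorphic_several_continuous_on[OF f] \<delta> continuous_on_subset in blast)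
  then obtain M where M: "\<And>z. norm z \<le> \<delta> \<Longrightarrow> norm (f z) \<le> M"
    using bounded_iff compact_imp_bounded by (metis image_eqI mem_cball_0)
  have small: "norm (c *s z) \<le> \<delta>" if "norm z \<le> \<delta>" "norm c \<le> 1" for c and z :: "complex ^ 'a"
    using that mult_mono[of "norm c" 1 "norm z" \<delta>] by (simp add: norm_scalar_mult_vec)
  have hM: "norm (hom_part f k z) \<le> M" if "norm z \<le> \<delta>" for k z
    by (rule hom_part_bound[OF f U(1)]) (use small[OF that] M \<delta> in auto)
  have growth: "norm (hom_part f n z) \<le> M * (norm z / \<delta>) ^ n" for z
    by (rule hom_part_growth[OF f U \<delta>(1) hM])
  have M0: "M \<ge> 0" using order_trans[OF norm_ge_zero M[of 0]] \<delta> by simp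
  \<comment> \<open>Any sequence tending to 0 would serve; the bound \<open>1/2\<close> makes the
    geometric tail \<open>1 / (1 - t j)\<close> at most 2.\<close>
  define t where "t j = 1 / (real j + 2)" for j
  have t: "0 < t j" "t j \<le> 1/2" "t j < 1" for j by (auto simp: t_def field_simps)
  define g where "g j z = (f (complex_of_real (t j) *s z) - (\<Sum>k<n. complex_of_real (t j) ^ k * hom_part f k z))
      / complex_of_real (t j) ^ n" for j z
  have gest: "norm (g j z - hom_part f n z) \<le> 2 * M * t j" if z: "norm z \<le> \<delta>" for j z
  proof -
    let ?t = "complex_of_real (t j)"
    have "(\<lambda>k. hom_part f k (?t *s z)) sums f (?t *s z)"
    \<comment> \<open>\<open>U\<close> is not assumed to be balanced, so the series is summed on the
      ball of radius \<delta> inside \<open>U\<close>.\<close>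
    proof (rule hom_part_sums[where U = "ball 0 (2 * \<delta> / 2)"])
      show "holomorphic_several f (ball 0 (2 * \<delta> / 2))"
        unfolding holomorphic_several_def
      proof
        fix x :: "complex ^ 'a" assume "x \<in> ball 0 (2 * \<delta> / 2)"
        then have "x \<in> U" using \<delta> by auto
        then obtain f' where "(f has_derivative f') (at x within U)" "\<forall>c v. f' (c *s v) = c * f' v"
          using f unfolding holomorphic_several_def by blast
        moreover have "ball 0 (2 * \<delta> / 2) \<subseteq> U" using \<delta> by auto
        ultimately show "\<exists>f'. (f has_derivative f') (at x within ball 0 (2 * \<delta> / 2)) \<and> (\<forall>c v. f' (c *s v) = c * f' v)"
          using has_derivative_subset by blast
      qed
      show "c *s x \<in> ball 0 (2 * \<delta> / 2)" if "x \<in> ball 0 (2 * \<delta> / 2)" "norm c \<le> 1" for c and x :: "complex ^ 'a"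
        using that mult_left_le_one_le[of "norm x" "norm c"] by (simp add: norm_scalar_mult_vec)
      have "t j * norm z \<le> (1/2) * \<delta>" using z t[of j] \<delta> by (intro mult_mono) auto
      then show "?t *s z \<in> ball 0 (2 * \<delta> / 2)" using t[of j] \<delta> by (simp add: norm_scalar_mult_vec)
    qed simp
    then have "(\<lambda>k. ?t ^ k * hom_part f k z) sums f (?t *s z)" by (simp add: scale)
    then have "(\<lambda>i. ?t ^ (i + Suc n) * hom_part f (i + Suc n) z) sums
        (f (?t *s z) - (\<Sum>k<Suc n. ?t ^ k * hom_part f k z))"
      by (rule sums_split_initial_segment)
    then have "(\<lambda>i. ?t ^ (i + Suc n) * hom_part f (i + Suc n) z / ?t ^ n) sums
        ((f (?t *s z) - (\<Sum>k<Suc n. ?t ^ k * hom_part f k z)) / ?t ^ n)"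
      by (rule sums_divide)
    moreover have "?t ^ (i + Suc n) * hom_part f (i + Suc n) z / ?t ^ n = ?t ^ Suc i * hom_part f (i + Suc n) z" for i
      using t[of j] by (simp add: power_add field_simps)
    moreover have "(f (?t *s z) - (\<Sum>k<Suc n. ?t ^ k * hom_part f k z)) / ?t ^ n = g j z - hom_part f n z"
      using t[of j] by (simp add: g_def field_simps)
    ultimately have s: "(\<lambda>i. ?t ^ Suc i * hom_part f (i + Suc n) z) sums (g j z - hom_part f n z)"
      by simp
    have geo: "(\<lambda>i. (M * t j) * t j ^ i) sums ((M * t j) * (1 / (1 - t j)))"
      by (intro sums_mult geometric_sums) (use t[of j] in auto)
    have "norm (g j z - hom_part f n z) \<le> (M * t j) * (1 / (1 - t j))"
    proof -
      have "norm (suminf (\<lambda>i. ?t ^ Suc i * hom_part f (i + Suc n) z)) \<le> suminf (\<lambda>i. (M * t j) * t j ^ i)"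
      proof (rule norm_suminf_le)
        show "norm (?t ^ Suc i * hom_part f (i + Suc n) z) \<le> (M * t j) * t j ^ i" for i
          using hM[OF z, of "i + Suc n"] t[of j]
          by (simp add: norm_mult norm_power mult.commute mult.left_commute mult_left_mono)
      qed (use geo sums_summable in blast)
      then show ?thesis using s geo by (simp add: sums_iff)
    qed
    also have "\<dots> \<le> (M * t j) * 2"
      using t[of j] M0 by (intro mult_left_mono) (auto simp: field_simps)
    finally show ?thesis by (simp add: mult_ac)
  qed
  have line: "(\<lambda>c. hom_part f n (a + c *s h)) holomorphic_on ball 0 1"
    if ah: "norm a + norm h \<le> \<delta>" for a h
  proof -
    have small: "norm (a + c *s h) \<le> \<delta>" if "norm c \<le> 1" for c
    proof -
      have "norm (a + c *s h) \<le> norm a + norm c * norm h"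
        by (metis norm_triangle_ineq norm_scalar_mult_vec)
      also have "norm c * norm h \<le> norm h" using that by (simp add: mult_left_le_one_le)
      finally show ?thesis using ah by simp
    qed
    have ul: "uniform_limit (cball 0 1) (\<lambda>j c. g j (a + c *s h)) (\<lambda>c. hom_part f n (a + c *s h)) sequentially"
    proof (rule uniform_limitI)
      fix e :: real assume "e > 0"
      have "(\<lambda>j. 2 * M * t j) \<longlonglongrightarrow> 2 * M * 0"
        unfolding t_def by (intro tendsto_intros) real_asymp
      then have "\<forall>\<^sub>F j in sequentially. 2 * M * t j < e"
        using \<open>e > 0\<close> by (intro order_tendstoD) auto
      then show "\<forall>\<^sub>F j in sequentially. \<forall>c\<in>cball 0 1. dist (g j (a + c *s h)) (hom_part f n (a + c *s h)) < e"
      proof eventually_elim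
        case (elim j)
        show ?case
        proof
          fix c :: complex assume "c \<in> cball 0 1"
          then have "norm (a + c *s h) \<le> \<delta>" by (intro small) simp
          from gest[OF this, of j] elim show "dist (g j (a + c *s h)) (hom_part f n (a + c *s h)) < e"
            by (simp add: dist_norm)
        qed
      qed
    qed
    show ?thesis
    proof (rule holomorphic_uniform_sequence[where f = "\<lambda>j c. g j (a + c *s h)"])
      fix j
      let ?t = "complex_of_real (t j)"
      have 1: "(\<lambda>c. f (?t *s a + c *s (?t *s h))) holomorphic_on ball 0 1"
      proof (rule holomorphic_on_subset[OF holomorphic_several_line[OF f U(1)]])
        show "ball 0 1 \<subseteq> {c. ?t *s a + c *s (?t *s h) \<in> U}"
        proof
          fix c :: complex assume "c \<in> ball 0 1"
          then have "norm (a + c *s h) \<le> \<delta>" by (intro small) simp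
          then have "norm (?t *s (a + c *s h)) \<le> \<delta>"
            unfolding norm_scalar_mult_vec
            using t[of j] mult_mono[of "t j" 1 "norm (a + c *s h)" \<delta>] by simp
          then have "?t *s (a + c *s h) \<in> U" using \<delta> by auto
          then show "c \<in> {c. ?t *s a + c *s (?t *s h) \<in> U}"
            by (simp add: vector_add_ldistrib mult.commute)
        qed
      qed
      have 2: "(\<lambda>c. hom_part f k (a + c *s h)) holomorphic_on ball 0 1" if k: "k < n" for k
      proof -
        obtain p where "\<forall>c. hom_part f k (a + c *s h) = poly p c"
          using polyfuns_line[OF less[OF k]] by blast
        then show ?thesis by (auto intro!: holomorphic_intros)
      qed
      have "(\<lambda>c. g j (a + c *s h)) = (\<lambda>c. (f (?t *s a + c *s (?t *s h)) -
          (\<Sum>k<n. ?t ^ k * hom_part f k (a + c *s h))) / ?t ^ n)"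
        unfolding g_def by (simp add: vector_add_ldistrib mult.commute)
      then show "(\<lambda>c. g j (a + c *s h)) holomorphic_on ball 0 1"
        using 1 2 t[of j] by (auto intro!: holomorphic_intros)
    next
      fix x :: complex assume x: "x \<in> ball 0 1"
      then obtain d where d: "d > 0" "cball x d \<subseteq> ball 0 1" by (meson open_ball open_contains_cball)
      then show "\<exists>d>0. cball x d \<subseteq> ball 0 1 \<and>
          uniform_limit (cball x d) (\<lambda>j c. g j (a + c *s h)) (\<lambda>c. hom_part f n (a + c *s h)) sequentially"
        using uniform_limit_on_subset[OF ul order.trans[OF d(2) ball_subset_cball]] by blast
    qed simp
  qed
  have entire: "(\<lambda>c. hom_part f n (z + c *s h)) holomorphic_on UNIV" for z h
  proof -
    have "(\<lambda>c. hom_part f n (z + c *s h)) holomorphic_on ball 0 T" if T: "T > 0" for T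
    proof -
      \<comment> \<open>Scaling by \<open>s\<close> brings all points \<open>z + c *s h\<close> with
        \<open>norm c < T\<close> into the small ball, and homogeneity removes the scaling
        afterwards.\<close>
      define s where "s = \<delta> / (norm z + T * norm h + 1)"
      have pos: "norm z + T * norm h + 1 > 0" using T by (simp add: add_nonneg_pos)
      have s: "s > 0" using \<delta> pos by (simp add: s_def)
      let ?s = "complex_of_real s"
      have "s * (norm z + T * norm h) \<le> \<delta>" using \<delta> pos by (simp add: s_def field_simps)
      then have "norm (?s *s z) + norm ((?s * complex_of_real T) *s h) \<le> \<delta>"
        using s T by (simp add: norm_scalar_mult_vec norm_mult algebra_simps)
      note hol = line[OF this]
      have "(\<lambda>c. hom_part f n (?s *s z + (c / T) *s ((?s * complex_of_real T) *s h))) holomorphic_on ball 0 T"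
        by (rule holomorphic_on_compose_gen[OF _ hol, unfolded o_def])
           (use T in \<open>auto intro!: holomorphic_intros simp: norm_divide\<close>)
      moreover have "hom_part f n (?s *s z + (c / T) *s ((?s * complex_of_real T) *s h)) = ?s ^ n * hom_part f n (z + c *s h)"
        for c :: complex
      proof -
        have "?s *s z + (c / T) *s ((?s * complex_of_real T) *s h) = ?s *s (z + c *s h)"
          using T by (simp add: vector_add_ldistrib mult.commute)
        then show ?thesis by (simp only: scale)
      qed
      ultimately have "(\<lambda>c. ?s ^ n * hom_part f n (z + c *s h)) holomorphic_on ball 0 T" by (simp only:)
      then have "(\<lambda>c. (?s ^ n * hom_part f n (z + c *s h)) / ?s ^ n) holomorphic_on ball 0 T"
        by (rule holomorphic_on_divide) (use s in auto)
      then show ?thesis using s by simp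
    qed
    then have "(\<lambda>c. hom_part f n (z + c *s h)) field_differentiable at c" for c
      using holomorphic_on_imp_differentiable_at[of _ "ball 0 (norm c + 1)" c]
      by (simp add: add_nonneg_pos)
    then show ?thesis by (intro holomorphic_onI) (simp add: field_differentiable_at_within)
  qed
  show ?case
  proof (rule separately_polynomial_imp_polyfuns[where n = n])
    fix z :: "complex ^ 'a" and i
    let ?\<phi> = "\<lambda>c. hom_part f n (z + c *s axis i 1)"
    have bnd: "norm (?\<phi> c) \<le> (M * ((norm z + norm (axis i (1::complex) :: complex ^ 'a)) / \<delta>) ^ n) * norm c ^ n"
      if "1 \<le> norm c" for c
    proof -
      have "norm (z + c *s axis i 1) \<le> norm z + norm c * norm (axis i (1::complex) :: complex ^ 'a)"
        by (metis norm_triangle_ineq norm_scalar_mult_vec)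
      also have "\<dots> \<le> norm c * norm z + norm c * norm (axis i (1::complex) :: complex ^ 'a)"
        using that mult_right_mono[of 1 "norm c" "norm z"] by simp
      finally have "norm (z + c *s axis i 1) / \<delta> \<le> ((norm z + norm (axis i (1::complex) :: complex ^ 'a)) / \<delta>) * norm c"
        using \<delta> by (simp add: divide_right_mono algebra_simps add_divide_distrib[symmetric])
      then have "(norm (z + c *s axis i 1) / \<delta>) ^ n \<le> (((norm z + norm (axis i (1::complex) :: complex ^ 'a)) / \<delta>) * norm c) ^ n"
        using \<delta> by (intro power_mono) auto
      then have "M * (norm (z + c *s axis i 1) / \<delta>) ^ n \<le> M * (((norm z + norm (axis i (1::complex) :: complex ^ 'a)) / \<delta>) * norm c) ^ n"
        using M0 by (rule mult_left_mono)
      then show ?thesis using growth[of "z + c *s axis i 1"]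
        unfolding power_mult_distrib mult.assoc by (rule order.trans[rotated])
    qed
    define p where "p = (\<Sum>k\<le>n. Polynomial.monom ((deriv ^^ k) ?\<phi> 0 / fact k) k)"
    have "Polynomial.degree p \<le> n" unfolding p_def by (intro degree_sum_le) (auto intro: order.trans[OF degree_monom_le])
    moreover have "?\<phi> c = poly p c" for c
      using Liouville_polynomial[OF entire[of z "axis i 1"] bnd, where \<xi> = c]
      by (simp add: p_def poly_sum poly_monom)
    ultimately show "\<exists>p. Polynomial.degree p \<le> n \<and> (\<forall>c. ?\<phi> c = poly p c)" by blast
  qed
qed

section \<open>Division estimates\<close>

text \<open>Division by \<open>l\<close> costs a constant and an enlargement of the compact set,
  neither of which depends on the quotient \<open>Q\<close>. The estimate can therefore be applied
  to differences of quotients, and a Cauchy condition survives division.\<close>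

definition divisor_bounded :: "(complex ^ 'd) set \<Rightarrow> (complex ^ 'd \<Rightarrow> complex) \<Rightarrow> bool" where
  "divisor_bounded U l \<longleftrightarrow> (\<forall>K. compact K \<and> K \<subseteq> U \<longrightarrow>
     (\<exists>K' C. compact K' \<and> K' \<subseteq> U \<and> C \<ge> 0 \<and>
       (\<forall>Q\<in>polyfuns. \<forall>B. (\<forall>z\<in>K'. norm (l z * Q z) \<le> B) \<longrightarrow> (\<forall>z\<in>K. norm (Q z) \<le> C * B))))"

lemma divisor_bounded_one: "divisor_bounded U (\<lambda>z. 1)"
  unfolding divisor_bounded_def
proof (intro allI impI)
  fix K assume "compact K \<and> K \<subseteq> U"
  then show "\<exists>K' C. compact K' \<and> K' \<subseteq> U \<and> C \<ge> 0 \<and>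
      (\<forall>Q\<in>polyfuns. \<forall>B. (\<forall>z\<in>K'. norm (1 * Q z) \<le> B) \<longrightarrow> (\<forall>z\<in>K. norm (Q z) \<le> C * B))"
    by (intro exI[of _ K] exI[of _ 1]) auto
qed

text \<open>The two divisions are made in succession: the second one starts from the enlarged
  compact set of the first.\<close>

lemma divisor_bounded_mult:
  assumes l: "divisor_bounded U l" and l': "divisor_bounded U l'" "l' \<in> polyfuns"
  shows "divisor_bounded U (\<lambda>z. l z * l' z)"
  unfolding divisor_bounded_def
proof (intro allI impI)
  fix K assume "compact K \<and> K \<subseteq> U"
  then obtain K1 C1 where 1: "compact K1" "K1 \<subseteq> U" "C1 \<ge> 0"
    "\<And>Q B. Q \<in> polyfuns \<Longrightarrow> (\<forall>z\<in>K1. norm (l' z * Q z) \<le> B) \<Longrightarrow> \<forall>z\<in>K. norm (Q z) \<le> C1 * B"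
    using l' unfolding divisor_bounded_def by meson
  then obtain K2 C2 where 2: "compact K2" "K2 \<subseteq> U" "C2 \<ge> 0"
    "\<And>Q B. Q \<in> polyfuns \<Longrightarrow> (\<forall>z\<in>K2. norm (l z * Q z) \<le> B) \<Longrightarrow> \<forall>z\<in>K1. norm (Q z) \<le> C2 * B"
    using l unfolding divisor_bounded_def by meson
  show "\<exists>K' C. compact K' \<and> K' \<subseteq> U \<and> C \<ge> 0 \<and>
       (\<forall>Q\<in>polyfuns. \<forall>B. (\<forall>z\<in>K'. norm (l z * l' z * Q z) \<le> B) \<longrightarrow> (\<forall>z\<in>K. norm (Q z) \<le> C * B))"
  proof (intro exI[of _ K2] exI[of _ "C1 * C2"] conjI ballI allI impI)
    fix Q B z assume Q: "Q \<in> polyfuns" and b: "\<forall>z\<in>K2. norm (l z * l' z * Q z) \<le> B" and z: "z \<in> K"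
    have "\<forall>z\<in>K1. norm (l' z * Q z) \<le> C2 * B"
      by (rule 2(4)) (use b Q l'(2) polyfuns_mult in \<open>auto simp: mult.assoc\<close>)
    from 1(4)[OF Q this] z show "norm (Q z) \<le> C1 * C2 * B" by (simp add: mult.assoc)
  qed (use 1 2 in auto)
qed

lemma divisor_bounded_power: "divisor_bounded U l \<Longrightarrow> l \<in> polyfuns \<Longrightarrow> divisor_bounded U (\<lambda>z. l z ^ n)"
proof (induction n)
  case (Suc n)
  then show ?case using divisor_bounded_mult[of U l "\<lambda>z. l z ^ n"] polyfuns_power[of l n] by simp
qed (simp add: divisor_bounded_one)

lemma divisor_bounded_prod:
  assumes "finite A" "\<And>i. i \<in> A \<Longrightarrow> divisor_bounded U (l i) \<and> l i \<in> polyfuns"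
  shows "divisor_bounded U (\<lambda>z. \<Prod>i\<in>A. l i z)"
  using assms
proof (induction A)
  case (insert i A)
  then show ?case using divisor_bounded_mult[of U "l i" "\<lambda>z. \<Prod>i\<in>A. l i z"] polyfuns_prod[of A l] by simp
qed (simp add: divisor_bounded_one)

text \<open>On a circle of radius \<open>e\<close> in the direction \<open>w\<close> the form is bounded below by \<open>e / 2\<close>
  whenever it is smaller than \<open>e / 2\<close> at the centre, so that the maximum principle applies.\<close>

lemma divisor_bounded_lin:
  assumes U: "open U" and v: "v \<noteq> 0"
  shows "divisor_bounded U (lin v)"
  unfolding divisor_bounded_def
proof (intro allI impI)
  fix K assume K: "compact K \<and> K \<subseteq> U"
  obtain w where w: "lin v w = 1" using lin_nonzero[OF v] by blast
  have "\<exists>r>0. (\<Union>x\<in>K. cball x r) \<subseteq> U"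
    using compact_subset_open_imp_cball_epsilon_subset[of K U] K U by (metis)
  then obtain r where r: "r > 0" "\<And>x. x \<in> K \<Longrightarrow> cball x r \<subseteq> U" by blast
  \<comment> \<open>Moving a point of \<open>K\<close> by \<open>c *s w\<close> with
    \<open>norm c \<le> e\<close> displaces it by at most \<open>r\<close>, so it remains in
    \<open>U\<close>.\<close>
  define e where "e = r / (norm w + 1)"
  have e: "e > 0" using r by (simp add: e_def add_nonneg_pos)
  have "norm w + 1 > 0" by (simp add: add_nonneg_pos)
  then have "e * (norm w + 1) = r" by (simp add: e_def)
  then have ew: "e * norm w \<le> r" using e by (simp add: distrib_left)
  define K' where "K' = (\<lambda>(z, c). z + c *s w) ` (K \<times> cball 0 e)"
  have "compact K'" unfolding K'_def
  proof (intro compact_continuous_image compact_Times compact_cball)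
    show "continuous_on (K \<times> cball 0 e) (\<lambda>(z, c). z + c *s w)"
      unfolding case_prod_beta vector_scalar_mult_def by (intro continuous_intros)
  qed (use K in auto)
  moreover have "K' \<subseteq> U"
  proof
    fix y assume "y \<in> K'"
    then obtain z c where zc: "z \<in> K" "norm c \<le> e" "y = z + c *s w" by (auto simp: K'_def)
    have "norm c * norm w \<le> r" using zc ew mult_right_mono[of "norm c" e "norm w"] by simp
    then have "y \<in> cball z r" by (simp add: zc dist_norm norm_scalar_mult_vec)
    then show "y \<in> U" using r zc by blast
  qed
  moreover have "norm (Q z) \<le> 2 / e * B"
    if Q: "Q \<in> polyfuns" and b: "\<forall>z\<in>K'. norm (lin v z * Q z) \<le> B" and z: "z \<in> K" for Q B z
  proof -
    have bd: "norm (lin v z + c) * norm (Q (z + c *s w)) \<le> B" if "norm c \<le> e" for c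
    proof -
      have "z + c *s w \<in> K'" unfolding K'_def using z that by force
      then show ?thesis using b by (auto simp: norm_mult lin_add lin_scale w)
    qed
    have key: "norm (Q (z + c *s w)) \<le> 2 / e * B" if "norm c \<le> e" "e / 2 \<le> norm (lin v z + c)" for c
    proof -
      have "e / 2 * norm (Q (z + c *s w)) \<le> B"
        using mult_right_mono[OF that(2), of "norm (Q (z + c *s w))"] bd[OF that(1)] by simp
      then show ?thesis using e by (simp add: field_simps)
    qed
    show ?thesis
    proof (cases "e / 2 \<le> norm (lin v z)")
      case True then show ?thesis using key[of 0] e by simp
    next
      case False
      have hol: "(\<lambda>c. Q (z + c *s w)) holomorphic_on UNIV"
        using holomorphic_several_line[OF holomorphic_several_polyfuns[OF Q] open_UNIV] by simp
      \<comment> \<open>The Cauchy inequality for the derivative of order 0 is the maximum principle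
        on the disc.\<close>
      have "norm ((deriv ^^ 0) (\<lambda>c. Q (z + c *s w)) 0) \<le> fact 0 * (2 / e * B) / e ^ 0"
      proof (rule Cauchy_inequality[OF _ _ e])
        show "(\<lambda>c. Q (z + c *s w)) holomorphic_on ball 0 e" using hol holomorphic_on_subset by blast
        show "continuous_on (cball 0 e) (\<lambda>c. Q (z + c *s w))"
          using hol holomorphic_on_imp_continuous_on holomorphic_on_subset by blast
        fix c :: complex assume c: "norm (0 - c) = e"
        have "norm c - norm (lin v z) \<le> norm (c + lin v z)" by (rule norm_diff_ineq)
        then have "e / 2 \<le> norm (lin v z + c)" using c False by (simp add: add.commute)
        then show "norm (Q (z + c *s w)) \<le> 2 / e * B" using c by (intro key) simp_all
      qed
      then show ?thesis by simp
    qed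
  qed
  ultimately show "\<exists>K' C. compact K' \<and> K' \<subseteq> U \<and> C \<ge> 0 \<and>
       (\<forall>Q\<in>polyfuns. \<forall>B. (\<forall>z\<in>K'. norm (lin v z * Q z) \<le> B) \<longrightarrow> (\<forall>z\<in>K. norm (Q z) \<le> C * B))"
    using e by (intro exI[of _ K'] exI[of _ "2 / e"]) auto
qed

section \<open>Square-integrable functions\<close>

text \<open>The Bochner integral of a non-integrable function is 0, so this is the norm only on
  members of \<open>L2\<close>; membership is therefore carried along throughout.\<close>

definition L2_norm :: "'a measure \<Rightarrow> ('a \<Rightarrow> complex) \<Rightarrow> real" where
  "L2_norm M f = sqrt (LINT x|M. (norm (f x))\<^sup>2)"

lemma borel_measurable_cnj [measurable (raw)]:
  assumes "f \<in> borel_measurable M"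
  shows "(\<lambda>x. cnj (f x)) \<in> borel_measurable M"
  using borel_measurable_continuous_on[OF _ assms, of cnj] continuous_on_cnj[OF continuous_on_id] by simp

lemma L2D: "f \<in> L2 M \<Longrightarrow> f \<in> borel_measurable M" "f \<in> L2 M \<Longrightarrow> integrable M (\<lambda>x. (norm (f x))\<^sup>2)"
  by (auto simp: L2_def)

lemma L2_add:
  assumes f: "f \<in> L2 M" and g: "g \<in> L2 M"
  shows "(\<lambda>x. f x + g x) \<in> L2 M"
proof -
  have [measurable]: "f \<in> borel_measurable M" "g \<in> borel_measurable M" using L2D f g by auto
  have "integrable M (\<lambda>x. 2 * (norm (f x))\<^sup>2 + 2 * (norm (g x))\<^sup>2)"
    using L2D(2)[OF f] L2D(2)[OF g] by auto
  then have "integrable M (\<lambda>x. (norm (f x + g x))\<^sup>2)"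
  proof (rule Bochner_Integration.integrable_bound)
    have "(norm (f x + g x))\<^sup>2 \<le> 2 * (norm (f x))\<^sup>2 + 2 * (norm (g x))\<^sup>2" for x
    proof -
      have "(norm (f x + g x))\<^sup>2 \<le> (norm (f x) + norm (g x))\<^sup>2"
        by (intro power_mono norm_triangle_ineq) auto
      also have "\<dots> \<le> 2 * (norm (f x))\<^sup>2 + 2 * (norm (g x))\<^sup>2"
        using zero_le_power2[of "norm (f x) - norm (g x)"] by (simp add: power2_eq_square algebra_simps)
      finally show ?thesis .
    qed
    then show "AE x in M. norm ((norm (f x + g x))\<^sup>2) \<le> norm (2 * (norm (f x))\<^sup>2 + 2 * (norm (g x))\<^sup>2)"
      by (auto intro!: AE_I2 order.trans[OF _ abs_ge_self])
  qed simp
  then show ?thesis by (simp add: L2_def)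
qed

lemma L2_cmult: "f \<in> L2 M \<Longrightarrow> (\<lambda>x. c * f x) \<in> L2 M"
  by (auto simp: L2_def norm_mult power_mult_distrib)

lemma L2_minus: "f \<in> L2 M \<Longrightarrow> (\<lambda>x. - f x) \<in> L2 M"
  by (auto simp: L2_def)

lemma L2_diff: "f \<in> L2 M \<Longrightarrow> g \<in> L2 M \<Longrightarrow> (\<lambda>x. f x - g x) \<in> L2 M"
  using L2_add[OF _ L2_minus] by fastforce

lemma L2_bounded_mult:
  assumes f: "f \<in> L2 M" and u: "u \<in> Linfty M"
  shows "(\<lambda>x. u x * f x) \<in> L2 M"
proof -
  have [measurable]: "f \<in> borel_measurable M" "u \<in> borel_measurable M" using f u by (auto simp: L2_def Linfty_def)
  obtain C where C: "AE x in M. norm (u x) \<le> C" using u by (auto simp: Linfty_def)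
  have "integrable M (\<lambda>x. C\<^sup>2 * (norm (f x))\<^sup>2)" using L2D(2)[OF f] by simp
  then have "integrable M (\<lambda>x. (norm (u x * f x))\<^sup>2)"
  proof (rule Bochner_Integration.integrable_bound)
    show "AE x in M. norm ((norm (u x * f x))\<^sup>2) \<le> norm (C\<^sup>2 * (norm (f x))\<^sup>2)"
      using C by eventually_elim (auto simp: norm_mult power_mult_distrib intro!: mult_right_mono power_mono)
  qed simp
  then show ?thesis by (simp add: L2_def)
qed

lemma L2_mult_integrable:
  assumes f: "f \<in> L2 M" and g: "g \<in> L2 M"
  shows "integrable M (\<lambda>x. f x * cnj (g x))"
proof -
  have [measurable]: "f \<in> borel_measurable M" "g \<in> borel_measurable M" using L2D f g by auto
  have "integrable M (\<lambda>x. (norm (f x))\<^sup>2 + (norm (g x))\<^sup>2)"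
    using L2D(2)[OF f] L2D(2)[OF g] by auto
  then show ?thesis
  proof (rule Bochner_Integration.integrable_bound)
    have "norm (f x) * norm (g x) \<le> (norm (f x))\<^sup>2 + (norm (g x))\<^sup>2" for x
    proof -
      have "2 * (norm (f x) * norm (g x)) \<le> (norm (f x))\<^sup>2 + (norm (g x))\<^sup>2"
        using zero_le_power2[of "norm (f x) - norm (g x)"] by (simp add: power2_eq_square algebra_simps)
      moreover have "0 \<le> norm (f x) * norm (g x)" by simp
      ultimately show ?thesis by linarith
    qed
    then show "AE x in M. norm (f x * cnj (g x)) \<le> norm ((norm (f x))\<^sup>2 + (norm (g x))\<^sup>2)"
      by (auto simp: norm_mult intro!: AE_I2 order.trans[OF _ abs_ge_self])
  qed simp
qed

lemma L2_inner_add_left: "f \<in> L2 M \<Longrightarrow> g \<in> L2 M \<Longrightarrow> h \<in> L2 M \<Longrightarrow>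
    L2_inner M (\<lambda>x. f x + g x) h = L2_inner M f h + L2_inner M g h"
  unfolding L2_inner_def distrib_right
  by (rule Bochner_Integration.integral_add) (rule L2_mult_integrable; assumption)+

lemma L2_inner_diff_left: "f \<in> L2 M \<Longrightarrow> g \<in> L2 M \<Longrightarrow> h \<in> L2 M \<Longrightarrow>
    L2_inner M (\<lambda>x. f x - g x) h = L2_inner M f h - L2_inner M g h"
  unfolding L2_inner_def left_diff_distrib
  by (rule Bochner_Integration.integral_diff) (rule L2_mult_integrable; assumption)+

lemma L2_inner_cmult_left: "L2_inner M (\<lambda>x. c * f x) h = c * L2_inner M f h"
  unfolding L2_inner_def mult.assoc by (rule integral_mult_right_zero)

lemma L2_inner_cnj: "cnj (L2_inner M f g) = L2_inner M g f"
proof -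
  have "cnj (L2_inner M f g) = (LINT x|M. cnj (f x * cnj (g x)))"
    unfolding L2_inner_def by (rule Bochner_Integration.integral_cnj[symmetric])
  also have "(\<lambda>x. cnj (f x * cnj (g x))) = (\<lambda>x. g x * cnj (f x))" by (simp add: fun_eq_iff)
  finally show ?thesis unfolding L2_inner_def .
qed

lemma L2_inner_add_right:
  assumes "f \<in> L2 M" "g \<in> L2 M" "h \<in> L2 M"
  shows "L2_inner M h (\<lambda>x. f x + g x) = L2_inner M h f + L2_inner M h g"
  using arg_cong[OF L2_inner_add_left[OF assms], of cnj]
  by (simp only: L2_inner_cnj complex_cnj_add)

lemma L2_inner_diff_right:
  assumes "f \<in> L2 M" "g \<in> L2 M" "h \<in> L2 M"
  shows "L2_inner M h (\<lambda>x. f x - g x) = L2_inner M h f - L2_inner M h g"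
  using arg_cong[OF L2_inner_diff_left[OF assms], of cnj]
  by (simp only: L2_inner_cnj complex_cnj_diff)

lemma L2_inner_cmult_right: "L2_inner M h (\<lambda>x. c * f x) = cnj c * L2_inner M h f"
  using arg_cong[OF L2_inner_cmult_left[of M c f h], of cnj]
  by (simp only: L2_inner_cnj complex_cnj_mult)

lemma L2_inner_self: "L2_inner M f f = complex_of_real ((L2_norm M f)\<^sup>2)"
proof -
  have "L2_inner M f f = (LINT x|M. complex_of_real ((norm (f x))\<^sup>2))"
    unfolding L2_inner_def by (simp only: complex_norm_square)
  also have "\<dots> = complex_of_real (LINT x|M. (norm (f x))\<^sup>2)" by (rule integral_complex_of_real)
  finally show ?thesis by (simp add: L2_norm_def)
qed

lemma L2_norm_nonneg: "L2_norm M f \<ge> 0"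
  by (simp add: L2_norm_def)

lemma L2_norm_sq: "(L2_norm M f)\<^sup>2 = (LINT x|M. (norm (f x))\<^sup>2)"
  by (simp add: L2_norm_def)

lemma L2_inner_cong_AE:
  assumes "AE x in M. f x = f' x" "AE x in M. g x = g' x"
    "f \<in> borel_measurable M" "f' \<in> borel_measurable M" "g \<in> borel_measurable M" "g' \<in> borel_measurable M"
  shows "L2_inner M f g = L2_inner M f' g'"
proof -
  have [measurable]: "f \<in> borel_measurable M" "f' \<in> borel_measurable M" "g \<in> borel_measurable M"
    "g' \<in> borel_measurable M" by fact+
  show ?thesis unfolding L2_inner_def
  proof (rule integral_cong_AE)
    show "AE x in M. f x * cnj (g x) = f' x * cnj (g' x)" using assms(1,2) by eventually_elim simp
  qed simp_all
qed

lemma L2_norm_eq_0_iff: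
  assumes "f \<in> L2 M"
  shows "L2_norm M f = 0 \<longleftrightarrow> (AE x in M. f x = 0)"
  using integral_nonneg_eq_0_iff_AE[OF L2D(2)[OF assms]] by (simp add: L2_norm_def)

text \<open>With \<open>B\<close> the square of the norm of \<open>g\<close> and \<open>c\<close>
  the inner product, the squared norm of \<open>B f - c g\<close> is nonnegative. This multiple of
  the usual projection error avoids divisions.\<close>

lemma L2_Cauchy_Schwarz:
  assumes f: "f \<in> L2 M" and g: "g \<in> L2 M"
  shows "norm (L2_inner M f g) \<le> L2_norm M f * L2_norm M g"
proof (cases "L2_norm M g = 0")
  case True
  have [measurable]: "f \<in> borel_measurable M" "g \<in> borel_measurable M" using L2D f g by auto
  have "L2_inner M f g = L2_inner M f (\<lambda>x. 0)"
    by (rule L2_inner_cong_AE) (use True L2_norm_eq_0_iff[OF g] in auto)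
  then show ?thesis using True by (simp add: L2_inner_def)
next
  case False
  define A where "A = (L2_norm M f)\<^sup>2"
  define B where "B = (L2_norm M g)\<^sup>2"
  define c where "c = L2_inner M f g"
  have B: "B > 0" using False by (simp add: B_def)
  have gf: "L2_inner M g f = cnj c" by (simp add: c_def L2_inner_cnj)
  have ff: "L2_inner M f f = complex_of_real A" and gg: "L2_inner M g g = complex_of_real B"
    unfolding A_def B_def by (rule L2_inner_self)+
  let ?h = "\<lambda>x. complex_of_real B * f x - c * g x"
  have "L2_inner M ?h ?h = complex_of_real B * (complex_of_real B * complex_of_real A - cnj c * c)
      - c * (complex_of_real B * cnj c - cnj c * complex_of_real B)"
    using f g by (simp add: L2_inner_diff_left L2_inner_diff_right L2_inner_cmult_left L2_inner_cmult_right
        L2_cmult L2_diff gf ff gg c_def[symmetric])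
  also have "\<dots> = complex_of_real (B * (B * A - (norm c)\<^sup>2))"
    unfolding of_real_mult of_real_diff complex_norm_square by (simp add: algebra_simps)
  finally have "B * (B * A - (norm c)\<^sup>2) = (L2_norm M ?h)\<^sup>2"
    by (metis L2_inner_self of_real_eq_iff)
  then have "B * (B * A - (norm c)\<^sup>2) \<ge> 0" by simp
  then have "(norm c)\<^sup>2 \<le> (L2_norm M f * L2_norm M g)\<^sup>2"
    using B by (simp add: zero_le_mult_iff power_mult_distrib A_def B_def mult.commute)
  then show ?thesis unfolding c_def[symmetric]
    by (rule power2_le_imp_le) (simp add: L2_norm_nonneg)
qed

lemma L2_norm_triangle:
  assumes f: "f \<in> L2 M" and g: "g \<in> L2 M"
  shows "L2_norm M (\<lambda>x. f x + g x) \<le> L2_norm M f + L2_norm M g"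
proof (rule power2_le_imp_le)
  have "complex_of_real ((L2_norm M (\<lambda>x. f x + g x))\<^sup>2) =
      complex_of_real ((L2_norm M f)\<^sup>2) + (L2_inner M f g + cnj (L2_inner M f g)) + complex_of_real ((L2_norm M g)\<^sup>2)"
    unfolding L2_inner_self[symmetric] L2_inner_cnj
    using f g by (simp add: L2_inner_add_left L2_inner_add_right L2_add)
  also have "\<dots> = complex_of_real ((L2_norm M f)\<^sup>2 + 2 * Re (L2_inner M f g) + (L2_norm M g)\<^sup>2)"
    by (simp add: complex_add_cnj)
  finally have "(L2_norm M (\<lambda>x. f x + g x))\<^sup>2 = (L2_norm M f)\<^sup>2 + 2 * Re (L2_inner M f g) + (L2_norm M g)\<^sup>2"
    using of_real_eq_iff by blast
  moreover have "Re (L2_inner M f g) \<le> L2_norm M f * L2_norm M g"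
    using L2_Cauchy_Schwarz[OF f g] complex_Re_le_cmod order_trans by blast
  ultimately show "(L2_norm M (\<lambda>x. f x + g x))\<^sup>2 \<le> (L2_norm M f + L2_norm M g)\<^sup>2"
    by (simp add: power2_sum)
qed (simp add: L2_norm_nonneg)

lemma L2_norm_cmult: "L2_norm M (\<lambda>x. c * f x) = norm c * L2_norm M f"
  by (simp add: L2_norm_def norm_mult power_mult_distrib real_sqrt_mult)

lemma L2_norm_minus_commute: "L2_norm M (\<lambda>x. f x - g x) = L2_norm M (\<lambda>x. g x - f x)"
  by (simp add: L2_norm_def norm_minus_commute)

lemma L2_norm_triangle_diff:
  assumes "f \<in> L2 M" "g \<in> L2 M" "h \<in> L2 M"
  shows "L2_norm M (\<lambda>x. f x - h x) \<le> L2_norm M (\<lambda>x. f x - g x) + L2_norm M (\<lambda>x. g x - h x)"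
  using L2_norm_triangle[OF L2_diff[OF assms(1,2)] L2_diff[OF assms(2,3)]] by simp

lemma L2_norm_diff_le:
  assumes "f \<in> L2 M" "g \<in> L2 M"
  shows "L2_norm M f \<le> L2_norm M g + L2_norm M (\<lambda>x. f x - g x)"
  using L2_norm_triangle[OF assms(2) L2_diff[OF assms]] by simp

lemma L2_norm_cong_AE:
  assumes "AE x in M. f x = g x" "f \<in> borel_measurable M" "g \<in> borel_measurable M"
  shows "L2_norm M f = L2_norm M g"
proof -
  have [measurable]: "f \<in> borel_measurable M" "g \<in> borel_measurable M" by fact+
  have "(LINT x|M. (norm (f x))\<^sup>2) = (LINT x|M. (norm (g x))\<^sup>2)"
    by (rule integral_cong_AE) (use assms in auto)
  then show ?thesis by (simp add: L2_norm_def)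
qed

lemma nn_integral_L2:
  assumes "f \<in> L2 M"
  shows "(\<integral>\<^sup>+ x. ennreal ((norm (f x))\<^sup>2) \<partial>M) = ennreal ((L2_norm M f)\<^sup>2)"
  unfolding L2_norm_sq by (rule nn_integral_eq_integral[OF L2D(2)[OF assms]]) simp

lemma L2I_nn_integral:
  assumes "f \<in> borel_measurable M" "(\<integral>\<^sup>+ x. ennreal ((norm (f x))\<^sup>2) \<partial>M) < \<infinity>"
  shows "f \<in> L2 M"
proof -
  have [measurable]: "f \<in> borel_measurable M" by fact
  have "integrable M (\<lambda>x. (norm (f x))\<^sup>2)"
    by (rule integrableI_bounded) (use assms in auto)
  then show ?thesis using assms by (simp add: L2_def)
qed

section \<open>Convergence, completeness and projection in L2\<close>

definition L2_lim :: "'a measure \<Rightarrow> (nat \<Rightarrow> 'a \<Rightarrow> complex) \<Rightarrow> ('a \<Rightarrow> complex) \<Rightarrow> bool" where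
  "L2_lim M F f \<longleftrightarrow> (\<lambda>n. L2_norm M (\<lambda>x. F n x - f x)) \<longlonglongrightarrow> 0"

definition L2_Cauchy :: "'a measure \<Rightarrow> (nat \<Rightarrow> 'a \<Rightarrow> complex) \<Rightarrow> bool" where
  "L2_Cauchy M F \<longleftrightarrow> (\<forall>e>0. \<exists>N. \<forall>m\<ge>N. \<forall>n\<ge>N. L2_norm M (\<lambda>x. F m x - F n x) < e)"

lemma L2_lim_inner:
  assumes lim: "L2_lim M F f" and F: "\<And>n. F n \<in> L2 M" and f: "f \<in> L2 M" and g: "g \<in> L2 M"
  shows "(\<lambda>n. L2_inner M (F n) g) \<longlonglongrightarrow> L2_inner M f g"
proof -
  have "(\<lambda>n. L2_norm M (\<lambda>x. F n x - f x) * L2_norm M g) \<longlonglongrightarrow> 0 * L2_norm M g"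
    using lim unfolding L2_lim_def by (intro tendsto_intros)
  then have 1: "(\<lambda>n. L2_norm M (\<lambda>x. F n x - f x) * L2_norm M g) \<longlonglongrightarrow> 0" by simp
  have "norm (L2_inner M (F n) g - L2_inner M f g) \<le> L2_norm M (\<lambda>x. F n x - f x) * L2_norm M g" for n
    using L2_Cauchy_Schwarz[OF L2_diff[OF F f] g, of n] unfolding L2_inner_diff_left[OF F f g] .
  then have ev: "\<forall>\<^sub>F n in sequentially. norm (L2_inner M (F n) g - L2_inner M f g) \<le> L2_norm M (\<lambda>x. F n x - f x) * L2_norm M g"
    by (rule eventuallyI)
  have "(\<lambda>n. L2_inner M (F n) g - L2_inner M f g) \<longlonglongrightarrow> 0" by (rule Lim_null_comparison[OF ev 1])
  then show ?thesis by (rule LIM_zero_cancel)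
qed

lemma L2_lim_inner_right:
  assumes "L2_lim M F f" "\<And>n. F n \<in> L2 M" "f \<in> L2 M" "g \<in> L2 M"
  shows "(\<lambda>n. L2_inner M g (F n)) \<longlonglongrightarrow> L2_inner M g f"
  using tendsto_cnj[OF L2_lim_inner[OF assms]] by (simp add: L2_inner_cnj)

lemma L2_lim_unique:
  assumes "L2_lim M F f" "L2_lim M F g" "\<And>n. F n \<in> L2 M" "f \<in> L2 M" "g \<in> L2 M"
  shows "AE x in M. f x = g x"
proof -
  have "L2_norm M (\<lambda>x. f x - g x) \<le> L2_norm M (\<lambda>x. F n x - f x) + L2_norm M (\<lambda>x. F n x - g x)" for n
    using L2_norm_triangle_diff[of f M "F n" g] assms by (simp add: L2_norm_minus_commute[of M f])
  moreover have "(\<lambda>n. L2_norm M (\<lambda>x. F n x - f x) + L2_norm M (\<lambda>x. F n x - g x)) \<longlonglongrightarrow> 0 + 0"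
    using assms unfolding L2_lim_def by (intro tendsto_intros)
  ultimately have "L2_norm M (\<lambda>x. f x - g x) \<le> 0" by (intro LIMSEQ_le_const) auto
  then have "L2_norm M (\<lambda>x. f x - g x) = 0" using L2_norm_nonneg[of M "\<lambda>x. f x - g x"] by linarith
  then show ?thesis using L2_norm_eq_0_iff[OF L2_diff[OF assms(4,5)]] by simp
qed

lemma L2_lim_imp_Cauchy:
  assumes "L2_lim M F f" "\<And>n. F n \<in> L2 M" "f \<in> L2 M"
  shows "L2_Cauchy M F"
  unfolding L2_Cauchy_def
proof (intro allI impI)
  fix e :: real assume "e > 0"
  then obtain N where N: "\<And>n. n \<ge> N \<Longrightarrow> L2_norm M (\<lambda>x. F n x - f x) < e / 2"
    using assms(1) LIMSEQ_D[of _ 0 "e / 2"] unfolding L2_lim_def by (force simp: L2_norm_nonneg)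
  have "L2_norm M (\<lambda>x. F m x - F n x) < e" if "m \<ge> N" "n \<ge> N" for m n
    using L2_norm_triangle_diff[of "F m" M f "F n"] N[OF that(1)] N[OF that(2)] assms
    by (simp add: L2_norm_minus_commute[of M f])
  then show "\<exists>N. \<forall>m\<ge>N. \<forall>n\<ge>N. L2_norm M (\<lambda>x. F m x - F n x) < e" by blast
qed

lemma (in finite_measure) L2_const: "(\<lambda>x. c) \<in> L2 M"
  by (simp add: L2_def)

lemma (in finite_measure) L2_bounded:
  assumes "f \<in> borel_measurable M" "\<And>x. x \<in> space M \<Longrightarrow> norm (f x) \<le> B"
  shows "f \<in> L2 M"
proof -
  have [measurable]: "f \<in> borel_measurable M" by fact
  have "integrable M (\<lambda>x. (norm (f x))\<^sup>2)"
    by (rule integrable_const_bound[where B = "B\<^sup>2"]) (auto intro!: AE_I2 power_mono assms)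
  then show ?thesis using assms by (simp add: L2_def)
qed

text \<open>Along a subsequence with increments at most \<open>(1/2) ^ j\<close>, finiteness of the
  measure turns L2 bounds into L1 bounds, so the increments are absolutely summable almost
  everywhere. Fatou's lemma then shows that the pointwise limit is the L2 limit of the whole
  sequence.\<close>

theorem (in finite_measure) Riesz_Fischer:
  assumes F: "\<And>n. F n \<in> L2 M" and cauchy: "L2_Cauchy M F"
  shows "\<exists>f\<in>L2 M. L2_lim M F f"
proof -
  have Fm[measurable]: "F n \<in> borel_measurable M" for n using F L2D by blast
  have "\<forall>j. \<exists>N. \<forall>m\<ge>N. \<forall>n\<ge>N. L2_norm M (\<lambda>x. F m x - F n x) < (1/2) ^ j"
    using cauchy unfolding L2_Cauchy_def by simp
  then obtain N where N: "\<And>j m n. m \<ge> N j \<Longrightarrow> n \<ge> N j \<Longrightarrow> L2_norm M (\<lambda>x. F m x - F n x) < (1/2) ^ j" by metis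
  \<comment> \<open>The sum is at least \<open>N j\<close> and is increasing in \<open>j\<close>,
    which \<open>N\<close> itself need not be.\<close>
  define k where "k j = (\<Sum>i\<le>j. N i)" for j
  have kN: "k j \<ge> N j" for j unfolding k_def by (rule member_le_sum) auto
  have kS: "k (Suc j) \<ge> k j" for j by (simp add: k_def)
  have kmono: "k i \<le> k j" if "i \<le> j" for i j using kS that by (rule lift_Suc_mono_le)
  define \<Delta> where "\<Delta> j x = F (k (Suc j)) x - F (k j) x" for j x
  have \<Delta>m[measurable]: "\<Delta> j \<in> borel_measurable M" for j unfolding \<Delta>_def[abs_def] by simp
  have \<Delta>L: "\<Delta> j \<in> L2 M" for j unfolding \<Delta>_def[abs_def] by (intro L2_diff F)
  have \<Delta>n: "L2_norm M (\<Delta> j) \<le> (1/2) ^ j" for j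
    using N[of j "k (Suc j)" "k j"] kN[of j] kS[of j] unfolding \<Delta>_def[abs_def] by simp
  define C where "C = L2_norm M (\<lambda>x. 1)"
  have abs: "(\<lambda>x. complex_of_real (norm (\<Delta> j x))) \<in> L2 M" for j
    using \<Delta>L[of j] by (simp add: L2_def)
  have int: "integrable M (\<lambda>x. norm (\<Delta> j x))" for j
    using integrable_norm[OF L2_mult_integrable[OF \<Delta>L[of j] L2_const[of 1]]] by simp
  have i1: "(\<integral>\<^sup>+ x. ennreal (norm (\<Delta> j x)) \<partial>M) \<le> ennreal (C * (1/2) ^ j)" for j
  proof -
    have "norm (L2_inner M (\<lambda>x. complex_of_real (norm (\<Delta> j x))) (\<lambda>x. 1)) \<le> L2_norm M (\<lambda>x. complex_of_real (norm (\<Delta> j x))) * C"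
      unfolding C_def by (rule L2_Cauchy_Schwarz[OF abs L2_const])
    also have "L2_norm M (\<lambda>x. complex_of_real (norm (\<Delta> j x))) = L2_norm M (\<Delta> j)" by (simp add: L2_norm_def)
    also have "\<dots> * C \<le> (1/2) ^ j * C" by (intro mult_right_mono \<Delta>n) (simp add: C_def L2_norm_nonneg)
    finally have "(LINT x|M. norm (\<Delta> j x)) \<le> C * (1/2) ^ j"
      by (simp add: L2_inner_def mult.commute)
    then show ?thesis using nn_integral_eq_integral[OF int] by (simp add: ennreal_leI)
  qed
  have "(\<integral>\<^sup>+ x. suminf (\<lambda>j. ennreal (norm (\<Delta> j x))) \<partial>M) = suminf (\<lambda>j. \<integral>\<^sup>+ x. ennreal (norm (\<Delta> j x)) \<partial>M)"
    by (rule nn_integral_suminf) simp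
  also have "\<dots> \<le> suminf (\<lambda>j. ennreal (C * (1/2) ^ j))"
    by (intro suminf_le i1) auto
  also have "\<dots> = ennreal (suminf (\<lambda>j. C * (1/2) ^ j))"
    by (rule suminf_ennreal2) (auto simp: C_def L2_norm_nonneg intro!: summable_mult summable_geometric)
  finally have "(\<integral>\<^sup>+ x. suminf (\<lambda>j. ennreal (norm (\<Delta> j x))) \<partial>M) \<noteq> \<infinity>"
    by (auto simp: top_unique)
  then have "AE x in M. suminf (\<lambda>j. ennreal (norm (\<Delta> j x))) \<noteq> \<infinity>"
    by (intro nn_integral_PInf_AE) simp
  then have conv: "AE x in M. convergent (\<lambda>j. F (k j) x)"
  proof eventually_elim
    case (elim x)
    have "summable (\<lambda>j. norm (\<Delta> j x))"
      by (rule summable_suminf_not_top) (use elim in auto)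
    then have "summable (\<lambda>j. \<Delta> j x)" by (rule summable_norm_cancel)
    then have "convergent (\<lambda>n. (\<Sum>j<n. \<Delta> j x))" by (simp add: summable_iff_convergent)
    moreover have "(\<Sum>j<n. \<Delta> j x) = F (k n) x - F (k 0) x" for n
      unfolding \<Delta>_def by (rule sum_lessThan_telescope)
    ultimately obtain L where "(\<lambda>n. F (k n) x - F (k 0) x) \<longlonglongrightarrow> L" by (auto simp: convergent_def)
    from tendsto_add[OF this tendsto_const[of "F (k 0) x"]] show ?case by (auto simp: convergent_def)
  qed
  define f where "f x = lim (\<lambda>j. F (k j) x)" for x
  have fm[measurable]: "f \<in> borel_measurable M" unfolding f_def[abs_def] by simp
  have lim: "AE x in M. (\<lambda>j. F (k j) x) \<longlonglongrightarrow> f x"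
    using conv by eventually_elim (simp add: f_def convergent_LIMSEQ_iff)
  have est: "(\<integral>\<^sup>+ x. ennreal ((norm (F n x - f x))\<^sup>2) \<partial>M) \<le> ennreal (((1/2) ^ j)\<^sup>2)" if n: "n \<ge> k j" for n j
  proof -
    have "(\<integral>\<^sup>+ x. ennreal ((norm (F n x - f x))\<^sup>2) \<partial>M) =
        (\<integral>\<^sup>+ x. liminf (\<lambda>i. ennreal ((norm (F n x - F (k i) x))\<^sup>2)) \<partial>M)"
    proof (rule nn_integral_cong_AE, use lim in eventually_elim)
      case (elim x)
      have "(\<lambda>i. ennreal ((norm (F n x - F (k i) x))\<^sup>2)) \<longlonglongrightarrow> ennreal ((norm (F n x - f x))\<^sup>2)"
        by (intro tendsto_intros elim)
      then show ?case by (intro lim_imp_Liminf[symmetric]) simp_all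
    qed
    also have "\<dots> \<le> liminf (\<lambda>i. \<integral>\<^sup>+ x. ennreal ((norm (F n x - F (k i) x))\<^sup>2) \<partial>M)"
      by (rule nn_integral_liminf) simp
    also have "\<dots> \<le> ennreal (((1/2) ^ j)\<^sup>2)"
    proof (rule Liminf_le)
      show "\<forall>\<^sub>F i in sequentially. (\<integral>\<^sup>+ x. ennreal ((norm (F n x - F (k i) x))\<^sup>2) \<partial>M) \<le> ennreal (((1/2) ^ j)\<^sup>2)"
        unfolding eventually_sequentially
      proof (intro exI[of _ j] allI impI)
        fix i assume "j \<le> i"
        then have "L2_norm M (\<lambda>x. F n x - F (k i) x) < (1/2) ^ j"
          using n kN[of j] kmono[of j i] by (intro N) auto
        then have "(L2_norm M (\<lambda>x. F n x - F (k i) x))\<^sup>2 \<le> ((1/2) ^ j)\<^sup>2"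
          by (intro power_mono L2_norm_nonneg) simp
        then show "(\<integral>\<^sup>+ x. ennreal ((norm (F n x - F (k i) x))\<^sup>2) \<partial>M) \<le> ennreal (((1/2) ^ j)\<^sup>2)"
          using nn_integral_L2[OF L2_diff[OF F F]] by (simp add: ennreal_leI)
      qed
    qed simp
    finally show ?thesis .
  qed
  have d: "(\<lambda>x. F n x - f x) \<in> L2 M" if "n \<ge> k 0" for n
    by (rule L2I_nn_integral) (use est[OF that] in \<open>auto intro: le_less_trans\<close>)
  have fL: "f \<in> L2 M" using L2_diff[OF F[of "k 0"] d[OF order_refl]] by simp
  have "L2_lim M F f"
    unfolding L2_lim_def
  proof (rule LIMSEQ_I)
    fix e :: real assume "e > 0"
    then obtain j where j: "(1/2 :: real) ^ j < e" using real_arch_pow_inv[of e "1/2"] by auto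
    have "norm (L2_norm M (\<lambda>x. F n x - f x) - 0) < e" if "n \<ge> k j" for n
    proof -
      have "ennreal ((L2_norm M (\<lambda>x. F n x - f x))\<^sup>2) \<le> ennreal (((1/2) ^ j)\<^sup>2)"
        using est[OF that] nn_integral_L2[OF L2_diff[OF F fL]] by simp
      then have "(L2_norm M (\<lambda>x. F n x - f x))\<^sup>2 \<le> ((1/2) ^ j)\<^sup>2" by simp
      then have "L2_norm M (\<lambda>x. F n x - f x) \<le> (1/2) ^ j" by (rule power2_le_imp_le) simp
      then show ?thesis using j L2_norm_nonneg[of M "\<lambda>x. F n x - f x"] by simp
    qed
    then show "\<exists>N. \<forall>n\<ge>N. norm (L2_norm M (\<lambda>x. F n x - f x) - 0) < e" by blast
  qed
  then show ?thesis using fL by blast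
qed

text \<open>\<open>V\<close> is not assumed to be closed, since it will be the space of polynomials.
  The projection is therefore delivered as the limit of a minimizing sequence in
  \<open>V\<close>.\<close>

theorem (in finite_measure) L2_projection:
  assumes V: "V \<subseteq> L2 M" "V \<noteq> {}" "\<And>f g. f \<in> V \<Longrightarrow> g \<in> V \<Longrightarrow> (\<lambda>x. f x + g x) \<in> V"
      "\<And>c f. f \<in> V \<Longrightarrow> (\<lambda>x. c * f x) \<in> V"
    and g: "g \<in> L2 M"
  shows "\<exists>p f. (\<forall>n::nat. p n \<in> V) \<and> f \<in> L2 M \<and> L2_lim M p f \<and> (\<forall>q\<in>V. L2_inner M (\<lambda>x. g x - f x) q = 0)"
proof -
  define E where "E p = (L2_norm M (\<lambda>x. g x - p x))\<^sup>2" for p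
  define \<delta> where "\<delta> = Inf (E ` V)"
  have bdd: "bdd_below (E ` V)" by (rule bdd_belowI[of _ 0]) (auto simp: E_def)
  have \<delta>_le: "\<delta> \<le> E p" if "p \<in> V" for p
    unfolding \<delta>_def using that bdd by (intro cInf_lower) auto
  have "\<exists>p\<in>V. E p < \<delta> + 1 / (real n + 1)" for n
  proof -
    have "Inf (E ` V) < \<delta> + 1 / (real n + 1)" unfolding \<delta>_def by simp
    then show ?thesis using cInf_less_iff[OF _ bdd] V(2) by auto
  qed
  then obtain p where p: "\<And>n. p n \<in> V" "\<And>n. E (p n) < \<delta> + 1 / (real n + 1)" by metis
  have pL: "p n \<in> L2 M" for n using p V by blast
  have dL: "(\<lambda>x. g x - p n x) \<in> L2 M" for n by (intro L2_diff g pL)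
  have par: "(L2_norm M (\<lambda>x. p m x - p n x))\<^sup>2 \<le> 2 / (real m + 1) + 2 / (real n + 1)" for m n
  proof -
    let ?h = "\<lambda>x. (1/2) * (p m x + p n x)"
    have h: "?h \<in> V" by (intro V p)
    \<comment> \<open>The parallelogram law for \<open>g - p m\<close> and \<open>g - p n\<close>.
      The midpoint \<open>?h\<close> lies in \<open>V\<close> and is thus at squared distance at
      least \<delta>.\<close>
    have id: "(norm (p m x - p n x))\<^sup>2 = 2 * (norm (g x - p m x))\<^sup>2 + 2 * (norm (g x - p n x))\<^sup>2 - 4 * (norm (g x - ?h x))\<^sup>2" for x
      unfolding cmod_power2 by (simp add: power2_eq_square field_simps)
    have "(L2_norm M (\<lambda>x. p m x - p n x))\<^sup>2 = 2 * E (p m) + 2 * E (p n) - 4 * E ?h"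
      unfolding L2_norm_sq E_def id
      using L2D(2)[OF dL] L2D(2)[OF L2_diff[OF g]] V(1) h by (subst Bochner_Integration.integral_diff; simp add: subset_iff)
    also have "\<dots> \<le> 2 * (\<delta> + 1 / (real m + 1)) + 2 * (\<delta> + 1 / (real n + 1)) - 4 * \<delta>"
    proof -
      have "2 * a + 2 * b - 4 * h \<le> 2 * (d + s) + 2 * (d + t) - 4 * d"
        if "d \<le> h" "a < d + s" "b < d + t" for a b h d s t :: real
        using that by argo
      from this[OF \<delta>_le[OF h] p(2) p(2)] show ?thesis .
    qed
    finally show ?thesis by simp
  qed
  have "L2_Cauchy M p" unfolding L2_Cauchy_def
  proof (intro allI impI)
    fix e :: real assume e: "e > 0"
    obtain N where N: "4 / e\<^sup>2 < real N" using reals_Archimedean2 by blast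
    have "L2_norm M (\<lambda>x. p m x - p n x) < e" if mn: "m \<ge> N" "n \<ge> N" for m n
    proof -
      have N0: "0 < real N" using N e by (metis divide_nonneg_nonneg less_eq_real_def le_less_trans zero_le_numeral zero_le_power2)
      have "2 / (real m + 1) \<le> 2 / real N" "2 / (real n + 1) \<le> 2 / real N"
        using mn N0 by (auto intro!: divide_left_mono)
      then have "(L2_norm M (\<lambda>x. p m x - p n x))\<^sup>2 \<le> 4 / real N" using par[of m n] by simp
      also have "\<dots> < e\<^sup>2" using N N0 e by (simp add: field_simps)
      finally show ?thesis using e by (simp add: power2_less_imp_less)
    qed
    then show "\<exists>N. \<forall>m\<ge>N. \<forall>n\<ge>N. L2_norm M (\<lambda>x. p m x - p n x) < e" by blast
  qed
  then obtain f where f: "f \<in> L2 M" "L2_lim M p f" using Riesz_Fischer[of p, OF pL] by blast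
  have orth: "L2_inner M (\<lambda>x. g x - f x) q = 0" if q: "q \<in> V" for q
  proof -
    have qL: "q \<in> L2 M" using q V by blast
    define B where "B = (L2_norm M q)\<^sup>2"
    have bound: "(norm (L2_inner M (\<lambda>x. g x - p n x) q))\<^sup>2 \<le> B / (real n + 1)" for n
    proof (cases "B = 0")
      case True
      then have "L2_norm M q = 0" by (simp add: B_def)
      then show ?thesis using L2_Cauchy_Schwarz[OF dL qL, of n] True by simp
    next
      case False
      define c where "c = L2_inner M (\<lambda>x. g x - p n x) q"
      have B: "B > 0" using False by (simp add: B_def)
      \<comment> \<open>\<open>?r\<close> is the best correction of \<open>p n\<close> in the
        direction of \<open>q\<close>. It lowers the squared distance by the squared modulus of
        \<open>c\<close> over \<open>B\<close>, but no more than \<open>1 / (real n + 1)\<close> is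
        left to gain.\<close>
      let ?d = "\<lambda>x. g x - p n x" and ?r = "\<lambda>x. (c / complex_of_real B) * q x"
      have rL: "?r \<in> L2 M" by (rule L2_cmult[OF qL])
      define t where "t = E (\<lambda>x. p n x + ?r x)"
      have t: "\<delta> \<le> t" unfolding t_def by (intro \<delta>_le V p q)
      have "(\<lambda>x. g x - (p n x + ?r x)) = (\<lambda>x. ?d x - ?r x)" by (simp add: fun_eq_iff)
      then have t': "complex_of_real t = L2_inner M (\<lambda>x. ?d x - ?r x) (\<lambda>x. ?d x - ?r x)"
        unfolding t_def E_def L2_inner_self by (simp only:)
      have qd: "L2_inner M q ?d = cnj c" by (simp add: c_def L2_inner_cnj)
      have dr: "L2_inner M ?d ?r = cnj (c / B) * c" and rd: "L2_inner M ?r ?d = c / B * cnj c"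
        and rr: "L2_inner M ?r ?r = c / B * (cnj (c / B) * B)" and dd: "L2_inner M ?d ?d = complex_of_real (E (p n))"
        by (simp_all only: L2_inner_cmult_left L2_inner_cmult_right qd c_def[symmetric] L2_inner_self E_def B_def)
      have "L2_inner M (\<lambda>x. ?d x - ?r x) (\<lambda>x. ?d x - ?r x) =
          complex_of_real (E (p n)) - cnj (c / B) * c - (c / B * cnj c - c / B * (cnj (c / B) * B))"
        unfolding L2_inner_diff_left[OF dL rL L2_diff[OF dL rL]] L2_inner_diff_right[OF dL rL dL]
          L2_inner_diff_right[OF dL rL rL] dr rd rr dd ..
      also have "\<dots> = complex_of_real (E (p n) - (norm c)\<^sup>2 / B)"
        unfolding of_real_diff of_real_divide complex_norm_square using B by (simp add: field_simps)
      finally have "t = E (p n) - (norm c)\<^sup>2 / B" unfolding t'[symmetric] of_real_eq_iff .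
      then have "(norm c)\<^sup>2 / B \<le> 1 / (real n + 1)" using p(2)[of n] t by linarith
      then show ?thesis unfolding c_def[symmetric] using B by (simp add: field_simps)
    qed
    have "(\<lambda>n. B / (real n + 1)) \<longlonglongrightarrow> 0" by real_asymp
    then have "(\<lambda>n. (norm (L2_inner M (\<lambda>x. g x - p n x) q))\<^sup>2) \<longlonglongrightarrow> 0"
      by (rule tendsto_sandwich[OF _ _ tendsto_const, rotated -1]) (auto intro!: always_eventually bound)
    moreover have "L2_lim M (\<lambda>n x. g x - p n x) (\<lambda>x. g x - f x)"
      using f(2) unfolding L2_lim_def by (simp add: L2_norm_def norm_minus_commute)
    then have "(\<lambda>n. L2_inner M (\<lambda>x. g x - p n x) q) \<longlonglongrightarrow> L2_inner M (\<lambda>x. g x - f x) q"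
      by (rule L2_lim_inner[OF _ dL L2_diff[OF g f(1)] qL])
    then have "(\<lambda>n. (norm (L2_inner M (\<lambda>x. g x - p n x) q))\<^sup>2) \<longlonglongrightarrow> (norm (L2_inner M (\<lambda>x. g x - f x) q))\<^sup>2"
      by (intro tendsto_intros)
    ultimately have "(norm (L2_inner M (\<lambda>x. g x - f x) q))\<^sup>2 = 0" using LIMSEQ_unique by blast
    then show ?thesis by simp
  qed
  show ?thesis using p(1) f orth by blast
qed

section \<open>Measures invariant under coordinate rotations\<close>

text \<open>Such a \<open>u\<close> detects different exponents: a rotation by \<open>u\<close>
  multiplies an integral of mixed type by a number other than 1, so the integral is 0.\<close>

lemma unimodular_powers:
  fixes a b :: nat
  assumes "a \<noteq> b"
  shows "\<exists>u. norm u = 1 \<and> u ^ a * cnj u ^ b \<noteq> 1"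
proof -
  have *: "\<exists>u. norm u = 1 \<and> u ^ a * cnj u ^ b \<noteq> 1" if "b < a" for a b :: nat
  proof -
    have "1 \<le> a - b" using that by simp
    from complex_not_root_unity[OF this] obtain u :: complex where u: "norm u = 1" "u ^ (a - b) \<noteq> 1" by blast
    have "u * cnj u = 1" using u(1) complex_norm_square[of u] by simp
    have "u ^ a * cnj u ^ b = u ^ (a - b) * (u ^ b * cnj u ^ b)"
      using that by (simp add: power_add[symmetric] mult.assoc[symmetric])
    also have "\<dots> = u ^ (a - b)" using \<open>u * cnj u = 1\<close> by (simp add: power_mult_distrib[symmetric])
    finally show ?thesis using u by auto
  qed
  show ?thesis
  proof (cases "b < a")
    case True then show ?thesis by (rule *)
  next
    case False
    then have "a < b" using assms by simp
    from *[OF this] obtain u where u: "norm u = 1" "u ^ b * cnj u ^ a \<noteq> 1" by blast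
    have "cnj (u ^ b * cnj u ^ a) \<noteq> 1" using u(2) by (metis complex_cnj_cnj complex_cnj_one)
    then show ?thesis using u(1) by (intro exI[of _ u]) (simp add: mult.commute)
  qed
qed

definition rotate_coords :: "('d \<Rightarrow> complex) \<Rightarrow> complex ^ 'd \<Rightarrow> complex ^ 'd" where
  "rotate_coords c z = (\<chi> i. c i * z $ i)"

definition monomial :: "('d::finite \<Rightarrow>\<^sub>0 nat) \<Rightarrow> complex ^ 'd \<Rightarrow> complex" where
  "monomial k z = (\<Prod>i\<in>UNIV. (z $ i) ^ Poly_Mapping.lookup k i)"

lemma monomial_polyfuns: "monomial k \<in> polyfuns"
  unfolding monomial_def[abs_def] by (intro polyfuns_prod polyfuns_power polyfuns_coord)

lemma eval_poly_monomials:
  "eval_poly p = (\<lambda>z. \<Sum>k\<in>Poly_Mapping.keys p. Poly_Mapping.lookup p k * monomial k z)"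
  by (simp add: eval_poly_def monomial_def fun_eq_iff)

text \<open>Besides the torus and the sphere this covers Lebesgue measure on balls, through which
  evaluation is estimated in the case of the sphere.\<close>

locale rotation_measure = finite_measure m for m :: "(complex ^ 'd) measure" +
  assumes sets_m: "sets m = sets (restrict_space borel (space m))"
    and bounded_space: "bounded (space m)"
    and rot_measurable: "\<And>c. (\<forall>i. norm (c i) = 1) \<Longrightarrow> rotate_coords c \<in> measurable m m"
    and rot_distr: "\<And>c. (\<forall>i. norm (c i) = 1) \<Longrightarrow> distr m m (rotate_coords c) = m"
begin

lemma continuous_measurable_m:
  assumes "continuous_on (space m) f"
  shows "f \<in> borel_measurable m"
  using borel_measurable_continuous_on_restrict[OF assms]
  by (subst measurable_cong_sets[OF sets_m refl])

lemma polyfuns_measurable: "f \<in> polyfuns \<Longrightarrow> f \<in> borel_measurable m"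
  by (intro continuous_measurable_m continuous_on_polyfuns)

lemma continuous_L2:
  assumes "continuous_on (closure (space m)) f"
  shows "f \<in> L2 m"
proof -
  have "compact (closure (space m))" using bounded_space by (simp add: compact_closure)
  then have "compact (f ` closure (space m))" using assms by (rule compact_continuous_image[rotated])
  then obtain B where B: "\<forall>y\<in>f ` closure (space m). norm y \<le> B"
    using compact_imp_bounded bounded_iff by blast
  have "norm (f x) \<le> B" if "x \<in> space m" for x using B closure_subset that by blast
  moreover have "f \<in> borel_measurable m"
    using continuous_on_subset[OF assms closure_subset] by (rule continuous_measurable_m)
  ultimately show ?thesis by (intro L2_bounded)
qed

lemma polyfuns_L2: "f \<in> polyfuns \<Longrightarrow> f \<in> L2 m"
  by (intro continuous_L2 continuous_on_polyfuns)

lemma L2_inner_rotate: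
  assumes "f \<in> borel_measurable m" "g \<in> borel_measurable m" "\<forall>i. norm (c i) = 1"
  shows "L2_inner m (\<lambda>z. f (rotate_coords c z)) (\<lambda>z. g (rotate_coords c z)) = L2_inner m f g"
proof -
  have [measurable]: "f \<in> borel_measurable m" "g \<in> borel_measurable m" by fact+
  have "L2_inner (distr m m (rotate_coords c)) f g =
      L2_inner m (\<lambda>z. f (rotate_coords c z)) (\<lambda>z. g (rotate_coords c z))"
    unfolding L2_inner_def by (rule integral_distr[OF rot_measurable[OF assms(3)]]) simp
  then show ?thesis using rot_distr[OF assms(3)] by simp
qed

text \<open>Rotating only a coordinate in which the exponents differ multiplies the inner product by
  a number other than 1 and, by invariance, leaves it unchanged.\<close>

lemma monomials_orthogonal:
  assumes "k \<noteq> l"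
  shows "L2_inner m (monomial k) (monomial l) = 0"
proof -
  obtain i where i: "Poly_Mapping.lookup k i \<noteq> Poly_Mapping.lookup l i"
    using assms by (meson poly_mapping_eqI)
  from unimodular_powers[OF this] obtain u where
    u: "norm u = 1" "u ^ Poly_Mapping.lookup k i * cnj u ^ Poly_Mapping.lookup l i \<noteq> 1" by blast
  define c where "c j = (if j = i then u else 1)" for j
  have c: "\<forall>j. norm (c j) = 1" using u by (simp add: c_def)
  have rot: "monomial k (rotate_coords c z) = u ^ Poly_Mapping.lookup k i * monomial k z" for k z
  proof -
    have "monomial k (rotate_coords c z) = (\<Prod>j\<in>UNIV. c j ^ Poly_Mapping.lookup k j) * monomial k z"
      by (simp add: monomial_def rotate_coords_def power_mult_distrib prod.distrib)
    also have "(\<Prod>j\<in>UNIV. c j ^ Poly_Mapping.lookup k j) = u ^ Poly_Mapping.lookup k i"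
      by (subst prod.remove[of _ i]) (auto simp: c_def)
    finally show ?thesis .
  qed
  have "L2_inner m (monomial k) (monomial l) =
      u ^ Poly_Mapping.lookup k i * (cnj (u ^ Poly_Mapping.lookup l i) * L2_inner m (monomial k) (monomial l))"
    using L2_inner_rotate[OF polyfuns_measurable[OF monomial_polyfuns[of k]] polyfuns_measurable[OF monomial_polyfuns[of l]] c]
    unfolding rot L2_inner_cmult_left L2_inner_cmult_right by simp
  then have "(u ^ Poly_Mapping.lookup k i * cnj u ^ Poly_Mapping.lookup l i - 1) * L2_inner m (monomial k) (monomial l) = 0"
    by (simp add: algebra_simps)
  then show ?thesis using u(2) by auto
qed

lemma L2_inner_sum_left:
  assumes "\<And>i. i \<in> A \<Longrightarrow> f i \<in> polyfuns" "g \<in> polyfuns"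
  shows "L2_inner m (\<lambda>z. \<Sum>i\<in>A. f i z) g = (\<Sum>i\<in>A. L2_inner m (f i) g)"
  using assms(1)
proof (induction A rule: infinite_finite_induct)
  case (insert i A)
  then show ?case
    using L2_inner_add_left[OF polyfuns_L2 polyfuns_L2 polyfuns_L2, of "f i" "\<lambda>z. \<Sum>i\<in>A. f i z" g] polyfuns_sum[of A f] assms(2)
    by simp
qed (simp_all add: L2_inner_def)

lemma L2_inner_monomial:
  "L2_inner m (eval_poly p) (monomial l) = Poly_Mapping.lookup p l * (L2_norm m (monomial l))\<^sup>2"
proof -
  have "L2_inner m (eval_poly p) (monomial l) =
      (\<Sum>k\<in>Poly_Mapping.keys p. Poly_Mapping.lookup p k * L2_inner m (monomial k) (monomial l))"
    unfolding eval_poly_monomials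
    by (subst L2_inner_sum_left) (auto intro: polyfuns_cmult monomial_polyfuns simp: L2_inner_cmult_left)
  also have "\<dots> = (\<Sum>k\<in>Poly_Mapping.keys p. if k = l then Poly_Mapping.lookup p l * (L2_norm m (monomial l))\<^sup>2 else 0)"
    by (intro sum.cong) (auto simp: monomials_orthogonal L2_inner_self)
  also have "\<dots> = Poly_Mapping.lookup p l * (L2_norm m (monomial l))\<^sup>2"
    by (auto simp: in_keys_iff)
  finally show ?thesis .
qed

lemma Parseval:
  "(L2_norm m (eval_poly p))\<^sup>2 =
    (\<Sum>k\<in>Poly_Mapping.keys p. (norm (Poly_Mapping.lookup p k))\<^sup>2 * (L2_norm m (monomial k))\<^sup>2)"
proof -
  have pf: "eval_poly p \<in> polyfuns" by (simp add: polyfuns_def)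
  have "L2_inner m (eval_poly p) (eval_poly p) =
    (\<Sum>k\<in>Poly_Mapping.keys p. L2_inner m (\<lambda>z. Poly_Mapping.lookup p k * monomial k z) (eval_poly p))"
    by (subst (1) eval_poly_monomials, subst L2_inner_sum_left)
       (auto intro: polyfuns_cmult monomial_polyfuns pf)
  also have "\<dots> = (\<Sum>k\<in>Poly_Mapping.keys p. Poly_Mapping.lookup p k * cnj (L2_inner m (eval_poly p) (monomial k)))"
    by (simp add: L2_inner_cmult_left L2_inner_cnj)
  also have "\<dots> = complex_of_real (\<Sum>k\<in>Poly_Mapping.keys p. (norm (Poly_Mapping.lookup p k))\<^sup>2 * (L2_norm m (monomial k))\<^sup>2)"
    unfolding of_real_sum of_real_mult complex_norm_square[of "Poly_Mapping.lookup _ _"] L2_inner_monomial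
    by (simp add: mult.assoc)
  finally show ?thesis unfolding L2_inner_self of_real_eq_iff .
qed

text \<open>All nonconstant monomials are orthogonal to 1, so only the constant coefficient
  \<open>q 0\<close> remains.\<close>

lemma mean_value:
  assumes q: "q \<in> polyfuns"
  shows "L2_inner m q (\<lambda>z. 1) = q 0 * measure m (space m)"
proof -
  obtain p where p: "q = eval_poly p" using q by (auto simp: polyfuns_def)
  have m0: "monomial 0 = (\<lambda>z. 1)" by (simp add: monomial_def fun_eq_iff)
  have "q 0 = Poly_Mapping.lookup p 0"
  proof -
    have z: "monomial k 0 = (if k = 0 then 1 else 0)" for k
    proof (cases "k = 0")
      case False
      then obtain i where "Poly_Mapping.lookup k i \<noteq> 0" by (metis lookup_zero poly_mapping_eqI)
      then show ?thesis using False unfolding monomial_def by (auto intro!: prod_zero bexI[of _ i])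
    qed (simp add: m0)
    show ?thesis unfolding p eval_poly_monomials z by (auto simp: in_keys_iff if_distrib cong: if_cong)
  qed
  moreover have "(L2_norm m (monomial 0))\<^sup>2 = measure m (space m)" by (simp add: L2_norm_sq m0)
  ultimately show ?thesis using L2_inner_monomial[of p 0] unfolding m0 p by simp
qed

end

section \<open>Invariance of Lebesgue measure under linear isometries\<close>

lemma nn_integral_lborel_translate:
  fixes h :: "'a::euclidean_space \<Rightarrow> ennreal"
  assumes [measurable]: "h \<in> borel_measurable borel"
  shows "(\<integral>\<^sup>+ x. h (x + c) \<partial>lborel) = (\<integral>\<^sup>+ x. h x \<partial>lborel)"
proof -
  have "(\<integral>\<^sup>+ x. h x \<partial>lborel) = (\<integral>\<^sup>+ x. h x \<partial>distr lborel borel ((+) c))"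
    by (simp add: lborel_distr_plus)
  also have "\<dots> = (\<integral>\<^sup>+ x. h (c + x) \<partial>lborel)" by (rule nn_integral_distr) auto
  finally show ?thesis by (simp add: add.commute)
qed

lemma emeasure_lborel_translate:
  fixes A :: "'a::euclidean_space set"
  assumes [measurable]: "A \<in> sets borel"
  shows "emeasure lborel {x. x + c \<in> A} = emeasure lborel A"
proof -
  have "{x. x + c \<in> A} \<in> sets borel" by measurable
  then show ?thesis
    using nn_integral_lborel_translate[of "indicator A" c]
    by (simp add: nn_integral_indicator[symmetric] indicator_def[abs_def] del: nn_integral_indicator)
qed

text \<open>Integrate \<open>1\<^sub>A(x) 1\<^sub>B(x - f t)\<close>, with \<open>B\<close> the unit ball, over \<open>x\<close> and \<open>t\<close> in both orders.\<close>

lemma emeasure_lborel_isometry: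
  fixes f :: "'a::euclidean_space \<Rightarrow> 'a"
  assumes f: "linear f" and iso: "\<And>x. norm (f x) = norm x" and A[measurable]: "A \<in> sets borel"
  shows "emeasure lborel {x. f x \<in> A} = emeasure lborel A"
proof -
  have inj: "inj f" using f iso by (metis linear_injective_0 norm_eq_zero)
  then have surj: "surj f" using f linear_injective_imp_surjective by blast
  define g where "g = inv_into UNIV f"
  have fg: "f (g x) = x" for x unfolding g_def using surj by (simp add: surj_f_inv_f)
  have [measurable]: "f \<in> borel_measurable borel"
    using f linear_continuous_on linear_conv_bounded_linear by (intro borel_measurable_continuous_onI) blast
  define B where "B = ball (0::'a) 1"
  have [measurable]: "B \<in> sets borel" by (simp add: B_def)
  define h where "h x t = indicator A x * (indicator B (x - f t) :: ennreal)" for x t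
  have [measurable]: "case_prod h \<in> borel_measurable (lborel \<Otimes>\<^sub>M lborel)"
    unfolding h_def[abs_def] case_prod_beta by measurable
  have 1: "(\<integral>\<^sup>+ t. h x t \<partial>lborel) = indicator A x * emeasure lborel B" for x
  proof -
    have "(\<integral>\<^sup>+ t. h x t \<partial>lborel) = indicator A x * (\<integral>\<^sup>+ t. indicator B (x - f t) \<partial>lborel)"
      unfolding h_def by (rule nn_integral_cmult) measurable
    also have "(\<lambda>t. indicator B (x - f t) :: ennreal) = (\<lambda>t. indicator B (t + (- g x)))"
    proof
      fix t
      have "x - f t = f (g x - t)" by (simp add: fg linear_diff[OF f])
      then have "norm (x - f t) = norm (t + (- g x))" by (simp add: iso norm_minus_commute)
      then show "(indicator B (x - f t) :: ennreal) = indicator B (t + (- g x))" by (simp add: B_def indicator_def)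
    qed
    also have "(\<integral>\<^sup>+ t. indicator B (t + (- g x)) \<partial>lborel) = emeasure lborel B"
      by (subst nn_integral_lborel_translate) auto
    finally show ?thesis .
  qed
  have 2: "(\<integral>\<^sup>+ x. h x t \<partial>lborel) = (\<integral>\<^sup>+ x. indicator A (x + f t) * indicator B x \<partial>lborel)" for t
    using nn_integral_lborel_translate[of "\<lambda>x. h x t" "f t"] by (simp add: h_def)
  have 3: "(\<integral>\<^sup>+ t. indicator A (x + f t) * indicator B x \<partial>lborel) = emeasure lborel {t. f t \<in> A} * indicator B x" for x
  proof -
    have m[measurable]: "{t. f t \<in> A} \<in> sets borel" by measurable
    have "(\<integral>\<^sup>+ t. indicator A (x + f t) * indicator B x \<partial>lborel) = (\<integral>\<^sup>+ t. indicator A (x + f t) \<partial>lborel) * indicator B x"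
      by (rule nn_integral_multc) measurable
    moreover have eq: "(\<lambda>t. indicator A (x + f t) :: ennreal) = (\<lambda>t. indicator {t. f t \<in> A} (t + g x))"
      by (simp add: fun_eq_iff indicator_def linear_add[OF f] fg add.commute)
    have "(\<integral>\<^sup>+ t. indicator A (x + f t) \<partial>lborel) = emeasure lborel {t. f t \<in> A}"
      unfolding eq by (subst nn_integral_lborel_translate) auto
    ultimately show ?thesis by (simp only:)
  qed
  have "emeasure lborel A * emeasure lborel B = (\<integral>\<^sup>+ x. \<integral>\<^sup>+ t. h x t \<partial>lborel \<partial>lborel)"
    unfolding 1 by (simp add: nn_integral_multc)
  also have "\<dots> = (\<integral>\<^sup>+ t. \<integral>\<^sup>+ x. h x t \<partial>lborel \<partial>lborel)" by (rule lborel_pair.Fubini'[symmetric]) simp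
  also have "\<dots> = (\<integral>\<^sup>+ t. \<integral>\<^sup>+ x. indicator A (x + f t) * indicator B x \<partial>lborel \<partial>lborel)" unfolding 2 ..
  also have "\<dots> = (\<integral>\<^sup>+ x. \<integral>\<^sup>+ t. indicator A (x + f t) * indicator B x \<partial>lborel \<partial>lborel)"
    by (rule lborel_pair.Fubini') (unfold case_prod_beta, measurable)
  also have "\<dots> = emeasure lborel {t. f t \<in> A} * emeasure lborel B"
    unfolding 3 by (simp add: nn_integral_cmult)
  finally have "emeasure lborel A * emeasure lborel B = emeasure lborel {t. f t \<in> A} * emeasure lborel B" .
  moreover have "emeasure lborel B \<noteq> 0" "emeasure lborel B \<noteq> \<infinity>"
  proof -
    show "emeasure lborel B \<noteq> \<infinity>" using emeasure_lborel_ball_finite[of "0::'a" 1] by (simp add: B_def)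
    show "emeasure lborel B \<noteq> 0"
      using content_ball_pos[of 1 "0::'a"] by (auto simp: B_def measure_def)
  qed
  ultimately show ?thesis by (metis ennreal_mult_divide_eq infinity_ennreal_def)
qed


lemma linear_rotate_coords: "linear (rotate_coords c)"
  by (rule linearI) (auto simp: rotate_coords_def vec_eq_iff algebra_simps scaleR_conv_of_real)

lemma norm_rotate_coords: "\<forall>i. norm (c i) = 1 \<Longrightarrow> norm (rotate_coords c z) = norm z"
  by (simp add: norm_vec_def rotate_coords_def norm_mult)

lemma measure_preserving_imp_distr:
  assumes f: "f \<in> measurable M M" and "\<And>A. A \<in> sets M \<Longrightarrow> emeasure M (f -` A \<inter> space M) = emeasure M A"
  shows "distr M M f = M"
  by (rule measure_eqI) (use assms in \<open>auto simp: emeasure_distr\<close>)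

section \<open>The sphere\<close>

lemma sgn_measurable:
  "(sgn :: complex ^ 'd \<Rightarrow> _) \<in> measurable (restrict_space (uniform_measure lborel (ball 0 1)) (- {0}))
     (restrict_space borel (sphere 0 1))"
proof (rule measurable_restrict_space2)
  show "sgn \<in> space (restrict_space (uniform_measure lborel (ball (0 :: complex ^ 'd) 1)) (- {0})) \<rightarrow> sphere 0 1"
    by (auto simp: space_restrict_space norm_sgn)
  have "continuous_on (- {0}) (sgn :: complex ^ 'd \<Rightarrow> _)"
    by (intro continuous_on_sgn continuous_on_id) auto
  then have "sgn \<in> borel_measurable (restrict_space borel (- {0 :: complex ^ 'd}))"
    by (rule borel_measurable_continuous_on_restrict)
  then show "sgn \<in> borel_measurable (restrict_space (uniform_measure lborel (ball (0 :: complex ^ 'd) 1)) (- {0}))"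
    using measurable_cong_sets[OF sets_restrict_space_cong[of "uniform_measure lborel (ball (0 :: complex ^ 'd) 1)" borel "- {0}"] refl, of borel]
    by simp
qed

lemma sets_sphere_measure: "sets sphere_measure = sets (restrict_space borel (sphere 0 1))"
  and space_sphere_measure: "space sphere_measure = sphere 0 1"
  by (simp_all add: sphere_measure_def space_restrict_space)

lemma sphere_preimage_borel:
  assumes "A \<in> sets (restrict_space borel (sphere (0 :: complex ^ 'd) 1))"
  shows "{x. x \<noteq> 0 \<and> sgn x \<in> A} \<in> sets borel"
proof -
  have "sgn -` A \<inter> space (restrict_space (uniform_measure lborel (ball (0 :: complex ^ 'd) 1)) (- {0}))
      \<in> sets (restrict_space (uniform_measure lborel (ball 0 1)) (- {0}))"
    by (rule measurable_sets[OF sgn_measurable assms])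
  also have "sgn -` A \<inter> space (restrict_space (uniform_measure lborel (ball (0 :: complex ^ 'd) 1)) (- {0})) = {x. x \<noteq> 0 \<and> sgn x \<in> A}"
    by (auto simp: space_restrict_space)
  finally show ?thesis by (subst (asm) sets_restrict_space_iff) auto
qed

lemma emeasure_sphere_measure:
  assumes A: "A \<in> sets (restrict_space borel (sphere (0 :: complex ^ 'd) 1))"
  shows "emeasure sphere_measure A =
    emeasure lborel (ball 0 1 \<inter> {x. x \<noteq> 0 \<and> sgn x \<in> A}) / emeasure lborel (ball (0 :: complex ^ 'd) 1)"
proof -
  have eq: "sgn -` A \<inter> space (restrict_space (uniform_measure lborel (ball (0 :: complex ^ 'd) 1)) (- {0})) = {x. x \<noteq> 0 \<and> sgn x \<in> A}"
    by (auto simp: space_restrict_space)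
  have "emeasure sphere_measure A = emeasure (restrict_space (uniform_measure lborel (ball 0 1)) (- {0})) {x. x \<noteq> 0 \<and> sgn x \<in> A}"
    unfolding sphere_measure_def by (subst emeasure_distr[OF sgn_measurable A]) (simp only: eq)
  also have "\<dots> = emeasure (uniform_measure lborel (ball 0 1)) {x. x \<noteq> 0 \<and> sgn x \<in> A}"
    by (rule emeasure_restrict_space) auto
  also have "\<dots> = emeasure lborel (ball 0 1 \<inter> {x. x \<noteq> 0 \<and> sgn x \<in> A}) / emeasure lborel (ball (0 :: complex ^ 'd) 1)"
    by (rule emeasure_uniform_measure) (use sphere_preimage_borel[OF A] in auto)
  finally show ?thesis .
qed

lemma ball_emeasure: "emeasure lborel (ball (0 :: 'a::euclidean_space) e) = ennreal (measure lborel (ball (0 :: 'a) e))"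
  using emeasure_lborel_ball_finite[of "0 :: 'a" e] by (intro emeasure_eq_ennreal_measure) auto

lemma finite_measure_sphere_measure: "finite_measure (sphere_measure :: (complex ^ 'd) measure)"
proof (rule finite_measureI)
  have "emeasure sphere_measure (sphere (0 :: complex ^ 'd) 1) \<le> emeasure lborel (ball (0 :: complex ^ 'd) 1) / emeasure lborel (ball (0 :: complex ^ 'd) 1)"
    by (subst emeasure_sphere_measure)
       (auto intro!: divide_right_mono_ennreal emeasure_mono simp: sets_restrict_space image_iff intro: exI[of _ UNIV])
  also have "\<dots> < \<infinity>"
    unfolding ball_emeasure using content_ball_pos[of 1 "0 :: complex ^ 'd"] by (simp add: divide_ennreal)
  finally show "emeasure sphere_measure (space (sphere_measure :: (complex ^ 'd) measure)) \<noteq> \<infinity>"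
    by (simp add: space_sphere_measure)
qed

text \<open>A linear isometry commutes with \<open>sgn\<close> and maps the ball to itself, so the
  claim reduces to the invariance of Lebesgue measure.\<close>

lemma sphere_measure_isometry:
  fixes f :: "complex ^ 'd \<Rightarrow> complex ^ 'd"
  assumes f: "linear f" and iso: "\<And>x. norm (f x) = norm x"
  shows "f \<in> measurable sphere_measure sphere_measure" "distr sphere_measure sphere_measure f = sphere_measure"
proof -
  have cont: "continuous_on S f" for S using f linear_continuous_on linear_conv_bounded_linear by blast
  show meas: "f \<in> measurable sphere_measure sphere_measure"
    unfolding measurable_cong_sets[OF sets_sphere_measure sets_sphere_measure]
    by (intro measurable_restrict_space2 borel_measurable_continuous_on_restrict cont)
       (auto simp: space_restrict_space iso)
  show "distr sphere_measure sphere_measure f = sphere_measure"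
  proof (rule measure_preserving_imp_distr[OF meas])
    fix A :: "(complex ^ 'd) set" assume A: "A \<in> sets sphere_measure"
    have A': "A \<in> sets (restrict_space borel (sphere 0 1))" using A by (simp only: sets_sphere_measure)
    let ?P = "ball 0 1 \<inter> {x. x \<noteq> 0 \<and> sgn x \<in> A}"
    have P: "?P \<in> sets borel" using sphere_preimage_borel[OF A'] by auto
    have "f (sgn x) = sgn (f x)" for x by (simp add: sgn_div_norm linear_cmul[OF f] iso)
    moreover have "f x = 0 \<longleftrightarrow> x = 0" for x using iso by (metis norm_eq_zero)
    ultimately have "ball 0 1 \<inter> {x. x \<noteq> 0 \<and> sgn x \<in> f -` A \<inter> sphere 0 1} = {x. f x \<in> ?P}"
      by (auto simp: iso norm_sgn)
    moreover have "f -` A \<inter> sphere 0 1 \<in> sets (restrict_space borel (sphere 0 1))"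
      using measurable_sets[OF meas A] by (simp only: sets_sphere_measure space_sphere_measure)
    ultimately show "emeasure sphere_measure (f -` A \<inter> space sphere_measure) = emeasure sphere_measure A"
      unfolding space_sphere_measure
      by (simp only: emeasure_sphere_measure A' emeasure_lborel_isometry[OF f iso P])
  qed
qed

lemma rotation_measure_sphere: "rotation_measure (sphere_measure :: (complex ^ 'd) measure)"
proof -
  interpret finite_measure "sphere_measure :: (complex ^ 'd) measure" by (rule finite_measure_sphere_measure)
  show ?thesis
    by unfold_locales
       (auto simp: sets_sphere_measure space_sphere_measure
         intro!: sphere_measure_isometry linear_rotate_coords norm_rotate_coords)
qed

lemma rotation_measure_ball: "rotation_measure (restrict_space lborel (ball (0 :: complex ^ 'd) e))"
proof -
  let ?m = "restrict_space lborel (ball (0 :: complex ^ 'd) e)"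
  have sp: "space ?m = ball 0 e" by (simp add: space_restrict_space)
  have se: "sets ?m = sets (restrict_space borel (ball 0 e))" by (intro sets_restrict_space_cong) simp
  have em: "emeasure ?m A = emeasure lborel A" if "A \<in> sets ?m" for A
    by (rule emeasure_restrict_space) (use that sets.sets_into_space[OF that] sp in auto)
  interpret finite_measure ?m
  proof (rule finite_measureI)
    have "emeasure ?m (space ?m) = emeasure lborel (ball (0 :: complex ^ 'd) e)"
      using em[OF sets.top] by (simp only: sp)
    then show "emeasure ?m (space ?m) \<noteq> \<infinity>" using emeasure_lborel_ball_finite[of "0 :: complex ^ 'd" e] by simp
  qed
  have meas: "rotate_coords c \<in> measurable ?m ?m" if c: "\<forall>i. norm (c i) = 1" for c
    unfolding measurable_cong_sets[OF se se]
    using linear_rotate_coords[of c] linear_continuous_on linear_conv_bounded_linear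
    by (intro measurable_restrict_space2 borel_measurable_continuous_on_restrict)
       (auto simp: space_restrict_space norm_rotate_coords[OF c])
  show ?thesis
  proof unfold_locales
    show "distr ?m ?m (rotate_coords c) = ?m" if c: "\<forall>i. norm (c i) = 1" for c
    proof (rule measure_preserving_imp_distr[OF meas[OF c]])
      fix A assume A: "A \<in> sets ?m"
      have "A \<subseteq> ball 0 e" using sets.sets_into_space[OF A] sp by simp
      then have "rotate_coords c -` A \<inter> space ?m = {x. rotate_coords c x \<in> A}"
        unfolding sp by (auto simp: norm_rotate_coords[OF c] subset_iff)
      moreover have "A \<in> sets borel" using A unfolding se by (subst (asm) sets_restrict_space_iff) auto
      ultimately show "emeasure ?m (rotate_coords c -` A \<inter> space ?m) = emeasure ?m A"
        using em[OF measurable_sets[OF meas[OF c] A]] em[OF A]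
          emeasure_lborel_isometry[OF linear_rotate_coords norm_rotate_coords[OF c]] by simp
    qed
  qed (use meas se sp in \<open>auto\<close>)
qed

text \<open>Polar coordinates reduce to the trivial inequality \<open>\<bar>z\<^sup>k\<bar> \<le> \<bar>sgn(z)\<^sup>k\<bar>\<close> on the ball.\<close>

lemma monomial_ball_le_sphere:
  "(L2_norm (restrict_space lborel (ball (0 :: complex ^ 'd) 1)) (monomial k))\<^sup>2 \<le>
    measure lborel (ball (0 :: complex ^ 'd) 1) * (L2_norm sphere_measure (monomial k))\<^sup>2"
proof -
  interpret S: rotation_measure "sphere_measure :: (complex ^ 'd) measure" by (rule rotation_measure_sphere)
  interpret B: rotation_measure "restrict_space lborel (ball (0 :: complex ^ 'd) 1)" by (rule rotation_measure_ball)
  let ?V = "measure lborel (ball (0 :: complex ^ 'd) 1)"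
  have V: "?V > 0" by (rule content_ball_pos) simp
  let ?h = "\<lambda>z :: complex ^ 'd. ennreal ((norm (monomial k z))\<^sup>2)"
  have hm: "?h \<in> borel_measurable (restrict_space borel (sphere 0 1))"
  proof -
    have [measurable]: "monomial k \<in> borel_measurable (restrict_space borel (sphere (0 :: complex ^ 'd) 1))"
      by (intro borel_measurable_continuous_on_restrict continuous_on_polyfuns monomial_polyfuns)
    show ?thesis by measurable
  qed
  have hb: "?h \<in> borel_measurable borel"
  proof -
    have [measurable]: "monomial k \<in> borel_measurable (borel :: (complex ^ 'd) measure)"
      by (intro borel_measurable_continuous_onI continuous_on_polyfuns monomial_polyfuns)
    show ?thesis by measurable
  qed
  have comp: "(\<lambda>x. ?h (sgn x)) \<in> borel_measurable (restrict_space (uniform_measure lborel (ball 0 1)) (- {0}))"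
    using measurable_comp[OF sgn_measurable hm] by (simp add: o_def)
  have ind: "(\<lambda>x. ?h (sgn x) * indicator (- {0}) x) \<in> borel_measurable borel"
    using comp by (subst (asm) borel_measurable_restrict_space_iff_ennreal) (auto cong: measurable_cong_sets)
  have "ennreal ((L2_norm (restrict_space lborel (ball (0 :: complex ^ 'd) 1)) (monomial k))\<^sup>2) =
      (\<integral>\<^sup>+ z. ?h z * indicator (ball 0 1) z \<partial>lborel)"
    by (subst nn_integral_L2[OF B.polyfuns_L2[OF monomial_polyfuns], symmetric])
       (rule nn_integral_restrict_space, simp)
  also have "\<dots> \<le> (\<integral>\<^sup>+ z. ?h (sgn z) * indicator (- {0}) z * indicator (ball 0 1) z \<partial>lborel)"
  proof (rule nn_integral_mono_AE)
    have "AE z in lborel. (z :: complex ^ 'd) \<noteq> 0" by (rule AE_lborel_singleton)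
    then show "AE z in lborel. ?h z * indicator (ball 0 1) z \<le> ?h (sgn z) * indicator (- {0}) z * indicator (ball 0 1) z"
    proof eventually_elim
      case (elim z)
      have "norm (monomial k z) \<le> norm (monomial k (sgn z))" if "norm z < 1"
        unfolding monomial_def prod_norm[symmetric] norm_power
      proof (intro prod_mono conjI power_mono)
        fix i
        have "norm (z $ i) = norm z * norm (sgn z $ i)" using elim by (simp add: sgn_div_norm)
        then show "norm (z $ i) \<le> norm (sgn z $ i)" using that by (simp add: mult_left_le_one_le)
      qed auto
      then show ?case using elim by (auto simp: indicator_def intro!: ennreal_leI power_mono)
    qed
  qed
  also have "\<dots> = ennreal ?V * ((\<integral>\<^sup>+ z. ?h (sgn z) * indicator (- {0}) z * indicator (ball 0 1) z \<partial>lborel) / ennreal ?V)"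
  proof -
    have "b * (X / b) = X" if "b \<noteq> 0" "b \<noteq> top_class.top" for X b :: ennreal
      using ennreal_mult_divide_eq[OF that, of X] by (simp only: ennreal_times_divide mult.commute[of b])
    from this[of "ennreal ?V"] show ?thesis using V by simp
  qed
  also have "(\<integral>\<^sup>+ z. ?h (sgn z) * indicator (- {0}) z * indicator (ball 0 1) z \<partial>lborel) / ennreal ?V = (\<integral>\<^sup>+ z. ?h z \<partial>sphere_measure)"
  proof -
    have "(\<integral>\<^sup>+ z. ?h z \<partial>sphere_measure) =
        (\<integral>\<^sup>+ z. ?h (sgn z) \<partial>restrict_space (uniform_measure lborel (ball (0 :: complex ^ 'd) 1)) (- {0}))"
      unfolding sphere_measure_def by (rule nn_integral_distr[OF sgn_measurable]) (simp add: hm)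
    also have "\<dots> = (\<integral>\<^sup>+ z. ?h (sgn z) * indicator (- {0}) z \<partial>uniform_measure lborel (ball 0 1))"
      by (rule nn_integral_restrict_space) simp
    also have "\<dots> = (\<integral>\<^sup>+ z. ?h (sgn z) * indicator (- {0}) z * indicator (ball 0 1) z \<partial>lborel) / ennreal ?V"
      unfolding ball_emeasure[symmetric] by (rule nn_integral_uniform_measure) (use ind in auto)
    finally show ?thesis by simp
  qed
  also have "\<dots> = ennreal ((L2_norm sphere_measure (monomial k))\<^sup>2)"
    by (rule nn_integral_L2[OF S.polyfuns_L2[OF monomial_polyfuns]])
  finally show ?thesis using V by (simp add: ennreal_mult[symmetric])
qed

text \<open>With \<open>e\<close> one minus the largest norm on \<open>K\<close>, the mean value
  property over the ball of radius \<open>e\<close> about \<open>z\<close> bounds \<open>q z\<close>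
  by the L2 norm over the unit ball. By Parseval on both sides, that norm is compared with the one
  on the sphere monomial by monomial.\<close>

lemma sphere_eval_bound:
  assumes K: "compact K" "K \<subseteq> ball (0 :: complex ^ 'd) 1"
  shows "\<exists>C. \<forall>q\<in>polyfuns. \<forall>z\<in>K. norm (q z) \<le> C * L2_norm sphere_measure q"
proof (cases "K = {}")
  case False
  interpret S: rotation_measure "sphere_measure :: (complex ^ 'd) measure" by (rule rotation_measure_sphere)
  interpret B: rotation_measure "restrict_space lborel (ball (0 :: complex ^ 'd) 1)" by (rule rotation_measure_ball)
  obtain y where y: "y \<in> K" "\<And>x. x \<in> K \<Longrightarrow> norm x \<le> norm y"
    using continuous_attains_sup[OF K(1) False, of norm] continuous_on_norm_id by blast
  define e where "e = 1 - norm y"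
  have e: "e > 0" using y K by (auto simp: e_def)
  interpret E: rotation_measure "restrict_space lborel (ball (0 :: complex ^ 'd) e)" by (rule rotation_measure_ball)
  let ?me = "restrict_space lborel (ball (0 :: complex ^ 'd) e)"
  let ?mb = "restrict_space lborel (ball (0 :: complex ^ 'd) 1)"
  define V where "V = measure ?me (space ?me)"
  define W where "W = measure lborel (ball (0 :: complex ^ 'd) 1)"
  have "V = measure lborel (ball (0 :: complex ^ 'd) e)"
    by (simp add: V_def space_restrict_space measure_restrict_space)
  then have V: "V > 0" using content_ball_pos[OF e] by simp
  have W: "W \<ge> 0" by (simp add: W_def)
  have "norm (q z) \<le> sqrt W / sqrt V * L2_norm sphere_measure q" if q: "q \<in> polyfuns" and z: "z \<in> K" for q z
  proof -
    let ?q = "\<lambda>w. q (z + w)"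
    have qz: "?q \<in> polyfuns" by (rule polyfuns_compose[OF q]) (simp add: polyfuns_add polyfuns_const polyfuns_coord)
    have "norm (q z) * V = norm (L2_inner ?me ?q (\<lambda>z. 1))"
      using E.mean_value[OF qz] V by (simp add: V_def norm_mult)
    also have "\<dots> \<le> L2_norm ?me ?q * L2_norm ?me (\<lambda>z. 1)"
      by (rule L2_Cauchy_Schwarz[OF E.polyfuns_L2[OF qz] E.L2_const])
    also have "L2_norm ?me (\<lambda>z. 1) = sqrt V" by (simp add: L2_norm_def V_def)
    finally have 1: "norm (q z) * V \<le> L2_norm ?me ?q * sqrt V" .
    have [measurable]: "ball (0 :: complex ^ 'd) 1 \<in> sets borel" by simp
    have [measurable]: "q \<in> borel_measurable borel" "?q \<in> borel_measurable borel"
      using q qz by (auto intro!: borel_measurable_continuous_onI continuous_on_polyfuns)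
    have "ennreal ((L2_norm ?me ?q)\<^sup>2) = (\<integral>\<^sup>+ w. ennreal ((norm (q (z + w)))\<^sup>2) * indicator (ball 0 e) w \<partial>lborel)"
      by (subst nn_integral_L2[OF E.polyfuns_L2[OF qz], symmetric]) (rule nn_integral_restrict_space, simp)
    also have "\<dots> \<le> (\<integral>\<^sup>+ w. ennreal ((norm (q (w + z)))\<^sup>2) * indicator (ball 0 1) (w + z) \<partial>lborel)"
    proof (rule nn_integral_mono)
      fix w
      have "norm (w + z) < 1" if "norm w < e"
        using norm_triangle_ineq[of w z] y(2)[OF z] that by (simp add: e_def)
      then show "ennreal ((norm (q (z + w)))\<^sup>2) * indicator (ball 0 e) w \<le> ennreal ((norm (q (w + z)))\<^sup>2) * indicator (ball 0 1) (w + z)"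
        by (auto simp: indicator_def add.commute)
    qed
    also have "\<dots> = (\<integral>\<^sup>+ w. ennreal ((norm (q w))\<^sup>2) * indicator (ball 0 1) w \<partial>lborel)"
      by (rule nn_integral_lborel_translate[where h = "\<lambda>w. ennreal ((norm (q w))\<^sup>2) * indicator (ball 0 1) w"]) simp
    also have "\<dots> = ennreal ((L2_norm ?mb q)\<^sup>2)"
      by (subst nn_integral_L2[OF B.polyfuns_L2[OF q], symmetric]) (rule nn_integral_restrict_space[symmetric], simp)
    finally have "(L2_norm ?me ?q)\<^sup>2 \<le> (L2_norm ?mb q)\<^sup>2" by simp
    also have "(L2_norm ?mb q)\<^sup>2 \<le> W * (L2_norm sphere_measure q)\<^sup>2"
    proof -
      obtain p where p: "q = eval_poly p" using q by (auto simp: polyfuns_def)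
      show ?thesis unfolding p B.Parseval S.Parseval sum_distrib_left
      proof (rule sum_mono)
        fix k assume "k \<in> Poly_Mapping.keys p"
        show "(norm (Poly_Mapping.lookup p k))\<^sup>2 * (L2_norm ?mb (monomial k))\<^sup>2 \<le>
            W * ((norm (Poly_Mapping.lookup p k))\<^sup>2 * (L2_norm sphere_measure (monomial k))\<^sup>2)"
          using mult_left_mono[OF monomial_ball_le_sphere[of k], of "(norm (Poly_Mapping.lookup p k))\<^sup>2"]
          by (simp add: W_def mult_ac)
      qed
    qed
    finally have "(L2_norm ?me ?q)\<^sup>2 \<le> (sqrt W * L2_norm sphere_measure q)\<^sup>2" using W by (simp add: power_mult_distrib)
    then have "L2_norm ?me ?q \<le> sqrt W * L2_norm sphere_measure q"
      by (rule power2_le_imp_le) (simp add: L2_norm_nonneg W)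
    then have "norm (q z) * V \<le> (sqrt W * L2_norm sphere_measure q) * sqrt V"
      using 1 V by (meson mult_right_mono order_trans real_sqrt_ge_zero less_imp_le)
    then have "norm (q z) * (sqrt V * sqrt V) \<le> (sqrt W * L2_norm sphere_measure q) * sqrt V" using V by simp
    then have "norm (q z) * sqrt V * sqrt V \<le> (sqrt W * L2_norm sphere_measure q) * sqrt V"
      by (simp only: mult.assoc)
    then have "norm (q z) * sqrt V \<le> sqrt W * L2_norm sphere_measure q"
      by (rule mult_right_le_imp_le) (use V in simp)
    then show ?thesis using V by (simp add: field_simps)
  qed
  then show ?thesis by blast
qed auto

section \<open>The torus\<close>

definition torus_param :: "real ^ 'd \<Rightarrow> complex ^ 'd" where
  "torus_param t = (\<chi> i. cis (t $ i))"

abbreviation torus_cube :: "(real ^ 'd) set" where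
  "torus_cube \<equiv> cbox 0 (\<chi> i. 2 * pi)"

text \<open>An exact fundamental domain for translations by multiples of \<open>2 * pi\<close>. It
  differs from the closed cube in \<open>torus_measure\<close> by a null set.\<close>

definition half_open_cube :: "(real ^ 'd) set" where
  "half_open_cube = {t. \<forall>i. 0 \<le> t $ i \<and> t $ i < 2 * pi}"

lemma mem_torus_cube: "t \<in> torus_cube \<longleftrightarrow> (\<forall>i. 0 \<le> t $ i \<and> t $ i \<le> 2 * pi)"
  by (simp add: mem_box_cart)

lemma half_open_cube_borel: "(half_open_cube :: (real ^ 'd) set) \<in> sets borel"
proof -
  have "(half_open_cube :: (real ^ 'd) set) = (\<Inter>i. {t. 0 \<le> t $ i} \<inter> {t. t $ i < 2 * pi})"
    by (auto simp: half_open_cube_def)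
  moreover have "{t :: real ^ 'd. 0 \<le> t $ i} \<in> sets borel" "{t :: real ^ 'd. t $ i < 2 * pi} \<in> sets borel" for i
    by (auto intro!: borel_closed closed_Collect_le borel_open open_Collect_less continuous_intros)
  then have "(\<Inter>i. {t :: real ^ 'd. 0 \<le> t $ i} \<inter> {t. t $ i < 2 * pi}) \<in> sets borel"
    by (intro sets.finite_INT sets.Int) auto
  ultimately show ?thesis by (simp only:)
qed

lemma emeasure_torus_cube_half_open:
  assumes B: "B \<in> sets borel"
  shows "emeasure lborel (torus_cube \<inter> B) = emeasure lborel (half_open_cube \<inter> B)"
proof -
  let ?N = "\<Union>i. {t :: real ^ 'a. t $ i = 2 * pi}"
  have "{t :: real ^ 'a. t $ i = 2 * pi} \<in> null_sets lborel" for i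
  proof -
    have "negligible {t :: real ^ 'a. t \<bullet> axis i 1 = 2 * pi}"
      by (rule negligible_standard_hyperplane) (simp add: axis_in_Basis_iff)
    then have "{t :: real ^ 'a. t $ i = 2 * pi} \<in> null_sets lebesgue"
      by (simp add: negligible_iff_null_sets inner_axis)
    moreover have "{t :: real ^ 'a. t $ i = 2 * pi} \<in> sets lborel"
      by (auto intro!: borel_closed closed_Collect_eq continuous_intros)
    ultimately show ?thesis by (simp add: null_sets_completion_iff)
  qed
  then have N: "?N \<in> null_sets lborel" by (intro null_sets_UN') auto
  have "half_open_cube \<inter> B \<in> sets lborel" using half_open_cube_borel B by auto
  then have "emeasure lborel (half_open_cube \<inter> B \<union> ?N) = emeasure lborel (half_open_cube \<inter> B)"
    by (rule emeasure_Un_null_set[OF _ N])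
  moreover have "torus_cube \<inter> B \<subseteq> half_open_cube \<inter> B \<union> ?N"
    by (auto simp: mem_torus_cube half_open_cube_def) (metis order_le_less)
  then have "emeasure lborel (torus_cube \<inter> B) \<le> emeasure lborel (half_open_cube \<inter> B \<union> ?N)"
    using \<open>half_open_cube \<inter> B \<in> sets lborel\<close> N by (intro emeasure_mono) auto
  moreover have "emeasure lborel (half_open_cube \<inter> B) \<le> emeasure lborel (torus_cube \<inter> B)"
    using B by (intro emeasure_mono) (auto simp: mem_torus_cube half_open_cube_def less_imp_le)
  ultimately show ?thesis by (simp add: antisym)
qed

definition lattice_point :: "('d \<Rightarrow> int) \<Rightarrow> real ^ 'd" where
  "lattice_point k = (\<chi> i. 2 * pi * of_int (k i))"

lemma tile_unique: "\<exists>!k. t + lattice_point k \<in> half_open_cube"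
proof -
  have *: "t + lattice_point k \<in> half_open_cube \<longleftrightarrow> (\<forall>i. k i = - \<lfloor>t $ i / (2 * pi)\<rfloor>)" for k
  proof -
    have "0 \<le> t $ i + 2 * pi * of_int (k i) \<and> t $ i + 2 * pi * of_int (k i) < 2 * pi \<longleftrightarrow> k i = - \<lfloor>t $ i / (2 * pi)\<rfloor>" for i
    proof -
      have "0 \<le> t $ i + 2 * pi * of_int (k i) \<and> t $ i + 2 * pi * of_int (k i) < 2 * pi
          \<longleftrightarrow> of_int (- k i) \<le> t $ i / (2 * pi) \<and> t $ i / (2 * pi) < of_int (- k i) + 1"
        by (auto simp: field_simps)
      also have "\<dots> \<longleftrightarrow> \<lfloor>t $ i / (2 * pi)\<rfloor> = - k i" by (simp only: floor_eq_iff)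
      also have "\<dots> \<longleftrightarrow> k i = - \<lfloor>t $ i / (2 * pi)\<rfloor>" by linarith
      finally show ?thesis .
    qed
    then show ?thesis by (simp add: half_open_cube_def lattice_point_def)
  qed
  show ?thesis unfolding * by (rule ex1I[of _ "\<lambda>i. - \<lfloor>t $ i / (2 * pi)\<rfloor>"]) auto
qed

text \<open>Both \<open>half_open_cube\<close> and its translate by \<open>s\<close> are fundamental domains for the lattice.\<close>

lemma emeasure_periodic_shift:
  fixes B :: "(real ^ 'd) set"
  assumes B: "B \<in> sets borel" and per: "\<And>t k. t + lattice_point k \<in> B \<longleftrightarrow> t \<in> B"
  shows "emeasure lborel (half_open_cube \<inter> {t. t + s \<in> B}) = emeasure lborel (half_open_cube \<inter> B)"
proof -
  note [measurable] = B half_open_cube_borel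
  have m[measurable]: "{t :: real ^ 'd. t + c \<in> A} \<in> sets borel" if "A \<in> sets borel" for A c
  proof -
    have [measurable]: "A \<in> sets borel" by fact
    show ?thesis by measurable
  qed
  \<comment> \<open>A set is cut along the lattice tiles, translated by \<open>- c\<close>. The
    value \<open>c = 0\<close> cuts along the original tiles and \<open>c = - s\<close> along the
    shifted ones.\<close>
  have split: "emeasure lborel A = (\<integral>\<^sup>+ k. emeasure lborel (A \<inter> {t. t + c + lattice_point k \<in> half_open_cube}) \<partial>count_space UNIV)"
    if A: "A \<in> sets borel" for A and c :: "real ^ 'd"
  proof -
    have "A = (\<Union>k. A \<inter> {t. t + c + lattice_point k \<in> half_open_cube})"
      using tile_unique by blast
    then have "emeasure lborel A = emeasure lborel (\<Union>k. A \<inter> {t. t + c + lattice_point k \<in> half_open_cube})"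
      by (rule arg_cong)
    also have "\<dots> = (\<integral>\<^sup>+ k. emeasure lborel (A \<inter> {t. t + c + lattice_point k \<in> half_open_cube}) \<partial>count_space UNIV)"
    proof (rule emeasure_UN_countable)
      show "A \<inter> {t. t + c + lattice_point k \<in> half_open_cube} \<in> sets lborel" for k
        using A m[OF half_open_cube_borel, of "c + lattice_point k"] by (simp add: add.assoc)
      show "disjoint_family_on (\<lambda>k. A \<inter> {t. t + c + lattice_point k \<in> half_open_cube}) UNIV"
        unfolding disjoint_family_on_def using tile_unique by blast
    qed auto
    finally show ?thesis .
  qed
  have lneg: "lattice_point (\<lambda>i. - k i) = - lattice_point k" for k :: "'d \<Rightarrow> int"
    by (simp add: lattice_point_def vec_eq_iff)
  have "emeasure lborel (half_open_cube \<inter> {t. t + s \<in> B}) =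
      emeasure lborel {t. t + (- s) \<in> half_open_cube \<inter> {t. t + s \<in> B}}"
    by (rule emeasure_lborel_translate[symmetric]) (use m[OF B] half_open_cube_borel in auto)
  also have "{t. t + (- s) \<in> half_open_cube \<inter> {t. t + s \<in> B}} = B \<inter> {t. t + (- s) \<in> half_open_cube}"
    by auto
  also have "emeasure lborel (B \<inter> {t. t + (- s) \<in> half_open_cube}) =
      (\<integral>\<^sup>+ k. emeasure lborel (B \<inter> {t. t + (- s) \<in> half_open_cube} \<inter> {t. t + 0 + lattice_point k \<in> half_open_cube}) \<partial>count_space UNIV)"
    by (rule split) (use m[OF half_open_cube_borel, of "- s"] in auto)
  \<comment> \<open>Each piece is moved by its own lattice vector, which leaves the periodic set
    \<open>B\<close> unchanged and exchanges the roles of the cube and its translate.\<close>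
  also have "\<dots> = (\<integral>\<^sup>+ k. emeasure lborel (half_open_cube \<inter> B \<inter> {t. t + (- s) + lattice_point (\<lambda>i. - k i) \<in> half_open_cube}) \<partial>count_space UNIV)"
  proof (rule nn_integral_cong)
    fix k
    let ?X = "half_open_cube \<inter> B \<inter> {t. t + (- s) + lattice_point (\<lambda>i. - k i) \<in> half_open_cube}"
    have "?X \<in> sets borel"
      using m[OF half_open_cube_borel, of "- s + lattice_point (\<lambda>i. - k i)"] by (auto simp: add.assoc[symmetric])
    then have "emeasure lborel ?X = emeasure lborel {t. t + lattice_point k \<in> ?X}"
      by (rule emeasure_lborel_translate[symmetric])
    also have "{t. t + lattice_point k \<in> ?X} = B \<inter> {t. t + (- s) \<in> half_open_cube} \<inter> {t. t + 0 + lattice_point k \<in> half_open_cube}"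
      by (auto simp: per lneg algebra_simps)
    finally show "emeasure lborel (B \<inter> {t. t + (- s) \<in> half_open_cube} \<inter> {t. t + 0 + lattice_point k \<in> half_open_cube}) = emeasure lborel ?X" ..
  qed
  also have "\<dots> = (\<integral>\<^sup>+ k. emeasure lborel (half_open_cube \<inter> B \<inter> {t. t + (- s) + lattice_point k \<in> half_open_cube}) \<partial>count_space UNIV)"
  proof -
    have "bij_betw (\<lambda>k i. - k i) (UNIV :: ('d \<Rightarrow> int) set) UNIV"
      by (rule bij_betw_byWitness[where f' = "\<lambda>k i. - k i"]) auto
    from nn_integral_bij_count_space[OF this] show ?thesis .
  qed
  also have "\<dots> = emeasure lborel (half_open_cube \<inter> B)" by (rule split[symmetric]) auto
  finally show ?thesis .
qed

lemma torus_param_measurable: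
  "torus_param \<in> measurable (uniform_measure lborel torus_cube) (restrict_space borel torus)"
  by (rule measurable_restrict_space2)
     (auto simp: torus_param_def torus_def intro!: borel_measurable_continuous_onI continuous_intros
       cong: measurable_cong_sets)

lemma torus_measure_eq:
  "torus_measure = distr (uniform_measure lborel torus_cube) (restrict_space borel torus) torus_param"
  unfolding torus_measure_def torus_param_def[abs_def] by simp

lemma sets_torus_measure: "sets torus_measure = sets (restrict_space borel torus)"
  and space_torus_measure: "space torus_measure = torus"
  by (simp_all add: torus_measure_eq space_restrict_space)

lemma torus_preimage_borel:
  assumes "A \<in> sets (restrict_space borel torus)"
  shows "{t. torus_param t \<in> A} \<in> sets borel"
  using measurable_sets[OF torus_param_measurable assms] by (simp add: vimage_def)

lemma emeasure_torus_measure: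
  assumes A: "A \<in> sets (restrict_space borel (torus :: (complex ^ 'd) set))"
  shows "emeasure torus_measure A =
    emeasure lborel (half_open_cube \<inter> {t. torus_param t \<in> A}) / emeasure lborel (torus_cube :: (real ^ 'd) set)"
proof -
  have "emeasure torus_measure A = emeasure (uniform_measure lborel torus_cube) {t. torus_param t \<in> A}"
    unfolding torus_measure_eq by (subst emeasure_distr[OF torus_param_measurable A]) (simp add: vimage_def)
  also have "\<dots> = emeasure lborel (torus_cube \<inter> {t. torus_param t \<in> A}) / emeasure lborel (torus_cube :: (real ^ 'd) set)"
    by (rule emeasure_uniform_measure) (use torus_preimage_borel[OF A] in auto)
  finally show ?thesis using emeasure_torus_cube_half_open[OF torus_preimage_borel[OF A]] by simp
qed

lemma torus_cube_emeasure:
  "emeasure lborel (torus_cube :: (real ^ 'd) set) \<noteq> 0" "emeasure lborel (torus_cube :: (real ^ 'd) set) \<noteq> \<infinity>"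
proof -
  have "emeasure lborel (torus_cube :: (real ^ 'd) set) < \<infinity>"
    by (rule emeasure_bounded_finite) simp
  then show "emeasure lborel (torus_cube :: (real ^ 'd) set) \<noteq> \<infinity>" by simp
  have "box 0 (\<chi> i. 2 * pi) \<noteq> ({} :: (real ^ 'd) set)"
    by (auto simp: mem_box_cart set_eq_iff intro!: exI[of _ "\<chi> i. pi"])
  then have "0 < measure lborel (torus_cube :: (real ^ 'd) set)"
    using content_pos_lt_eq[of "0 :: real ^ 'd" "\<chi> i. 2 * pi"] box_ne_empty by blast
  then show "emeasure lborel (torus_cube :: (real ^ 'd) set) \<noteq> 0" by (auto simp: measure_def)
qed

lemma prob_space_torus_measure: "prob_space (torus_measure :: (complex ^ 'd) measure)"
  unfolding torus_measure_eq
  by (intro prob_space.prob_space_distr prob_space_uniform_measure torus_cube_emeasure torus_param_measurable)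

text \<open>The action of a generalized permutation matrix. These matrices, with unimodular entries,
  are the linear automorphisms of the polydisc; in angular coordinates on the torus they permute the
  coordinates, a linear isometry, and then translate modulo \<open>2 * pi\<close>.\<close>

definition monomial_map :: "('d \<Rightarrow> complex) \<Rightarrow> ('d \<Rightarrow> 'd) \<Rightarrow> complex ^ 'd \<Rightarrow> complex ^ 'd" where
  "monomial_map c \<pi> z = (\<chi> i. c i * z $ (\<pi> i))"

lemma torus_measure_monomial_map:
  fixes c :: "'d::finite \<Rightarrow> complex"
  assumes c: "\<And>i. norm (c i) = 1" and \<pi>: "bij \<pi>"
  shows "monomial_map c \<pi> \<in> measurable torus_measure torus_measure"
    "distr torus_measure torus_measure (monomial_map c \<pi>) = torus_measure"
proof -
  show meas: "monomial_map c \<pi> \<in> measurable torus_measure torus_measure"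
    unfolding measurable_cong_sets[OF sets_torus_measure sets_torus_measure] monomial_map_def[abs_def]
    by (intro measurable_restrict_space2 borel_measurable_continuous_on_restrict continuous_intros)
       (auto simp: space_restrict_space torus_def norm_mult c)
  have "\<forall>i. \<exists>s. c i = cis s" using c by (metis cis_Arg complex_norm_eq_1_exp norm_zero zero_neq_one sgn_div_norm div_by_1 scaleR_one inverse_1)
  then obtain s where s: "\<And>i. c i = cis (s i)" by metis
  define P where "P t = (\<chi> i. t $ (\<pi> i))" for t :: "real ^ 'd"
  have P: "linear P" by (rule linearI) (auto simp: P_def vec_eq_iff)
  have iso: "norm (P t) = norm t" for t
  proof -
    have "(\<Sum>i\<in>UNIV. (t $ \<pi> i)\<^sup>2) = (\<Sum>i\<in>UNIV. (t $ i)\<^sup>2)"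
      by (rule sum.reindex_bij_betw[of \<pi> UNIV UNIV "\<lambda>i. (t $ i)\<^sup>2"]) (use \<pi> in simp)
    then show ?thesis by (simp add: norm_vec_def L2_set_def P_def)
  qed
  show "distr torus_measure torus_measure (monomial_map c \<pi>) = torus_measure"
  proof (rule measure_preserving_imp_distr[OF meas])
    fix A :: "(complex ^ 'd) set" assume A: "A \<in> sets torus_measure"
    have A': "A \<in> sets (restrict_space borel torus)" using A by (simp only: sets_torus_measure)
    define B where "B = {t. torus_param t \<in> A}"
    have B: "B \<in> sets borel" unfolding B_def by (rule torus_preimage_borel[OF A'])
    have "torus_param (t + lattice_point k) = torus_param t" for t :: "real ^ 'd" and k
      by (simp add: torus_param_def lattice_point_def vec_eq_iff cis_mult[symmetric] cis_multiple_2pi)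
    then have per: "t + lattice_point k \<in> B \<longleftrightarrow> t \<in> B" for t k by (simp add: B_def)
    define X where "X = half_open_cube \<inter> {t. t + (\<chi> i. s i) \<in> B}"
    have "{t. t + (\<chi> i. s i) \<in> B} \<in> sets borel"
    proof -
      note [measurable] = B
      show ?thesis by measurable
    qed
    then have X: "X \<in> sets borel" unfolding X_def using half_open_cube_borel by auto
    have cube: "P t \<in> half_open_cube \<longleftrightarrow> t \<in> half_open_cube" for t
    proof -
      have "(\<forall>i. Q (\<pi> i)) \<longleftrightarrow> (\<forall>i. Q i)" for Q using \<pi> by (metis bij_pointE)
      from this[of "\<lambda>i. 0 \<le> t $ i \<and> t $ i < 2 * pi"] show ?thesis by (simp add: P_def half_open_cube_def)
    qed
    have "monomial_map c \<pi> (torus_param t) = torus_param (P t + (\<chi> i. s i))" for t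
      by (simp add: monomial_map_def torus_param_def P_def vec_eq_iff s cis_mult add.commute)
    then have "half_open_cube \<inter> {t. torus_param t \<in> monomial_map c \<pi> -` A \<inter> torus} = {t. P t \<in> X}"
      using sets.sets_into_space[OF A']
      by (auto simp: X_def cube B_def torus_def torus_param_def space_restrict_space)
    then have "emeasure lborel (half_open_cube \<inter> {t. torus_param t \<in> monomial_map c \<pi> -` A \<inter> torus}) = emeasure lborel X"
      using emeasure_lborel_isometry[OF P iso X] by simp
    also have "\<dots> = emeasure lborel (half_open_cube \<inter> B)"
      unfolding X_def by (rule emeasure_periodic_shift[OF B per])
    finally have eq: "emeasure lborel (half_open_cube \<inter> {t. torus_param t \<in> monomial_map c \<pi> -` A \<inter> torus}) = emeasure lborel (half_open_cube \<inter> B)" .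
    have "monomial_map c \<pi> -` A \<inter> torus \<in> sets (restrict_space borel torus)"
      using measurable_sets[OF meas A] by (simp only: sets_torus_measure space_torus_measure)
    then show "emeasure torus_measure (monomial_map c \<pi> -` A \<inter> space torus_measure) = emeasure torus_measure A"
      unfolding space_torus_measure by (simp only: emeasure_torus_measure A' eq B_def)
  qed
qed

lemma bounded_torus: "bounded (torus :: (complex ^ 'd) set)"
  and torus_sphere: "torus \<subseteq> sphere (0 :: complex ^ 'd) (sqrt (CARD('d)))"
proof -
  show "torus \<subseteq> sphere (0 :: complex ^ 'd) (sqrt (CARD('d)))"
    by (auto simp: torus_def norm_vec_def L2_set_def)
  then show "bounded (torus :: (complex ^ 'd) set)"
    by (rule bounded_subset[OF bounded_sphere])
qed

lemma rotation_measure_torus: "rotation_measure (torus_measure :: (complex ^ 'd) measure)"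
proof -
  interpret prob_space "torus_measure :: (complex ^ 'd) measure" by (rule prob_space_torus_measure)
  have rot: "rotate_coords c = monomial_map c id" for c :: "'d \<Rightarrow> complex"
    by (simp add: rotate_coords_def monomial_map_def fun_eq_iff)
  show ?thesis
    by unfold_locales
       (auto simp: sets_torus_measure space_torus_measure bounded_torus rot intro!: torus_measure_monomial_map)
qed

text \<open>On the torus the monomials are orthonormal. Cauchy-Schwarz for the coefficients leaves
  the sum of the squared moduli of monomials at \<open>z\<close>, which is bounded by the product
  \<open>H z\<close> of geometric series, the Szego kernel on the diagonal.\<close>

lemma torus_eval_bound:
  assumes K: "compact K" "K \<subseteq> (polydisc :: (complex ^ 'd) set)"
  shows "\<exists>C. \<forall>q\<in>polyfuns. \<forall>z\<in>K. norm (q z) \<le> C * L2_norm torus_measure q"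
proof -
  interpret T: rotation_measure "torus_measure :: (complex ^ 'd) measure" by (rule rotation_measure_torus)
  interpret prob_space "torus_measure :: (complex ^ 'd) measure" by (rule prob_space_torus_measure)
  have w: "(L2_norm torus_measure (monomial k :: complex ^ 'd \<Rightarrow> complex))\<^sup>2 = 1" for k
  proof -
    have "(LINT z|torus_measure. (norm (monomial k (z :: complex ^ 'd)))\<^sup>2) = (LINT z|(torus_measure :: (complex ^ 'd) measure). 1)"
      by (rule Bochner_Integration.integral_cong)
         (auto simp: space_torus_measure torus_def monomial_def prod_norm[symmetric] norm_power)
    then show ?thesis by (simp add: L2_norm_sq prob_space)
  qed
  define H where "H z = (\<Prod>i\<in>UNIV. 1 / (1 - (norm (z $ i))\<^sup>2))" for z :: "complex ^ 'd"
  have "continuous_on K H" unfolding H_def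
  proof (intro continuous_intros ballI)
    fix z i assume "z \<in> K"
    then have "norm (z $ i) < 1" using K by (auto simp: polydisc_def)
    then have "(norm (z $ i))\<^sup>2 < 1" by (simp add: power_less_one_iff)
    then show "1 - (norm (z $ i))\<^sup>2 \<noteq> 0" by simp
  qed
  then have "bounded (H ` K)" using K compact_continuous_image compact_imp_bounded by blast
  then obtain C where C: "\<And>z. z \<in> K \<Longrightarrow> H z \<le> C" unfolding bounded_iff by (metis abs_le_D1 image_eqI real_norm_def)
  have "norm (q z) \<le> sqrt C * L2_norm torus_measure q" if q: "q \<in> polyfuns" and z: "z \<in> K" for q z
  proof -
    obtain p where p: "q = eval_poly p" using q by (auto simp: polyfuns_def)
    let ?A = "Poly_Mapping.keys p"
    have z1: "norm (z $ i) < 1" for i using z K by (auto simp: polydisc_def)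
    have "norm (q z) \<le> (\<Sum>k\<in>?A. norm (Poly_Mapping.lookup p k) * norm (monomial k z))"
      unfolding p eval_poly_monomials by (rule order.trans[OF norm_sum]) (simp add: norm_mult)
    also have "\<dots> \<le> L2_set (\<lambda>k. norm (Poly_Mapping.lookup p k)) ?A * L2_set (\<lambda>k. norm (monomial k z)) ?A"
      by (rule order.trans[OF _ L2_set_mult_ineq]) (simp add: sum_mono)
    finally have 1: "norm (q z) \<le> L2_set (\<lambda>k. norm (Poly_Mapping.lookup p k)) ?A * L2_set (\<lambda>k. norm (monomial k z)) ?A" .
    have 2: "L2_set (\<lambda>k. norm (Poly_Mapping.lookup p k)) ?A = L2_norm torus_measure q"
      using T.Parseval[of p] unfolding w p L2_set_def
      by (metis (no_types, lifting) L2_norm_nonneg mult.right_neutral real_sqrt_abs abs_of_nonneg sum.cong)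
    have 3: "L2_set (\<lambda>k. norm (monomial k z)) ?A \<le> sqrt C"
    proof -
      \<comment> \<open>\<open>N\<close> bounds all exponents that occur, so the sum over the keys
        is dominated by the sum over a full box, which factors over the coordinates.\<close>
      define N where "N = Max (insert 0 ((\<lambda>(k, i). Poly_Mapping.lookup k i) ` (?A \<times> UNIV)))"
      have N: "Poly_Mapping.lookup k i \<le> N" if "k \<in> ?A" for k i
        unfolding N_def using that by (intro Max_ge) (auto intro!: image_eqI[of _ _ "(k, i)"])
      have "(\<Sum>k\<in>?A. (norm (monomial k z))\<^sup>2) = (\<Sum>k\<in>?A. \<Prod>i\<in>UNIV. ((norm (z $ i))\<^sup>2) ^ Poly_Mapping.lookup k i)"
        by (simp add: monomial_def prod_norm[symmetric] norm_power prod_power_distrib power_mult[symmetric] mult.commute)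
      also have "\<dots> = (\<Sum>g\<in>Poly_Mapping.lookup ` ?A. \<Prod>i\<in>UNIV. ((norm (z $ i))\<^sup>2) ^ g i)"
      proof -
        have "inj_on Poly_Mapping.lookup ?A" by (rule inj_onI) (simp only: poly_mapping_eq_iff)
        from sum.reindex[OF this, of "\<lambda>g. \<Prod>i\<in>UNIV. ((norm (z $ i))\<^sup>2) ^ g i"] show ?thesis
          unfolding o_def by (rule sym)
      qed
      also have "\<dots> \<le> (\<Sum>g\<in>Pi\<^sub>E UNIV (\<lambda>_. {..N}). \<Prod>i\<in>UNIV. ((norm (z $ i))\<^sup>2) ^ g i)"
        by (intro sum_mono2) (auto simp: N prod_nonneg intro!: finite_PiE)
      also have "\<dots> = (\<Prod>i\<in>UNIV. \<Sum>n\<le>N. ((norm (z $ i))\<^sup>2) ^ n)"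
        by (rule prod_sum_PiE[symmetric]) auto
      also have "\<dots> \<le> H z" unfolding H_def
      proof (intro prod_mono conjI sum_nonneg)
        fix i
        have x: "0 \<le> (norm (z $ i))\<^sup>2" "(norm (z $ i))\<^sup>2 < 1" using z1[of i] by (auto simp: power_less_one_iff)
        show "(\<Sum>n\<le>N. ((norm (z $ i))\<^sup>2) ^ n) \<le> 1 / (1 - (norm (z $ i))\<^sup>2)"
          using sum_le_suminf[OF summable_geometric[of "(norm (z $ i))\<^sup>2"], of "{..N}"] x suminf_geometric[of "(norm (z $ i))\<^sup>2"]
          by simp
      qed auto
      finally show ?thesis using C[OF z] unfolding L2_set_def by simp
    qed
    show ?thesis using 1 mult_left_mono[OF 3 L2_norm_nonneg[of torus_measure q]]
      unfolding 2 by (simp only: mult.commute)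
  qed
  then show ?thesis by blast
qed

section \<open>Linear automorphisms\<close>

text \<open>Absolute row sums are at most 1, while every column has an entry of modulus at least 1,
  for otherwise a basis vector outside the polydisc would be sent into it. Hence the row of such an
  entry has no other nonzero entry.\<close>

lemma polydisc_automorphism_monomial:
  fixes \<sigma> :: "complex ^ 'd ^ 'd"
  assumes inv: "invertible \<sigma>" and img: "(\<lambda>z. \<sigma> *v z) ` polydisc = polydisc"
  shows "\<exists>c \<pi>. (\<forall>i. norm (c i) = 1) \<and> bij \<pi> \<and> (\<lambda>z. \<sigma> *v z) = monomial_map c \<pi>"
proof -
  have row: "(\<Sum>j\<in>UNIV. norm (\<sigma> $ i $ j)) \<le> 1" for i
  proof (rule ccontr)
    assume "\<not> ?thesis"
    then have S: "(\<Sum>j\<in>UNIV. norm (\<sigma> $ i $ j)) > 1" by simp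
    define r where "r = 1 / (\<Sum>j\<in>UNIV. norm (\<sigma> $ i $ j))"
    have r: "0 < r" "r < 1" using S by (auto simp: r_def)
    \<comment> \<open>The phases are opposite to those of row \<open>i\<close>, and \<open>r\<close>
      normalizes the \<open>i\<close>-th coordinate of the image to exactly 1, although
      \<open>z\<close> lies in the polydisc.\<close>
    define z where "z = (\<chi> j. complex_of_real r * cnj (sgn (\<sigma> $ i $ j)))"
    have "norm (z $ j) < 1" for j
      using r mult_left_le[of "norm (sgn (\<sigma> $ i $ j))" r] by (simp add: z_def norm_mult norm_sgn)
    then have "\<sigma> *v z \<in> polydisc" using img by (force simp: polydisc_def)
    then have "norm ((\<sigma> *v z) $ i) < 1" by (simp add: polydisc_def)
    have eqj: "\<sigma> $ i $ j * (complex_of_real r * cnj (sgn (\<sigma> $ i $ j))) = complex_of_real (r * norm (\<sigma> $ i $ j))" for j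
    proof -
      have "\<sigma> $ i $ j * cnj (sgn (\<sigma> $ i $ j)) = complex_of_real (norm (\<sigma> $ i $ j))"
      proof (cases "\<sigma> $ i $ j = 0")
        case False
        have "\<sigma> $ i $ j * cnj (sgn (\<sigma> $ i $ j)) = \<sigma> $ i $ j * cnj (\<sigma> $ i $ j) / complex_of_real (norm (\<sigma> $ i $ j))"
          by (simp add: sgn_eq)
        also have "\<dots> = complex_of_real ((norm (\<sigma> $ i $ j))\<^sup>2) / complex_of_real (norm (\<sigma> $ i $ j))"
          by (simp only: complex_norm_square)
        finally show ?thesis using False by (simp add: power2_eq_square)
      qed simp
      then show ?thesis by (simp add: mult.left_commute)
    qed
    have "(\<sigma> *v z) $ i = (\<Sum>j\<in>UNIV. \<sigma> $ i $ j * (complex_of_real r * cnj (sgn (\<sigma> $ i $ j))))"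
      by (simp add: matrix_vector_mult_def z_def)
    also have "\<dots> = complex_of_real (r * (\<Sum>j\<in>UNIV. norm (\<sigma> $ i $ j)))"
      unfolding eqj by (simp add: sum_distrib_left)
    also have "r * (\<Sum>j\<in>UNIV. norm (\<sigma> $ i $ j)) = 1" using S by (simp add: r_def)
    finally show False using \<open>norm ((\<sigma> *v z) $ i) < 1\<close> by simp
  qed
  have col: "\<exists>i. norm (\<sigma> $ i $ j) \<ge> 1" for j
  proof (rule ccontr)
    assume "\<not> ?thesis"
    then have "\<sigma> *v axis j 1 \<in> polydisc"
      by (simp add: polydisc_def matrix_vector_mult_def axis_def if_distrib[where f = "\<lambda>x. _ * x"] cong: if_cong)
         (simp add: not_le)
    then obtain y where y: "y \<in> polydisc" "\<sigma> *v axis j 1 = \<sigma> *v y" using img by (metis imageE)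
    then have "axis j 1 = y" using matrix_inv_vector(2)[OF inv] by metis
    then have "norm (axis j (1::complex) $ j) < 1" using y by (simp add: polydisc_def)
    then show False by simp
  qed
  then obtain p where p: "\<And>j. norm (\<sigma> $ p j $ j) \<ge> 1" by metis
  have zero: "\<sigma> $ p j $ k = 0" and one: "norm (\<sigma> $ p j $ j) = 1" if "k \<noteq> j" for j k
  proof -
    have "norm (\<sigma> $ p j $ j) + norm (\<sigma> $ p j $ k) \<le> (\<Sum>i\<in>UNIV. norm (\<sigma> $ p j $ i))"
      using sum_mono2[of UNIV "{j, k}" "\<lambda>i. norm (\<sigma> $ p j $ i)"] that by auto
    then have "norm (\<sigma> $ p j $ j) + norm (\<sigma> $ p j $ k) \<le> 1" using row[of "p j"] by linarith
    then show "\<sigma> $ p j $ k = 0" "norm (\<sigma> $ p j $ j) = 1" using p[of j] norm_ge_zero[of "\<sigma> $ p j $ k"]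
      by (auto simp: norm_le_zero_iff[symmetric] simp del: norm_le_zero_iff norm_ge_zero)
  qed
  have one': "norm (\<sigma> $ p j $ j) = 1" for j
  proof -
    have "norm (\<sigma> $ p j $ j) \<le> (\<Sum>i\<in>UNIV. norm (\<sigma> $ p j $ i))" by (rule member_le_sum) auto
    then show ?thesis using row[of "p j"] p[of j] by linarith
  qed
  have "inj p"
  proof (rule injI, rule ccontr)
    fix j k assume "p j = p k" "j \<noteq> k"
    then have "\<sigma> $ p k $ k = 0" using zero[of k j] by simp
    then show False using one'[of k] by simp
  qed
  then have bij: "bij p" by (simp add: finite_UNIV_inj_surj bij_def)
  define \<pi> where "\<pi> = inv_into UNIV p"
  have \<pi>: "p (\<pi> i) = i" "bij \<pi>" for i
    using bij by (auto simp: \<pi>_def bij_is_surj surj_f_inv_f bij_imp_bij_inv)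
  have z: "\<sigma> $ i $ k = 0" if "k \<noteq> \<pi> i" for i k using zero[OF that] \<pi>(1)[of i] by simp
  have "\<sigma> *v x = monomial_map (\<lambda>i. \<sigma> $ i $ \<pi> i) \<pi> x" for x
  proof (subst vec_eq_iff, intro allI)
    fix i
    have "(\<sigma> *v x) $ i = (\<Sum>k\<in>UNIV. \<sigma> $ i $ k * x $ k)" by (simp add: matrix_vector_mult_def)
    also have "\<dots> = \<sigma> $ i $ \<pi> i * x $ \<pi> i" by (subst sum.remove[of _ "\<pi> i"]) (auto simp: z intro!: sum.neutral)
    finally show "(\<sigma> *v x) $ i = monomial_map (\<lambda>i. \<sigma> $ i $ \<pi> i) \<pi> x $ i" by (simp add: monomial_map_def)
  qed
  moreover have "norm (\<sigma> $ i $ \<pi> i) = 1" for i using one'[of "\<pi> i"] \<pi>(1)[of i] by simp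
  ultimately show ?thesis using \<pi>(2) by (intro exI[of _ "\<lambda>i. \<sigma> $ i $ \<pi> i"] exI[of _ \<pi>]) auto
qed

text \<open>If a vector were lengthened, dividing it by the norm of its image would give a point of
  the ball sent to the sphere. The argument is applied to the matrix and to its inverse.\<close>

lemma ball_automorphism_isometry:
  fixes \<sigma> :: "complex ^ 'd ^ 'd"
  assumes inv: "invertible \<sigma>" and img: "(\<lambda>z. \<sigma> *v z) ` ball 0 1 = ball 0 1"
  shows "norm (\<sigma> *v z) = norm z"
proof -
  have scale: "norm (\<tau> *v z) \<le> norm z" if \<tau>: "\<And>z. norm z < 1 \<Longrightarrow> norm (\<tau> *v z) < 1" for \<tau> :: "complex ^ 'd ^ 'd" and z
  proof (rule ccontr)
    assume "\<not> ?thesis"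
    then have lt: "norm z < norm (\<tau> *v z)" by simp
    then have pos: "norm (\<tau> *v z) > 0" using norm_ge_zero[of z] by linarith
    let ?c = "complex_of_real (1 / norm (\<tau> *v z))"
    have "norm (?c *s z) < 1" using lt pos unfolding norm_scalar_mult_vec by (simp add: norm_divide)
    then have "norm (\<tau> *v (?c *s z)) < 1" by (rule \<tau>)
    moreover have "norm (\<tau> *v (?c *s z)) = 1"
      unfolding vector_scalar_commute norm_scalar_mult_vec using pos by (simp add: norm_divide)
    ultimately show False by simp
  qed
  have "norm (\<sigma> *v z) \<le> norm z" by (rule scale) (use img in force)
  moreover have "norm (matrix_inv \<sigma> *v (\<sigma> *v z)) \<le> norm (\<sigma> *v z)"
  proof (rule scale)
    fix y :: "complex ^ 'd" assume "norm y < 1"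
    then have "y \<in> (\<lambda>z. \<sigma> *v z) ` ball 0 1" using img by simp
    then show "norm (matrix_inv \<sigma> *v y) < 1" using matrix_inv_vector(2)[OF inv] by auto
  qed
  ultimately show ?thesis by (simp add: matrix_inv_vector(2)[OF inv])
qed

lemma linear_matrix_complex: "linear (\<lambda>z. \<sigma> *v z)" for \<sigma> :: "complex ^ 'd ^ 'd"
  by (rule linearI) (simp_all add: matrix_vector_right_distrib scaleR_eq_scalar_mult vector_scalar_commute)

lemma automorphism_measure_preserving:
  assumes "domain_with_measure \<Omega> m" "invertible \<sigma>" "(\<lambda>z. \<sigma> *v z) ` \<Omega> = \<Omega>"
  shows "(\<lambda>z. \<sigma> *v z) \<in> measurable m m" "distr m m (\<lambda>z. \<sigma> *v z) = m"
proof -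
  have "(\<lambda>z. \<sigma> *v z) \<in> measurable m m \<and> distr m m (\<lambda>z. \<sigma> *v z) = m"
  proof (cases "\<Omega> = polydisc \<and> m = torus_measure")
    case True
    then obtain c \<pi> where "\<And>i. norm (c i) = 1" "bij \<pi>" "(\<lambda>z. \<sigma> *v z) = monomial_map c \<pi>"
      using polydisc_automorphism_monomial[OF assms(2)] assms(3) by blast
    then show ?thesis using torus_measure_monomial_map[of c \<pi>] True by simp
  next
    case False
    then have *: "\<Omega> = ball 0 1" "m = sphere_measure" using assms(1) by (auto simp: domain_with_measure_def)
    have "norm (\<sigma> *v z) = norm z" for z
      by (rule ball_automorphism_isometry[OF assms(2)]) (use assms(3) * in simp)
    then show ?thesis using sphere_measure_isometry[OF linear_matrix_complex[of \<sigma>]] * by simp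
  qed
  then show "(\<lambda>z. \<sigma> *v z) \<in> measurable m m" "distr m m (\<lambda>z. \<sigma> *v z) = m" by auto
qed

section \<open>The two model domains\<close>

text \<open>What the rest uses about the two domains. \<open>R\<close> is the radius of the sphere
  containing the Shilov boundary, 1 or the square root of the dimension. \<open>shrink\<close> moves
  boundary points into \<Omega>, as dilation requires; \<open>balanced\<close> serves the
  homogeneous expansion.\<close>

locale model_domain = rotation_measure m for \<Omega> :: "(complex ^ 'd) set" and m :: "(complex ^ 'd) measure" +
  fixes R :: real
  assumes open_domain: "open \<Omega>" and zero_in: "0 \<in> \<Omega>"
    and shrink: "\<And>z c. z \<in> closure \<Omega> \<Longrightarrow> norm c < 1 \<Longrightarrow> c *s z \<in> \<Omega>"
    and closure_sub: "closure \<Omega> \<subseteq> cball 0 R"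
    and boundary_sub: "space m \<subseteq> closure \<Omega>" and boundary_sphere: "space m \<subseteq> sphere 0 R"
    and balanced: "\<And>z c. z \<in> \<Omega> \<Longrightarrow> norm c \<le> 1 \<Longrightarrow> c *s z \<in> \<Omega>"
    and eval_bound: "\<And>K. compact K \<Longrightarrow> K \<subseteq> \<Omega> \<Longrightarrow> \<exists>C. \<forall>q\<in>polyfuns. \<forall>z\<in>K. norm (q z) \<le> C * L2_norm m q"

lemma model_domain_polydisc:
  "model_domain (polydisc :: (complex ^ 'd) set) torus_measure (sqrt (CARD('d)))"
proof -
  interpret rotation_measure "torus_measure :: (complex ^ 'd) measure" by (rule rotation_measure_torus)
  have op: "open (polydisc :: (complex ^ 'd) set)"
  proof -
    have "polydisc = (\<Inter>i. {z :: complex ^ 'd. norm (z $ i) < 1})" by (auto simp: polydisc_def)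
    moreover have "open (\<Inter>i. {z :: complex ^ 'd. norm (z $ i) < 1})"
      by (intro open_INT ballI open_Collect_less continuous_intros) simp
    ultimately show ?thesis by (simp only:)
  qed
  have le: "norm (z $ i) \<le> 1" if "z \<in> closure polydisc" for z :: "complex ^ 'd" and i
  proof -
    have "closed {z :: complex ^ 'd. norm (z $ i) \<le> 1}" by (intro closed_Collect_le continuous_intros)
    then have "closure polydisc \<subseteq> {z :: complex ^ 'd. norm (z $ i) \<le> 1}"
      by (intro closure_minimal) (auto simp: polydisc_def less_imp_le)
    then show ?thesis using that by blast
  qed
  have shr: "c *s z \<in> polydisc" if "\<And>i. norm (z $ i) \<le> 1" "norm c < 1" for z :: "complex ^ 'd" and c
    using that mult_left_le[of "norm (z $ _)" "norm c"] by (auto simp: polydisc_def norm_mult intro: le_less_trans)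
  show ?thesis
  proof unfold_locales
    show "closure (polydisc :: (complex ^ 'd) set) \<subseteq> cball 0 (sqrt (CARD('d)))"
    proof
      fix z :: "complex ^ 'd" assume "z \<in> closure polydisc"
      then have "(\<Sum>i\<in>UNIV. (norm (z $ i))\<^sup>2) \<le> (\<Sum>i\<in>(UNIV :: 'd set). 1)"
        using le by (intro sum_mono) (simp add: power_le_one)
      then show "z \<in> cball 0 (sqrt (CARD('d)))" by (simp add: norm_vec_def L2_set_def)
    qed
    show "space torus_measure \<subseteq> closure (polydisc :: (complex ^ 'd) set)"
    proof
      fix z :: "complex ^ 'd" assume "z \<in> space torus_measure"
      then have z: "norm (z $ i) \<le> 1" for i by (simp add: space_torus_measure torus_def)
      have "(\<lambda>n. complex_of_real (1 - 1 / (real n + 1)) *s z) \<longlonglongrightarrow> complex_of_real 1 *s z"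
        unfolding vector_scalar_mult_def
        by (intro tendsto_vec_lambda tendsto_mult tendsto_of_real tendsto_const) real_asymp
      moreover have "complex_of_real (1 - 1 / (real n + 1)) *s z \<in> polydisc" for n
      proof (rule shr[OF z])
        have "norm (complex_of_real (1 - 1 / (real n + 1))) = \<bar>1 - 1 / (real n + 1)\<bar>" by (rule norm_of_real)
        also have "\<dots> < 1" by (simp add: field_simps)
        finally show "norm (complex_of_real (1 - 1 / (real n + 1))) < 1" .
      qed
      ultimately show "z \<in> closure polydisc" unfolding closure_sequential by (intro exI conjI allI) auto
    qed
    show "c *s z \<in> polydisc" if "z \<in> polydisc" "norm c \<le> 1" for z :: "complex ^ 'd" and c
      using that mult_left_le_one_le[of "norm (z $ _)" "norm c"] by (auto simp: polydisc_def norm_mult intro: le_less_trans)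
  qed (use op le shr torus_sphere torus_eval_bound in \<open>auto simp: polydisc_def space_torus_measure\<close>)
qed

lemma model_domain_ball: "model_domain (ball (0 :: complex ^ 'd) 1) sphere_measure 1"
proof -
  interpret rotation_measure "sphere_measure :: (complex ^ 'd) measure" by (rule rotation_measure_sphere)
  show ?thesis
  proof unfold_locales
    show "c *s z \<in> ball 0 1" if "z \<in> closure (ball 0 1)" "norm c < 1" for z :: "complex ^ 'd" and c
      using that mult_left_le[of "norm z" "norm c"] by (auto simp: norm_scalar_mult_vec intro: le_less_trans)
    show "c *s z \<in> ball 0 1" if "z \<in> ball 0 1" "norm c \<le> 1" for z :: "complex ^ 'd" and c
      using that mult_left_le_one_le[of "norm z" "norm c"] by (auto simp: norm_scalar_mult_vec intro: le_less_trans)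
  qed (use sphere_eval_bound in \<open>auto simp: space_sphere_measure\<close>)
qed

lemma model_domain_exists:
  assumes "domain_with_measure \<Omega> m"
  shows "\<exists>R. model_domain \<Omega> m R"
  using assms model_domain_polydisc model_domain_ball unfolding domain_with_measure_def by blast

section \<open>Boundary values and completeness of the Hardy space\<close>

text \<open>Membership in \<open>L2\<close> and additivity of the inner product are part of the
  claim, because the induction step uses both for the partial sum.\<close>

lemma L2_Pythagoras:
  assumes "finite A" "\<And>i. i \<in> A \<Longrightarrow> f i \<in> L2 M"
    and "\<And>i j. i \<in> A \<Longrightarrow> j \<in> A \<Longrightarrow> i \<noteq> j \<Longrightarrow> L2_inner M (f i) (f j) = 0"
  shows "(\<lambda>x. \<Sum>i\<in>A. f i x) \<in> L2 M \<and> (\<forall>g\<in>L2 M. L2_inner M (\<lambda>x. \<Sum>i\<in>A. f i x) g = (\<Sum>i\<in>A. L2_inner M (f i) g)) \<and>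
    (L2_norm M (\<lambda>x. \<Sum>i\<in>A. f i x))\<^sup>2 = (\<Sum>i\<in>A. (L2_norm M (f i))\<^sup>2)"
  using assms
proof (induction A)
  case empty then show ?case by (simp add: L2_def L2_inner_def L2_norm_def)
next
  case (insert i A)
  let ?S = "\<lambda>x. \<Sum>i\<in>A. f i x"
  have IH: "?S \<in> L2 M" "\<And>g. g \<in> L2 M \<Longrightarrow> L2_inner M ?S g = (\<Sum>i\<in>A. L2_inner M (f i) g)"
    "(L2_norm M ?S)\<^sup>2 = (\<Sum>i\<in>A. (L2_norm M (f i))\<^sup>2)"
    using insert.IH insert.prems by (simp_all add: insert.hyps)
  have fi: "f i \<in> L2 M" using insert.prems by simp
  have eq: "(\<lambda>x. \<Sum>i\<in>insert i A. f i x) = (\<lambda>x. f i x + ?S x)" using insert.hyps by simp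
  have add: "L2_inner M (\<lambda>x. f i x + ?S x) g = L2_inner M (f i) g + L2_inner M ?S g" if "g \<in> L2 M" for g
    by (rule L2_inner_add_left[OF fi IH(1) that])
  have Sfi: "L2_inner M ?S (f i) = 0"
    unfolding IH(2)[OF fi] using insert.prems(2) insert.hyps(2) by (intro sum.neutral) auto
  then have fiS: "L2_inner M (f i) ?S = 0" using L2_inner_cnj[of M ?S "f i"] by simp
  have SL: "(\<lambda>x. f i x + ?S x) \<in> L2 M" by (rule L2_add[OF fi IH(1)])
  have "complex_of_real ((L2_norm M (\<lambda>x. f i x + ?S x))\<^sup>2) = L2_inner M (f i) (\<lambda>x. f i x + ?S x) + L2_inner M ?S (\<lambda>x. f i x + ?S x)"
    unfolding L2_inner_self[symmetric] by (rule add[OF SL])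
  also have "\<dots> = complex_of_real ((L2_norm M (f i))\<^sup>2 + (L2_norm M ?S)\<^sup>2)"
    unfolding L2_inner_add_right[OF fi IH(1) fi] L2_inner_add_right[OF fi IH(1) IH(1)] Sfi fiS L2_inner_self by simp
  finally have "(L2_norm M (\<lambda>x. f i x + ?S x))\<^sup>2 = (L2_norm M (f i))\<^sup>2 + (L2_norm M ?S)\<^sup>2"
    unfolding of_real_eq_iff .
  then show ?case unfolding eq using SL add IH insert.hyps by simp
qed

lemma (in finite_measure) L2_norm_le_sup:
  assumes f: "f \<in> borel_measurable M" and B: "\<And>x. x \<in> space M \<Longrightarrow> norm (f x) \<le> B"
  shows "L2_norm M f \<le> \<bar>B\<bar> * sqrt (measure M (space M))"
proof -
  have fL: "f \<in> L2 M" by (rule L2_bounded[OF f B])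
  have "(L2_norm M f)\<^sup>2 \<le> (LINT x|M. B\<^sup>2)"
    unfolding L2_norm_sq
    by (rule integral_mono[OF L2D(2)[OF fL]]) (auto intro!: power_mono B)
  also have "\<dots> = (\<bar>B\<bar> * sqrt (measure M (space M)))\<^sup>2" by (simp add: power_mult_distrib)
  finally show ?thesis by (rule power2_le_imp_le) simp
qed

lemma (in finite_measure) uniform_limit_L2_lim:
  assumes ul: "uniform_limit (space M) F f sequentially" and F: "\<And>n. F n \<in> borel_measurable M" and f: "f \<in> borel_measurable M"
  shows "L2_lim M F f"
  unfolding L2_lim_def
proof (rule LIMSEQ_I)
  fix e :: real assume e: "e > 0"
  define d where "d = e / (sqrt (measure M (space M)) + 1)"
  have pos: "sqrt (measure M (space M)) + 1 > 0" by (simp add: add_nonneg_pos)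
  have d: "d > 0" using e pos by (simp add: d_def)
  have "d * (sqrt (measure M (space M)) + 1) = e" using pos unfolding d_def by simp
  then have lt: "d * sqrt (measure M (space M)) < e" using d by (simp add: distrib_left)
  obtain N where N: "\<And>n x. n \<ge> N \<Longrightarrow> x \<in> space M \<Longrightarrow> dist (F n x) (f x) < d"
    using uniform_limitD[OF ul d] unfolding eventually_sequentially by blast
  have "norm (L2_norm M (\<lambda>x. F n x - f x) - 0) < e" if "n \<ge> N" for n
  proof -
    have "L2_norm M (\<lambda>x. F n x - f x) \<le> \<bar>d\<bar> * sqrt (measure M (space M))"
      by (rule L2_norm_le_sup) (use F f N[OF that] in \<open>auto simp: dist_norm intro: less_imp_le\<close>)
    then show ?thesis using lt d L2_norm_nonneg[of M "\<lambda>x. F n x - f x"] by simp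
  qed
  then show "\<exists>N. \<forall>n\<ge>N. norm (L2_norm M (\<lambda>x. F n x - f x) - 0) < e" by blast
qed

lemma L2_lim_norm:
  assumes "L2_lim M F f" "\<And>n. F n \<in> L2 M" "f \<in> L2 M"
  shows "(\<lambda>n. L2_norm M (F n)) \<longlonglongrightarrow> L2_norm M f"
proof (rule LIM_zero_cancel, rule Lim_null_comparison)
  show "(\<lambda>n. L2_norm M (\<lambda>x. F n x - f x)) \<longlonglongrightarrow> 0" using assms(1) by (simp add: L2_lim_def)
  show "\<forall>\<^sub>F n in sequentially. norm (L2_norm M (F n) - L2_norm M f) \<le> L2_norm M (\<lambda>x. F n x - f x)"
  proof (rule eventuallyI)
    fix n
    show "norm (L2_norm M (F n) - L2_norm M f) \<le> L2_norm M (\<lambda>x. F n x - f x)"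
      using L2_norm_diff_le[OF assms(2,3), of n] L2_norm_diff_le[OF assms(3,2), of n]
      by (simp add: abs_le_iff L2_norm_minus_commute[of M f])
  qed
qed

definition dilate :: "real \<Rightarrow> (complex ^ 'd \<Rightarrow> complex) \<Rightarrow> complex ^ 'd \<Rightarrow> complex" where
  "dilate r f z = f (r *\<^sub>R z)"

context model_domain
begin

lemma compact_closure_space: "compact (closure (space m))"
  using bounded_space by (simp add: compact_closure)

lemma closure_space_sub: "closure (space m) \<subseteq> closure \<Omega>"
  using boundary_sub closure_mono[of "space m" "closure \<Omega>"] by simp

lemma dilated_in: "z \<in> closure (space m) \<Longrightarrow> 0 \<le> r \<Longrightarrow> r < 1 \<Longrightarrow> r *\<^sub>R z \<in> \<Omega>"
  unfolding scaleR_eq_scalar_mult using closure_space_sub by (intro shrink) auto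

lemma space_closure: "z \<in> space m \<Longrightarrow> z \<in> closure (space m)"
  using closure_subset by blast

lemma compact_dilated: "compact ((\<lambda>z. r *\<^sub>R z) ` closure (space m))"
  by (intro compact_continuous_image compact_closure_space continuous_intros)

lemma dilate_continuous:
  assumes f: "continuous_on \<Omega> f" and r: "0 \<le> r" "r < 1"
  shows "continuous_on (closure (space m)) (dilate r f)"
proof -
  have "continuous_on (closure (space m)) (f \<circ> (\<lambda>z. r *\<^sub>R z))"
    by (rule continuous_on_compose) (use f dilated_in r in \<open>auto intro!: continuous_intros elim!: continuous_on_subset\<close>)
  then show ?thesis by (simp add: dilate_def[abs_def] o_def)
qed

lemma dilate_L2: "continuous_on \<Omega> f \<Longrightarrow> 0 \<le> r \<Longrightarrow> r < 1 \<Longrightarrow> dilate r f \<in> L2 m"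
  by (intro continuous_L2 dilate_continuous)

lemma dilate_polyfuns: "f \<in> polyfuns \<Longrightarrow> dilate r f \<in> polyfuns"
  unfolding dilate_def[abs_def]
  by (rule polyfuns_compose) (auto simp: scaleR_conv_of_real intro: polyfuns_cmult polyfuns_coord)

text \<open>The same rotation argument as for monomials, now with all coordinates rotated by a
  common factor.\<close>

lemma homogeneous_orthogonal:
  assumes f: "f \<in> borel_measurable m" "\<And>c z. f (c *s z) = c ^ a * f z"
    and g: "g \<in> borel_measurable m" "\<And>c z. g (c *s z) = c ^ b * g z" and ab: "a \<noteq> b"
  shows "L2_inner m f g = 0"
proof -
  obtain u where u: "norm u = 1" "u ^ a * cnj u ^ b \<noteq> 1" using unimodular_powers[OF ab] by blast
  have rot: "rotate_coords (\<lambda>_. u) z = u *s z" for z by (simp add: rotate_coords_def vec_eq_iff)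
  have "L2_inner m f g = u ^ a * (cnj (u ^ b) * L2_inner m f g)"
    using L2_inner_rotate[OF f(1) g(1), of "\<lambda>_. u"] u(1)
    unfolding rot f(2) g(2) L2_inner_cmult_left L2_inner_cmult_right by simp
  then have "(u ^ a * cnj u ^ b - 1) * L2_inner m f g = 0" by (simp add: algebra_simps)
  then show ?thesis using u(2) by auto
qed

text \<open>Dilation multiplies the coefficient of a monomial by \<open>r\<close> to its degree, a
  number at most 1, and monomials are orthogonal.\<close>

lemma dilate_contractive:
  assumes p: "p \<in> polyfuns" and r: "0 \<le> r" "r \<le> 1"
  shows "L2_norm m (dilate r p) \<le> L2_norm m p"
proof -
  obtain P where P: "p = eval_poly P" using p by (auto simp: polyfuns_def)
  let ?A = "Poly_Mapping.keys P"
  define s where "s k = r ^ (\<Sum>i\<in>UNIV. Poly_Mapping.lookup k i)" for k :: "'d \<Rightarrow>\<^sub>0 nat"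
  define f where "f k z = complex_of_real (s k) * Poly_Mapping.lookup P k * monomial k z" for k z
  have s: "0 \<le> s k" "s k \<le> 1" for k using r by (auto simp: s_def power_le_one)
  have mon: "monomial k (r *\<^sub>R z) = complex_of_real (s k) * monomial k z" for k and z :: "complex ^ 'd"
    unfolding monomial_def vector_scaleR_component
    unfolding scaleR_conv_of_real power_mult_distrib prod.distrib
    by (simp add: s_def power_sum)
  have eq: "dilate r p = (\<lambda>z. \<Sum>k\<in>?A. f k z)"
    by (simp add: dilate_def[abs_def] P eval_poly_monomials mon f_def mult_ac)
  have pf: "f k \<in> polyfuns" for k unfolding f_def[abs_def] by (intro polyfuns_cmult monomial_polyfuns)
  have "(L2_norm m (dilate r p))\<^sup>2 = (\<Sum>k\<in>?A. (L2_norm m (f k))\<^sup>2)"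
    unfolding eq
    by (rule L2_Pythagoras[THEN conjunct2, THEN conjunct2])
       (auto simp: f_def[abs_def] L2_inner_cmult_left L2_inner_cmult_right monomials_orthogonal
          intro: polyfuns_L2 polyfuns_cmult monomial_polyfuns)
  also have "\<dots> = (\<Sum>k\<in>?A. (s k)\<^sup>2 * ((norm (Poly_Mapping.lookup P k))\<^sup>2 * (L2_norm m (monomial k))\<^sup>2))"
    unfolding f_def[abs_def] L2_norm_cmult by (simp add: norm_mult power_mult_distrib mult.assoc)
  also have "\<dots> \<le> (\<Sum>k\<in>?A. 1 * ((norm (Poly_Mapping.lookup P k))\<^sup>2 * (L2_norm m (monomial k))\<^sup>2))"
    using s by (intro sum_mono mult_right_mono) (auto intro: power_le_one)
  also have "\<dots> = (L2_norm m p)\<^sup>2" unfolding P Parseval by simp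
  finally show ?thesis by (rule power2_le_imp_le) (rule L2_norm_nonneg)
qed

text \<open>The condition under \<open>SOME\<close> in \<open>boundary_value\<close>, named so that
  its consequences can be stated for arbitrary representatives.\<close>

definition radial :: "(complex ^ 'd \<Rightarrow> complex) \<Rightarrow> (complex ^ 'd \<Rightarrow> complex) \<Rightarrow> bool" where
  "radial f F \<longleftrightarrow> F \<in> L2 m \<and>
     ((\<lambda>r. \<integral>\<^sup>+ \<zeta>. ennreal ((norm (f (r *\<^sub>R \<zeta>) - F \<zeta>))\<^sup>2) \<partial>m) \<longlongrightarrow> 0) (at_left 1)"

lemma eventually_at_left_1: "\<forall>\<^sub>F r in at_left (1::real). 0 < r \<and> r < 1"
  unfolding eventually_at_left_field by (intro exI[of _ 0]) auto

lemma radial_iff: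
  assumes f: "continuous_on \<Omega> f" and F: "F \<in> L2 m"
  shows "radial f F \<longleftrightarrow> ((\<lambda>r. L2_norm m (\<lambda>z. dilate r f z - F z)) \<longlongrightarrow> 0) (at_left 1)"
proof -
  have "((\<lambda>r. \<integral>\<^sup>+ \<zeta>. ennreal ((norm (f (r *\<^sub>R \<zeta>) - F \<zeta>))\<^sup>2) \<partial>m) \<longlongrightarrow> 0) (at_left 1) \<longleftrightarrow>
      ((\<lambda>r. ennreal ((L2_norm m (\<lambda>z. dilate r f z - F z))\<^sup>2)) \<longlongrightarrow> ennreal 0) (at_left 1)"
  proof (rule filterlim_cong)
    show "\<forall>\<^sub>F r in at_left 1. (\<integral>\<^sup>+ \<zeta>. ennreal ((norm (f (r *\<^sub>R \<zeta>) - F \<zeta>))\<^sup>2) \<partial>m) = ennreal ((L2_norm m (\<lambda>z. dilate r f z - F z))\<^sup>2)"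
      using eventually_at_left_1
    proof eventually_elim
      case (elim r)
      show ?case
        using nn_integral_L2[OF L2_diff[OF dilate_L2[OF f, of r] F]] elim by (simp add: dilate_def)
    qed
  qed simp_all
  also have "\<dots> \<longleftrightarrow> ((\<lambda>r. (L2_norm m (\<lambda>z. dilate r f z - F z))\<^sup>2) \<longlongrightarrow> 0) (at_left 1)"
    by (rule tendsto_ennreal_iff) auto
  also have "\<dots> \<longleftrightarrow> ((\<lambda>r. L2_norm m (\<lambda>z. dilate r f z - F z)) \<longlongrightarrow> 0) (at_left 1)"
  proof
    assume "((\<lambda>r. (L2_norm m (\<lambda>z. dilate r f z - F z))\<^sup>2) \<longlongrightarrow> 0) (at_left 1)"
    then have "((\<lambda>r. sqrt ((L2_norm m (\<lambda>z. dilate r f z - F z))\<^sup>2)) \<longlongrightarrow> sqrt 0) (at_left 1)"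
      by (rule tendsto_real_sqrt)
    then show "((\<lambda>r. L2_norm m (\<lambda>z. dilate r f z - F z)) \<longlongrightarrow> 0) (at_left 1)"
      by (simp add: L2_norm_nonneg)
  next
    assume "((\<lambda>r. L2_norm m (\<lambda>z. dilate r f z - F z)) \<longlongrightarrow> 0) (at_left 1)"
    then have "((\<lambda>r. (L2_norm m (\<lambda>z. dilate r f z - F z))\<^sup>2) \<longlongrightarrow> 0\<^sup>2) (at_left 1)"
      by (rule tendsto_power)
    then show "((\<lambda>r. (L2_norm m (\<lambda>z. dilate r f z - F z))\<^sup>2) \<longlongrightarrow> 0) (at_left 1)" by simp
  qed
  finally show ?thesis unfolding radial_def using F by simp
qed

lemma radial_lincomb:
  assumes f: "continuous_on \<Omega> f" "radial f F" and g: "continuous_on \<Omega> g" "radial g G"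
  shows "radial (\<lambda>z. f z + c * g z) (\<lambda>z. F z + c * G z)"
proof -
  have F: "F \<in> L2 m" and G: "G \<in> L2 m" using f(2) g(2) by (auto simp: radial_def)
  have FG: "(\<lambda>z. F z + c * G z) \<in> L2 m" by (intro L2_add L2_cmult F G)
  have cont: "continuous_on \<Omega> (\<lambda>z. f z + c * g z)" by (intro continuous_intros f g)
  show ?thesis
    unfolding radial_iff[OF cont FG]
  proof (rule Lim_null_comparison)
    have "((\<lambda>r. L2_norm m (\<lambda>z. dilate r f z - F z) + norm c * L2_norm m (\<lambda>z. dilate r g z - G z)) \<longlongrightarrow> 0 + norm c * 0) (at_left 1)"
      using f(2) g(2) unfolding radial_iff[OF f(1) F] radial_iff[OF g(1) G] by (intro tendsto_intros)
    then show "((\<lambda>r. L2_norm m (\<lambda>z. dilate r f z - F z) + norm c * L2_norm m (\<lambda>z. dilate r g z - G z)) \<longlongrightarrow> 0) (at_left 1)"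
      by simp
    show "\<forall>\<^sub>F r in at_left 1. norm (L2_norm m (\<lambda>z. dilate r (\<lambda>z. f z + c * g z) z - (F z + c * G z)))
        \<le> L2_norm m (\<lambda>z. dilate r f z - F z) + norm c * L2_norm m (\<lambda>z. dilate r g z - G z)"
      using eventually_at_left_1
    proof eventually_elim
      case (elim r)
      have 1: "(\<lambda>z. dilate r f z - F z) \<in> L2 m" and 2: "(\<lambda>z. dilate r g z - G z) \<in> L2 m"
        using elim by (auto intro!: L2_diff dilate_L2 f g F G)
      have "(\<lambda>z. dilate r (\<lambda>z. f z + c * g z) z - (F z + c * G z)) = (\<lambda>z. (dilate r f z - F z) + c * (dilate r g z - G z))"
        by (simp add: dilate_def fun_eq_iff algebra_simps)
      then show ?case
        using L2_norm_triangle[OF 1 L2_cmult[OF 2, of c]] by (simp add: L2_norm_cmult L2_norm_nonneg)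
    qed
  qed
qed

lemma radial_unique:
  assumes f: "continuous_on \<Omega> f" and F: "radial f F" and G: "radial f G"
  shows "AE z in m. F z = G z"
proof -
  have L: "F \<in> L2 m" "G \<in> L2 m" using F G by (auto simp: radial_def)
  have "radial (\<lambda>z. f z + (-1) * f z) (\<lambda>z. F z + (-1) * G z)" by (rule radial_lincomb[OF f F f G])
  then have rad: "radial (\<lambda>z. 0) (\<lambda>z. F z - G z)" by simp
  have c0: "continuous_on \<Omega> (\<lambda>z. 0 :: complex)" by simp
  have "((\<lambda>r. L2_norm m (\<lambda>z. dilate r (\<lambda>z. 0) z - (F z - G z))) \<longlongrightarrow> 0) (at_left 1)"
    using rad unfolding radial_iff[OF c0 L2_diff[OF L]] .
  then have "((\<lambda>r::real. L2_norm m (\<lambda>z. 0 - (F z - G z))) \<longlongrightarrow> 0) (at_left 1)" by (simp add: dilate_def)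
  then have "L2_norm m (\<lambda>z. 0 - (F z - G z)) = 0"
    using tendsto_unique[OF _ _ tendsto_const, of "at_left (1::real)"] trivial_limit_at_left_real by metis
  then have "AE z in m. 0 - (F z - G z) = 0"
    using L2_norm_eq_0_iff[OF L2_diff[OF L2_const L2_diff[OF L]], of 0] by simp
  then show ?thesis by eventually_elim simp
qed

lemma hardy_continuous: "f \<in> hardy \<Omega> m \<Longrightarrow> continuous_on \<Omega> f"
  by (simp add: hardy_def holomorphic_several_continuous_on)

lemma hardy_iff:
  "f \<in> hardy \<Omega> m \<longleftrightarrow> holomorphic_several f \<Omega> \<and> (\<forall>z. z \<notin> \<Omega> \<longrightarrow> f z = 0) \<and>
     (\<exists>C. \<forall>r. 0 < r \<and> r < 1 \<longrightarrow> L2_norm m (dilate r f) \<le> C)"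
proof -
  have "(SUP r\<in>{0<..<1}. \<integral>\<^sup>+ \<zeta>. ennreal ((norm (f (r *\<^sub>R \<zeta>)))\<^sup>2) \<partial>m) < \<infinity> \<longleftrightarrow>
      (\<exists>C. \<forall>r. 0 < r \<and> r < 1 \<longrightarrow> L2_norm m (dilate r f) \<le> C)" if hol: "holomorphic_several f \<Omega>"
  proof -
    have eq: "(\<integral>\<^sup>+ \<zeta>. ennreal ((norm (f (r *\<^sub>R \<zeta>)))\<^sup>2) \<partial>m) = ennreal ((L2_norm m (dilate r f))\<^sup>2)" if "0 < r" "r < 1" for r
      using nn_integral_L2[OF dilate_L2[OF holomorphic_several_continuous_on[OF hol], of r]] that by (simp add: dilate_def)
    show ?thesis
    proof
      assume fin: "(SUP r\<in>{0<..<1}. \<integral>\<^sup>+ \<zeta>. ennreal ((norm (f (r *\<^sub>R \<zeta>)))\<^sup>2) \<partial>m) < \<infinity>"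
      define C where "C = enn2real (SUP r\<in>{0<..<1}. \<integral>\<^sup>+ \<zeta>. ennreal ((norm (f (r *\<^sub>R \<zeta>)))\<^sup>2) \<partial>m)"
      have "L2_norm m (dilate r f) \<le> sqrt C" if r: "0 < r \<and> r < 1" for r
      proof -
        have "ennreal ((L2_norm m (dilate r f))\<^sup>2) \<le> (SUP r\<in>{0<..<1}. \<integral>\<^sup>+ \<zeta>. ennreal ((norm (f (r *\<^sub>R \<zeta>)))\<^sup>2) \<partial>m)"
          using r by (subst eq[symmetric]) (auto intro!: SUP_upper)
        also have "\<dots> = ennreal C" unfolding C_def using fin by simp
        finally have "(L2_norm m (dilate r f))\<^sup>2 \<le> C" by (simp add: C_def)
        then show ?thesis by (rule real_le_rsqrt)
      qed
      then show "\<exists>C. \<forall>r. 0 < r \<and> r < 1 \<longrightarrow> L2_norm m (dilate r f) \<le> C" by blast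
    next
      assume "\<exists>C. \<forall>r. 0 < r \<and> r < 1 \<longrightarrow> L2_norm m (dilate r f) \<le> C"
      then obtain C where C: "\<And>r. 0 < r \<Longrightarrow> r < 1 \<Longrightarrow> L2_norm m (dilate r f) \<le> C" by blast
      have "(SUP r\<in>{0<..<1}. \<integral>\<^sup>+ \<zeta>. ennreal ((norm (f (r *\<^sub>R \<zeta>)))\<^sup>2) \<partial>m) \<le> ennreal (C\<^sup>2)"
        by (rule SUP_least) (auto simp: eq intro!: ennreal_leI power_mono C L2_norm_nonneg)
      then show "(SUP r\<in>{0<..<1}. \<integral>\<^sup>+ \<zeta>. ennreal ((norm (f (r *\<^sub>R \<zeta>)))\<^sup>2) \<partial>m) < \<infinity>"
        by (rule le_less_trans) simp
    qed
  qed
  then show ?thesis unfolding hardy_def by blast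
qed

lemma hardy_lincomb:
  assumes f: "f \<in> hardy \<Omega> m" and g: "g \<in> hardy \<Omega> m"
  shows "(\<lambda>z. f z + c * g z) \<in> hardy \<Omega> m"
proof -
  obtain C D where C: "\<And>r. 0 < r \<and> r < 1 \<Longrightarrow> L2_norm m (dilate r f) \<le> C"
    and D: "\<And>r. 0 < r \<and> r < 1 \<Longrightarrow> L2_norm m (dilate r g) \<le> D" using f g unfolding hardy_iff by blast
  have "L2_norm m (dilate r (\<lambda>z. f z + c * g z)) \<le> C + norm c * D" if r: "0 < r \<and> r < 1" for r
  proof -
    have "dilate r (\<lambda>z. f z + c * g z) = (\<lambda>z. dilate r f z + c * dilate r g z)" by (simp add: dilate_def fun_eq_iff)
    then have "L2_norm m (dilate r (\<lambda>z. f z + c * g z)) \<le> L2_norm m (dilate r f) + norm c * L2_norm m (dilate r g)"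
      using L2_norm_triangle[of "dilate r f" m "\<lambda>z. c * dilate r g z"] r
      by (simp add: dilate_L2 hardy_continuous f g L2_cmult L2_norm_cmult)
    also have "\<dots> \<le> C + norm c * D" by (intro add_mono mult_left_mono C D r) simp
    finally show ?thesis .
  qed
  then show ?thesis
    using f g unfolding hardy_iff by (auto intro!: holomorphic_several_add holomorphic_several_cmult)
qed

lemma hardy_zero: "(\<lambda>z. 0) \<in> hardy \<Omega> m"
  unfolding hardy_def by (simp add: holomorphic_several_const)

lemma hardy_diff: "f \<in> hardy \<Omega> m \<Longrightarrow> g \<in> hardy \<Omega> m \<Longrightarrow> (\<lambda>z. f z - g z) \<in> hardy \<Omega> m"
  using hardy_lincomb[of f g "-1"] by simp

lemma hardy_cmult: "f \<in> hardy \<Omega> m \<Longrightarrow> (\<lambda>z. c * f z) \<in> hardy \<Omega> m"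
  using hardy_lincomb[OF hardy_zero, of f c] by simp

text \<open>By \<open>eval_bound\<close>, L2 convergence on the boundary forces locally uniform
  convergence inside, which defines \<open>h\<close>. Contractivity of dilation makes the
  approximation of the dilates of \<open>h\<close> by those of \<open>p n\<close> uniform in
  \<open>r\<close>, so the radial limit can be computed on a single polynomial.\<close>

theorem hardy_complete:
  assumes p: "\<And>n. p n \<in> polyfuns" and F: "F \<in> L2 m" and lim: "L2_lim m p F"
  shows "\<exists>h\<in>hardy \<Omega> m. (\<forall>z\<in>\<Omega>. (\<lambda>n. p n z) \<longlonglongrightarrow> h z) \<and> radial h F"
proof -
  have pL: "p n \<in> L2 m" for n by (rule polyfuns_L2[OF p])
  have cauchy: "L2_Cauchy m p" by (rule L2_lim_imp_Cauchy[OF lim pL F])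
  have uc: "uniformly_Cauchy_on K p" if K: "compact K" "K \<subseteq> \<Omega>" for K
  proof (rule uniformly_Cauchy_onI)
    fix e :: real assume e: "e > 0"
    obtain C where C: "\<And>q z. q \<in> polyfuns \<Longrightarrow> z \<in> K \<Longrightarrow> norm (q z) \<le> C * L2_norm m q"
      using eval_bound[OF K] by blast
    have "e / (\<bar>C\<bar> + 1) > 0" using e by (simp add: add_nonneg_pos)
    then obtain N where N: "\<And>i j. i \<ge> N \<Longrightarrow> j \<ge> N \<Longrightarrow> L2_norm m (\<lambda>x. p i x - p j x) < e / (\<bar>C\<bar> + 1)"
      using cauchy unfolding L2_Cauchy_def by meson
    have "dist (p i z) (p j z) < e" if ij: "i \<ge> N" "j \<ge> N" "z \<in> K" for i j z
    proof -
      have "norm (p i z - p j z) \<le> C * L2_norm m (\<lambda>x. p i x - p j x)"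
        by (rule C[OF polyfuns_diff[OF p p] ij(3)])
      also have "\<dots> \<le> (\<bar>C\<bar> + 1) * L2_norm m (\<lambda>x. p i x - p j x)"
        by (rule mult_right_mono) (auto simp: L2_norm_nonneg)
      also have "\<dots> < (\<bar>C\<bar> + 1) * (e / (\<bar>C\<bar> + 1))"
        by (rule mult_strict_left_mono[OF N[OF ij(1,2)]]) (simp add: add_nonneg_pos)
      also have "\<dots> = e" by (simp add: add_nonneg_eq_0_iff)
      finally show ?thesis by (simp add: dist_norm)
    qed
    then show "\<exists>M. \<forall>x\<in>K. \<forall>i\<ge>M. \<forall>n\<ge>M. dist (p i x) (p n x) < e" by blast
  qed
  define h where "h z = (if z \<in> \<Omega> then lim (\<lambda>n. p n z) else 0)" for z
  have ul: "uniform_limit K p h sequentially" if K: "compact K" "K \<subseteq> \<Omega>" for K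
  proof -
    obtain l where l: "uniform_limit K p l sequentially"
      using uc[OF K] uniformly_convergent_eq_Cauchy[of K p] unfolding uniformly_convergent_on_def by blast
    have "l z = h z" if "z \<in> K" for z
      using limI[OF tendsto_uniform_limitI[OF l that]] that K by (auto simp: h_def)
    then show ?thesis using uniform_limit_cong'[of K p p l h] l by blast
  qed
  have ptw: "(\<lambda>n. p n z) \<longlonglongrightarrow> h z" if "z \<in> \<Omega>" for z
    using tendsto_uniform_limitI[OF ul[of "{z}"]] that by simp
  have hol: "holomorphic_several h \<Omega>"
  proof (rule polyfuns_uniform_limit_holomorphic[OF p])
    fix z assume "z \<in> \<Omega>"
    then obtain e where "e > 0" "cball z e \<subseteq> \<Omega>" using open_domain open_contains_cball by blast
    then show "\<exists>e>0. uniform_limit (cball z e) p h sequentially" using ul[of "cball z e"] by auto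
  qed
  have hc: "continuous_on \<Omega> h" by (rule holomorphic_several_continuous_on[OF hol])
  have dl: "L2_lim m (\<lambda>n. dilate r (p n)) (dilate r h)" if r: "0 < r" "r < 1" for r
  proof (rule uniform_limit_L2_lim)
    have "uniform_limit ((\<lambda>z. r *\<^sub>R z) ` closure (space m)) p h sequentially"
      by (rule ul[OF compact_dilated]) (use dilated_in r in auto)
    then show "uniform_limit (space m) (\<lambda>n. dilate r (p n)) (dilate r h) sequentially"
      unfolding uniform_limit_iff dilate_def using space_closure by (auto elim!: eventually_mono)
    show "dilate r (p n) \<in> borel_measurable m" for n by (rule polyfuns_measurable[OF dilate_polyfuns[OF p]])
    show "dilate r h \<in> borel_measurable m" using L2D(1)[OF dilate_L2[OF hc, of r]] r by simp
  qed
  have dL: "dilate r (p n) \<in> L2 m" for r n by (rule polyfuns_L2[OF dilate_polyfuns[OF p]])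
  have hL: "dilate r h \<in> L2 m" if "0 < r" "r < 1" for r using dilate_L2[OF hc] that by simp
  \<comment> \<open>The estimate for the undilated polynomials passes to all radii at once; the
    first argument \<open>i\<close> is then sent to infinity.\<close>
  have diff: "L2_norm m (\<lambda>z. dilate r h z - dilate r (p n) z) \<le> \<delta>"
    if r: "0 < r" "r < 1" and \<delta>: "\<And>i. i \<ge> n \<Longrightarrow> L2_norm m (\<lambda>z. p i z - p n z) \<le> \<delta>" for r n \<delta>
  proof -
    have "L2_lim m (\<lambda>i z. dilate r (p i) z - dilate r (p n) z) (\<lambda>z. dilate r h z - dilate r (p n) z)"
      using dl[OF r] by (simp add: L2_lim_def)
    from L2_lim_norm[OF this L2_diff[OF dL dL] L2_diff[OF hL[OF r] dL]]
    have "(\<lambda>i. L2_norm m (\<lambda>z. dilate r (p i) z - dilate r (p n) z)) \<longlonglongrightarrow> L2_norm m (\<lambda>z. dilate r h z - dilate r (p n) z)" .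
    then show ?thesis
    proof (rule LIMSEQ_le_const2, intro exI[of _ n] allI impI)
      fix i assume "n \<le> i"
      have "(\<lambda>z. dilate r (p i) z - dilate r (p n) z) = dilate r (\<lambda>z. p i z - p n z)" by (simp add: dilate_def fun_eq_iff)
      then have "L2_norm m (\<lambda>z. dilate r (p i) z - dilate r (p n) z) \<le> L2_norm m (\<lambda>z. p i z - p n z)"
        using dilate_contractive[OF polyfuns_diff[OF p p], of r i n] r by simp
      then show "L2_norm m (\<lambda>z. dilate r (p i) z - dilate r (p n) z) \<le> \<delta>" using \<delta>[OF \<open>n \<le> i\<close>] by simp
    qed
  qed
  have hardy: "h \<in> hardy \<Omega> m"
  proof -
    obtain N where N: "\<And>i j. i \<ge> N \<Longrightarrow> j \<ge> N \<Longrightarrow> L2_norm m (\<lambda>x. p i x - p j x) < 1"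
      using cauchy unfolding L2_Cauchy_def by (meson zero_less_one)
    have "L2_norm m (dilate r h) \<le> L2_norm m (p N) + 1" if r: "0 < r \<and> r < 1" for r
    proof -
      have "L2_norm m (\<lambda>z. dilate r h z - dilate r (p N) z) \<le> 1"
        by (rule diff) (use r N in \<open>auto intro: less_imp_le\<close>)
      moreover have "L2_norm m (dilate r h) \<le> L2_norm m (dilate r (p N)) + L2_norm m (\<lambda>z. dilate r h z - dilate r (p N) z)"
        by (rule L2_norm_diff_le) (use hL dL r in auto)
      moreover have "L2_norm m (dilate r (p N)) \<le> L2_norm m (p N)" by (rule dilate_contractive[OF p]) (use r in auto)
      ultimately show ?thesis by linarith
    qed
    then show ?thesis unfolding hardy_iff using hol by (auto simp: h_def)
  qed
  have rad: "radial h F"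
    unfolding radial_iff[OF hc F]
  proof (rule tendstoI)
    fix e :: real assume e: "e > 0"
    have e4: "e / 4 > 0" using e by simp
    obtain N1 where N1: "\<And>i j. i \<ge> N1 \<Longrightarrow> j \<ge> N1 \<Longrightarrow> L2_norm m (\<lambda>x. p i x - p j x) < e / 4"
      using cauchy e4 unfolding L2_Cauchy_def by meson
    obtain N2 where N2: "\<And>n. n \<ge> N2 \<Longrightarrow> norm (L2_norm m (\<lambda>x. p n x - F x) - 0) < e / 4"
      using LIMSEQ_D[OF lim[unfolded L2_lim_def] e4] by blast
    define n where "n = max N1 N2"
    have A: "L2_norm m (\<lambda>x. p n x - F x) < e / 4" using N2[of n] by (simp add: n_def)
    have B: "L2_norm m (\<lambda>z. dilate r h z - dilate r (p n) z) \<le> e / 4" if "0 < r" "r < 1" for r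
      by (rule diff[OF that]) (use N1[of _ n] in \<open>auto simp: n_def intro: less_imp_le\<close>)
    have "uniformly_continuous_on (cball 0 R) (p n)"
      by (rule compact_uniformly_continuous[OF continuous_on_polyfuns[OF p] compact_cball])
    define s where "s = e / 4 / (sqrt (measure m (space m)) + 1)"
    have spos: "sqrt (measure m (space m)) + 1 > 0" by (simp add: add_nonneg_pos)
    have s: "s > 0" using e spos by (simp add: s_def)
    have "s * (sqrt (measure m (space m)) + 1) = e / 4"
      using spos unfolding s_def by (metis less_irrefl nonzero_eq_divide_eq)
    then have sl: "s * sqrt (measure m (space m)) \<le> e / 4" using s by (simp add: distrib_left)
    obtain d where d: "d > 0" "\<And>x y. x \<in> cball 0 R \<Longrightarrow> y \<in> cball 0 R \<Longrightarrow> dist y x < d \<Longrightarrow> dist (p n y) (p n x) < s"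
      using \<open>uniformly_continuous_on (cball 0 R) (p n)\<close> s unfolding uniformly_continuous_on_def by meson
    \<comment> \<open>Boundary points have norm \<open>R\<close>, so dilation moves them by
      \<open>(1 - r) * R\<close>, which is below \<open>d\<close> for \<open>r\<close> beyond
      \<open>r0\<close>. The \<open>+ 1\<close> keeps the denominator positive.\<close>
    define r0 where "r0 = max 0 (1 - d / (\<bar>R\<bar> + 1))"
    have "d / (\<bar>R\<bar> + 1) > 0" using d by (simp add: add_nonneg_pos)
    then have "r0 < 1" by (simp add: r0_def)
    have C: "L2_norm m (\<lambda>z. dilate r (p n) z - p n z) \<le> e / 4" if r: "r0 < r" "r < 1" for r
    proof -
      have r': "0 < r" "1 - r < d / (\<bar>R\<bar> + 1)" using r by (auto simp: r0_def)
      have "norm (dilate r (p n) z - p n z) \<le> s" if z: "z \<in> space m" for z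
      proof -
        have nz: "norm z = R" using z boundary_sphere by auto
        have "dist (r *\<^sub>R z) z = (1 - r) * R"
        proof -
          have "r *\<^sub>R z - z = (r - 1) *\<^sub>R z" by (simp add: scaleR_diff_left)
          then show ?thesis using r by (simp add: dist_norm nz)
        qed
        also have "\<dots> \<le> (1 - r) * (\<bar>R\<bar> + 1)" using r by (intro mult_left_mono) auto
        also have "\<dots> < d" using r'(2) by (simp add: less_divide_eq add_nonneg_pos split: if_splits)
        finally have "dist (r *\<^sub>R z) z < d" .
        moreover have "norm (r *\<^sub>R z) \<le> R" using r r' nz mult_left_le_one_le[of "norm z" r] norm_ge_zero[of z] by simp
        ultimately show ?thesis using d(2)[of z "r *\<^sub>R z"] nz by (simp add: dilate_def dist_norm)
      qed
      then have "L2_norm m (\<lambda>z. dilate r (p n) z - p n z) \<le> \<bar>s\<bar> * sqrt (measure m (space m))"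
        by (intro L2_norm_le_sup polyfuns_measurable polyfuns_diff dilate_polyfuns p) simp_all
      then show ?thesis using sl s by simp
    qed
    have "dist (L2_norm m (\<lambda>z. dilate r h z - F z)) 0 < e" if r: "r0 < r" "r < 1" for r
    proof -
      have r': "0 < r" using r by (auto simp: r0_def)
      have "L2_norm m (\<lambda>z. dilate r h z - F z) \<le> L2_norm m (\<lambda>z. dilate r h z - dilate r (p n) z) + L2_norm m (\<lambda>z. dilate r (p n) z - F z)"
        by (rule L2_norm_triangle_diff[OF hL[OF r' r(2)] dL F])
      moreover have "L2_norm m (\<lambda>z. dilate r (p n) z - F z) \<le> L2_norm m (\<lambda>z. dilate r (p n) z - p n z) + L2_norm m (\<lambda>z. p n z - F z)"
        by (rule L2_norm_triangle_diff[OF dL pL F])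
      ultimately have "L2_norm m (\<lambda>z. dilate r h z - F z) < e" using A B[OF r' r(2)] C[OF r] e by linarith
      then show ?thesis by (simp add: L2_norm_nonneg)
    qed
    then show "\<forall>\<^sub>F r in at_left 1. dist (L2_norm m (\<lambda>z. dilate r h z - F z)) 0 < e"
      unfolding eventually_at_left_field using \<open>r0 < 1\<close> by (intro exI[of _ r0]) auto
  qed
  show ?thesis using hardy ptw rad by blast
qed

text \<open>Terms are grouped by degree rather than by monomial, so that a function transforming by
  a character under linear maps has partial sums transforming by the same character.\<close>

definition psum :: "(complex ^ 'd \<Rightarrow> complex) \<Rightarrow> nat \<Rightarrow> complex ^ 'd \<Rightarrow> complex" where
  "psum f N z = (\<Sum>n<N. hom_part f n z)"

lemma psum_polyfuns: "holomorphic_several f \<Omega> \<Longrightarrow> psum f N \<in> polyfuns"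
  unfolding psum_def[abs_def] by (intro polyfuns_sum hom_part_polyfuns[OF _ open_domain zero_in])

lemma psum_tendsto: "holomorphic_several f \<Omega> \<Longrightarrow> z \<in> \<Omega> \<Longrightarrow> (\<lambda>N. psum f N z) \<longlonglongrightarrow> f z"
  using hom_part_sums[OF _ open_domain balanced] unfolding psum_def sums_def by blast

lemma hom_parts_Pythagoras:
  assumes f: "holomorphic_several f \<Omega>" and A: "finite A"
  shows "(L2_norm m (\<lambda>z. \<Sum>n\<in>A. a n * hom_part f n z))\<^sup>2 = (\<Sum>n\<in>A. (norm (a n))\<^sup>2 * (L2_norm m (hom_part f n))\<^sup>2)"
proof -
  have pf: "hom_part f n \<in> polyfuns" for n by (rule hom_part_polyfuns[OF f open_domain zero_in])
  have orth: "L2_inner m (hom_part f i) (hom_part f j) = 0" if "i \<noteq> j" for i j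
    by (rule homogeneous_orthogonal[OF polyfuns_measurable[OF pf] hom_part_scale[OF f open_domain zero_in]
          polyfuns_measurable[OF pf] hom_part_scale[OF f open_domain zero_in] that])
  have "(L2_norm m (\<lambda>z. \<Sum>n\<in>A. a n * hom_part f n z))\<^sup>2 = (\<Sum>n\<in>A. (L2_norm m (\<lambda>z. a n * hom_part f n z))\<^sup>2)"
    by (rule L2_Pythagoras[OF A, THEN conjunct2, THEN conjunct2])
       (auto simp: L2_inner_cmult_left L2_inner_cmult_right orth intro: polyfuns_L2 polyfuns_cmult pf)
  then show ?thesis by (simp add: L2_norm_cmult power_mult_distrib)
qed

text \<open>A Cauchy bound at the intermediate radius \<open>s\<close> gives terms of size at most
  \<open>(r / s) ^ n * M\<close>, so the series converges uniformly on the boundary.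
  \<open>K\<close> is the compact set swept out by the discs used for that bound.\<close>

lemma psum_dilate_L2_lim:
  assumes f: "holomorphic_several f \<Omega>" and r: "0 < r" "r < 1"
  shows "L2_lim m (\<lambda>N. dilate r (psum f N)) (dilate r f)"
proof (rule uniform_limit_L2_lim)
  note hc = holomorphic_several_continuous_on[OF f]
  define s where "s = (r + 1) / 2"
  have s: "r < s" "s < 1" "0 < s" using r by (auto simp: s_def)
  define K where "K = (\<lambda>(c, z). c *s z) ` (cball (0::complex) 1 \<times> ((\<lambda>z. s *\<^sub>R z) ` closure (space m)))"
  have "compact K" unfolding K_def
    by (intro compact_continuous_image compact_Times compact_cball compact_dilated)
       (auto simp: case_prod_beta intro!: continuous_on_scalar_mult_vec continuous_intros)
  moreover have Ksub: "K \<subseteq> \<Omega>" unfolding K_def using dilated_in[of _ s] s by (auto intro!: balanced)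
  ultimately have "bounded (f ` K)"
    using compact_continuous_image[OF continuous_on_subset[OF hc]] compact_imp_bounded by blast
  then obtain M where M: "\<And>y. y \<in> K \<Longrightarrow> norm (f y) \<le> M" unfolding bounded_iff by blast
  have hb: "norm (hom_part f n (s *\<^sub>R z)) \<le> M" if z: "z \<in> closure (space m)" for n z
  proof (rule hom_part_bound[OF f open_domain])
    fix c :: complex assume "norm c \<le> 1"
    then have "c *s (s *\<^sub>R z) \<in> K" unfolding K_def using z by (intro image_eqI[of _ _ "(c, s *\<^sub>R z)"]) auto
    then show "c *s (s *\<^sub>R z) \<in> \<Omega> \<and> norm (f (c *s (s *\<^sub>R z))) \<le> M" using M Ksub by blast
  qed
  have "uniform_limit (space m) (\<lambda>N z. \<Sum>n<N. hom_part f n (r *\<^sub>R z)) (\<lambda>z. suminf (\<lambda>n. hom_part f n (r *\<^sub>R z))) sequentially"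
  proof (rule Weierstrass_m_test)
    fix n z assume z: "z \<in> space m"
    have "r *\<^sub>R z = complex_of_real (r / s) *s (s *\<^sub>R z)"
      using s by (simp add: scaleR_eq_scalar_mult)
    then have "norm (hom_part f n (r *\<^sub>R z)) = (r / s) ^ n * norm (hom_part f n (s *\<^sub>R z))"
      using hom_part_scale[OF f open_domain zero_in, of n "complex_of_real (r / s)" "s *\<^sub>R z"] r s
      by (simp add: norm_mult norm_power norm_divide)
    also have "\<dots> \<le> (r / s) ^ n * M" using hb[OF space_closure[OF z]] r s by (intro mult_left_mono) auto
    finally show "norm (hom_part f n (r *\<^sub>R z)) \<le> (r / s) ^ n * M" .
  next
    show "summable (\<lambda>n. (r / s) ^ n * M)" using r s by (intro summable_mult2 summable_geometric) simp
  qed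
  moreover have "suminf (\<lambda>n. hom_part f n (r *\<^sub>R z)) = dilate r f z" if "z \<in> space m" for z
    unfolding dilate_def
    by (rule sums_unique[symmetric], rule hom_part_sums[OF f open_domain balanced])
       (use dilated_in[OF space_closure[OF that]] r in auto)
  ultimately show "uniform_limit (space m) (\<lambda>N. dilate r (psum f N)) (dilate r f) sequentially"
    using uniform_limit_cong'[of "space m" "\<lambda>N z. \<Sum>n<N. hom_part f n (r *\<^sub>R z)" "\<lambda>N. dilate r (psum f N)"
        "\<lambda>z. suminf (\<lambda>n. hom_part f n (r *\<^sub>R z))" "dilate r f"]
    by (simp add: dilate_def psum_def)
  show "dilate r (psum f N) \<in> borel_measurable m" for N
    by (rule polyfuns_measurable[OF dilate_polyfuns[OF psum_polyfuns[OF f]]])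
  show "dilate r f \<in> borel_measurable m" using L2D(1)[OF dilate_L2[OF hc, of r]] r by simp
qed

text \<open>By orthogonality of the homogeneous parts, every finite sum of
  \<open>(r ^ n)\<^sup>2 * w n\<close> is bounded by the squared norm of a dilate, hence uniformly
  in \<open>r\<close>. Letting \<open>r\<close> tend to 1 in the finite sums makes \<open>w\<close>
  summable.\<close>

lemma hardy_psum_Cauchy:
  assumes f: "f \<in> hardy \<Omega> m"
  shows "L2_Cauchy m (psum f)"
proof -
  obtain C where hol: "holomorphic_several f \<Omega>" and C: "\<And>r. 0 < r \<Longrightarrow> r < 1 \<Longrightarrow> L2_norm m (dilate r f) \<le> C"
    using f unfolding hardy_iff by blast
  note hc = holomorphic_several_continuous_on[OF hol]
  define w where "w n = (L2_norm m (hom_part f n))\<^sup>2" for n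
  have w: "w n \<ge> 0" for n by (simp add: w_def)
  have dil: "dilate r (psum f N) = (\<lambda>z. \<Sum>n<N. complex_of_real r ^ n * hom_part f n z)" for r N
    by (simp add: dilate_def psum_def scaleR_eq_scalar_mult hom_part_scale[OF hol open_domain zero_in] fun_eq_iff)
  have bound_r: "(\<Sum>n<N. (r ^ n)\<^sup>2 * w n) \<le> C\<^sup>2" if r: "0 < r" "r < 1" for r N
  proof -
    have eq: "(L2_norm m (dilate r (psum f k)))\<^sup>2 = (\<Sum>n<k. (r ^ n)\<^sup>2 * w n)" for k
      unfolding dil hom_parts_Pythagoras[OF hol finite_lessThan] w_def using r by (simp add: norm_power)
    have "(\<lambda>k. (L2_norm m (dilate r (psum f k)))\<^sup>2) \<longlonglongrightarrow> (L2_norm m (dilate r f))\<^sup>2"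
      by (intro tendsto_power L2_lim_norm psum_dilate_L2_lim hol r
          polyfuns_L2 dilate_polyfuns psum_polyfuns dilate_L2 hc less_imp_le)
    then have "(\<Sum>n<N. (r ^ n)\<^sup>2 * w n) \<le> (L2_norm m (dilate r f))\<^sup>2"
      unfolding eq by (rule LIMSEQ_le_const) (auto intro!: exI[of _ N] sum_mono2 mult_nonneg_nonneg w)
    also have "\<dots> \<le> C\<^sup>2" by (intro power_mono C r L2_norm_nonneg)
    finally show ?thesis .
  qed
  have bound: "(\<Sum>n<N. w n) \<le> C\<^sup>2" for N
  proof (rule tendsto_upperbound)
    have "((\<lambda>r. \<Sum>n<N. (r ^ n)\<^sup>2 * w n) \<longlongrightarrow> (\<Sum>n<N. (1 ^ n)\<^sup>2 * w n)) (at_left 1)"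
      by (intro tendsto_intros)
    then show "((\<lambda>r. \<Sum>n<N. (r ^ n)\<^sup>2 * w n) \<longlongrightarrow> (\<Sum>n<N. w n)) (at_left 1)" by simp
    show "\<forall>\<^sub>F r in at_left 1. (\<Sum>n<N. (r ^ n)\<^sup>2 * w n) \<le> C\<^sup>2"
      using eventually_at_left_1 by eventually_elim (auto intro: bound_r)
  qed (rule trivial_limit_at_left_real)
  then have "summable w" by (intro summableI_nonneg_bounded w) auto
  then have sc: "Cauchy (\<lambda>N. \<Sum>n<N. w n)" by (rule LIMSEQ_imp_Cauchy[OF summable_LIMSEQ])
  show ?thesis unfolding L2_Cauchy_def
  proof (intro allI impI)
    fix e :: real assume e: "e > 0"
    obtain N where N: "\<And>i j. i \<ge> N \<Longrightarrow> j \<ge> N \<Longrightarrow> norm ((\<Sum>n<i. w n) - (\<Sum>n<j. w n)) < e\<^sup>2"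
      using CauchyD[OF sc, of "e\<^sup>2"] e by auto
    have le: "L2_norm m (\<lambda>x. psum f j x - psum f i x) < e" if "i \<ge> N" "i \<le> j" for i j
    proof -
      have "psum f j x - psum f i x = (\<Sum>n\<in>{i..<j}. 1 * hom_part f n x)" for x
        unfolding psum_def using sum_diff_nat_ivl[of 0 i j "\<lambda>n. hom_part f n x"] that by (simp add: atLeast0LessThan)
      then have "(L2_norm m (\<lambda>x. psum f j x - psum f i x))\<^sup>2 = (\<Sum>n\<in>{i..<j}. w n)"
        using hom_parts_Pythagoras[OF hol, of "{i..<j}" "\<lambda>_. 1"] by (simp add: w_def)
      also have "\<dots> = (\<Sum>n<j. w n) - (\<Sum>n<i. w n)"
        using sum_diff_nat_ivl[of 0 i j w] that by (simp add: atLeast0LessThan)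
      also have "\<dots> < e\<^sup>2" using N[of j i] that by simp
      finally show ?thesis using e by (simp add: power2_less_imp_less)
    qed
    have "L2_norm m (\<lambda>x. psum f i x - psum f j x) < e" if "i \<ge> N" "j \<ge> N" for i j
      using le[of i j] le[of j i] that L2_norm_minus_commute[of m "psum f i" "psum f j"] by (cases "i \<le> j") auto
    then show "\<exists>N. \<forall>i\<ge>N. \<forall>j\<ge>N. L2_norm m (\<lambda>x. psum f i x - psum f j x) < e" by blast
  qed
qed

abbreviation "bv \<equiv> boundary_value m"

text \<open>The partial sums converge in L2 to some \<open>F\<close>, and
  \<open>hardy_complete\<close> returns a function with radial limit \<open>F\<close> which agrees
  with \<open>f\<close> pointwise. So the condition under \<open>SOME\<close> is satisfiable, and
  every representative is \<open>F\<close> almost everywhere.\<close>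

lemma boundary_value_radial:
  assumes f: "f \<in> hardy \<Omega> m"
  shows "radial f (bv f)" "bv f \<in> L2 m" "L2_lim m (psum f) (bv f)"
proof -
  have hol: "holomorphic_several f \<Omega>" using f by (simp add: hardy_def)
  note pL = polyfuns_L2[OF psum_polyfuns[OF hol]]
  obtain F where F: "F \<in> L2 m" "L2_lim m (psum f) F"
    using Riesz_Fischer[of "psum f", OF pL hardy_psum_Cauchy[OF f]] by blast
  obtain h where h: "h \<in> hardy \<Omega> m" "\<And>z. z \<in> \<Omega> \<Longrightarrow> (\<lambda>n. psum f n z) \<longlonglongrightarrow> h z" "radial h F"
    using hardy_complete[OF psum_polyfuns[OF hol] F] by blast
  have "h z = f z" for z
  proof (cases "z \<in> \<Omega>")
    case True then show ?thesis using h(2) psum_tendsto[OF hol] LIMSEQ_unique by blast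
  next
    case False then show ?thesis using f h(1) by (simp add: hardy_def)
  qed
  then have "h = f" by (simp add: fun_eq_iff)
  then have rF: "radial f F" using h(3) by simp
  have "radial f (bv f)"
    unfolding boundary_value_def radial_def[symmetric] by (rule someI[of "radial f" F]) (rule rF)
  then show "radial f (bv f)" "bv f \<in> L2 m" by (auto simp: radial_def)
  then have "AE z in m. F z = bv f z" using radial_unique[OF hardy_continuous[OF f] rF] by blast
  then have "L2_norm m (\<lambda>x. psum f n x - F x) = L2_norm m (\<lambda>x. psum f n x - bv f x)" for n
    using F(1) \<open>bv f \<in> L2 m\<close> pL[of n]
    by (intro L2_norm_cong_AE) (auto intro!: L2D(1)[OF L2_diff] elim!: eventually_mono)
  then show "L2_lim m (psum f) (bv f)" using F(2) by (simp add: L2_lim_def)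
qed

lemma boundary_value_unique: "f \<in> hardy \<Omega> m \<Longrightarrow> radial f F \<Longrightarrow> AE z in m. bv f z = F z"
  using radial_unique[OF hardy_continuous boundary_value_radial(1)] by blast

lemma boundary_value_lincomb:
  assumes "f \<in> hardy \<Omega> m" "g \<in> hardy \<Omega> m"
  shows "AE z in m. bv (\<lambda>z. f z + c * g z) z = bv f z + c * bv g z"
  by (rule boundary_value_unique[OF hardy_lincomb[OF assms]])
     (intro radial_lincomb hardy_continuous boundary_value_radial assms)

lemma boundary_value_diff:
  assumes "f \<in> hardy \<Omega> m" "g \<in> hardy \<Omega> m"
  shows "AE z in m. bv (\<lambda>z. f z - g z) z = bv f z - bv g z"
  using boundary_value_lincomb[OF assms, of "-1"] by simp

lemma boundary_value_cmult:
  assumes "f \<in> hardy \<Omega> m"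
  shows "AE z in m. bv (\<lambda>z. c * f z) z = c * bv f z"
proof -
  have c0: "continuous_on \<Omega> (\<lambda>z. 0 :: complex)" by simp
  have "radial (\<lambda>z. 0) (\<lambda>z. 0)" using radial_iff[OF c0 L2_const[of 0]] by (simp add: dilate_def L2_norm_def)
  from radial_lincomb[OF c0 this hardy_continuous[OF assms] boundary_value_radial(1)[OF assms], of c]
  show ?thesis by (intro boundary_value_unique hardy_cmult assms) simp
qed

text \<open>The norms of the partial sums tend to 0, and point evaluation is continuous in that
  norm.\<close>

lemma boundary_value_eq_0:
  assumes f: "f \<in> hardy \<Omega> m" and "AE z in m. bv f z = 0"
  shows "f = (\<lambda>z. 0)"
proof
  fix z
  show "f z = 0"
  proof (cases "z \<in> \<Omega>")
    case True
    have hol: "holomorphic_several f \<Omega>" using f by (simp add: hardy_def)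
    note pL = polyfuns_L2[OF psum_polyfuns[OF hol]]
    have "L2_norm m (bv f) = 0" using assms L2_norm_eq_0_iff boundary_value_radial(2) by blast
    then have lim: "(\<lambda>n. L2_norm m (psum f n)) \<longlonglongrightarrow> 0"
      using L2_lim_norm[OF boundary_value_radial(3)[OF f] pL boundary_value_radial(2)[OF f]] by simp
    obtain C where C: "\<And>q. q \<in> polyfuns \<Longrightarrow> norm (q z) \<le> C * L2_norm m q"
      using eval_bound[of "{z}"] True by auto
    have "(\<lambda>n. C * L2_norm m (psum f n)) \<longlonglongrightarrow> C * 0" by (intro tendsto_intros lim)
    then have "(\<lambda>n. psum f n z) \<longlonglongrightarrow> 0"
      by (intro Lim_null_comparison[OF eventuallyI[OF C[OF psum_polyfuns[OF hol]]]]) simp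
    then show ?thesis using psum_tendsto[OF hol True] LIMSEQ_unique by blast
  next
    case False then show ?thesis using f by (simp add: hardy_def)
  qed
qed

section \<open>The orthogonal projection and Toeplitz operators\<close>

text \<open>The projection is taken onto the polynomials; by completeness its limit is a boundary
  value. Orthogonality to polynomials extends to all Hardy functions through their partial
  sums.\<close>

lemma hardy_projection_exists:
  assumes g: "g \<in> L2 m"
  shows "\<exists>h\<in>hardy \<Omega> m. \<forall>k\<in>hardy \<Omega> m. L2_inner m (\<lambda>z. g z - bv h z) (bv k) = 0"
proof -
  obtain p F where pF: "\<And>n::nat. p n \<in> polyfuns" "F \<in> L2 m" "L2_lim m p F"
    "\<And>q. q \<in> polyfuns \<Longrightarrow> L2_inner m (\<lambda>z. g z - F z) q = 0"
    using L2_projection[of polyfuns g, OF _ _ polyfuns_add polyfuns_cmult g] polyfuns_L2 polyfuns_const by blast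
  obtain h where h: "h \<in> hardy \<Omega> m" "radial h F" using hardy_complete[OF pF(1-3)] by blast
  have gF: "(\<lambda>z. g z - F z) \<in> L2 m" by (rule L2_diff[OF g pF(2)])
  have "L2_inner m (\<lambda>z. g z - bv h z) (bv k) = 0" if k: "k \<in> hardy \<Omega> m" for k
  proof -
    have hol: "holomorphic_several k \<Omega>" using k by (simp add: hardy_def)
    have "AE z in m. g z - bv h z = g z - F z" using boundary_value_unique[OF h] by eventually_elim simp
    then have "L2_inner m (\<lambda>z. g z - bv h z) (bv k) = L2_inner m (\<lambda>z. g z - F z) (bv k)"
      by (intro L2_inner_cong_AE L2D(1) gF L2_diff g boundary_value_radial h k) auto
    also have "\<dots> = 0"
    proof (rule LIMSEQ_unique)
      show "(\<lambda>n. L2_inner m (\<lambda>z. g z - F z) (psum k n)) \<longlonglongrightarrow> L2_inner m (\<lambda>z. g z - F z) (bv k)"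
        by (intro L2_lim_inner_right boundary_value_radial k gF polyfuns_L2 psum_polyfuns hol)
      show "(\<lambda>n. L2_inner m (\<lambda>z. g z - F z) (psum k n)) \<longlonglongrightarrow> 0"
        using pF(4)[OF psum_polyfuns[OF hol]] by simp
    qed
    finally show ?thesis .
  qed
  then show ?thesis using h(1) by blast
qed

text \<open>Stated for a subset \<open>D\<close> closed under differences, because in the
  semi-invariant subspace orthogonality is only tested against members of that subspace.\<close>

lemma hardy_projection_unique:
  assumes g: "g \<in> L2 m" and D: "D \<subseteq> hardy \<Omega> m" "\<And>h h'. h \<in> D \<Longrightarrow> h' \<in> D \<Longrightarrow> (\<lambda>z. h z - h' z) \<in> D"
    and h: "h \<in> D" "\<And>k. k \<in> D \<Longrightarrow> L2_inner m (\<lambda>z. g z - bv h z) (bv k) = 0"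
    and h': "h' \<in> D" "\<And>k. k \<in> D \<Longrightarrow> L2_inner m (\<lambda>z. g z - bv h' z) (bv k) = 0"
  shows "h = h'"
proof -
  define k where "k = (\<lambda>z. h z - h' z)"
  have kD: "k \<in> D" unfolding k_def by (rule D(2)[OF h(1) h'(1)])
  have hh: "h \<in> hardy \<Omega> m" "h' \<in> hardy \<Omega> m" "k \<in> hardy \<Omega> m" using h h' kD D by auto
  note L = boundary_value_radial(2)
  have "L2_inner m (bv k) (bv k) = L2_inner m (\<lambda>z. (g z - bv h' z) - (g z - bv h z)) (bv k)"
    using boundary_value_diff[OF hh(1,2)] unfolding k_def[symmetric]
    by (intro L2_inner_cong_AE L2D(1) L2_diff L hh g) (auto elim!: eventually_mono)
  also have "\<dots> = L2_inner m (\<lambda>z. g z - bv h' z) (bv k) - L2_inner m (\<lambda>z. g z - bv h z) (bv k)"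
    by (intro L2_inner_diff_left L2_diff L hh g)
  also have "\<dots> = 0" using h(2)[OF kD] h'(2)[OF kD] by simp
  finally have "L2_norm m (bv k) = 0" unfolding L2_inner_self by simp
  then have "k = (\<lambda>z. 0)"
    using boundary_value_eq_0[OF hh(3)] L2_norm_eq_0_iff[OF L[OF hh(3)]] by blast
  then show ?thesis unfolding k_def by (auto simp: fun_eq_iff)
qed

lemma orth_proj_hardy:
  assumes g: "g \<in> L2 m"
  shows "orth_proj (hardy \<Omega> m) bv (L2_inner m) g \<in> hardy \<Omega> m"
    "k \<in> hardy \<Omega> m \<Longrightarrow> L2_inner m (\<lambda>z. g z - bv (orth_proj (hardy \<Omega> m) bv (L2_inner m) g) z) (bv k) = 0"
proof -
  let ?P = "\<lambda>h. h \<in> hardy \<Omega> m \<and> (\<forall>k\<in>hardy \<Omega> m. L2_inner m (\<lambda>x. g x - bv h x) (bv k) = 0)"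
  obtain h where h: "?P h" using hardy_projection_exists[OF g] by blast
  have u: "h' = h" if "?P h'" for h'
    by (rule hardy_projection_unique[where D="hardy \<Omega> m", OF g order_refl hardy_diff])
      (use h that in simp_all)
  have "?P (THE h. ?P h)" by (rule theI[where P="?P" and a=h, OF h]) (rule u)
  then show "orth_proj (hardy \<Omega> m) bv (L2_inner m) g \<in> hardy \<Omega> m"
    "k \<in> hardy \<Omega> m \<Longrightarrow> L2_inner m (\<lambda>z. g z - bv (orth_proj (hardy \<Omega> m) bv (L2_inner m) g) z) (bv k) = 0"
    unfolding orth_proj_def by auto
qed

lemma hardy_toeplitz:
  assumes f: "f \<in> hardy \<Omega> m" and u: "u \<in> Linfty m"
  shows "hardy_toeplitz \<Omega> m u f \<in> hardy \<Omega> m"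
    "k \<in> hardy \<Omega> m \<Longrightarrow> L2_inner m (\<lambda>z. u z * bv f z - bv (hardy_toeplitz \<Omega> m u f) z) (bv k) = 0"
  using orth_proj_hardy[OF L2_bounded_mult[OF boundary_value_radial(2)[OF f] u]]
  by (simp_all add: hardy_toeplitz_def toeplitz_def)

lemma hardy_toeplitz_unique:
  assumes f: "f \<in> hardy \<Omega> m" and u: "u \<in> Linfty m" and h: "h \<in> hardy \<Omega> m"
    "\<And>k. k \<in> hardy \<Omega> m \<Longrightarrow> L2_inner m (\<lambda>z. u z * bv f z - bv h z) (bv k) = 0"
  shows "h = hardy_toeplitz \<Omega> m u f"
  by (rule hardy_projection_unique[OF L2_bounded_mult[OF boundary_value_radial(2)[OF f] u] order_refl hardy_diff])
     (use h hardy_toeplitz[OF f u] in auto)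

section \<open>Symmetries\<close>

definition symmetry :: "complex ^ 'd ^ 'd \<Rightarrow> bool" where
  "symmetry A \<longleftrightarrow> invertible A \<and> (\<lambda>z. A *v z) ` \<Omega> = \<Omega> \<and> (\<lambda>z. A *v z) \<in> measurable m m \<and> distr m m (\<lambda>z. A *v z) = m"

lemma symmetry_in_iff: "symmetry A \<Longrightarrow> A *v z \<in> \<Omega> \<longleftrightarrow> z \<in> \<Omega>"
  unfolding symmetry_def by (metis image_eqI image_iff matrix_inv_vector(2))

lemma symmetry_L2_norm:
  assumes A: "symmetry A" and f: "f \<in> borel_measurable m"
  shows "L2_norm m (\<lambda>z. f (A *v z)) = L2_norm m f"
proof -
  have [measurable]: "f \<in> borel_measurable m" by fact
  have "(LINT z|distr m m (\<lambda>z. A *v z). (norm (f z))\<^sup>2) = (LINT z|m. (norm (f (A *v z)))\<^sup>2)"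
    by (rule integral_distr) (use A in \<open>auto simp: symmetry_def\<close>)
  then show ?thesis using A by (simp add: L2_norm_def symmetry_def)
qed

lemma symmetry_L2_inner:
  assumes A: "symmetry A" and [measurable]: "f \<in> borel_measurable m" "g \<in> borel_measurable m"
  shows "L2_inner m (\<lambda>z. f (A *v z)) (\<lambda>z. g (A *v z)) = L2_inner m f g"
proof -
  have "(LINT z|distr m m (\<lambda>z. A *v z). f z * cnj (g z)) = (LINT z|m. f (A *v z) * cnj (g (A *v z)))"
    by (rule integral_distr) (use A in \<open>auto simp: symmetry_def\<close>)
  then show ?thesis using A by (simp add: L2_inner_def symmetry_def)
qed

lemma symmetry_L2: "symmetry A \<Longrightarrow> f \<in> L2 m \<Longrightarrow> (\<lambda>z. f (A *v z)) \<in> L2 m"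
proof -
  assume A: "symmetry A" and f: "f \<in> L2 m"
  have am: "(\<lambda>z. A *v z) \<in> measurable m m" using A by (simp add: symmetry_def)
  have "integrable (distr m m (\<lambda>z. A *v z)) (\<lambda>z. (norm (f z))\<^sup>2)" using A L2D(2)[OF f] by (simp add: symmetry_def)
  then have "integrable m (\<lambda>z. (norm (f (A *v z)))\<^sup>2)" by (rule integrable_distr[OF am])
  moreover have "(\<lambda>z. f (A *v z)) \<in> borel_measurable m" using measurable_compose[OF am L2D(1)[OF f]] .
  ultimately show ?thesis by (simp add: L2_def)
qed

lemma symmetry_hardy:
  assumes A: "symmetry A" and f: "f \<in> hardy \<Omega> m"
  shows "(\<lambda>z. f (A *v z)) \<in> hardy \<Omega> m"
proof -
  have coord: "(\<lambda>z. (A *v z) $ i) \<in> polyfuns" for i using polyfuns_matrix[OF polyfuns_coord] .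
  have "holomorphic_several f ((\<lambda>z. A *v z) ` \<Omega>)" using f A by (simp add: hardy_def symmetry_def)
  then have hol: "holomorphic_several (\<lambda>z. f (A *v z)) \<Omega>"
    by (rule holomorphic_several_compose_polynomial_map) (rule coord)
  obtain C where C: "\<And>r. 0 < r \<and> r < 1 \<Longrightarrow> L2_norm m (dilate r f) \<le> C" using f unfolding hardy_iff by blast
  have "L2_norm m (dilate r (\<lambda>z. f (A *v z))) \<le> C" if r: "0 < r \<and> r < 1" for r
  proof -
    have "dilate r (\<lambda>z. f (A *v z)) = (\<lambda>z. dilate r f (A *v z))"
      by (simp add: dilate_def linear_cmul[OF linear_matrix_complex] fun_eq_iff)
    then show ?thesis
      using symmetry_L2_norm[OF A L2D(1)[OF dilate_L2[OF hardy_continuous[OF f], of r]]] C[OF r] r by simp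
  qed
  then show ?thesis unfolding hardy_iff using hol f symmetry_in_iff[OF A] by (auto simp: hardy_def)
qed

text \<open>Dilation commutes with the linear map, and the L2 distance to the radial limit is
  unchanged because the map preserves the measure.\<close>

lemma symmetry_boundary_value:
  assumes A: "symmetry A" and f: "f \<in> hardy \<Omega> m"
  shows "AE z in m. bv (\<lambda>z. f (A *v z)) z = bv f (A *v z)"
proof (rule boundary_value_unique[OF symmetry_hardy[OF A f]])
  note L = symmetry_L2[OF A boundary_value_radial(2)[OF f]]
  show "radial (\<lambda>z. f (A *v z)) (\<lambda>z. bv f (A *v z))"
    unfolding radial_iff[OF hardy_continuous[OF symmetry_hardy[OF A f]] L]
  proof (rule Lim_transform_eventually)
    show "((\<lambda>r. L2_norm m (\<lambda>z. dilate r f z - bv f z)) \<longlongrightarrow> 0) (at_left 1)"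
      using boundary_value_radial(1)[OF f] unfolding radial_iff[OF hardy_continuous[OF f] boundary_value_radial(2)[OF f]] .
    show "\<forall>\<^sub>F r in at_left 1. L2_norm m (\<lambda>z. dilate r f z - bv f z) = L2_norm m (\<lambda>z. dilate r (\<lambda>z. f (A *v z)) z - bv f (A *v z))"
      using eventually_at_left_1
    proof eventually_elim
      case (elim r)
      have "dilate r (\<lambda>z. f (A *v z)) z = dilate r f (A *v z)" for z
        by (simp add: dilate_def linear_cmul[OF linear_matrix_complex])
      then show ?case
        using symmetry_L2_norm[OF A L2D(1)[OF L2_diff[OF dilate_L2[OF hardy_continuous[OF f], of r] boundary_value_radial(2)[OF f]]]] elim
        by simp
    qed
  qed
qed

text \<open>The candidate \<open>h'\<close>, the transform of the Toeplitz image divided by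
  \<kappa>, satisfies the same orthogonality relations: a test function \<open>k\<close> is replaced
  by its transform under the inverse of \<open>A\<close>. Uniqueness of the projection finishes the
  argument.\<close>

lemma hardy_toeplitz_equivariant:
  assumes A: "symmetry A" "symmetry (matrix_inv A)" and f: "f \<in> hardy \<Omega> m" and u: "u \<in> Linfty m"
    and inv: "AE z in m. u (A *v z) = u z" and \<kappa>: "\<kappa> \<noteq> 0" and eq: "\<And>z. f (A *v z) = \<kappa> * f z"
  shows "hardy_toeplitz \<Omega> m u f (A *v z) = \<kappa> * hardy_toeplitz \<Omega> m u f z"
proof -
  define h where "h = hardy_toeplitz \<Omega> m u f"
  note h = hardy_toeplitz[OF f u, folded h_def]
  define h' where "h' = (\<lambda>z. 1 / \<kappa> * h (A *v z))"
  have hA: "(\<lambda>z. h (A *v z)) \<in> hardy \<Omega> m" by (rule symmetry_hardy[OF A(1) h(1)])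
  have h': "h' \<in> hardy \<Omega> m" unfolding h'_def by (rule hardy_cmult[OF hA])
  have uf: "(\<lambda>z. u z * bv f z) \<in> L2 m" by (rule L2_bounded_mult[OF boundary_value_radial(2)[OF f] u])
  have G: "(\<lambda>z. u z * bv f z - bv h z) \<in> L2 m" by (rule L2_diff[OF uf boundary_value_radial(2)[OF h(1)]])
  have bvf: "AE z in m. bv f (A *v z) = \<kappa> * bv f z"
  proof -
    have "(\<lambda>z. f (A *v z)) = (\<lambda>z. \<kappa> * f z)" using eq by (simp add: fun_eq_iff)
    then show ?thesis using symmetry_boundary_value[OF A(1) f] boundary_value_cmult[OF f, of \<kappa>]
      by (auto elim: eventually_elim2)
  qed
  have bvh: "AE z in m. bv h' z = 1 / \<kappa> * bv h (A *v z)"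
    using boundary_value_cmult[OF hA, of "1 / \<kappa>"] symmetry_boundary_value[OF A(1) h(1)]
    unfolding h'_def by eventually_elim simp
  have "L2_inner m (\<lambda>z. u z * bv f z - bv h' z) (bv k) = 0" if k: "k \<in> hardy \<Omega> m" for k
  proof -
    define k' where "k' = (\<lambda>z. k (matrix_inv A *v z))"
    have k': "k' \<in> hardy \<Omega> m" unfolding k'_def by (rule symmetry_hardy[OF A(2) k])
    have "invertible A" using A(1) by (simp add: symmetry_def)
    then have "(\<lambda>z. k' (A *v z)) = k" by (simp add: k'_def matrix_inv_vector)
    then have bvk: "AE z in m. bv k z = bv k' (A *v z)" using symmetry_boundary_value[OF A(1) k'] by simp
    have "AE z in m. u z * bv f z - bv h' z = 1 / \<kappa> * (u (A *v z) * bv f (A *v z) - bv h (A *v z))"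
      using inv bvf bvh by eventually_elim (use \<kappa> in \<open>simp add: field_simps\<close>)
    then have "L2_inner m (\<lambda>z. u z * bv f z - bv h' z) (bv k) =
        L2_inner m (\<lambda>z. 1 / \<kappa> * (u (A *v z) * bv f (A *v z) - bv h (A *v z))) (\<lambda>z. bv k' (A *v z))"
      using bvk
      by (intro L2_inner_cong_AE L2D(1) L2_cmult symmetry_L2[OF A(1) G] symmetry_L2[OF A(1)] L2_diff uf
          boundary_value_radial h' k k') assumption+
    also have "\<dots> = 1 / \<kappa> * L2_inner m (\<lambda>z. u z * bv f z - bv h z) (bv k')"
      unfolding L2_inner_cmult_left
      using symmetry_L2_inner[OF A(1) L2D(1)[OF G] L2D(1)[OF boundary_value_radial(2)[OF k']]] by simp
    also have "\<dots> = 0" using h(2)[OF k'] by simp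
    finally show ?thesis .
  qed
  then have "h' = h" unfolding h_def by (rule hardy_toeplitz_unique[OF f u h'])
  then have "1 / \<kappa> * h (A *v z) = h z" unfolding h'_def by (simp add: fun_eq_iff)
  then show ?thesis using \<kappa> unfolding h_def by (simp add: field_simps)
qed

end

section \<open>The basic polynomial map\<close>

locale basic_map = pr_group G for G :: "(complex ^ 'd ^ 'd) set" +
  fixes \<theta> :: "complex ^ 'd \<Rightarrow> complex ^ 'd"
  assumes basic: "basic_polynomial_map G \<theta>"
begin

lemma theta_polyfuns: "(\<lambda>z. \<theta> z $ i) \<in> polyfuns"
proof -
  obtain p where "\<forall>z. \<theta> z $ i = eval_poly p z" using basic unfolding basic_polynomial_map_def by blast
  then have "(\<lambda>z. \<theta> z $ i) = eval_poly p" by (simp add: fun_eq_iff)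
  then show ?thesis by (simp add: polyfuns_def)
qed

lemma theta_compose: "q \<in> polyfuns \<Longrightarrow> (\<lambda>z. q (\<theta> z)) \<in> polyfuns"
  by (rule polyfuns_compose[OF _ theta_polyfuns])

lemma theta_continuous: "continuous_on S \<theta>"
proof -
  have "continuous_on S (\<lambda>z. \<chi> i. \<theta> z $ i)"
    by (intro continuous_on_vec_lambda continuous_on_polyfuns theta_polyfuns)
  then show ?thesis by simp
qed

lemma invariant_factor:
  assumes f: "f \<in> polyfuns" "\<And>\<sigma> z. \<sigma> \<in> G \<Longrightarrow> f (\<sigma> *v z) = f z"
  shows "\<exists>q\<in>polyfuns. \<forall>z. f z = q (\<theta> z)"
proof -
  have "\<forall>\<sigma>\<in>G. act \<sigma> f = f" using f(2) inv_in by (simp add: act_def fun_eq_iff)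
  moreover have "{f \<in> range eval_poly. \<forall>\<sigma>\<in>G. act \<sigma> f = f} = {eval_poly q \<circ> \<theta> |q. True}"
    using basic unfolding basic_polynomial_map_def by (elim conjE)
  ultimately have "f \<in> {eval_poly q \<circ> \<theta> |q. True}" using f(1) unfolding polyfuns_def by auto
  then show ?thesis by (auto simp: polyfuns_def)
qed

lemma theta_invariant:
  assumes "\<sigma> \<in> G"
  shows "\<theta> (\<sigma> *v z) = \<theta> z"
proof (subst vec_eq_iff, intro allI)
  fix i :: 'd
  obtain q where q: "(\<lambda>z. z $ i) = eval_poly q" using polyfuns_coord[of i] unfolding polyfuns_def by blast
  have "{f \<in> range eval_poly. \<forall>\<sigma>\<in>G. act \<sigma> f = f} = {eval_poly q \<circ> \<theta> |q. True}"
    using basic unfolding basic_polynomial_map_def by (elim conjE)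
  then have "eval_poly q \<circ> \<theta> \<in> {f \<in> range eval_poly. \<forall>\<sigma>\<in>G. act \<sigma> f = f}" by auto
  then have "act (matrix_inv \<sigma>) (eval_poly q \<circ> \<theta>) = eval_poly q \<circ> \<theta>" using inv_in[OF assms] by simp
  then have "act (matrix_inv \<sigma>) (eval_poly q \<circ> \<theta>) z = (eval_poly q \<circ> \<theta>) z" by simp
  then show "\<theta> (\<sigma> *v z) $ i = \<theta> z $ i"
    by (simp add: act_def matrix_inv_matrix_inv[OF invertible[OF assms]] q[symmetric])
qed

text \<open>An invariant polynomial in \<open>x\<close> vanishing exactly when the orbit of
  \<open>x\<close> meets the hyperplane \<open>lin v (y - a) = 0\<close>. Being a polynomial in
  \<theta>, it translates statements about orbits into statements about \<theta>.\<close>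

definition orbit_poly :: "complex ^ 'd \<Rightarrow> complex ^ 'd \<Rightarrow> complex ^ 'd \<Rightarrow> complex" where
  "orbit_poly v a x = (\<Prod>\<sigma>\<in>G. lin v (\<sigma> *v x - a))"

lemma lin_affine_polyfuns: "(\<lambda>x. lin v (\<sigma> *v x - a)) \<in> polyfuns"
proof -
  have "(\<lambda>x. lin v (\<sigma> *v x) - lin v a) \<in> polyfuns"
    by (intro polyfuns_diff polyfuns_const polyfuns_matrix lin_polyfuns)
  then show ?thesis by (simp add: lin_diff)
qed

lemma orbit_poly_factor: "\<exists>q\<in>polyfuns. \<forall>z. orbit_poly v a z = q (\<theta> z)"
proof (rule invariant_factor)
  show "orbit_poly v a \<in> polyfuns"
    unfolding orbit_poly_def[abs_def] by (intro polyfuns_prod lin_affine_polyfuns)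
  show "orbit_poly v a (\<tau> *v z) = orbit_poly v a z" if "\<tau> \<in> G" for \<tau> z
    unfolding orbit_poly_def
    using prod.reindex_bij_betw[OF bij_mult[OF that], of "\<lambda>\<sigma>. lin v (\<sigma> *v z - a)"]
    by (simp add: matrix_vector_mul_assoc)
qed

text \<open>If \<open>z\<close> is not in the orbit of \<open>z'\<close>, some form \<open>v\<close>
  is nonzero on all differences. The orbit polynomial centred at \<open>z\<close> then distinguishes
  the two points although it depends on \<theta> alone.\<close>

lemma theta_separates:
  assumes "\<theta> z = \<theta> z'"
  shows "\<exists>\<sigma>\<in>G. \<sigma> *v z' = z"
proof (rule ccontr)
  assume "\<not> ?thesis"
  then have "0 \<notin> (\<lambda>\<sigma>. \<sigma> *v z' - z) ` G" by auto
  then obtain v where v: "\<forall>a\<in>(\<lambda>\<sigma>. \<sigma> *v z' - z) ` G. lin v a \<noteq> 0"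
    using separating_linear[of "(\<lambda>\<sigma>. \<sigma> *v z' - z) ` G"] fin unfolding lin_def by blast
  then have "orbit_poly v z z' \<noteq> 0" unfolding orbit_poly_def using fin by simp
  moreover have "orbit_poly v z z = 0"
    unfolding orbit_poly_def using fin one_in by (intro prod_zero bexI[of _ "mat 1"]) (auto simp: lin_def)
  ultimately show False using orbit_poly_factor[of v z] assms by metis
qed

definition free_point :: "complex ^ 'd \<Rightarrow> bool" where
  "free_point z \<longleftrightarrow> (\<forall>\<sigma>\<in>G. \<sigma> \<noteq> mat 1 \<longrightarrow> \<sigma> *v z \<noteq> z)"

text \<open>At a free point only the identity factor of the orbit polynomial vanishes, so in
  direction \<open>h\<close> it has a simple zero. Since it factors through \<theta>,
  \<open>D h = 0\<close> would make its derivative zero. This takes the place of a formula for the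
  Jacobian.\<close>

lemma theta_derivative_injective:
  assumes z: "free_point z" and D: "(\<theta> has_derivative D) (at z)" and h: "D h = 0"
  shows "h = 0"
proof (rule ccontr)
  assume "h \<noteq> 0"
  let ?A = "insert h ((\<lambda>\<sigma>. \<sigma> *v z - z) ` (G - {mat 1}))"
  have "0 \<notin> ?A" using \<open>h \<noteq> 0\<close> z by (auto simp: free_point_def)
  then obtain v where v: "\<forall>a\<in>?A. lin v a \<noteq> 0"
    using separating_linear[of ?A] fin unfolding lin_def by blast
  define g where "g x = (\<Prod>\<sigma>\<in>G - {mat 1}. lin v (\<sigma> *v x - z))" for x
  have split: "orbit_poly v z x = lin v (x - z) * g x" for x
    unfolding orbit_poly_def g_def using prod.remove[OF fin one_in, of "\<lambda>\<sigma>. lin v (\<sigma> *v x - z)"] by simp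
  have "g \<in> polyfuns" unfolding g_def[abs_def] by (intro polyfuns_prod lin_affine_polyfuns)
  then obtain p where p: "\<forall>c. g (z + c *s h) = poly p c" using polyfuns_line by blast
  have g0: "poly p 0 \<noteq> 0"
  proof -
    have "g z \<noteq> 0" unfolding g_def using v fin by simp
    then show ?thesis using p[rule_format, of 0] by simp
  qed
  have eq1: "orbit_poly v z (z + c *s h) = c * (lin v h * poly p c)" for c
    unfolding split using p by (simp add: lin_scale)
  have "((\<lambda>c. c * (lin v h * poly p c)) has_field_derivative (1 * (lin v h * poly p 0) + lin v h * poly (pderiv p) 0 * 0)) (at 0)"
    by (rule DERIV_mult[where x = 0 and s = UNIV and f = "\<lambda>c. c", OF DERIV_ident DERIV_cmult[OF poly_DERIV]])
  then have d1: "((\<lambda>c. orbit_poly v z (z + c *s h)) has_field_derivative (lin v h * poly p 0)) (at 0)"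
    by (simp add: eq1)
  obtain q where q: "q \<in> polyfuns" "\<And>x. orbit_poly v z x = q (\<theta> x)" using orbit_poly_factor by blast
  obtain q' where q': "(q has_derivative q') (at (\<theta> z))" "\<And>c v. q' (c *s v) = c * q' v"
    using polyfuns_has_derivative[OF q(1)] by blast
  obtain D' where D': "(\<theta> has_derivative D') (at z)" "\<And>c v. D' (c *s v) = c *s D' v"
    using polynomial_map_has_derivative[of \<theta>, OF theta_polyfuns] by blast
  have DD: "D' = D" using has_derivative_unique[OF D'(1) D] .
  have line: "((\<lambda>c. z + c *s h) has_derivative (\<lambda>t. t *s h)) (at 0)"
    using has_derivative_add[OF has_derivative_const bounded_linear_imp_has_derivative[OF bounded_linear_scalar_mult_vec]]
    by simp
  have "((\<lambda>c. \<theta> (z + c *s h)) has_derivative (\<lambda>t. D (t *s h))) (at 0)"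
    using has_derivative_compose[OF line, of \<theta> D] D by simp
  then have "((\<lambda>c. q (\<theta> (z + c *s h))) has_derivative (\<lambda>t. q' (D (t *s h)))) (at 0)"
    using has_derivative_compose[of "\<lambda>c. \<theta> (z + c *s h)" "\<lambda>t. D (t *s h)" 0 UNIV q q'] q'(1) by simp
  moreover have "(\<lambda>t. q' (D (t *s h))) = (*) 0"
    using D'(2) q'(2)[of 0 0] h unfolding DD by (simp add: fun_eq_iff)
  ultimately have "((\<lambda>c. orbit_poly v z (z + c *s h)) has_field_derivative 0) (at 0)"
    unfolding q(2) has_field_derivative_def by simp
  then have "lin v h * poly p 0 = 0" using d1 DERIV_unique by blast
  then show False using g0 v by simp
qed

lemma theta_open_free:
  assumes z: "free_point z" and T: "z \<in> interior T"
  shows "\<theta> z \<in> interior (\<theta> ` T)"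
proof -
  obtain D where D: "(\<theta> has_derivative D) (at z)"
    using polynomial_map_has_derivative[of \<theta>, OF theta_polyfuns] by blast
  have lin: "linear D" using D has_derivative_linear by blast
  have "inj D" using lin theta_derivative_injective[OF z D] by (simp add: linear_injective_0)
  then have "surj D" using lin linear_injective_imp_surjective by blast
  then obtain g where g: "linear g" "D \<circ> g = id" using linear_surjective_right_inverse[OF lin] by blast
  show ?thesis
    by (rule sussmann_open_mapping[OF open_UNIV theta_continuous UNIV_I D _ g(2) subset_UNIV T])
       (use g(1) in \<open>simp add: linear_conv_bounded_linear\<close>)
qed

text \<open>Each nontrivial \<sigma> moves some point \<open>x \<sigma>\<close>, so one form
  \<open>v\<close> makes all the factors of \<open>E\<close> nonzero polynomials. The product over
  the group is invariant, hence a polynomial in \<theta>, and where it is nonzero no nontrivial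
  element has a fixed point.\<close>

lemma discriminant: "\<exists>\<Delta>\<in>polyfuns. (\<exists>z. \<Delta> (\<theta> z) \<noteq> 0) \<and> (\<forall>z. \<Delta> (\<theta> z) \<noteq> 0 \<longrightarrow> free_point z)"
proof -
  let ?G = "G - {mat 1}"
  have "\<forall>\<sigma>\<in>?G. \<exists>x. \<sigma> *v x - x \<noteq> 0" by (auto simp: matrix_eq)
  then obtain x where x: "\<And>\<sigma>. \<sigma> \<in> ?G \<Longrightarrow> \<sigma> *v x \<sigma> - x \<sigma> \<noteq> 0" by metis
  let ?A = "(\<lambda>\<sigma>. \<sigma> *v x \<sigma> - x \<sigma>) ` ?G"
  have "0 \<notin> ?A" using x by force
  then obtain v where v: "\<forall>a\<in>?A. lin v a \<noteq> 0"
    using separating_linear[of ?A] fin unfolding lin_def by blast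
  define E where "E z = (\<Prod>\<sigma>\<in>?G. lin v (\<sigma> *v z - z))" for z
  define F where "F z = (\<Prod>\<tau>\<in>G. E (\<tau> *v z))" for z
  have lp: "(\<lambda>z. lin v (\<sigma> *v z - z)) \<in> polyfuns" for \<sigma>
  proof -
    have "(\<lambda>z. lin v (\<sigma> *v z) - lin v z) \<in> polyfuns"
      by (intro polyfuns_diff polyfuns_matrix lin_polyfuns)
    then show ?thesis by (simp add: lin_diff)
  qed
  have E: "E \<in> polyfuns" unfolding E_def[abs_def] by (intro polyfuns_prod lp)
  have F: "F \<in> polyfuns" unfolding F_def[abs_def] by (intro polyfuns_prod polyfuns_matrix E)
  have "\<exists>w\<in>UNIV. E w \<noteq> 0" unfolding E_def
    by (rule polyfuns_prod_nonzero) (use fin v lp in auto)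
  then obtain w where w: "E w \<noteq> 0" by blast
  have Fnz: "\<exists>z\<in>UNIV. F z \<noteq> 0" unfolding F_def
  proof (rule polyfuns_prod_nonzero)
    show "\<exists>z\<in>UNIV. E (\<tau> *v z) \<noteq> 0" if "\<tau> \<in> G" for \<tau>
      using w mv_inv(1)[OF that, of w] by (intro bexI[of _ "matrix_inv \<tau> *v w"]) auto
  qed (use fin E polyfuns_matrix in auto)
  have "F (\<sigma> *v z) = F z" if "\<sigma> \<in> G" for \<sigma> z
    unfolding F_def using prod.reindex_bij_betw[OF bij_mult[OF that], of "\<lambda>\<tau>. E (\<tau> *v z)"]
    by (simp add: matrix_vector_mul_assoc)
  then obtain \<Delta> where \<Delta>: "\<Delta> \<in> polyfuns" "\<And>z. F z = \<Delta> (\<theta> z)" using invariant_factor[OF F] by blast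
  have "free_point z" if "F z \<noteq> 0" for z
  proof -
    have "E (mat 1 *v z) \<noteq> 0" using that fin one_in unfolding F_def by (metis prod_zero_iff)
    then have "lin v (\<sigma> *v z - z) \<noteq> 0" if "\<sigma> \<in> ?G" for \<sigma> using that fin unfolding E_def by simp
    then show ?thesis unfolding free_point_def by (metis DiffI cancel_comm_monoid_add_class.diff_cancel lin_diff singletonD)
  qed
  then show ?thesis using \<Delta> Fnz by (intro bexI[of _ \<Delta>]) auto
qed

text \<open>Near \<open>\<theta> z\<^sub>0\<close> the image of a small ball is relatively clopen off the zero set of the
  discriminant, whose complement is connected along complex lines.\<close>

theorem theta_open:
  assumes e: "e > 0"
  shows "\<theta> z0 \<in> interior (\<theta> ` cball z0 e)"
proof -
  obtain \<Delta> where \<Delta>: "\<Delta> \<in> polyfuns" "\<exists>z. \<Delta> (\<theta> z) \<noteq> 0" "\<And>z. \<Delta> (\<theta> z) \<noteq> 0 \<Longrightarrow> free_point z"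
    using discriminant by blast
  have "finite ((\<lambda>\<sigma>. \<sigma> *v z0) ` G)" using fin by simp
  then obtain d where d: "d > 0" "\<And>x. x \<in> (\<lambda>\<sigma>. \<sigma> *v z0) ` G \<Longrightarrow> x \<noteq> z0 \<Longrightarrow> d \<le> dist z0 x"
    using finite_set_avoid[of "(\<lambda>\<sigma>. \<sigma> *v z0) ` G" z0] by blast
  \<comment> \<open>Since \<open>r < d\<close>, the sphere of radius \<open>r\<close> contains no
    point of the orbit of \<open>z0\<close>, so \<theta>\<open>z0\<close> is not in its
    image.\<close>
  define r where "r = min e (d / 2)"
  have r: "r > 0" "r \<le> e" "r < d" using e d by (auto simp: r_def)
  have notin: "\<theta> z0 \<notin> \<theta> ` sphere z0 r"
  proof
    assume "\<theta> z0 \<in> \<theta> ` sphere z0 r"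
    then obtain y where y: "y \<in> sphere z0 r" "\<theta> y = \<theta> z0" by auto
    then obtain \<sigma> where "\<sigma> \<in> G" "\<sigma> *v z0 = y" using theta_separates by blast
    then have "d \<le> dist z0 y" using d(2)[of y] y(1) r by fastforce
    then show False using y(1) r by simp
  qed
  have "compact (\<theta> ` sphere z0 r)" by (intro compact_continuous_image theta_continuous compact_sphere)
  then have "open (- (\<theta> ` sphere z0 r))" using compact_imp_closed by blast
  then obtain \<rho> where \<rho>: "\<rho> > 0" "ball (\<theta> z0) \<rho> \<subseteq> - (\<theta> ` sphere z0 r)"
    using notin by (meson ComplI open_contains_ball)
  define W where "W = ball (\<theta> z0) \<rho>"
  define B where "B = \<theta> ` cball z0 r"
  define N where "N = \<theta> ` ball z0 r"
  have "compact B" unfolding B_def by (intro compact_continuous_image theta_continuous compact_cball)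
  then have Bc: "closed B" by (rule compact_imp_closed)
  \<comment> \<open>\<open>W\<close> misses the image of the sphere, so inside \<open>W\<close> the
    images of the open and of the closed ball coincide. The former gives openness, the latter
    closedness.\<close>
  have WN: "w \<in> N" if wW: "w \<in> W" and wB: "w \<in> B" for w
  proof -
    obtain y where y: "y \<in> cball z0 r" "w = \<theta> y" using wB by (auto simp: B_def)
    have "y \<notin> sphere z0 r" using wW \<rho>(2) y(2) by (auto simp: W_def)
    then show ?thesis using y by (auto simp: N_def)
  qed
  have NB: "N \<subseteq> B" unfolding N_def B_def by (intro image_mono ball_subset_cball)
  have Nint: "w \<in> interior N" if wN: "w \<in> N" and wd: "\<Delta> w \<noteq> 0" for w
  proof -
    obtain y where y: "y \<in> ball z0 r" "w = \<theta> y" using wN by (auto simp: N_def)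
    show ?thesis unfolding y(2) N_def
      by (rule theta_open_free[OF \<Delta>(3)]) (use that y in \<open>simp_all add: interior_open\<close>)
  qed
  have "open (ball z0 r \<inter> \<theta> -` W)"
    by (intro open_Int open_ball open_vimage theta_continuous) (simp add: W_def)
  moreover have "z0 \<in> ball z0 r \<inter> \<theta> -` W" using r \<rho> by (simp add: W_def)
  moreover obtain z1 where "\<Delta> (\<theta> z1) \<noteq> 0" using \<Delta>(2) by blast
  ultimately obtain z2 where z2: "z2 \<in> ball z0 r \<inter> \<theta> -` W" "\<Delta> (\<theta> z2) \<noteq> 0"
    using polyfuns_zeros_no_interior[OF theta_compose[OF \<Delta>(1)], of z1 "ball z0 r \<inter> \<theta> -` W"] by blast
  define a where "a = \<theta> z2"
  have a: "a \<in> W" "a \<in> N" "\<Delta> a \<noteq> 0" using z2 by (auto simp: a_def N_def)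
  have gen: "b \<in> B" if b: "b \<in> W" "\<Delta> b \<noteq> 0" for b
  proof -
    let ?L = "\<lambda>c. a + c *s (b - a)"
    let ?D = "{c. ?L c \<in> W}" and ?T = "{c. \<Delta> (?L c) = 0}"
    have cont: "continuous_on UNIV ?L"
      by (rule continuous_on_add[OF continuous_on_const linear_continuous_on[OF bounded_linear_scalar_mult_vec]])
    have opn: "open {c. ?L c \<in> U}" if "open U" for U by (rule open_line_preimage[OF that])
    have conv: "convex ?D"
    proof (rule convexI)
      fix x y :: complex and s t :: real
      assume xy: "x \<in> ?D" "y \<in> ?D" "0 \<le> s" "0 \<le> t" "s + t = 1"
      have "?L (s *\<^sub>R x + t *\<^sub>R y) = s *\<^sub>R ?L x + t *\<^sub>R ?L y"
      proof -
        interpret line: bounded_linear "\<lambda>c. c *s (b - a)" by (rule bounded_linear_scalar_mult_vec)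
        have "s *\<^sub>R a + t *\<^sub>R a = a" using xy(5) unfolding scaleR_add_left[symmetric] by simp
        then show ?thesis unfolding line.add line.scaleR scaleR_add_right
          by (metis (no_types, opaque_lifting) add.assoc add.commute)
      qed
      moreover have "convex W" by (simp add: W_def)
      ultimately show "s *\<^sub>R x + t *\<^sub>R y \<in> ?D" using convexD[of W "?L x" "?L y" s t] xy by simp
    qed
    have "\<Delta> (?L 0) \<noteq> 0" using a(3) by simp
    then have "finite ?T" by (rule polyfuns_zeros_line[OF \<Delta>(1)])
    moreover have "open ?D" by (rule opn) (simp add: W_def)
    \<comment> \<open>The line is a copy of the complex plane: removing the finitely many zeros of
      \<Delta> from a convex open subset leaves it connected.\<close>
    ultimately have conn: "connected (?D - ?T)"
      using connected_open_delete_finite[of ?D ?T] convex_connected[OF conv] by simp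
    let ?U = "{c. ?L c \<in> interior N}" and ?V = "{c. ?L c \<in> - B}"
    have U: "open ?U" by (rule opn) simp
    have V: "open ?V" by (rule opn) (use Bc in \<open>simp add: open_Compl\<close>)
    have UV: "?U \<inter> ?V \<inter> (?D - ?T) = {}" using interior_subset[of N] NB by blast
    have cov: "?D - ?T \<subseteq> ?U \<union> ?V" using WN Nint by blast
    have "0 \<in> ?U \<inter> (?D - ?T)" using a Nint[OF a(2,3)] by simp
    then have "?V \<inter> (?D - ?T) = {}" using connectedD[OF conn U V UV cov] by blast
    moreover have "?L 1 = b" by simp
    then have "1 \<in> ?D - ?T" using b by (simp only: Diff_iff mem_Collect_eq) simp
    ultimately have "\<not> ?L 1 \<in> - B" by blast
    then show ?thesis unfolding \<open>?L 1 = b\<close> by simp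
  qed
  \<comment> \<open>Points of \<open>W\<close> where \<Delta> vanishes are reached because
    \<open>B\<close> is closed and the zeros of \<Delta> have no interior.\<close>
  have "W \<subseteq> B"
  proof (rule ccontr)
    assume "\<not> W \<subseteq> B"
    then have "W - B \<noteq> {}" by blast
    moreover have "open (W - B)" using Bc by (simp add: W_def open_Diff)
    ultimately obtain b where "b \<in> W - B" "\<Delta> b \<noteq> 0"
      using polyfuns_zeros_no_interior[OF \<Delta>(1) a(3), of "W - B"] by blast
    then show False using gen by blast
  qed
  also have "B \<subseteq> \<theta> ` cball z0 e" unfolding B_def using r by (intro image_mono) (simp add: subset_cball)
  finally have "W \<subseteq> \<theta> ` cball z0 e" .
  moreover have "open W" "\<theta> z0 \<in> W" using \<rho> by (auto simp: W_def)
  ultimately show ?thesis by (meson interiorI)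
qed

end

section \<open>The Shilov boundary of the image\<close>

text \<open>Cauchy-Schwarz gives \<open>norm x \<le> 1\<close>, with equality also at unimodular
  multiples of \<zeta>. Averaging with 1 excludes these: a modulus of 1 forces
  \<open>Re x \<ge> 1\<close>, and then the distance from \<open>z\<close> to \<zeta> is 0.\<close>

lemma peak_function_bound:
  fixes \<zeta> z :: "complex ^ 'd"
  assumes R: "R > 0" and \<zeta>: "norm \<zeta> = R" and z: "norm z \<le> R"
  defines "x \<equiv> (\<Sum>i\<in>UNIV. cnj (\<zeta> $ i) * z $ i) / complex_of_real (R\<^sup>2)"
  shows "norm ((1 + x) / 2) \<le> 1" "norm ((1 + x) / 2) = 1 \<Longrightarrow> z = \<zeta>"
proof -
  have "norm (\<Sum>i\<in>UNIV. cnj (\<zeta> $ i) * z $ i) \<le> (\<Sum>i\<in>UNIV. \<bar>norm (\<zeta> $ i)\<bar> * \<bar>norm (z $ i)\<bar>)"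
    by (rule order.trans[OF norm_sum]) (simp add: norm_mult)
  also have "\<dots> \<le> norm \<zeta> * norm z" unfolding norm_vec_def by (rule L2_set_mult_ineq)
  also have "\<dots> \<le> R * R" using \<zeta> z R by (intro mult_mono) auto
  finally have "norm (\<Sum>i\<in>UNIV. cnj (\<zeta> $ i) * z $ i) \<le> R\<^sup>2" by (simp add: power2_eq_square)
  moreover have "norm (complex_of_real (R\<^sup>2)) = R\<^sup>2" unfolding norm_of_real by simp
  ultimately have x: "norm x \<le> 1" unfolding x_def norm_divide using R by simp
  then show le: "norm ((1 + x) / 2) \<le> 1"
    using norm_triangle_ineq[of 1 x] by (simp add: norm_divide)
  assume "norm ((1 + x) / 2) = 1"
  then have "norm (1 + x) = 2" by (simp add: norm_divide)
  then have "(norm (1 + x))\<^sup>2 = 4" by simp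
  moreover have "(norm (1 + x))\<^sup>2 = 1 + 2 * Re x + (norm x)\<^sup>2"
    unfolding cmod_power2 by (simp add: power2_eq_square algebra_simps)
  moreover have "(norm x)\<^sup>2 \<le> 1" using x by (simp add: power_le_one)
  ultimately have "Re x \<ge> 1" by linarith
  moreover have "Re x = (z \<bullet> \<zeta>) / R\<^sup>2"
  proof -
    have "Re (\<Sum>i\<in>UNIV. cnj (\<zeta> $ i) * z $ i) = z \<bullet> \<zeta>"
      by (simp add: inner_vec_def inner_complex_def mult.commute)
    then show ?thesis unfolding x_def by (simp add: Re_divide_of_real)
  qed
  ultimately have "z \<bullet> \<zeta> \<ge> R\<^sup>2" using R by (simp add: le_divide_eq)
  moreover have "(norm (z - \<zeta>))\<^sup>2 = (norm z)\<^sup>2 - 2 * (z \<bullet> \<zeta>) + (norm \<zeta>)\<^sup>2"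
    by (simp add: power2_norm_eq_inner inner_diff_left inner_diff_right inner_commute)
  moreover have "(norm z)\<^sup>2 \<le> R\<^sup>2" using z by (simp add: power_mono)
  ultimately have "(norm (z - \<zeta>))\<^sup>2 \<le> 0" using \<zeta> by simp
  then show "z = \<zeta>" by simp
qed

locale model_action = model_domain \<Omega> m R + basic_map G \<theta>
  for \<Omega> :: "(complex ^ 'd) set" and m R and G :: "(complex ^ 'd ^ 'd) set" and \<theta> +
  assumes action: "\<And>\<sigma>. \<sigma> \<in> G \<Longrightarrow> symmetry \<sigma>"
begin

lemma action_closure: "\<sigma> \<in> G \<Longrightarrow> z \<in> closure \<Omega> \<Longrightarrow> \<sigma> *v z \<in> closure \<Omega>"
proof -
  assume s: "\<sigma> \<in> G" and z: "z \<in> closure \<Omega>"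
  have "bounded_linear (\<lambda>z. \<sigma> *v z)" using linear_matrix_complex linear_conv_bounded_linear by blast
  then have "(\<lambda>z. \<sigma> *v z) ` closure \<Omega> \<subseteq> closure ((\<lambda>z. \<sigma> *v z) ` \<Omega>)"
    by (rule closure_bounded_linear_image_subset)
  then show ?thesis using action[OF s] z by (auto simp: symmetry_def)
qed

lemma compact_closure_domain: "compact (closure \<Omega>)"
  using closure_sub bounded_subset[OF bounded_cball] by (simp add: compact_eq_bounded_closed)

lemma closure_theta: "closure (\<theta> ` \<Omega>) = \<theta> ` closure \<Omega>"
proof
  have "closed (\<theta> ` closure \<Omega>)"
    by (intro compact_imp_closed compact_continuous_image theta_continuous compact_closure_domain)
  then show "closure (\<theta> ` \<Omega>) \<subseteq> \<theta> ` closure \<Omega>"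
    by (intro closure_minimal image_mono closure_subset)
  show "\<theta> ` closure \<Omega> \<subseteq> closure (\<theta> ` \<Omega>)"
    by (rule image_closure_subset[OF theta_continuous closed_closure closure_subset])
qed

text \<open>If a closed \<open>K\<close> with the maximum property missed
  \<theta>\<open>\<zeta>\<close>, the peak function would be at most \<open>c < 1\<close> on the
  preimage of \<open>K\<close>, which is stable under the group. The symmetrized powers would then
  tend to 0 at \<zeta>. Their actual limit there is the order of the stabilizer of \<zeta>, which is
  at least 1.\<close>

theorem theta_boundary:
  assumes \<zeta>: "\<zeta> \<in> space m"
  shows "\<theta> \<zeta> \<in> shilov_boundary (\<theta> ` \<Omega>)"
  unfolding shilov_boundary_def
proof (rule InterI, clarify, rule ccontr)
  fix K
  assume K: "closed K" "K \<subseteq> closure (\<theta> ` \<Omega>)"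
    and max: "\<forall>f. continuous_on (closure (\<theta> ` \<Omega>)) f \<and> holomorphic_several f (\<theta> ` \<Omega>) \<longrightarrow>
      (\<forall>z\<in>closure (\<theta> ` \<Omega>). \<exists>w\<in>K. norm (f z) \<le> norm (f w))"
    and notin: "\<theta> \<zeta> \<notin> K"
  have \<zeta>R: "norm \<zeta> = R" using boundary_sphere \<zeta> by auto
  have \<zeta>c: "\<zeta> \<in> closure \<Omega>" using boundary_sub \<zeta> by blast
  have R: "R > 0"
  proof -
    obtain e where e: "e > 0" "cball 0 e \<subseteq> \<Omega>" using open_domain zero_in by (meson open_contains_cball)
    have "\<exists>x::complex ^ 'd. norm x = e" using vector_choose_size[of e] e(1) by (metis less_imp_le)
    then obtain x :: "complex ^ 'd" where "norm x = e" by blast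
    then have "x \<in> closure \<Omega>" using e closure_subset by (metis mem_cball_0 order_refl subsetD)
    then show ?thesis using closure_sub \<open>norm x = e\<close> e(1) by (meson less_le_trans mem_cball_0 subsetD)
  qed
  define h where "h z = (1 + (\<Sum>i\<in>UNIV. cnj (\<zeta> $ i) * z $ i) / complex_of_real (R\<^sup>2)) / 2" for z
  have hp: "h \<in> polyfuns" unfolding h_def[abs_def] divide_inverse
    by (intro polyfuns_mult polyfuns_add polyfuns_sum polyfuns_const polyfuns_coord)
  have h_le: "norm (h z) \<le> 1" and h_eq: "norm (h z) = 1 \<Longrightarrow> z = \<zeta>" if "z \<in> closure \<Omega>" for z
    using peak_function_bound[OF R \<zeta>R, of z] that closure_sub unfolding h_def by auto
  have h\<zeta>: "h \<zeta> = 1"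
  proof -
    have "(\<Sum>i\<in>UNIV. cnj (\<zeta> $ i) * \<zeta> $ i) = complex_of_real (\<Sum>i\<in>UNIV. (norm (\<zeta> $ i))\<^sup>2)"
      unfolding of_real_sum complex_norm_square by (simp add: mult.commute)
    also have "(\<Sum>i\<in>UNIV. (norm (\<zeta> $ i))\<^sup>2) = R\<^sup>2"
      unfolding \<zeta>R[symmetric] norm_vec_def L2_set_def by (rule real_sqrt_pow2[symmetric]) (simp add: sum_nonneg)
    finally show ?thesis using R by (simp add: h_def)
  qed
  define K1 where "K1 = closure \<Omega> \<inter> \<theta> -` K"
  have "compact K1" unfolding K1_def
    by (rule compact_Int_closed[OF compact_closure_domain closed_vimage[OF K(1) theta_continuous]])
  have lt: "norm (h z) < 1" if "z \<in> K1" for z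
    using h_le[of z] h_eq[of z] that notin unfolding K1_def by (metis IntE le_neq_trans vimageE)
  obtain c where c: "0 \<le> c" "c < 1" "\<And>z. z \<in> K1 \<Longrightarrow> norm (h z) \<le> c"
  proof (cases "K1 = {}")
    case True then show ?thesis using that[of 0] by simp
  next
    case False
    obtain y where y: "y \<in> K1" "\<And>z. z \<in> K1 \<Longrightarrow> norm (h z) \<le> norm (h y)"
      using continuous_attains_sup[OF \<open>compact K1\<close> False, of "\<lambda>z. norm (h z)"]
        continuous_on_norm[OF continuous_on_polyfuns[OF hp]] by blast
    show ?thesis using that[of "norm (h y)"] lt[OF y(1)] y(2) by simp
  qed
  define F where "F n z = (\<Sum>\<sigma>\<in>G. h (\<sigma> *v z) ^ n)" for n z
  have bound: "norm (F n \<zeta>) \<le> real (card G) * c ^ n" for n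
  proof -
    have Fp: "F n \<in> polyfuns" unfolding F_def[abs_def] by (intro polyfuns_sum polyfuns_power polyfuns_matrix hp)
    have "F n (\<tau> *v z) = F n z" if "\<tau> \<in> G" for \<tau> z
      unfolding F_def using sum.reindex_bij_betw[OF bij_mult[OF that], of "\<lambda>\<sigma>. h (\<sigma> *v z) ^ n"]
      by (simp add: matrix_vector_mul_assoc)
    then obtain q where q: "q \<in> polyfuns" "\<And>z. F n z = q (\<theta> z)" using invariant_factor[OF Fp] by blast
    have "\<theta> \<zeta> \<in> closure (\<theta> ` \<Omega>)" unfolding closure_theta using \<zeta>c by blast
    then obtain w where w: "w \<in> K" "norm (q (\<theta> \<zeta>)) \<le> norm (q w)"
      using max[rule_format, of q "\<theta> \<zeta>"] continuous_on_polyfuns[OF q(1)] holomorphic_several_polyfuns[OF q(1)] by blast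
    obtain z where z: "z \<in> closure \<Omega>" "w = \<theta> z" using w(1) K(2) unfolding closure_theta by blast
    have "norm (h (\<sigma> *v z) ^ n) \<le> c ^ n" if "\<sigma> \<in> G" for \<sigma>
    proof -
      have "\<sigma> *v z \<in> K1" unfolding K1_def using action_closure[OF that z(1)] theta_invariant[OF that, of z] z w by simp
      then show ?thesis unfolding norm_power by (intro power_mono c) auto
    qed
    then have "norm (F n z) \<le> (\<Sum>\<sigma>\<in>G. c ^ n)" unfolding F_def by (intro order.trans[OF norm_sum] sum_mono)
    then show ?thesis using w(2) unfolding z(2) q(2)[symmetric] by simp
  qed
  have "(\<lambda>n. real (card G) * c ^ n) \<longlonglongrightarrow> real (card G) * 0"
    using c by (intro tendsto_intros LIMSEQ_power_zero) simp
  then have "(\<lambda>n. F n \<zeta>) \<longlonglongrightarrow> 0"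
    by (intro Lim_null_comparison[OF eventuallyI[OF bound]]) simp
  moreover have "(\<lambda>n. F n \<zeta>) \<longlonglongrightarrow> (\<Sum>\<sigma>\<in>G. if \<sigma> *v \<zeta> = \<zeta> then 1 else 0)"
    unfolding F_def
  proof (rule tendsto_sum)
    fix \<sigma> assume s: "\<sigma> \<in> G"
    show "(\<lambda>n. h (\<sigma> *v \<zeta>) ^ n) \<longlonglongrightarrow> (if \<sigma> *v \<zeta> = \<zeta> then 1 else 0)"
    proof (cases "\<sigma> *v \<zeta> = \<zeta>")
      case True then show ?thesis by (simp add: h\<zeta>)
    next
      case False
      then have "norm (h (\<sigma> *v \<zeta>)) < 1"
        using h_le[OF action_closure[OF s \<zeta>c]] h_eq[OF action_closure[OF s \<zeta>c]] by linarith
      then show ?thesis using False by (simp add: LIMSEQ_power_zero)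
    qed
  qed
  ultimately have "(\<Sum>\<sigma>\<in>G. if \<sigma> *v \<zeta> = \<zeta> then 1 else (0::complex)) = 0" using LIMSEQ_unique by blast
  then have "of_nat (card {\<sigma> \<in> G. \<sigma> *v \<zeta> = \<zeta>}) = (0::complex)"
    using fin by (simp add: sum.If_cases Int_def)
  moreover have "mat 1 \<in> {\<sigma> \<in> G. \<sigma> *v \<zeta> = \<zeta>}" using one_in by simp
  moreover have "finite {\<sigma> \<in> G. \<sigma> *v \<zeta> = \<zeta>}" using fin by simp
  ultimately show False unfolding of_nat_eq_0_iff card_eq_0_iff by blast
qed

end

section \<open>Isotypic subspaces of the Hardy space\<close>

lemma one_dim_rep_contragredient:
  assumes "finite G" "pseudoreflection_group G" "one_dim_rep G \<rho>"
  shows "one_dim_rep G (contragredient \<rho>)"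
proof -
  interpret pr_rep G \<rho> by unfold_locales (rule assms)+
  have "contragredient \<rho> (\<sigma> ** \<tau>) = contragredient \<rho> \<sigma> * contragredient \<rho> \<tau>" if "\<sigma> \<in> G" "\<tau> \<in> G" for \<sigma> \<tau>
    using that by (simp add: contragredient_def rep_inv rep_mult mult_in)
  then show ?thesis unfolding one_dim_rep_def hom_def
    using rep_nz inv_in by (auto simp: contragredient_def)
qed

context model_action
begin

lemma hardy_sum:
  assumes "finite A" "\<And>i. i \<in> A \<Longrightarrow> f i \<in> hardy \<Omega> m"
  shows "(\<lambda>z. \<Sum>i\<in>A. f i z) \<in> hardy \<Omega> m"
  using assms
proof (induction A)
  case empty
  then show ?case by (simp add: hardy_zero)
next
  case (insert i A)
  then have "f i \<in> hardy \<Omega> m" "(\<lambda>z. \<Sum>i\<in>A. f i z) \<in> hardy \<Omega> m" by auto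
  from hardy_lincomb[OF this, of 1] insert.hyps show ?case by simp
qed

text \<open>The condition is written with \<sigma> and not its inverse, to match the behaviour of
  \<open>lpoly\<close>. The ranges of \<open>rep_proj\<close> therefore appear with the
  contragredient.\<close>

definition semi_hardy :: "(complex ^ 'd ^ 'd \<Rightarrow> complex) \<Rightarrow> (complex ^ 'd \<Rightarrow> complex) set" where
  "semi_hardy \<omega> = {h \<in> hardy \<Omega> m. \<forall>\<sigma>\<in>G. \<forall>z. h (\<sigma> *v z) = \<omega> \<sigma> * h z}"

lemma semi_hardy_diff: "h \<in> semi_hardy \<omega> \<Longrightarrow> k \<in> semi_hardy \<omega> \<Longrightarrow> (\<lambda>z. h z - k z) \<in> semi_hardy \<omega>"
  by (auto simp: semi_hardy_def hardy_diff right_diff_distrib)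

text \<open>Reindexing by inverses turns the projection into an average of
  \<tau>\<open>\<sigma> * \<phi> (\<sigma> *v z)\<close>. Translating the summation index shows how
  it transforms, and on functions of this type it is the identity.\<close>

lemma rep_proj_image:
  assumes "one_dim_rep G \<tau>"
  shows "rep_proj G \<tau> ` hardy \<Omega> m = semi_hardy (contragredient \<tau>)"
proof
  interpret rep: pr_rep G \<tau> by unfold_locales (rule assms)
  have eq: "rep_proj G \<tau> \<phi> z = 1 / of_nat (card G) * (\<Sum>\<sigma>\<in>G. \<tau> \<sigma> * \<phi> (\<sigma> *v z))" for \<phi> z
    unfolding rep_proj_def act_def using sum.reindex_bij_betw[OF bij_inv, of "\<lambda>\<sigma>. \<tau> \<sigma> * \<phi> (\<sigma> *v z)"] by simp
  show "rep_proj G \<tau> ` hardy \<Omega> m \<subseteq> semi_hardy (contragredient \<tau>)"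
  proof
    fix h assume "h \<in> rep_proj G \<tau> ` hardy \<Omega> m"
    then obtain \<phi> where \<phi>: "\<phi> \<in> hardy \<Omega> m" "h = rep_proj G \<tau> \<phi>" by blast
    have "(\<lambda>z. 1 / of_nat (card G) * (\<Sum>\<sigma>\<in>G. \<tau> \<sigma> * \<phi> (\<sigma> *v z))) \<in> hardy \<Omega> m"
      by (intro hardy_cmult hardy_sum fin symmetry_hardy action \<phi>)
    then have "h \<in> hardy \<Omega> m" unfolding \<phi>(2) eq[abs_def] .
    moreover have "h (\<alpha> *v z) = contragredient \<tau> \<alpha> * h z" if \<alpha>: "\<alpha> \<in> G" for \<alpha> z
    proof -
      have "(\<Sum>\<sigma>\<in>G. \<tau> \<sigma> * \<phi> (\<sigma> *v (\<alpha> *v z))) = (\<Sum>\<sigma>\<in>G. 1 / \<tau> \<alpha> * (\<tau> (\<sigma> ** \<alpha>) * \<phi> ((\<sigma> ** \<alpha>) *v z)))"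
        by (rule sum.cong[OF refl]) (use \<alpha> rep.rep_nz[OF \<alpha>] in \<open>simp add: rep.rep_mult matrix_vector_mul_assoc\<close>)
      also have "\<dots> = 1 / \<tau> \<alpha> * (\<Sum>\<sigma>\<in>G. \<tau> \<sigma> * \<phi> (\<sigma> *v z))"
        unfolding sum_distrib_left[symmetric]
        using sum.reindex_bij_betw[OF bij_mult[OF \<alpha>], of "\<lambda>\<sigma>. \<tau> \<sigma> * \<phi> (\<sigma> *v z)"] by simp
      finally show ?thesis unfolding \<phi>(2) eq contragredient_def rep.rep_inv[OF \<alpha>] by simp
    qed
    ultimately show "h \<in> semi_hardy (contragredient \<tau>)" by (simp add: semi_hardy_def)
  qed
  show "semi_hardy (contragredient \<tau>) \<subseteq> rep_proj G \<tau> ` hardy \<Omega> m"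
  proof
    fix h assume h: "h \<in> semi_hardy (contragredient \<tau>)"
    have "rep_proj G \<tau> h z = h z" for z
    proof -
      have "(\<Sum>\<sigma>\<in>G. \<tau> \<sigma> * h (\<sigma> *v z)) = (\<Sum>\<sigma>\<in>G. h z)"
        by (rule sum.cong[OF refl]) (use h rep.rep_nz in \<open>simp add: semi_hardy_def contragredient_def rep.rep_inv\<close>)
      then show ?thesis using card_pos by (simp add: eq)
    qed
    then have "h = rep_proj G \<tau> h" by (simp add: fun_eq_iff)
    then show "h \<in> rep_proj G \<tau> ` hardy \<Omega> m" using h by (auto simp: semi_hardy_def)
  qed
qed

lemma semi_hardy_toeplitz:
  assumes f: "f \<in> semi_hardy \<omega>" and u: "u \<in> Linfty m"
    and inv: "\<And>\<sigma>. \<sigma> \<in> G \<Longrightarrow> AE \<zeta> in m. act \<sigma> u \<zeta> = u \<zeta>"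
    and nz: "\<And>\<sigma>. \<sigma> \<in> G \<Longrightarrow> \<omega> \<sigma> \<noteq> 0"
  shows "hardy_toeplitz \<Omega> m u f \<in> semi_hardy \<omega>"
proof -
  have f': "f \<in> hardy \<Omega> m" and eq: "\<And>\<sigma> z. \<sigma> \<in> G \<Longrightarrow> f (\<sigma> *v z) = \<omega> \<sigma> * f z"
    using f by (auto simp: semi_hardy_def)
  have "hardy_toeplitz \<Omega> m u f (\<sigma> *v z) = \<omega> \<sigma> * hardy_toeplitz \<Omega> m u f z" if s: "\<sigma> \<in> G" for \<sigma> z
  proof (rule hardy_toeplitz_equivariant[OF action[OF s] action[OF inv_in[OF s]] f' u _ nz[OF s] eq[OF s]])
    show "AE z in m. u (\<sigma> *v z) = u z"
      using inv[OF inv_in[OF s]] unfolding act_def matrix_inv_matrix_inv[OF invertible[OF s]] .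
  qed
  then show ?thesis using hardy_toeplitz(1)[OF f' u] by (simp add: semi_hardy_def)
qed

end

section \<open>The Hardy space of the quotient domain\<close>

locale quotient_hardy = model_action \<Omega> m rad G \<theta> + generating_data G \<rho> a v
  for \<Omega> :: "(complex ^ 'd) set" and m rad and G :: "(complex ^ 'd ^ 'd) set" and \<theta> \<rho> a v
begin

abbreviation "M \<equiv> qmeasure \<Omega> m \<theta> lpoly"
abbreviation "\<Gamma> \<equiv> Gamma_hardy \<Omega> G \<theta> lpoly"
abbreviation "Q \<equiv> qhardy \<Omega> m G \<theta> lpoly"
abbreviation "qbv \<equiv> qboundary_value \<Omega> m G \<theta> lpoly"

definition \<kappa> :: complex where "\<kappa> = 1 / of_real (sqrt (real (card G)))"

lemma kappa_nz: "\<kappa> \<noteq> 0" and kappa_sq: "\<kappa> * cnj \<kappa> = 1 / of_nat (card G)"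
  and kappa_norm: "(norm \<kappa>)\<^sup>2 = 1 / real (card G)"
proof -
  show "\<kappa> \<noteq> 0" using card_pos by (simp add: \<kappa>_def)
  show n: "(norm \<kappa>)\<^sup>2 = 1 / real (card G)" by (simp add: \<kappa>_def norm_divide power_divide)
  show "\<kappa> * cnj \<kappa> = 1 / of_nat (card G)" unfolding complex_norm_square[symmetric] n by simp
qed

lemma Gamma_eq: "\<Gamma> f z = (if z \<in> \<Omega> then \<kappa> * lpoly z * f (\<theta> z) else 0)"
  by (simp add: Gamma_hardy_def \<kappa>_def)

text \<open>This is where the theorem on the Shilov boundary enters: it makes
  \<open>qmeasure\<close> an honest image measure, so that integrals can be transported.\<close>

lemma theta_measurable: "\<theta> \<in> measurable m (restrict_space borel (shilov_boundary (\<theta> ` \<Omega>)))"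
proof (rule measurable_restrict_space2)
  have "\<theta> \<in> borel_measurable (restrict_space borel (space m))"
    by (intro measurable_restrict_space1 borel_measurable_continuous_onI theta_continuous)
  then show "\<theta> \<in> borel_measurable m" unfolding measurable_cong_sets[OF sets_m refl] .
qed (use theta_boundary in blast)

lemma borel_measurable_M: "borel_measurable M = borel_measurable (restrict_space borel (shilov_boundary (\<theta> ` \<Omega>)))"
  by (simp add: qmeasure_def)

lemma compose_theta_measurable: "f \<in> borel_measurable M \<Longrightarrow> (\<lambda>\<zeta>. f (\<theta> \<zeta>)) \<in> borel_measurable m"
  unfolding borel_measurable_M by (rule measurable_compose[OF theta_measurable])

lemma weight_measurable: "(\<lambda>\<zeta>. (norm (lpoly \<zeta>))\<^sup>2) \<in> borel_measurable m"
  using polyfuns_measurable[OF lpoly_polyfuns] by measurable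

lemma theta_measurable_density:
  "\<theta> \<in> measurable (density m w) (restrict_space borel (shilov_boundary (\<theta> ` \<Omega>)))"
  using theta_measurable by simp

lemma integral_M:
  fixes h :: "complex ^ 'd \<Rightarrow> 'b :: {banach, second_countable_topology}"
  assumes h: "h \<in> borel_measurable M"
  shows "(LINT w|M. h w) = (LINT \<zeta>|m. (norm (lpoly \<zeta>))\<^sup>2 *\<^sub>R h (\<theta> \<zeta>))"
    "integrable M h \<longleftrightarrow> integrable m (\<lambda>\<zeta>. (norm (lpoly \<zeta>))\<^sup>2 *\<^sub>R h (\<theta> \<zeta>))"
proof -
  have hr: "h \<in> borel_measurable (restrict_space borel (shilov_boundary (\<theta> ` \<Omega>)))"
    using h by (simp add: qmeasure_def)
  have hm: "(\<lambda>\<zeta>. h (\<theta> \<zeta>)) \<in> borel_measurable m" by (rule measurable_compose[OF theta_measurable hr])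
  have nn: "AE \<zeta> in m. 0 \<le> (norm (lpoly \<zeta>))\<^sup>2" by simp
  show "(LINT w|M. h w) = (LINT \<zeta>|m. (norm (lpoly \<zeta>))\<^sup>2 *\<^sub>R h (\<theta> \<zeta>))"
    unfolding qmeasure_def integral_distr[OF theta_measurable_density hr]
    by (rule integral_density[OF hm weight_measurable nn])
  show "integrable M h \<longleftrightarrow> integrable m (\<lambda>\<zeta>. (norm (lpoly \<zeta>))\<^sup>2 *\<^sub>R h (\<theta> \<zeta>))"
    unfolding qmeasure_def integrable_distr_eq[OF theta_measurable_density hr]
    by (rule integrable_density[OF hm weight_measurable nn])
qed

lemma finite_M: "finite_measure M"
proof -
  have "emeasure (density m (\<lambda>\<zeta>. ennreal ((norm (lpoly \<zeta>))\<^sup>2))) (space m) = (\<integral>\<^sup>+ \<zeta>. ennreal ((norm (lpoly \<zeta>))\<^sup>2) \<partial>m)"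
    by (subst emeasure_density) (use weight_measurable in \<open>auto intro!: nn_integral_cong\<close>)
  also have "\<dots> < \<infinity>" using nn_integral_L2[OF polyfuns_L2[OF lpoly_polyfuns]] by simp
  finally interpret D: finite_measure "density m (\<lambda>\<zeta>. ennreal ((norm (lpoly \<zeta>))\<^sup>2))"
    by (intro finite_measureI) simp
  show ?thesis unfolding qmeasure_def by (rule D.finite_measure_distr[OF theta_measurable_density])
qed

lemma L2_M_iff: "f \<in> L2 M \<longleftrightarrow> f \<in> borel_measurable M \<and> (\<lambda>\<zeta>. lpoly \<zeta> * f (\<theta> \<zeta>)) \<in> L2 m"
proof (cases "f \<in> borel_measurable M")
  case True
  have "(\<lambda>w. (norm (f w))\<^sup>2) \<in> borel_measurable M" using True by measurable
  note int = integral_M(2)[OF this]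
  have meas: "(\<lambda>\<zeta>. lpoly \<zeta> * f (\<theta> \<zeta>)) \<in> borel_measurable m"
    by (rule borel_measurable_times[OF polyfuns_measurable[OF lpoly_polyfuns] compose_theta_measurable[OF True]])
  show ?thesis unfolding L2_def using True meas int by (simp add: norm_mult power_mult_distrib)
qed (simp add: L2_def)

lemma L2_inner_M:
  assumes f: "f \<in> borel_measurable M" and g: "g \<in> borel_measurable M"
  shows "L2_inner M f g = L2_inner m (\<lambda>\<zeta>. lpoly \<zeta> * f (\<theta> \<zeta>)) (\<lambda>\<zeta>. lpoly \<zeta> * g (\<theta> \<zeta>))"
proof -
  have "(\<lambda>w. f w * cnj (g w)) \<in> borel_measurable M"
    by (rule borel_measurable_times[OF f borel_measurable_cnj[OF g]])
  from integral_M(1)[OF this] show ?thesis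
    unfolding L2_inner_def scaleR_conv_of_real complex_norm_square by (simp add: mult_ac)
qed

lemma L2_norm_M:
  assumes f: "f \<in> borel_measurable M"
  shows "L2_norm M f = L2_norm m (\<lambda>\<zeta>. lpoly \<zeta> * f (\<theta> \<zeta>))"
proof -
  have "(\<lambda>w. (norm (f w))\<^sup>2) \<in> borel_measurable M" using f by measurable
  from integral_M(1)[OF this] show ?thesis
    unfolding L2_norm_def by (simp add: norm_mult power_mult_distrib)
qed

lemma polyfuns_measurable_M: "q \<in> polyfuns \<Longrightarrow> q \<in> borel_measurable M"
  unfolding borel_measurable_M
  by (intro measurable_restrict_space1 borel_measurable_continuous_onI continuous_on_polyfuns)

lemma polyfuns_L2_M: "q \<in> polyfuns \<Longrightarrow> q \<in> L2 M"
  unfolding L2_M_iff by (intro conjI polyfuns_measurable_M polyfuns_L2 polyfuns_mult lpoly_polyfuns theta_compose)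

section \<open>The map \<Gamma> between the Hardy spaces\<close>

lemma qhardy_norm_sq_Gamma:
  assumes f: "holomorphic_several f (\<theta> ` \<Omega>)"
  shows "qhardy_norm_sq m G \<theta> lpoly f =
    (SUP r\<in>{0<..<1}. \<integral>\<^sup>+ \<zeta>. ennreal ((norm (\<Gamma> f (r *\<^sub>R \<zeta>)))\<^sup>2) \<partial>m)"
  unfolding qhardy_norm_sq_def SUP_mult_left_ennreal
proof (rule SUP_cong[OF refl])
  fix r :: real assume r: "r \<in> {0<..<1}"
  have cont: "continuous_on \<Omega> (\<lambda>z. f (\<theta> z))"
    by (intro holomorphic_several_continuous_on holomorphic_several_compose_polynomial_map[OF f] theta_polyfuns)
  have m1: "(\<lambda>\<zeta>. f (\<theta> (r *\<^sub>R \<zeta>))) \<in> borel_measurable m"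
    using L2D(1)[OF dilate_L2[OF cont, of r]] r by (simp add: dilate_def[abs_def])
  have m2: "(\<lambda>\<zeta>. lpoly (r *\<^sub>R \<zeta>)) \<in> borel_measurable m"
    using polyfuns_measurable[OF dilate_polyfuns[OF lpoly_polyfuns, of r]] by (simp add: dilate_def[abs_def])
  let ?A = "\<lambda>\<zeta>. ennreal ((norm (f (\<theta> (r *\<^sub>R \<zeta>))))\<^sup>2 * (norm (lpoly (r *\<^sub>R \<zeta>)))\<^sup>2)"
  have "?A \<in> borel_measurable m" using m1 m2 by measurable
  then have "ennreal (1 / real (card G)) * (\<integral>\<^sup>+ \<zeta>. ?A \<zeta> \<partial>m) = (\<integral>\<^sup>+ \<zeta>. ennreal (1 / real (card G)) * ?A \<zeta> \<partial>m)"
    by (rule nn_integral_cmult[symmetric])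
  also have "\<dots> = (\<integral>\<^sup>+ \<zeta>. ennreal ((norm (\<Gamma> f (r *\<^sub>R \<zeta>)))\<^sup>2) \<partial>m)"
  proof (rule nn_integral_cong)
    fix \<zeta> assume "\<zeta> \<in> space m"
    then have "r *\<^sub>R \<zeta> \<in> \<Omega>" using dilated_in[OF space_closure] r by simp
    then show "ennreal (1 / real (card G)) * ?A \<zeta> = ennreal ((norm (\<Gamma> f (r *\<^sub>R \<zeta>)))\<^sup>2)"
      by (simp add: Gamma_eq norm_mult power_mult_distrib kappa_norm ennreal_mult''[symmetric] mult_ac)
  qed
  finally show "ennreal (1 / real (card G)) * (\<integral>\<^sup>+ \<zeta>. ?A \<zeta> \<partial>m) =
      (\<integral>\<^sup>+ \<zeta>. ennreal ((norm (\<Gamma> f (r *\<^sub>R \<zeta>)))\<^sup>2) \<partial>m)" .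
qed

lemma Gamma_holomorphic:
  assumes f: "holomorphic_several f (\<theta> ` \<Omega>)"
  shows "holomorphic_several (\<Gamma> f) \<Omega>"
proof -
  have "holomorphic_several (\<lambda>z. \<kappa> * lpoly z * f (\<theta> z)) \<Omega>"
    by (intro holomorphic_several_mult holomorphic_several_const holomorphic_several_polyfuns lpoly_polyfuns
        holomorphic_several_compose_polynomial_map[OF f] theta_polyfuns)
  then show ?thesis by (subst holomorphic_several_cong[where g = "\<lambda>z. \<kappa> * lpoly z * f (\<theta> z)"]) (simp_all add: Gamma_eq)
qed

lemma qhardy_iff:
  "f \<in> Q \<longleftrightarrow> holomorphic_several f (\<theta> ` \<Omega>) \<and> (\<forall>w. w \<notin> \<theta> ` \<Omega> \<longrightarrow> f w = 0) \<and> \<Gamma> f \<in> hardy \<Omega> m"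
proof (cases "holomorphic_several f (\<theta> ` \<Omega>)")
  case True
  have "\<forall>z. z \<notin> \<Omega> \<longrightarrow> \<Gamma> f z = 0" by (simp add: Gamma_eq)
  then have "\<Gamma> f \<in> hardy \<Omega> m \<longleftrightarrow> qhardy_norm_sq m G \<theta> lpoly f < \<infinity>"
    unfolding hardy_def qhardy_norm_sq_Gamma[OF True] using Gamma_holomorphic[OF True] by simp
  then show ?thesis unfolding qhardy_def using True by simp
qed (simp add: qhardy_def)

lemma Gamma_semi_hardy: "f \<in> Q \<Longrightarrow> \<Gamma> f \<in> semi_hardy \<rho>"
  unfolding semi_hardy_def
  by (simp add: qhardy_iff Gamma_eq symmetry_in_iff[OF action] lpoly_semi_invariant theta_invariant)

text \<open>The points of \<Omega> where the two pullbacks differ form an open set. If nonempty, it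
  contains a point where \<open>lpoly\<close> does not vanish, and there the images under \<Gamma>
  differ.\<close>

lemma Gamma_inj:
  assumes f: "f \<in> Q" and g: "g \<in> Q" and eq: "\<Gamma> f = \<Gamma> g"
  shows "f = g"
proof (rule ccontr)
  assume "f \<noteq> g"
  then obtain w where w: "f w \<noteq> g w" by blast
  have "w \<in> \<theta> ` \<Omega>"
  proof (rule ccontr)
    assume "w \<notin> \<theta> ` \<Omega>"
    then show False using f g w unfolding qhardy_iff by simp
  qed
  then obtain z0 where z0: "z0 \<in> \<Omega>" "w = \<theta> z0" by (rule imageE)
  have hol: "holomorphic_several f (\<theta> ` \<Omega>)" "holomorphic_several g (\<theta> ` \<Omega>)" using f g qhardy_iff by blast+
  have cont: "continuous_on \<Omega> (\<lambda>z. f (\<theta> z) - g (\<theta> z))"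
    by (intro continuous_on_diff holomorphic_several_continuous_on
        holomorphic_several_compose_polynomial_map[OF hol(1) theta_polyfuns]
        holomorphic_several_compose_polynomial_map[OF hol(2) theta_polyfuns])
  let ?D = "\<Omega> \<inter> (\<lambda>z. f (\<theta> z) - g (\<theta> z)) -` (- {0})"
  have "open ?D" by (rule continuous_open_preimage[OF cont open_domain]) auto
  moreover have "?D \<noteq> {}" using z0 w by auto
  moreover obtain z1 where "lpoly z1 \<noteq> 0" using lpoly_nonzero by blast
  ultimately obtain z where z: "z \<in> ?D" "lpoly z \<noteq> 0"
    using polyfuns_zeros_no_interior[OF lpoly_polyfuns] by blast
  then show False using fun_cong[OF eq, of z] kappa_nz by (simp add: Gamma_eq)
qed

lemma hom_part_equivariant:
  assumes g: "g \<in> semi_hardy \<omega>" and s: "\<sigma> \<in> G"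
  shows "hom_part g n (\<sigma> *v z) = \<omega> \<sigma> * hom_part g n z"
proof -
  have hol: "holomorphic_several g \<Omega>" using g by (simp add: semi_hardy_def hardy_def)
  have "g (c *s (\<sigma> *v z)) = \<omega> \<sigma> * g (c *s z)" for c
    using g s unfolding semi_hardy_def by (simp add: vector_scalar_commute[symmetric])
  then have "hom_part g n (\<sigma> *v z) = (deriv ^^ n) (\<lambda>c. \<omega> \<sigma> * g (c *s z)) 0 / fact n" by (simp add: hom_part_def)
  also have "(deriv ^^ n) (\<lambda>c. \<omega> \<sigma> * g (c *s z)) 0 = \<omega> \<sigma> * (deriv ^^ n) (\<lambda>c. g (c *s z)) 0"
    by (rule higher_deriv_cmult[OF holomorphic_several_radial(1)[OF hol open_domain] _ holomorphic_several_radial(2)[OF hol open_domain]])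
       (simp add: zero_in)
  finally show ?thesis by (simp add: hom_part_def)
qed

lemma psum_factor:
  assumes g: "g \<in> semi_hardy \<rho>"
  shows "\<exists>q. \<forall>N. q N \<in> polyfuns \<and> (\<forall>z. psum g N z = lpoly z * q N (\<theta> z))"
proof (intro choice allI)
  fix N
  have hol: "holomorphic_several g \<Omega>" using g by (simp add: semi_hardy_def hardy_def)
  have "psum g N (\<sigma> *v z) = \<rho> \<sigma> * psum g N z" if "\<sigma> \<in> G" for \<sigma> z
    by (simp add: psum_def hom_part_equivariant[OF g that] sum_distrib_left)
  then obtain p where p: "p \<in> polyfuns" "\<And>z. psum g N z = lpoly z * p z" "\<And>\<sigma> z. \<sigma> \<in> G \<Longrightarrow> p (\<sigma> *v z) = p z"
    using lpoly_dvd[OF psum_polyfuns[OF hol]] by blast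
  obtain q where q: "q \<in> polyfuns" "\<And>z. p z = q (\<theta> z)" using invariant_factor[OF p(1,3)] by blast
  have "q \<in> polyfuns \<and> (\<forall>z. psum g N z = lpoly z * q (\<theta> z))" using p(2) q by simp
  then show "\<exists>q. q \<in> polyfuns \<and> (\<forall>z. psum g N z = lpoly z * q (\<theta> z))" by blast
qed

lemma divisor_bounded_lpoly: "divisor_bounded \<Omega> lpoly"
  unfolding lpoly_def[abs_def]
  by (rule divisor_bounded_prod[OF finite_R])
     (auto intro!: divisor_bounded_power divisor_bounded_lin polyfuns_power lin_polyfuns open_domain v_nonzero)

text \<open>Division by \<open>lpoly\<close> preserves locally uniform convergence of polynomials, so the quotients of the
  partial sums converge locally uniformly on \<open>\<Omega>\<close>; openness of \<open>\<theta>\<close> carries this over to \<open>\<theta>(\<Omega>)\<close>.\<close>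

theorem Gamma_surj:
  assumes g: "g \<in> semi_hardy \<rho>"
  shows "\<exists>f\<in>Q. \<Gamma> f = g"
proof -
  have gh: "g \<in> hardy \<Omega> m" and hol: "holomorphic_several g \<Omega>" using g by (auto simp: semi_hardy_def hardy_def)
  obtain q where q: "\<And>N. q N \<in> polyfuns" "\<And>N z. psum g N z = lpoly z * q N (\<theta> z)"
    using psum_factor[OF g] by blast
  have local: "\<exists>d>0. uniform_limit (cball (\<theta> z0) d) q (\<lambda>w. lim (\<lambda>N. q N w)) sequentially" if z0: "z0 \<in> \<Omega>" for z0
  proof -
    obtain e where e: "e > 0" "cball z0 e \<subseteq> \<Omega>" using open_domain z0 by (meson open_contains_cball)
    \<comment> \<open>Openness of \<theta>: bounds on \<theta>-pullbacks over the ball at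
      \<open>z0\<close> become bounds on a full neighbourhood of \<theta>\<open>z0\<close>, also at
      ramified points.\<close>
    obtain d where d: "d > 0" "cball (\<theta> z0) d \<subseteq> \<theta> ` cball z0 e"
      using theta_open[OF e(1), of z0] by (meson mem_interior_cball)
    obtain K C where K: "compact K" "K \<subseteq> \<Omega>" and C: "C \<ge> 0" and
      div: "\<And>p B. p \<in> polyfuns \<Longrightarrow> (\<forall>z\<in>K. norm (lpoly z * p z) \<le> B) \<Longrightarrow> \<forall>z\<in>cball z0 e. norm (p z) \<le> C * B"
    proof -
      have "compact (cball z0 e) \<and> cball z0 e \<subseteq> \<Omega>" using e(2) by simp
      from divisor_bounded_lpoly[unfolded divisor_bounded_def, rule_format, OF this] that show thesis by blast
    qed
    obtain E where E: "\<And>p z. p \<in> polyfuns \<Longrightarrow> z \<in> K \<Longrightarrow> norm (p z) \<le> E * L2_norm m p"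
      using eval_bound[OF K] by blast
    have bound: "norm (q i w - q j w) \<le> C * (E * L2_norm m (\<lambda>z. psum g i z - psum g j z))"
      if w: "w \<in> cball (\<theta> z0) d" for i j w
    proof -
      obtain y where y: "y \<in> cball z0 e" "w = \<theta> y" using d(2) w by blast
      have "\<forall>z\<in>cball z0 e. norm (q i (\<theta> z) - q j (\<theta> z)) \<le> C * (E * L2_norm m (\<lambda>z. psum g i z - psum g j z))"
      proof (rule div)
        show "(\<lambda>z. q i (\<theta> z) - q j (\<theta> z)) \<in> polyfuns" by (intro polyfuns_diff theta_compose q)
        show "\<forall>z\<in>K. norm (lpoly z * (q i (\<theta> z) - q j (\<theta> z))) \<le> E * L2_norm m (\<lambda>z. psum g i z - psum g j z)"
          using E[OF polyfuns_diff[OF psum_polyfuns[OF hol, of i] psum_polyfuns[OF hol, of j]]]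
          by (simp add: right_diff_distrib q(2)[symmetric])
      qed
      then show ?thesis using y by blast
    qed
    have "uniformly_Cauchy_on (cball (\<theta> z0) d) q"
    proof (rule uniformly_Cauchy_onI)
      fix \<epsilon> :: real assume \<epsilon>: "\<epsilon> > 0"
      define B where "B = C * \<bar>E\<bar> + 1"
      have B: "B > 0" using C by (simp add: B_def add_nonneg_pos)
      then obtain N where N: "\<And>i j. i \<ge> N \<Longrightarrow> j \<ge> N \<Longrightarrow> L2_norm m (\<lambda>z. psum g i z - psum g j z) < \<epsilon> / B"
        using hardy_psum_Cauchy[OF gh] \<epsilon> unfolding L2_Cauchy_def by (meson divide_pos_pos)
      have "dist (q i w) (q j w) < \<epsilon>" if w: "w \<in> cball (\<theta> z0) d" and ij: "i \<ge> N" "j \<ge> N" for w i j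
      proof -
        let ?n = "L2_norm m (\<lambda>z. psum g i z - psum g j z)"
        have "norm (q i w - q j w) \<le> C * (E * ?n)" by (rule bound[OF w])
        also have "\<dots> \<le> B * ?n"
        proof -
          have "E * ?n \<le> \<bar>E\<bar> * ?n" by (intro mult_right_mono L2_norm_nonneg) simp
          then have "C * (E * ?n) \<le> C * (\<bar>E\<bar> * ?n)" using C by (rule mult_left_mono)
          then show ?thesis using L2_norm_nonneg[of m "\<lambda>z. psum g i z - psum g j z"] by (simp add: B_def algebra_simps)
        qed
        also have "\<dots> < \<epsilon>" using N[OF ij] B by (simp add: field_simps)
        finally show ?thesis by (simp add: dist_norm)
      qed
      then show "\<exists>N. \<forall>x\<in>cball (\<theta> z0) d. \<forall>i\<ge>N. \<forall>j\<ge>N. dist (q i x) (q j x) < \<epsilon>" by blast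
    qed
    then have "uniformly_convergent_on (cball (\<theta> z0) d) q" by (rule Cauchy_uniformly_convergent)
    then show ?thesis using d(1) unfolding uniformly_convergent_uniform_limit_iff by blast
  qed
  define F where "F w = lim (\<lambda>N. q N w)" for w
  have hF: "holomorphic_several F (\<theta> ` \<Omega>)" unfolding F_def[abs_def]
    by (rule polyfuns_uniform_limit_holomorphic[where F = q, OF q(1)]) (use local in blast)
  have limF: "(\<lambda>N. q N (\<theta> z)) \<longlonglongrightarrow> F (\<theta> z)" if z: "z \<in> \<Omega>" for z
  proof -
    obtain d where "d > 0" "uniform_limit (cball (\<theta> z) d) q F sequentially"
      using local[OF z] unfolding F_def[abs_def] by blast
    then show ?thesis using tendsto_uniform_limitI[where S = "cball (\<theta> z) d" and f = q and x = "\<theta> z"] by simp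
  qed
  define f where "f w = (if w \<in> \<theta> ` \<Omega> then 1 / \<kappa> * F w else 0)" for w
  have hf: "holomorphic_several f (\<theta> ` \<Omega>)"
    using holomorphic_several_cmult[OF hF, of "1 / \<kappa>"]
    by (subst holomorphic_several_cong[where g = "\<lambda>w. 1 / \<kappa> * F w"]) (simp_all add: f_def)
  have "\<Gamma> f z = g z" for z
  proof (cases "z \<in> \<Omega>")
    case True
    have "(\<lambda>N. psum g N z) \<longlonglongrightarrow> lpoly z * F (\<theta> z)" unfolding q(2) by (intro tendsto_intros limF True)
    then have "lpoly z * F (\<theta> z) = g z" using psum_tendsto[OF hol True] LIMSEQ_unique by blast
    then show ?thesis using True kappa_nz by (simp add: Gamma_eq f_def)
  next
    case False then show ?thesis using gh by (simp add: Gamma_eq hardy_def)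
  qed
  then have "\<Gamma> f = g" by (simp add: fun_eq_iff)
  moreover have "f \<in> Q" unfolding qhardy_iff \<open>\<Gamma> f = g\<close> using hf gh by (simp add: f_def)
  ultimately show ?thesis by blast
qed

text \<open>The \<open>SOME\<close> needs a measurable function on the Shilov boundary of the image
  whose pullback is prescribed almost everywhere. It is found as an L2 limit of the quotient
  polynomials, whose distances for \<open>qmeasure\<close> are those of the partial sums on the
  boundary of \<Omega>.\<close>

lemma qboundary_value:
  assumes f: "f \<in> Q"
  shows "qbv f \<in> L2 M" "AE \<zeta> in m. \<kappa> * lpoly \<zeta> * qbv f (\<theta> \<zeta>) = bv (\<Gamma> f) \<zeta>"
proof -
  have g: "\<Gamma> f \<in> semi_hardy \<rho>" by (rule Gamma_semi_hardy[OF f])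
  have gh: "\<Gamma> f \<in> hardy \<Omega> m" and hol: "holomorphic_several (\<Gamma> f) \<Omega>" using g by (auto simp: semi_hardy_def hardy_def)
  obtain q where q: "\<And>N. q N \<in> polyfuns" "\<And>N z. psum (\<Gamma> f) N z = lpoly z * q N (\<theta> z)"
    using psum_factor[OF g] by blast
  have "L2_norm M (\<lambda>w. q i w - q j w) = L2_norm m (\<lambda>z. psum (\<Gamma> f) i z - psum (\<Gamma> f) j z)" for i j
    using L2_norm_M[OF polyfuns_measurable_M[OF polyfuns_diff[OF q(1)[of i] q(1)[of j]]]]
    by (simp add: right_diff_distrib q(2))
  then have "L2_Cauchy M q" using hardy_psum_Cauchy[OF gh] by (simp add: L2_Cauchy_def)
  then obtain F where F: "F \<in> L2 M" "L2_lim M q F"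
    using finite_measure.Riesz_Fischer[where F = q, OF finite_M polyfuns_L2_M[OF q(1)]] by blast
  have lF: "(\<lambda>\<zeta>. lpoly \<zeta> * F (\<theta> \<zeta>)) \<in> L2 m" using F(1) L2_M_iff by blast
  have "L2_norm M (\<lambda>w. q n w - F w) = L2_norm m (\<lambda>z. psum (\<Gamma> f) n z - lpoly z * F (\<theta> z))" for n
    using L2_norm_M[OF L2D(1)[OF L2_diff[OF polyfuns_L2_M[OF q(1)[of n]] F(1)]]]
    by (simp add: right_diff_distrib q(2))
  then have "L2_lim m (psum (\<Gamma> f)) (\<lambda>\<zeta>. lpoly \<zeta> * F (\<theta> \<zeta>))" using F(2) by (simp add: L2_lim_def)
  then have AE: "AE \<zeta> in m. bv (\<Gamma> f) \<zeta> = lpoly \<zeta> * F (\<theta> \<zeta>)"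
    by (rule L2_lim_unique[OF boundary_value_radial(3)[OF gh] _ polyfuns_L2[OF psum_polyfuns[OF hol]]
          boundary_value_radial(2)[OF gh] lF])
  define P where "P = (\<lambda>F. F \<in> L2 M \<and> (AE \<zeta> in m. Gamma_L2 G \<theta> lpoly F \<zeta> = bv (\<Gamma> f) \<zeta>))"
  have "P (\<lambda>w. 1 / \<kappa> * F w)" unfolding P_def
    using L2_cmult[OF F(1), of "1 / \<kappa>"] AE kappa_nz unfolding Gamma_L2_def \<kappa>_def[symmetric]
    by (auto elim!: eventually_mono)
  then have "P (qbv f)" unfolding qboundary_value_def P_def[symmetric] by (rule someI[where P = P])
  then show "qbv f \<in> L2 M" "AE \<zeta> in m. \<kappa> * lpoly \<zeta> * qbv f (\<theta> \<zeta>) = bv (\<Gamma> f) \<zeta>"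
    by (auto simp: P_def Gamma_L2_def \<kappa>_def)
qed

text \<open>The factor \<open>1 / card G\<close> of the quotient inner product is split as
  \<kappa>\<open>* cnj\<close>\<kappa> and absorbed by the two copies of \<Gamma>.\<close>

lemma qinner_eq:
  assumes f: "f \<in> Q" and h: "h \<in> Q" and k: "k \<in> Q"
    and u: "u \<in> borel_measurable M" and ut: "ut \<in> Linfty m" "AE \<zeta> in m. ut \<zeta> = u (\<theta> \<zeta>)"
  shows "qinner \<Omega> m G \<theta> lpoly (\<lambda>w. u w * qbv f w - qbv h w) (qbv k) =
    L2_inner m (\<lambda>\<zeta>. ut \<zeta> * bv (\<Gamma> f) \<zeta> - bv (\<Gamma> h) \<zeta>) (bv (\<Gamma> k))"
proof -
  have gh: "\<Gamma> f \<in> hardy \<Omega> m" "\<Gamma> h \<in> hardy \<Omega> m" "\<Gamma> k \<in> hardy \<Omega> m" using f h k qhardy_iff by auto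
  note qm = L2D(1)[OF qboundary_value(1)]
  have m1: "(\<lambda>w. u w * qbv f w - qbv h w) \<in> borel_measurable M"
    by (intro borel_measurable_diff borel_measurable_times u qm f h)
  let ?A = "\<lambda>\<zeta>. lpoly \<zeta> * (u (\<theta> \<zeta>) * qbv f (\<theta> \<zeta>) - qbv h (\<theta> \<zeta>))" and ?B = "\<lambda>\<zeta>. lpoly \<zeta> * qbv k (\<theta> \<zeta>)"
  have mA: "?A \<in> borel_measurable m"
    by (intro borel_measurable_times polyfuns_measurable lpoly_polyfuns compose_theta_measurable[OF m1])
  have mB: "?B \<in> borel_measurable m"
    by (intro borel_measurable_times polyfuns_measurable lpoly_polyfuns compose_theta_measurable[OF qm[OF k]])
  have "qinner \<Omega> m G \<theta> lpoly (\<lambda>w. u w * qbv f w - qbv h w) (qbv k) = \<kappa> * cnj \<kappa> * L2_inner m ?A ?B"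
    unfolding qinner_def kappa_sq L2_inner_M[OF m1 qm[OF k]] ..
  also have "\<dots> = L2_inner m (\<lambda>\<zeta>. \<kappa> * ?A \<zeta>) (\<lambda>\<zeta>. \<kappa> * ?B \<zeta>)"
    unfolding L2_inner_cmult_left L2_inner_cmult_right by simp
  also have "\<dots> = L2_inner m (\<lambda>\<zeta>. ut \<zeta> * bv (\<Gamma> f) \<zeta> - bv (\<Gamma> h) \<zeta>) (bv (\<Gamma> k))"
  proof (rule L2_inner_cong_AE)
    show "AE \<zeta> in m. \<kappa> * ?A \<zeta> = ut \<zeta> * bv (\<Gamma> f) \<zeta> - bv (\<Gamma> h) \<zeta>"
      using qboundary_value(2)[OF f] qboundary_value(2)[OF h] ut(2)
    proof eventually_elim
      case (elim \<zeta>)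
      show ?case unfolding elim(1,2)[symmetric] elim(3) by (simp add: algebra_simps)
    qed
    show "AE \<zeta> in m. \<kappa> * ?B \<zeta> = bv (\<Gamma> k) \<zeta>"
      using qboundary_value(2)[OF k] by (simp add: mult.assoc)
    show "(\<lambda>\<zeta>. \<kappa> * ?A \<zeta>) \<in> borel_measurable m" "(\<lambda>\<zeta>. \<kappa> * ?B \<zeta>) \<in> borel_measurable m"
      by (intro borel_measurable_times borel_measurable_const mA mB)+
    show "(\<lambda>\<zeta>. ut \<zeta> * bv (\<Gamma> f) \<zeta> - bv (\<Gamma> h) \<zeta>) \<in> borel_measurable m" "bv (\<Gamma> k) \<in> borel_measurable m"
      by (intro L2D(1) L2_diff L2_bounded_mult boundary_value_radial gh ut)+
  qed
  finally show ?thesis .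
qed

text \<open>Surjectivity of \<Gamma> is used twice: it supplies a preimage \<open>h\<close> of the
  Toeplitz image, and it shows that the test functions from the quotient are all semi-invariant
  ones. Hence two solutions of the condition under \<open>THE\<close> have the same image under
  \<Gamma>, and injectivity identifies them.\<close>

theorem qtoeplitz:
  assumes f: "f \<in> Q" and u: "u \<in> borel_measurable M" and ut: "ut \<in> Linfty m" "AE \<zeta> in m. ut \<zeta> = u (\<theta> \<zeta>)"
    and inv: "\<And>\<sigma>. \<sigma> \<in> G \<Longrightarrow> AE \<zeta> in m. act \<sigma> ut \<zeta> = ut \<zeta>"
  shows "qtoeplitz \<Omega> m G \<theta> lpoly u f \<in> Q"
    "\<Gamma> (qtoeplitz \<Omega> m G \<theta> lpoly u f) = hardy_toeplitz \<Omega> m ut (\<Gamma> f)"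
proof -
  note g = Gamma_semi_hardy[OF f]
  have gh: "\<Gamma> f \<in> hardy \<Omega> m" using f qhardy_iff by blast
  define H where "H = hardy_toeplitz \<Omega> m ut (\<Gamma> f)"
  have H: "H \<in> semi_hardy \<rho>" unfolding H_def by (rule semi_hardy_toeplitz[OF g ut(1) inv rep_nz])
  obtain h where h: "h \<in> Q" "\<Gamma> h = H" using Gamma_surj[OF H] by blast
  define P where "P = (\<lambda>h. h \<in> Q \<and> (\<forall>k\<in>Q. qinner \<Omega> m G \<theta> lpoly (\<lambda>w. u w * qbv f w - qbv h w) (qbv k) = 0))"
  have Ph: "P h" unfolding P_def
  proof (intro conjI ballI h)
    fix k assume k: "k \<in> Q"
    then have "\<Gamma> k \<in> hardy \<Omega> m" using qhardy_iff by blast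
    then show "qinner \<Omega> m G \<theta> lpoly (\<lambda>w. u w * qbv f w - qbv h w) (qbv k) = 0"
      unfolding qinner_eq[OF f h(1) k u ut] h(2) H_def by (rule hardy_toeplitz(2)[OF gh ut(1)])
  qed
  have orth: "L2_inner m (\<lambda>\<zeta>. ut \<zeta> * bv (\<Gamma> f) \<zeta> - bv (\<Gamma> h') \<zeta>) (bv k) = 0" if h': "P h'" and k: "k \<in> semi_hardy \<rho>" for h' k
  proof -
    obtain k' where k': "k' \<in> Q" "\<Gamma> k' = k" using Gamma_surj[OF k] by blast
    have "h' \<in> Q" "qinner \<Omega> m G \<theta> lpoly (\<lambda>w. u w * qbv f w - qbv h' w) (qbv k') = 0"
      using h' k' by (auto simp: P_def)
    then show ?thesis using qinner_eq[OF f _ k'(1) u ut, of h'] k'(2) by simp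
  qed
  have "h' = h" if h': "P h'" for h'
  proof (rule Gamma_inj)
    show Q: "h' \<in> Q" "h \<in> Q" using h' h by (auto simp: P_def)
    show "\<Gamma> h' = \<Gamma> h"
    proof (rule hardy_projection_unique[where D = "semi_hardy \<rho>"])
      show "(\<lambda>\<zeta>. ut \<zeta> * bv (\<Gamma> f) \<zeta>) \<in> L2 m" by (intro L2_bounded_mult boundary_value_radial gh ut)
      show "semi_hardy \<rho> \<subseteq> hardy \<Omega> m" by (auto simp: semi_hardy_def)
    qed (use Gamma_semi_hardy Q semi_hardy_diff orth[OF h'] orth[OF Ph] in auto)
  qed
  then have "(THE h. P h) = h" by (rule the_equality[where P = P, OF Ph])
  moreover have "qtoeplitz \<Omega> m G \<theta> lpoly u f = (THE h. P h)"
    by (simp add: qtoeplitz_def toeplitz_def orth_proj_def P_def)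
  ultimately show "qtoeplitz \<Omega> m G \<theta> lpoly u f \<in> Q"
    "\<Gamma> (qtoeplitz \<Omega> m G \<theta> lpoly u f) = hardy_toeplitz \<Omega> m ut (\<Gamma> f)"
    using h by (simp_all add: H_def)
qed

end

text \<open>The first three conjuncts give meaning to the last one: the operators and \<Gamma> map
  between the spaces in question, the Toeplitz operator on \<Omega> respecting the range for every
  one-dimensional representation.\<close>

theorem lemma3p1:
  fixes \<Omega> :: "(complex ^ 'd) set"
    and m :: "(complex ^ 'd) measure"
    and G :: "(complex ^ 'd ^ 'd) set"
    and \<theta> :: "complex ^ 'd \<Rightarrow> complex ^ 'd"
    and \<rho> :: "complex ^ 'd ^ 'd \<Rightarrow> complex"
    and \<l> u ut :: "complex ^ 'd \<Rightarrow> complex"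
  assumes "domain_with_measure \<Omega> m"
    and "finite G" and "pseudoreflection_group G" and "acts_on G \<Omega>"
    and "basic_polynomial_map G \<theta>"
    and "ut \<in> Linfty m"
    and "\<And>\<sigma>. \<sigma> \<in> G \<Longrightarrow> AE \<zeta> in m. act \<sigma> ut \<zeta> = ut \<zeta>"
    and "u \<in> borel_measurable (restrict_space borel (shilov_boundary (\<theta> ` \<Omega>)))"
    and "AE \<zeta> in m. ut \<zeta> = u (\<theta> \<zeta>)"
    and "one_dim_rep G \<rho>"
    and "is_generating_polynomial G \<rho> \<l>"
  shows "qtoeplitz \<Omega> m G \<theta> \<l> u \<in> qhardy \<Omega> m G \<theta> \<l> \<rightarrow> qhardy \<Omega> m G \<theta> \<l> \<and>
    (\<forall>\<tau>. one_dim_rep G \<tau> \<longrightarrow>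
       hardy_toeplitz \<Omega> m ut \<in> rep_proj G \<tau> ` hardy \<Omega> m \<rightarrow> rep_proj G \<tau> ` hardy \<Omega> m) \<and>
    Gamma_hardy \<Omega> G \<theta> \<l> \<in> qhardy \<Omega> m G \<theta> \<l> \<rightarrow> rep_proj G (contragredient \<rho>) ` hardy \<Omega> m \<and>
    (\<forall>f \<in> qhardy \<Omega> m G \<theta> \<l>.
       Gamma_hardy \<Omega> G \<theta> \<l> (qtoeplitz \<Omega> m G \<theta> \<l> u f) =
       hardy_toeplitz \<Omega> m ut (Gamma_hardy \<Omega> G \<theta> \<l> f))"
proof -
  obtain R where R: "model_domain \<Omega> m R" using model_domain_exists[OF assms(1)] by blast
  obtain a v where av: "\<forall>H\<in>reflecting_hyperplanes G.
      a H \<in> G \<and> generate GL {a H} = pointwise_stabilizer G H \<and> {z. lin (v H) z = 0} = H"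
    and \<l>: "\<forall>z. \<l> z = (\<Prod>H\<in>reflecting_hyperplanes G. lin (v H) z ^ (LEAST c. \<rho> (a H) = det (a H) ^ c))"
    using assms(11) unfolding is_generating_polynomial_def lin_def[symmetric]
    by (elim exE conjE) (rule that)
  interpret model_domain \<Omega> m R by (rule R)
  interpret pr_group G by unfold_locales (rule assms)+
  have sym: "symmetry \<sigma>" if "\<sigma> \<in> G" for \<sigma>
  proof -
    have im: "(\<lambda>z. \<sigma> *v z) ` \<Omega> = \<Omega>" using assms(4) that by (simp add: acts_on_def)
    show ?thesis unfolding symmetry_def
      using invertible[OF that] im automorphism_measure_preserving[OF assms(1) invertible[OF that] im] by simp
  qed
  interpret quotient_hardy \<Omega> m R G \<theta> \<rho> a v
    by unfold_locales (fact assms(5), erule sym, fact assms(10), rule av[rule_format])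
  have \<l>_eq: "\<l> = lpoly" using \<l> by (simp add: fun_eq_iff lpoly_def cexp_def)
  have u: "u \<in> borel_measurable M" using assms(8) unfolding borel_measurable_M .
  \<comment> \<open>Taking the contragredient twice returns \<rho> only at invertible matrices, so
    the spaces are compared rather than the functions.\<close>
  have cc: "semi_hardy (contragredient (contragredient \<rho>)) = semi_hardy \<rho>"
    unfolding semi_hardy_def contragredient_def by (simp add: matrix_inv_matrix_inv invertible cong: ball_cong)
  have "hardy_toeplitz \<Omega> m ut \<in> rep_proj G \<tau> ` hardy \<Omega> m \<rightarrow> rep_proj G \<tau> ` hardy \<Omega> m" if \<tau>: "one_dim_rep G \<tau>" for \<tau>
  proof -
    interpret pr_rep G "contragredient \<tau>"
      by unfold_locales (rule one_dim_rep_contragredient[OF assms(2,3) \<tau>])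
    show ?thesis unfolding rep_proj_image[OF \<tau>]
      by (rule funcsetI) (rule semi_hardy_toeplitz[OF _ assms(6,7) rep_nz])
  qed
  moreover have "\<Gamma> \<in> Q \<rightarrow> rep_proj G (contragredient \<rho>) ` hardy \<Omega> m"
    unfolding rep_proj_image[OF one_dim_rep_contragredient[OF assms(2,3,10)]] cc by (rule funcsetI) (rule Gamma_semi_hardy)
  ultimately show ?thesis unfolding \<l>_eq using qtoeplitz[OF _ u assms(6,9,7)] by blast
qed

end
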